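(* Let $A$ be a $\mathbb{Q}$-division algebra whose center is a number field $K$. Let $n=\sqrt{[A:K]}$ and $m=[K:\mathbb{Q}]$. Let $\mathcal{O}$ be an order in $A$, and for an integer $t\ge 2$ consider an infinite family of surjective reduction maps $$\phi_p:\mathcal{O}^t\to M_n(\mathbb{F}_q)^t$$ given in each coordinate by reduction modulo a prime of $\mathcal{O}_K$ as described in the context. Let $i:A^t\to(A\otimes_{\mathbb{Q}}\mathbb{R})^t\cong\mathbb{R}^{n^2mt}$ denote the coordinatewise embedding and let $f:\mathbb{R}^{n^2mt}\to\mathbb{R}$ be a semi-admissible function. For a fixed integer $k$ with $n\le k<nt$, set $$\mathcal{C}_{k,p}=\{C\subseteq M_n(\mathbb{F}_q)^{\oplus t}\ |\ C\text{ is an } M_n(\mathbb{F}_q)\text{-submodule isomorphic to }(\mathbb{F}_q^n)^{\oplus k}\},$$ $$\mathbb{L}_{k,p}=\{\beta_p\phi_p^{-1}(C)\ |\ C\in\mathcal{C}_{k,p}\},$$ where the constant $\beta_p=q^{\frac{nk-n^2t}{n^2mt}}$ normalizes the covolume of the lattices in $\mathbb{L}_{k,p}$ to $V:=\mathrm{Vol}(\mathcal{O}^t)$. If $(n-1)t<k<nt$, then $$\lim_{p\to\infty}\mathbb{E}_{\mathbb{L}_{k,p}}\left(\sum_{x\in(\beta_p\phi_p^{-1}(C))'}f(i(x))\right)\ \le\ (\zeta(n^2mt)\cdot V)^{-1}\cdot\int_{\mathbb{R}^{n^2mt}}f(x)\,dx,$$ where the limit is taken over the primes in the family and $(\beta_p\phi_p^{-1}(C))'$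 denotes the set of primitive vectors in $\beta_p\phi_p^{-1}(C)$.
   Context: $\mathcal{O}$ is an $\mathcal{O}_K$-order in $A$: a subring containing $1_A$, finitely generated as $\mathcal{O}_K$-module, with $K\cdot\mathcal{O}=A$. For all but finitely many primes $\mathfrak{p}$ of $\mathcal{O}_K$, $\mathcal{O}/\mathfrak{p}\mathcal{O}\cong M_n(\mathbb{F}_q)$ with $\mathbb{F}_q\cong\mathcal{O}_K/\mathfrak{p}$. The family of maps $\phi_p$ is indexed by such primes $\mathfrak{p}$ (with $\mathfrak p\mid p$, $q=|\mathcal{O}_K/\mathfrak{p}|$ depending on the prime, $p\to\infty$ in the family); $\phi_p$ is the reduction $\mathcal{O}\to\mathcal{O}/\mathfrak{p}\mathcal{O}\cong M_n(\mathbb{F}_q)$ applied in each of the $t$ coordinates. "Submodule" means left submodule of the left module $M_n(\mathbb{F}_q)^{\oplus t}$, and $\mathbb{F}_q^n$ is the simple left $M_n(\mathbb{F}_q)$-module. $\mathbb{E}_{\mathbb{L}_{k,p}}$ is the average over all the lattices in the finite set $\mathbb{L}_{k,p}$ (uniformly over $C\in\mathcal{C}_{k,p}$). $\mathcal{O}^t$ is regarded via $i$ as a lattice in $\mathbb{R}^{n^2mt}$, with $\mathrm{Vol}$ its covolume. For a lattice $\Lambda$, $\Lambda'$ denotes its primitive vectors, i.e. the nonzero lattice vectors that are shortest vectors of the lattice on the real line they span. A function $f:\mathbb{R}^d\to\mathbb{R}$ is semi-admissible if it is Riemann-integrable and there are constants $b,\delta>0$ with $|f(\mathbf{x})|\le\frac{b}{(1+\|\mathbf{x}\|)^{d+\delta}}$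 for all $\mathbf{x}\in\mathbb{R}^d$. *)

theory Defs
  imports
    "HOL-Analysis.Analysis"
    "HOL-Computational_Algebra.Primes"
    "HOL-Computational_Algebra.Polynomial"
    "HOL-Library.Poly_Mapping"
    "HOL-Algebra.QuotRing"
    "HOL-Algebra.Ideal_Product"
    "HOL-Algebra.Module"
begin

section \<open>Division algebras over a number field and their orders\<close>

text \<open>
  A division ring of characteristic 0 carries a unique structure of a \<open>\<rat>\<close>-algebra;
  \<open>of_rat\<close> is only available for commutative fields, hence \<open>rat_smult\<close>.
\<close>

definition rat_smult :: "rat \<Rightarrow> 'a \<Rightarrow> 'a :: {division_ring, ring_char_0}" where
  "rat_smult r x = of_int (fst (quotient_of r)) / of_int (snd (quotient_of r)) * x"

definition rat_degree :: "'k::field_char_0 itself \<Rightarrow> nat" where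
  "rat_degree _ = vector_space.dim (rat_smult :: rat \<Rightarrow> 'k \<Rightarrow> 'k) UNIV"

definition number_field :: "'k::field_char_0 itself \<Rightarrow> bool" where
  "number_field _ \<longleftrightarrow>
     (\<exists>B. finite_dimensional_vector_space (rat_smult :: rat \<Rightarrow> 'k \<Rightarrow> 'k) B)"

text \<open>
  The center of the division ring \<open>'a\<close> is identified with the field \<open>'k\<close> by \<open>\<iota>\<close>.
\<close>

definition center_embedding :: "('k::field \<Rightarrow> 'a::division_ring) \<Rightarrow> bool" where
  "center_embedding \<iota> \<longleftrightarrow>
     \<iota> 1 = 1 \<and> (\<forall>x y. \<iota> (x + y) = \<iota> x + \<iota> y) \<and> (\<forall>x y. \<iota> (x * y) = \<iota> x * \<iota> y) \<and>
     range \<iota> = {z. \<forall>x. z * x = x * z}"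

definition alg_smult :: "('k::field \<Rightarrow> 'a::division_ring) \<Rightarrow> 'k \<Rightarrow> 'a \<Rightarrow> 'a" where
  "alg_smult \<iota> c x = \<iota> c * x"

definition ring_of_integers :: "'k::field_char_0 set" ("\<O>\<^sub>K") where
  "\<O>\<^sub>K = {x. algebraic_int x}"

definition is_order :: "('k::field_char_0 \<Rightarrow> 'a::division_ring) \<Rightarrow> 'a set \<Rightarrow> bool" where
  "is_order \<iota> \<O> \<longleftrightarrow>
     1 \<in> \<O> \<and> (\<forall>x\<in>\<O>. \<forall>y\<in>\<O>. x - y \<in> \<O> \<and> x * y \<in> \<O>) \<and>
     (\<forall>c\<in>\<O>\<^sub>K. \<forall>x\<in>\<O>. alg_smult \<iota> c x \<in> \<O>) \<and>
     (\<exists>G. finite G \<and> \<O> = {\<Sum>g\<in>G. alg_smult \<iota> (c g) g | c. \<forall>g\<in>G. c g \<in> \<O>\<^sub>K}) \<and>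
     Modules.module.span (alg_smult \<iota>) \<O> = UNIV"


section \<open>The real vector space \<open>A \<otimes>\<^sub>\<rat> \<real>\<close>\<close>

text \<open>
  The free abelian group on \<open>A \<times> \<real>\<close> modulo the subgroup generated by the relations
  of a \<open>\<rat>\<close>-balanced biadditive map.
\<close>

inductive_set tensor_relations ::
    "('a::{division_ring,ring_char_0} \<times> real \<Rightarrow>\<^sub>0 int) set" where
  add_left: "frag_of (a + b, r) - frag_of (a, r) - frag_of (b, r) \<in> tensor_relations"
| add_right: "frag_of (a, r + s) - frag_of (a, r) - frag_of (a, s) \<in> tensor_relations"
| balanced: "frag_of (rat_smult c a, r) - frag_of (a, of_rat c * r) \<in> tensor_relations"
| zero: "0 \<in> tensor_relations"
| diff: "u \<in> tensor_relations \<Longrightarrow> v \<in> tensor_relations \<Longrightarrow> u - v \<in> tensor_relations"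

lemma tensor_relations_uminus: "u \<in> tensor_relations \<Longrightarrow> - u \<in> tensor_relations"
  using tensor_relations.diff[OF tensor_relations.zero] by fastforce

lemma tensor_relations_add:
  "u \<in> tensor_relations \<Longrightarrow> v \<in> tensor_relations \<Longrightarrow> u + v \<in> tensor_relations"
  using tensor_relations.diff[OF _ tensor_relations_uminus] by fastforce

definition tensor_eq ::
    "('a::{division_ring,ring_char_0} \<times> real \<Rightarrow>\<^sub>0 int) \<Rightarrow> ('a \<times> real \<Rightarrow>\<^sub>0 int) \<Rightarrow> bool" where
  "tensor_eq u v \<longleftrightarrow> u - v \<in> tensor_relations"

lemma equivp_tensor_eq: "equivp tensor_eq"
proof (rule equivpI)
  show "reflp tensor_eq"
    by (simp add: reflp_def tensor_eq_def tensor_relations.zero)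
  show "symp tensor_eq"
    unfolding symp_def tensor_eq_def using tensor_relations_uminus by fastforce
  show "transp tensor_eq"
    unfolding transp_def tensor_eq_def using tensor_relations_add by fastforce
qed

quotient_type (overloaded) 'a real_tensor =
    "'a::{division_ring,ring_char_0} \<times> real \<Rightarrow>\<^sub>0 int" / tensor_eq
  by (rule equivp_tensor_eq)

definition frag_scale :: "real \<Rightarrow> ('a \<times> real \<Rightarrow>\<^sub>0 int) \<Rightarrow> ('a \<times> real \<Rightarrow>\<^sub>0 int)" where
  "frag_scale r = frag_extend (\<lambda>(a, s). frag_of (a, r * s))"

lemma frag_scale_of [simp]: "frag_scale r (frag_of (a, s)) = frag_of (a, r * s)"
  by (simp add: frag_scale_def)

lemma frag_scale_diff: "frag_scale r (u - v) = frag_scale r u - frag_scale r v"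
  by (simp add: frag_scale_def frag_extend_diff)

lemma frag_scale_add: "frag_scale r (u + v) = frag_scale r u + frag_scale r v"
  by (simp add: frag_scale_def frag_extend_add)

lemma frag_scale_zero [simp]: "frag_scale r 0 = 0"
  by (simp add: frag_scale_def)

lemma frag_scale_relations: "u \<in> tensor_relations \<Longrightarrow> frag_scale r u \<in> tensor_relations"
proof (induction rule: tensor_relations.induct)
  case (add_left a b s)
  show ?case by (simp add: frag_scale_diff tensor_relations.add_left)
next
  case (add_right a s s')
  show ?case
    using tensor_relations.add_right[of a "r * s" "r * s'"]
    by (simp add: frag_scale_diff distrib_left)
next
  case (balanced c a s)
  show ?case
    using tensor_relations.balanced[of c a "r * s"]
    by (simp add: frag_scale_diff mult.left_commute)
qed (simp_all add: frag_scale_diff tensor_relations.zero tensor_relations.diff)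

lemma frag_scale_scale: "frag_scale r (frag_scale s u) = frag_scale (r * s) u"
  by (rule frag_induction[of u UNIV])
     (auto simp: frag_scale_diff mult.assoc)

lemma frag_scale_one: "frag_scale 1 u = u"
  by (rule frag_induction[of u UNIV]) (auto simp: frag_scale_diff)

lemma frag_scale_distrib:
  fixes u :: "'a::{division_ring,ring_char_0} \<times> real \<Rightarrow>\<^sub>0 int"
  shows "frag_scale (r + s) u - (frag_scale r u + frag_scale s u) \<in> tensor_relations"
proof (rule frag_induction[of u UNIV])
  fix x :: "'a \<times> real"
  obtain a t where x: "x = (a, t)" by (cases x)
  show "frag_scale (r + s) (frag_of x) - (frag_scale r (frag_of x) + frag_scale s (frag_of x))
          \<in> tensor_relations"
    using tensor_relations.add_right[of a "r * t" "s * t"]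
    by (simp add: x distrib_right diff_diff_eq)
next
  fix v w :: "'a \<times> real \<Rightarrow>\<^sub>0 int"
  assume "frag_scale (r + s) v - (frag_scale r v + frag_scale s v) \<in> tensor_relations"
    and "frag_scale (r + s) w - (frag_scale r w + frag_scale s w) \<in> tensor_relations"
  from tensor_relations.diff[OF this]
  show "frag_scale (r + s) (v - w) - (frag_scale r (v - w) + frag_scale s (v - w))
          \<in> tensor_relations"
    by (simp add: frag_scale_diff algebra_simps)
qed (auto simp: tensor_relations.zero)

instantiation real_tensor :: ("{division_ring,ring_char_0}") real_vector
begin

lift_definition zero_real_tensor :: "'a real_tensor" is 0 .

lift_definition plus_real_tensor :: "'a real_tensor \<Rightarrow> 'a real_tensor \<Rightarrow> 'a real_tensor" is "(+)"
  unfolding tensor_eq_def using tensor_relations_add by (fastforce simp: algebra_simps)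

lift_definition minus_real_tensor :: "'a real_tensor \<Rightarrow> 'a real_tensor \<Rightarrow> 'a real_tensor" is "(-)"
  unfolding tensor_eq_def using tensor_relations.diff by (fastforce simp: algebra_simps)

lift_definition uminus_real_tensor :: "'a real_tensor \<Rightarrow> 'a real_tensor" is uminus
  unfolding tensor_eq_def using tensor_relations_uminus by fastforce

lift_definition scaleR_real_tensor :: "real \<Rightarrow> 'a real_tensor \<Rightarrow> 'a real_tensor" is frag_scale
  unfolding tensor_eq_def by (metis frag_scale_diff frag_scale_relations)

instance
proof
  fix a b c :: "'a real_tensor" and r s :: real
  show "a + b + c = a + (b + c)"
    by transfer (simp add: tensor_eq_def add.assoc tensor_relations.zero)
  show "a + b = b + a"
    by transfer (simp add: tensor_eq_def add.commute tensor_relations.zero)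
  show "0 + a = a"
    by transfer (simp add: tensor_eq_def tensor_relations.zero)
  show "- a + a = 0"
    by transfer (simp add: tensor_eq_def tensor_relations.zero)
  show "a - b = a + - b"
    by transfer (simp add: tensor_eq_def tensor_relations.zero)
  show "r *\<^sub>R (a + b) = r *\<^sub>R a + r *\<^sub>R b"
    by transfer (simp add: tensor_eq_def frag_scale_add tensor_relations.zero)
  show "(r + s) *\<^sub>R a = r *\<^sub>R a + s *\<^sub>R a"
    by transfer (simp add: tensor_eq_def frag_scale_distrib)
  show "r *\<^sub>R s *\<^sub>R a = (r * s) *\<^sub>R a"
    by transfer (simp add: tensor_eq_def frag_scale_scale tensor_relations.zero)
  show "1 *\<^sub>R a = a"
    by transfer (simp add: tensor_eq_def frag_scale_one tensor_relations.zero)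
qed

end

lift_definition tensor :: "'a::{division_ring,ring_char_0} \<Rightarrow> real \<Rightarrow> 'a real_tensor"
  is "\<lambda>a r. frag_of (a, r)" .

text \<open>
  \<open>\<Psi>\<close> is the chosen linear identification of \<open>(A \<otimes>\<^sub>\<rat> \<real>)\<^sup>t\<close> with a coordinate space.
\<close>

definition real_embedding ::
    "(('a::{division_ring,ring_char_0} real_tensor) ^ 't \<Rightarrow> real ^ 'd) \<Rightarrow> 'a ^ 't \<Rightarrow> real ^ 'd" where
  "real_embedding \<Psi> x = \<Psi> (\<chi> j. tensor (x $ j) 1)"

definition coord_power :: "'a set \<Rightarrow> ('a ^ 't) set" where
  "coord_power S = {x. \<forall>j. x $ j \<in> S}"


section \<open>Reduction modulo a prime\<close>

definition subring_of :: "'a::ring_1 set \<Rightarrow> 'a ring" where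
  "subring_of S = \<lparr>carrier = S, monoid.mult = (*), one = 1, ring.zero = 0, add = (+)\<rparr>"

definition nonzero_primes :: "'k::field_char_0 set set" where
  "nonzero_primes = {\<pp>. primeideal \<pp> (subring_of \<O>\<^sub>K) \<and> \<pp> \<noteq> {0}}"

definition residue_field :: "'k::field_char_0 set \<Rightarrow> 'k set ring" where
  "residue_field \<pp> = subring_of \<O>\<^sub>K Quot \<pp>"

definition residue_card :: "'k::field_char_0 set \<Rightarrow> nat" where
  "residue_card \<pp> = card (carrier (residue_field \<pp>))"

definition prime_below :: "'k::field_char_0 set \<Rightarrow> nat" where
  "prime_below \<pp> = (THE p. prime p \<and> of_nat p \<in> \<pp>)"

text \<open>
  \<open>\<pp>\<O>\<close>: finite sums of products. The library's \<open>ideal_prod\<close> only uses that its arguments are sets.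
\<close>

definition extended_ideal ::
    "('k::field_char_0 \<Rightarrow> 'a::division_ring) \<Rightarrow> 'a set \<Rightarrow> 'k set \<Rightarrow> 'a set" where
  "extended_ideal \<iota> \<O> \<pp> = ideal_prod (subring_of \<O>) (\<iota> ` \<pp>) \<O>"

text \<open>\<open>M\<^sub>n(R)\<close> for a ring record \<open>R\<close>, with \<open>n = CARD('n)\<close>.\<close>

definition matrix_ring :: "'r ring \<Rightarrow> ('r ^ 'n ^ 'n) ring" where
  "matrix_ring R =
    \<lparr>carrier = {M. \<forall>i j. M $ i $ j \<in> carrier R},
     monoid.mult = (\<lambda>M N. \<chi> i j. \<Oplus>\<^bsub>R\<^esub>l\<in>UNIV. M $ i $ l \<otimes>\<^bsub>R\<^esub> N $ l $ j),
     one = (\<chi> i j. if i = j then \<one>\<^bsub>R\<^esub> else \<zero>\<^bsub>R\<^esub>),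
     ring.zero = (\<chi> i j. \<zero>\<^bsub>R\<^esub>),
     add = (\<lambda>M N. \<chi> i j. M $ i $ j \<oplus>\<^bsub>R\<^esub> N $ i $ j)\<rparr>"

text \<open>\<open>h\<close> is the chosen isomorphism from \<open>\<O>/\<pp>\<O>\<close> to matrices over the residue field.\<close>

definition reduction ::
    "('k::field_char_0 \<Rightarrow> 'a::division_ring) \<Rightarrow> 'a set \<Rightarrow> 'k set \<Rightarrow>
     ('a set \<Rightarrow> 'k set ^ 'n ^ 'n) \<Rightarrow> 'a ^ 't \<Rightarrow> ('t \<Rightarrow> 'k set ^ 'n ^ 'n)" where
  "reduction \<iota> \<O> \<pp> h x = (\<lambda>j. h (extended_ideal \<iota> \<O> \<pp> +>\<^bsub>subring_of \<O>\<^esub> x $ j))"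


section \<open>Left modules over matrix rings\<close>

text \<open>
  Left modules over a noncommutative ring are represented by the library's \<open>module\<close> record
  (whose fields \<open>mult\<close> and \<open>one\<close> play no role), and submodules by the library's locale
  \<open>submodule\<close>, which does not require the ring of scalars to be commutative.
\<close>

definition left_regular_module :: "'a ring \<Rightarrow> ('a, 'a) module" where
  "left_regular_module R =
    \<lparr>carrier = carrier R, monoid.mult = undefined, one = undefined,
     ring.zero = \<zero>\<^bsub>R\<^esub>, add = add R, smult = monoid.mult R\<rparr>"

definition column_module :: "'r ring \<Rightarrow> ('r ^ 'n ^ 'n, 'r ^ 'n) module" where
  "column_module R =
    \<lparr>carrier = {v. \<forall>i. v $ i \<in> carrier R}, monoid.mult = undefined, one = undefined,
     ring.zero = (\<chi> i. \<zero>\<^bsub>R\<^esub>),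
     add = (\<lambda>v w. \<chi> i. v $ i \<oplus>\<^bsub>R\<^esub> w $ i),
     smult = (\<lambda>M v. \<chi> i. \<Oplus>\<^bsub>R\<^esub>l\<in>UNIV. M $ i $ l \<otimes>\<^bsub>R\<^esub> v $ l)\<rparr>"

definition direct_power :: "'i set \<Rightarrow> ('s, 'm) module \<Rightarrow> ('s, 'i \<Rightarrow> 'm) module" where
  "direct_power I M =
    \<lparr>carrier = I \<rightarrow>\<^sub>E carrier M, monoid.mult = undefined, one = undefined,
     ring.zero = (\<lambda>i\<in>I. \<zero>\<^bsub>M\<^esub>),
     add = (\<lambda>v w. \<lambda>i\<in>I. v i \<oplus>\<^bsub>M\<^esub> w i),
     smult = (\<lambda>a v. \<lambda>i\<in>I. a \<odot>\<^bsub>M\<^esub> v i)\<rparr>"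

definition left_module_isomorphic ::
    "'s ring \<Rightarrow> ('s, 'm) module \<Rightarrow> ('s, 'l) module \<Rightarrow> bool" where
  "left_module_isomorphic R M N \<longleftrightarrow>
     (\<exists>g. bij_betw g (carrier M) (carrier N) \<and>
          (\<forall>x\<in>carrier M. \<forall>y\<in>carrier M. g (x \<oplus>\<^bsub>M\<^esub> y) = g x \<oplus>\<^bsub>N\<^esub> g y) \<and>
          (\<forall>a\<in>carrier R. \<forall>x\<in>carrier M. g (a \<odot>\<^bsub>M\<^esub> x) = a \<odot>\<^bsub>N\<^esub> g x))"

definition codes :: "nat \<Rightarrow> 'r ring \<Rightarrow> ('t \<Rightarrow> 'r ^ 'n ^ 'n) set set" where
  "codes k R =
     (let M = direct_power UNIV (left_regular_module (matrix_ring R)) in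
      {C. submodule C (matrix_ring R) M \<and>
          left_module_isomorphic (matrix_ring R) (M\<lparr>carrier := C\<rparr>)
            (direct_power {..<k} (column_module R))})"


section \<open>Lattices in Euclidean space\<close>

definition lattice_basis :: "('d \<Rightarrow> real ^ 'd) \<Rightarrow> (real ^ 'd) set \<Rightarrow> bool" where
  "lattice_basis B \<Lambda> \<longleftrightarrow>
     inj B \<and> independent (range B) \<and> \<Lambda> = {\<Sum>i\<in>UNIV. real_of_int (z i) *\<^sub>R B i | z. True}"

definition covolume :: "(real ^ 'd) set \<Rightarrow> real" where
  "covolume \<Lambda> =
     (THE V. \<exists>B. lattice_basis B \<Lambda> \<and>
        V = measure lebesgue {\<Sum>i\<in>UNIV. c i *\<^sub>R B i | c. \<forall>i. 0 \<le> c i \<and> c i < 1})"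

definition primitive_vectors :: "(real ^ 'd) set \<Rightarrow> (real ^ 'd) set" where
  "primitive_vectors \<Lambda> =
     {x \<in> \<Lambda>. x \<noteq> 0 \<and> (\<forall>y \<in> \<Lambda> \<inter> span {x}. y \<noteq> 0 \<longrightarrow> norm x \<le> norm y)}"


section \<open>Semi-admissible functions\<close>

text \<open>
  The Riemann integral on a box: as the library's gauge integral, with constant gauges.
\<close>

definition riemann_integrable_box ::
    "('v::euclidean_space \<Rightarrow> real) \<Rightarrow> 'v \<Rightarrow> 'v \<Rightarrow> bool" where
  "riemann_integrable_box f a b \<longleftrightarrow>
     (\<exists>I. \<forall>e>0. \<exists>d>0. \<forall>p. p tagged_division_of (cbox a b) \<and> (\<lambda>x. ball x d) fine p \<longrightarrow>
        \<bar>(\<Sum>(x, K)\<in>p. measure lborel K * f x) - I\<bar> < e)"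

text \<open>
  On the whole space, Riemann integrability is understood on every box; convergence of the
  improper integral is then a consequence of the decay condition.
\<close>

definition semi_admissible :: "('v::euclidean_space \<Rightarrow> real) \<Rightarrow> bool" where
  "semi_admissible f \<longleftrightarrow>
     (\<forall>a b. riemann_integrable_box f a b) \<and>
     (\<exists>b>0. \<exists>\<delta>>0. \<forall>x. \<bar>f x\<bar> \<le> b / (1 + norm x) powr (real DIM('v) + \<delta>))"

definition zeta_nat :: "nat \<Rightarrow> real" where
  "zeta_nat s = suminf (\<lambda>j. 1 / real (Suc j) ^ s)"


section \<open>The random lattices\<close>

definition scaling_factor :: "nat \<Rightarrow> nat \<Rightarrow> nat \<Rightarrow> nat \<Rightarrow> nat \<Rightarrow> real" where
  "scaling_factor n m t k q =
     real q powr ((real n * real k - real n ^ 2 * real t) / (real n ^ 2 * real m * real t))"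

definition code_lattice ::
    "real \<Rightarrow> ('a ^ 't \<Rightarrow> real ^ 'd) \<Rightarrow> 'a set \<Rightarrow> ('a ^ 't \<Rightarrow> 'c) \<Rightarrow> 'c set \<Rightarrow> (real ^ 'd) set" where
  "code_lattice \<beta> i \<O> \<phi> C = (\<lambda>x. \<beta> *\<^sub>R i x) ` {x \<in> coord_power \<O>. \<phi> x \<in> C}"

definition average :: "('c \<Rightarrow> real) \<Rightarrow> 'c set \<Rightarrow> real" where
  "average g S = (\<Sum>c\<in>S. g c) / real (card S)"

end

theory Submission
  imports Defs
begin

text \<open>
  Let \<open>\<pp>\<close> have residue cardinality \<open>q\<close>, and let \<open>x \<noteq> 0\<close> in \<open>\<O>\<^sup>t\<close> reduce to a matrix of rank \<open>r\<close>.
  Submodules correspond to row spaces, so a random code contains the reduction of \<open>x\<close> with the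
  probability \<open>(\<Prod>i<r. (q ^ k - q ^ i) / (q ^ (n t) - q ^ i))\<close>. For \<open>r = n\<close> this cancels the scaling, and the
  full-rank vectors contribute a Riemann sum that converges to the integral divided by the covolume.
  Vectors of rank \<open>r < n\<close> have a left kernel of dimension \<open>n - r\<close>. Those annihilated by a given
  subspace are closed under differences, and they are long: the left ideal \<open>\<O> y\<close> generated by a
  coordinate \<open>y\<close> of such a vector has index at least \<open>q ^ (n (n - r))\<close>, while the index is bounded by a
  power of the size of \<open>y\<close>. Since \<open>k \<ge> n\<close>, their total contribution is \<open>O(1/q)\<close>, even after
  summing over all subspaces. The sums over primitive vectors scaled by \<open>j\<close> are recovered from the
  sums over all nonzero vectors by a contraction argument, which produces the factor \<open>1 / \<zeta>\<close>.
\<close>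

section \<open>Lattice sums as Riemann sums\<close>

text \<open>What shapes the proof is the vectors of rank \<open>r < n\<close>: they lie in a random
  code more often than the scaling can absorb, and \<open>f\<close> may have either sign, so they
  cannot simply be dropped. They are estimated through a positive weight dominating \<open>f\<close>
  in absolute value, and the powers of \<open>q\<close> from four sources have to balance: the
  probability, the number of possible left kernels, the sparseness of the vectors with a given
  kernel, and the covolume normalisation. The count is in \<open>weighted_rank_bound\<close>.

  All constants must be the same for every prime. Therefore size is measured by rational coordinates
  with respect to one basis of \<open>A\<close> contained in the order. That these coordinates have
  bounded denominators on the order, so that its image is a lattice with a well-defined covolume,
  has to be derived from integrality alone.

  Every estimate is made for all dilations of the lattices by integers \<open>j\<close>, because the
  passage to primitive vectors involves all of them. The limit \<open>L\<close> obtained at the end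
  is the right-hand side itself.\<close>

text \<open>Dyadic shells: where \<open>2 ^ k \<le> 1 + norm x < 2 ^ Suc k\<close>, the integrand is
  at most \<open>2 powr (- s k)\<close> with \<open>s = DIM + \<delta>\<close>, while the ball of
  radius \<open>2 ^ Suc k\<close> has volume of order \<open>2 ^ (DIM k)\<close>. The products form
  a geometric series with ratio \<open>2 powr (- \<delta>)\<close>.\<close>

lemma integrable_decay:
  fixes \<delta> :: real
  assumes "\<delta> > 0"
  shows "integrable lborel (\<lambda>x::'v::euclidean_space. (1 + norm x) powr (- (real DIM('v) + \<delta>)))"
proof (rule integrableI_bounded)
  let ?s = "real DIM('v) + \<delta>"
  let ?a = "\<lambda>k::nat. 2 powr (- ?s * real k)"
  let ?B = "\<lambda>k::nat. ball (0::'v) (2 ^ Suc k)"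
  show "(\<lambda>x::'v. (1 + norm x) powr (- ?s)) \<in> borel_measurable lborel" by measurable
  have le_suminf: "F k \<le> suminf F" for F :: "nat \<Rightarrow> ennreal" and k
    using sum_le_suminf[of F "{k}"] by simp
  have bound: "ennreal (norm ((1 + norm x) powr (- ?s))) \<le> suminf (\<lambda>k. ennreal (?a k) * indicator (?B k) x)"
    for x :: 'v
  proof -
    define k where "k = nat \<lfloor>log 2 (1 + norm x)\<rfloor>"
    have k: "real k \<le> log 2 (1 + norm x)" "log 2 (1 + norm x) < real (Suc k)"
    proof -
      have "0 \<le> log 2 (1 + norm x)" by (subst zero_le_log_cancel_iff) (auto intro: add_pos_nonneg)
      then show "real k \<le> log 2 (1 + norm x)" "log 2 (1 + norm x) < real (Suc k)"
        unfolding k_def by linarith+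
    qed
    have "2 powr real k \<le> 1 + norm x"
      using k(1) by (subst (asm) le_log_iff) (auto intro: add_pos_nonneg)
    moreover have "1 + norm x < 2 powr real (Suc k)"
      using k(2) by (subst (asm) log_less_iff) (auto intro: add_pos_nonneg)
    ultimately have 1: "2 powr real k \<le> 1 + norm x" "1 + norm x < 2 ^ Suc k"
      by (auto simp: powr_realpow simp del: of_nat_Suc)
    have "(1 + norm x) powr (- ?s) \<le> (2 powr real k) powr (- ?s)"
      by (rule powr_mono2') (use 1 assms in auto)
    also have "\<dots> = ?a k" by (simp add: powr_powr mult.commute)
    finally have "ennreal (norm ((1 + norm x) powr (- ?s))) \<le> ennreal (?a k) * indicator (?B k) x"
      using 1 by (auto simp: indicator_def intro!: ennreal_leI)
    also have "\<dots> \<le> suminf (\<lambda>k. ennreal (?a k) * indicator (?B k) x)"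
      by (rule le_suminf)
    finally show ?thesis .
  qed
  let ?b = "\<lambda>k::nat. unit_ball_vol (real DIM('v)) * 2 ^ DIM('v) * (2 powr (-\<delta>)) ^ k"
  have summ: "summable ?b"
    by (intro summable_mult summable_geometric) (use assms in \<open>auto simp: powr_less_one\<close>)
  have term_eq: "?a k * (unit_ball_vol (real DIM('v)) * (2 ^ Suc k) ^ DIM('v)) = ?b k" for k
  proof -
    have "?a k = 2 powr (- real (DIM('v) * k)) * 2 powr (- \<delta> * real k)"
      by (subst powr_add [symmetric]) (simp add: algebra_simps)
    also have "2 powr (- real (DIM('v) * k)) = inverse (2 ^ (DIM('v) * k))"
      by (simp add: powr_minus powr_realpow del: of_nat_mult)
    also have "2 powr (- \<delta> * real k) = (2 powr (-\<delta>)) ^ k"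
      by (subst powr_power) (simp_all add: mult.commute[of _ \<delta>])
    finally have "?a k = inverse (2 ^ (DIM('v) * k)) * (2 powr (-\<delta>)) ^ k" .
    moreover have "(2 ^ Suc k) ^ DIM('v) = 2 ^ DIM('v) * (2::real) ^ (DIM('v) * k)"
      by (subst power_mult [symmetric], subst power_add [symmetric]) (simp add: algebra_simps)
    ultimately show ?thesis by (simp del: power_Suc)
  qed
  have ind: "(\<lambda>x::'v. c * indicator (ball 0 r) x) \<in> borel_measurable lborel" for c :: ennreal and r
    by (rule borel_measurable_times_ennreal) (auto intro: borel_measurable_indicator)
  have nn: "(\<integral>\<^sup>+ x. ennreal (?a k) * indicator (?B k) x \<partial>lborel) = ennreal (?b k)" for k
  proof -
    have "(\<integral>\<^sup>+ x. ennreal (?a k) * indicator (?B k) x \<partial>lborel) = ennreal (?a k) * emeasure lborel (?B k)"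
      by (rule nn_integral_cmult_indicator) simp
    also have "emeasure lborel (?B k) = ennreal (unit_ball_vol (real DIM('v)) * (2 ^ Suc k) ^ DIM('v))"
      by (rule emeasure_ball) simp
    also have "ennreal (?a k) * \<dots> = ennreal (?b k)"
      unfolding term_eq [symmetric] by (rule ennreal_mult [symmetric]) auto
    finally show ?thesis .
  qed
  have "(\<integral>\<^sup>+ x. ennreal (norm ((1 + norm x) powr (- ?s))) \<partial>(lborel :: 'v measure))
      \<le> (\<integral>\<^sup>+ x. suminf (\<lambda>k. ennreal (?a k) * indicator (?B k) x) \<partial>lborel)"
    by (rule nn_integral_mono) (rule bound)
  also have "\<dots> = suminf (\<lambda>k. \<integral>\<^sup>+ x. ennreal (?a k) * indicator (?B k) x \<partial>lborel)"
    by (rule nn_integral_suminf) (rule ind)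
  also have "\<dots> = suminf (\<lambda>k. ennreal (?b k))"
    unfolding nn ..
  also have "\<dots> = ennreal (suminf ?b)"
    by (rule suminf_ennreal2[OF _ summ]) simp
  finally show "(\<integral>\<^sup>+ x. ennreal (norm ((1 + norm x) powr (- ?s))) \<partial>(lborel :: 'v measure)) < \<infinity>"
    unfolding infinity_ennreal_def by (rule order_le_less_trans) (rule ennreal_less_top)
qed

text \<open>Packing: the balls of radius \<open>l / 2\<close> about the points are disjoint, and
  since \<open>l \<le> norm x\<close>, the weight at a centre exceeds the weight in its ball by at
  most a factor independent of \<open>l\<close>. So the sum times the volume of one ball is
  dominated by an integral. The gain \<open>1 / l ^ DIM\<close> is what later makes sparse sets of
  long vectors negligible.\<close>

lemma separated_sum_bound:
  fixes \<delta> :: real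
  assumes "\<delta> > 0"
  obtains C where "C > 0"
    "\<And>(X :: 'v::euclidean_space set) l. finite X \<Longrightarrow> l > 0 \<Longrightarrow> (\<And>x. x \<in> X \<Longrightarrow> l \<le> norm x) \<Longrightarrow>
       (\<And>x y. x \<in> X \<Longrightarrow> y \<in> X \<Longrightarrow> x \<noteq> y \<Longrightarrow> l \<le> dist x y) \<Longrightarrow>
       (\<Sum>x\<in>X. (1 + norm x) powr (- (real DIM('v) + \<delta>))) \<le> C / l ^ DIM('v)"
proof -
  let ?s = "real DIM('v) + \<delta>"
  let ?w = "\<lambda>x::'v. (1 + norm x) powr (- ?s)"
  let ?v = "unit_ball_vol (real DIM('v))"
  define J where "J = (\<integral>x. ?w x \<partial>lborel)"
  have "J \<ge> 0" unfolding J_def by (rule Bochner_Integration.integral_nonneg) auto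
  have vpos: "?v > 0" by simp
  \<comment> \<open>\<open>J\<close> is only known to be nonnegative at this point; the added 1
    makes \<open>C\<close> positive.\<close>
  define C where "C = (3/2) powr ?s * J * 2 ^ DIM('v) / ?v + 1"
  have main: "(\<Sum>x\<in>X. ?w x) \<le> C / l ^ DIM('v)"
    if X: "finite X" and l: "l > 0" and nX: "\<And>x. x \<in> X \<Longrightarrow> l \<le> norm x"
      and sep: "\<And>x y. x \<in> X \<Longrightarrow> y \<in> X \<Longrightarrow> x \<noteq> y \<Longrightarrow> l \<le> dist x y" for X :: "'v set" and l
  proof -
    have point: "(\<Sum>x\<in>X. ?w x * indicator (ball x (l/2)) y) \<le> (3/2) powr ?s * ?w y" for y
    proof (cases "\<exists>x\<in>X. y \<in> ball x (l/2)")
      case True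
      then obtain x where x: "x \<in> X" "dist x y < l/2" by auto
      have uniq: "y \<notin> ball z (l/2)" if "z \<in> X" "z \<noteq> x" for z
        using sep[OF that(1) x(1) that(2)] x(2) dist_triangle_half_r[of y z l x] by (auto simp: dist_commute)
      have "(\<Sum>x\<in>X. ?w x * indicator (ball x (l/2)) y) = ?w x * indicator (ball x (l/2)) y"
        using uniq X x(1) by (subst sum.remove[of X x]) (auto intro!: sum.neutral)
      also have "\<dots> = ?w x" using x by simp
      also have "\<dots> = (3/2) powr ?s * (3/2 * (1 + norm x)) powr (- ?s)"
        by (subst powr_mult) (auto simp: powr_minus field_simps powr_diff powr_add)
      also have "\<dots> \<le> (3/2) powr ?s * ?w y"
      proof (intro mult_left_mono powr_mono2')
        have "norm y \<le> norm x + dist x y" by norm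
        also have "\<dots> \<le> 3/2 * norm x" using x nX[OF x(1)] by simp
        finally show "1 + norm y \<le> 3/2 * (1 + norm x)" by simp
      qed (use assms in \<open>auto intro: add_pos_nonneg\<close>)
      finally show ?thesis .
    next
      case False
      then have "(\<Sum>x\<in>X. ?w x * indicator (ball x (l/2)) y) = 0"
        by (intro sum.neutral) auto
      then show ?thesis by simp
    qed
    have vol: "measure lborel (ball x (l/2)) = ?v * (l/2) ^ DIM('v)" for x :: 'v
      using l by (simp add: content_ball)
    have int: "integrable lborel (\<lambda>y. ?w x * indicator (ball x (l/2)) y)" for x :: 'v
      by (intro integrable_mult_right integrable_real_indicator)
         (use emeasure_lborel_ball_finite in auto)
    have "(\<Sum>x\<in>X. ?w x) * (?v * (l/2) ^ DIM('v)) = (\<Sum>x\<in>X. \<integral>y. ?w x * indicator (ball x (l/2)) y \<partial>lborel)"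
      by (simp add: sum_distrib_right vol)
    also have "\<dots> = (\<integral>y. (\<Sum>x\<in>X. ?w x * indicator (ball x (l/2)) y) \<partial>lborel)"
      by (rule Bochner_Integration.integral_sum [symmetric]) (rule int)
    also have "\<dots> \<le> (\<integral>y. (3/2) powr ?s * ?w y \<partial>lborel)"
      by (intro integral_mono Bochner_Integration.integrable_sum int point integrable_mult_right integrable_decay assms)
    also have "\<dots> = (3/2) powr ?s * J" by (simp add: J_def)
    finally have "(\<Sum>x\<in>X. ?w x) * (?v * (l/2) ^ DIM('v)) \<le> (3/2) powr ?s * J" .
    then have "(\<Sum>x\<in>X. ?w x) \<le> (3/2) powr ?s * J / (?v * (l/2) ^ DIM('v))"
      using l vpos by (subst pos_le_divide_eq) (auto intro!: mult_pos_pos)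
    also have "\<dots> = ((3/2) powr ?s * J * 2 ^ DIM('v) / ?v) / l ^ DIM('v)"
      using l vpos by (simp add: power_divide)
    also have "\<dots> \<le> C / l ^ DIM('v)"
      unfolding C_def using l by (intro divide_right_mono) auto
    finally show ?thesis .
  qed
  have "C > 0" unfolding C_def using \<open>J \<ge> 0\<close> vpos by (intro add_nonneg_pos) auto
  then show ?thesis using main that by blast
qed

section \<open>Lebesgue's criterion for Riemann integrability\<close>

text \<open>A cell of a fine tagged division that meets the set in its interior contains two points
  whose values differ by more than \<open>e\<close>. Tagging all such cells once by the upper and
  once by the lower point gives two Riemann sums close to \<open>I\<close>, so these cells have
  total measure below \<open>\<eta>\<close>. The rest of the set lies in the frontiers of the cells,
  which are negligible.\<close>

lemma riemann_integrable_oscillation: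
  fixes f :: "'v::euclidean_space \<Rightarrow> real"
  assumes f: "riemann_integrable_box f a b" and e: "e > 0"
  shows "negligible {x \<in> cbox a b. \<forall>r>0. \<exists>y\<in>ball x r. \<exists>z\<in>ball x r. f y - f z > e}"
    (is "negligible ?D")
  unfolding negligible_outer
proof (intro allI impI)
  fix \<eta> :: real assume \<eta>: "\<eta> > 0"
  from f obtain I where I: "\<And>e. e > 0 \<Longrightarrow> \<exists>d>0. \<forall>p. p tagged_division_of (cbox a b) \<and> (\<lambda>x. ball x d) fine p \<longrightarrow>
        \<bar>(\<Sum>(x, K)\<in>p. measure lborel K * f x) - I\<bar> < e"
    unfolding riemann_integrable_box_def by blast
  have "e * \<eta> / 2 > 0" using e \<eta> by simp
  from I[OF this] obtain d where d: "d > 0"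
    and dI: "\<And>p. p tagged_division_of (cbox a b) \<Longrightarrow> (\<lambda>x. ball x d) fine p \<Longrightarrow>
        \<bar>(\<Sum>(x, K)\<in>p. measure lborel K * f x) - I\<bar> < e * \<eta> / 2"
    by blast
  \<comment> \<open>Half the radius, because a cell is only known to lie within \<open>d/2\<close>
    of its old tag; any two of its points are then less than \<open>d\<close> apart.\<close>
  have "gauge (\<lambda>x::'v. ball x (d/2))" using d by (intro gauge_ball) auto
  then obtain p where p: "p tagged_division_of (cbox a b)" and pf: "(\<lambda>x. ball x (d/2)) fine p"
    by (rule fine_division_exists)
  have finp: "finite p" using p by (rule tagged_division_of_finite)
  define good where "good K \<longleftrightarrow> interior K \<inter> ?D \<noteq> {}" for K
  have "\<exists>y z. y \<in> K \<and> z \<in> K \<and> f y - f z > e" if good: "good K" for K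
  proof -
    from good obtain x where x: "x \<in> interior K" "x \<in> ?D" unfolding good_def by blast
    then obtain r where r: "r > 0" "ball x r \<subseteq> K"
      by (meson interior_subset open_contains_ball_eq open_interior subset_trans)
    then show ?thesis using x(2) by blast
  qed
  then obtain Y Z where YZ: "\<And>K. good K \<Longrightarrow> Y K \<in> K" "\<And>K. good K \<Longrightarrow> Z K \<in> K"
    "\<And>K. good K \<Longrightarrow> f (Y K) - f (Z K) > e"
    by metis
  define retag where "retag T = (\<lambda>(x, K). (if good K then T K else x, K))"
    for T :: "'v set \<Rightarrow> 'v" and x :: 'v
  \<comment> \<open>A good cell has nonempty interior and so occurs with a single tag; otherwise
    retagging could merge two members of \<open>p\<close> and change the sum.\<close>
  have uniq: "x = x'" if "(x, K) \<in> p" "(x', K) \<in> p" "good K" for x x' K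
  proof (rule ccontr)
    assume "x \<noteq> x'"
    then have "interior K \<inter> interior K = {}"
      using tagged_division_ofD(5)[OF p that(1) that(2)] by blast
    then show False using that(3) unfolding good_def by blast
  qed
  have retag: "retag T ` p tagged_division_of (cbox a b)" "(\<lambda>x. ball x d) fine (retag T ` p)"
    "(\<Sum>(x, K)\<in>retag T ` p. measure lborel K * f x)
       = (\<Sum>(x, K)\<in>p. measure lborel K * f (if good K then T K else x))"
    "\<bar>(\<Sum>(x, K)\<in>p. measure lborel K * f (if good K then T K else x)) - I\<bar> < e * \<eta> / 2"
    if T: "\<And>K. good K \<Longrightarrow> T K \<in> K" for T
  proof -
    have inj: "inj_on (retag T) p"
      by (auto simp: inj_on_def retag_def split: if_splits intro: uniq)
    show div: "retag T ` p tagged_division_of (cbox a b)"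
    proof (rule tagged_division_ofI)
      show "finite (retag T ` p)" using finp by simp
      show "x \<in> K" if "(x, K) \<in> retag T ` p" for x K
        using that T tagged_division_ofD(2)[OF p] by (auto simp: retag_def split: if_splits)
      show "K \<subseteq> cbox a b" if "(x, K) \<in> retag T ` p" for x K
        using that tagged_division_ofD(3)[OF p] by (auto simp: retag_def)
      show "\<exists>a b. K = cbox a b" if "(x, K) \<in> retag T ` p" for x K
        using that tagged_division_ofD(4)[OF p] by (auto simp: retag_def)
      show "interior K1 \<inter> interior K2 = {}"
        if "(x1, K1) \<in> retag T ` p" "(x2, K2) \<in> retag T ` p" "(x1, K1) \<noteq> (x2, K2)" for x1 K1 x2 K2
      proof -
        from that obtain y1 y2 where y: "(y1, K1) \<in> p" "(y2, K2) \<in> p"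
          "x1 = (if good K1 then T K1 else y1)" "x2 = (if good K2 then T K2 else y2)"
          by (auto simp: retag_def)
        with that(3) have "(y1, K1) \<noteq> (y2, K2)" by auto
        then show ?thesis using tagged_division_ofD(5)[OF p y(1,2)] by blast
      qed
      have "{K. \<exists>x. (x, K) \<in> retag T ` p} = {K. \<exists>x. (x, K) \<in> p}"
        by (force simp: retag_def)
      then show "\<Union>{K. \<exists>x. (x, K) \<in> retag T ` p} = cbox a b"
        using tagged_division_ofD(6)[OF p] by simp
    qed
    show fine: "(\<lambda>x. ball x d) fine (retag T ` p)"
    proof (rule fineI)
      fix x K assume "(x, K) \<in> retag T ` p"
      then obtain y where y: "(y, K) \<in> p" "x = (if good K then T K else y)"
        by (auto simp: retag_def)
      have xK: "x \<in> K" using y T tagged_division_ofD(2)[OF p y(1)] by auto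
      have K: "K \<subseteq> ball y (d/2)" using pf y(1) by (auto simp: fine_def)
      show "K \<subseteq> ball x d"
      proof
        fix u assume "u \<in> K"
        then have "dist y u < d/2" "dist y x < d/2" using K xK by auto
        then show "u \<in> ball x d" by (auto intro: dist_triangle_half_r)
      qed
    qed
    show sum: "(\<Sum>(x, K)\<in>retag T ` p. measure lborel K * f x)
       = (\<Sum>(x, K)\<in>p. measure lborel K * f (if good K then T K else x))"
      by (subst sum.reindex[OF inj]) (auto simp: retag_def intro!: sum.cong)
    show "\<bar>(\<Sum>(x, K)\<in>p. measure lborel K * f (if good K then T K else x)) - I\<bar> < e * \<eta> / 2"
      using dI[OF div fine] by (simp add: sum)
  qed
  let ?G = "{(x, K). (x, K) \<in> p \<and> good K}"
  let ?R = "\<Union>(x, K)\<in>?G. K" and ?F = "\<Union>(x, K)\<in>p. frontier K"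
  have finG: "finite ?G" by (rule finite_subset[OF _ finp]) auto
  have cboxK: "\<exists>u v. K = cbox u v" if "(x, K) \<in> p" for x K
    using tagged_division_ofD(4)[OF p that] .
  have "e * (\<Sum>(x, K)\<in>?G. measure lborel K) \<le> (\<Sum>(x, K)\<in>?G. measure lborel K * (f (Y K) - f (Z K)))"
    unfolding sum_distrib_left
    by (intro sum_mono) (auto simp: mult.commute[of e] intro!: mult_left_mono less_imp_le[OF YZ(3)])
  also have "\<dots> = (\<Sum>(x, K)\<in>p. if good K then measure lborel K * (f (Y K) - f (Z K)) else 0)"
    by (intro sum.mono_neutral_cong_left finp) (auto split: if_splits)
  also have "\<dots> = (\<Sum>(x, K)\<in>p. measure lborel K * f (if good K then Y K else x)
                      - measure lborel K * f (if good K then Z K else x))"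
    by (intro sum.cong) (auto simp: algebra_simps)
  also have "\<dots> = (\<Sum>(x, K)\<in>p. measure lborel K * f (if good K then Y K else x))
                - (\<Sum>(x, K)\<in>p. measure lborel K * f (if good K then Z K else x))"
    by (simp add: sum_subtractf case_prod_unfold)
  also have "\<dots> < e * \<eta>"
    using retag(4)[OF YZ(1)] retag(4)[OF YZ(2)] by linarith
  finally have small: "(\<Sum>(x, K)\<in>?G. measure lborel K) < \<eta>" using e by simp
  have measK: "K \<in> lmeasurable" "measure lebesgue K = measure lborel K" if "(x, K) \<in> p" for x K
    using cboxK[OF that] by auto
  have R: "?R \<in> lmeasurable" by (rule fmeasurable.finite_UN) (use finG measK in auto)
  have "negligible ?F"
    by (rule negligible_Union) (use finp cboxK in \<open>auto intro!: negligible_convex_frontier dest!: cboxK\<close>)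
  then have F: "?F \<in> lmeasurable" "measure lebesgue ?F = 0"
    by (auto simp: negligible_iff_measure)
  have "measure lebesgue (?R \<union> ?F) \<le> measure lebesgue ?R + measure lebesgue ?F"
    using R F by (intro measure_Un_le) auto
  also have "\<dots> = measure lebesgue ?R" using F by simp
  also have "\<dots> \<le> (\<Sum>xK\<in>?G. measure lebesgue (snd xK))"
    unfolding case_prod_unfold
    using finG measK by (intro measure_UNION_le) (auto intro: fmeasurableD simp: case_prod_unfold)
  also have "\<dots> = (\<Sum>(x, K)\<in>?G. measure lborel K)"
    by (intro sum.cong) (auto simp: measK)
  also note small
  finally have meas: "measure lebesgue (?R \<union> ?F) < \<eta>" .
  have sub: "?D \<subseteq> ?R \<union> ?F"
  proof
    fix x assume x: "x \<in> ?D"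
    then have "x \<in> \<Union>{K. \<exists>x. (x, K) \<in> p}" using tagged_division_ofD(6)[OF p] by auto
    then obtain t K where K: "(t, K) \<in> p" "x \<in> K" by blast
    show "x \<in> ?R \<union> ?F"
    proof (cases "x \<in> interior K")
      case True
      then have "good K" using x unfolding good_def by blast
      then show ?thesis using K by blast
    next
      case False
      then have "x \<in> frontier K" using K by (auto simp: frontier_def intro: closure_subset[THEN subsetD])
      then show ?thesis using K by blast
    qed
  qed
  show "\<exists>T. ?D \<subseteq> T \<and> T \<in> lmeasurable \<and> measure lebesgue T < \<eta>"
    using sub meas R F by (intro exI[of _ "?R \<union> ?F"]) auto
qed

text \<open>A point of discontinuity lies in some box and has oscillation above some
  \<open>1 / Suc j\<close>, so countably many negligible sets cover the exceptional points.\<close>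

lemma riemann_integrable_isCont_ae:
  fixes f :: "'v::euclidean_space \<Rightarrow> real"
  assumes f: "\<And>a b. riemann_integrable_box f a b"
  shows "negligible {x. \<not> isCont f x}"
proof -
  let ?c = "\<lambda>n::nat. real n *\<^sub>R (One::'v)"
  let ?D = "\<lambda>n j. {x \<in> cbox (- ?c n) (?c n). \<forall>r>0. \<exists>y\<in>ball x r. \<exists>z\<in>ball x r. f y - f z > inverse (real (Suc j))}"
  have "negligible (\<Union>n. \<Union>j. ?D n j)"
    by (intro negligible_countable_Union) (auto intro!: negligible_countable_Union riemann_integrable_oscillation f)
  moreover have "{x. \<not> isCont f x} \<subseteq> (\<Union>n. \<Union>j. ?D n j)"
  proof
    fix x assume "x \<in> {x. \<not> isCont f x}"
    then obtain e where e: "e > 0" "\<And>r. r > 0 \<Longrightarrow> \<exists>y. dist y x < r \<and> dist (f y) (f x) \<ge> e"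
      unfolding continuous_at_eps_delta mem_Collect_eq by (metis not_less)
    obtain j where j: "inverse (real (Suc j)) < e" using reals_Archimedean[OF e(1)] by blast
    obtain n :: nat where n: "norm x \<le> real n" using real_arch_simple by blast
    have "x \<in> cbox (- ?c n) (?c n)"
      using n Basis_le_norm[of _ x] by (force simp: mem_box abs_le_iff)
    moreover have "\<exists>y\<in>ball x r. \<exists>z\<in>ball x r. f y - f z > inverse (real (Suc j))" if "r > 0" for r
    proof -
      from e(2)[OF that] obtain y where y: "dist y x < r" "dist (f y) (f x) \<ge> e" by blast
      then have "f y - f x > inverse (real (Suc j)) \<or> f x - f y > inverse (real (Suc j))"
        using j by (auto simp: dist_real_def)
      then show ?thesis using y(1) that by (metis centre_in_ball dist_commute mem_ball)
    qed
    ultimately show "x \<in> (\<Union>n. \<Union>j. ?D n j)" by blast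
  qed
  ultimately show ?thesis by (rule negligible_subset)
qed

section \<open>Fundamental domains, lattice sums and covolume\<close>

text \<open>Reduces questions on lattices to the integer lattice and the half-open unit cube, where
  rounding down finds the tile of a point.\<close>

lemma lattice_basis_linear:
  fixes B :: "'d::finite \<Rightarrow> real ^ 'd"
  assumes "lattice_basis B \<Lambda>"
  obtains T :: "real ^ 'd \<Rightarrow> real ^ 'd" where "linear T" "bij T" "\<Lambda> = T ` {z. \<forall>i. z $ i \<in> \<int>}"
    "{\<Sum>i\<in>UNIV. c i *\<^sub>R B i | c. \<forall>i. 0 \<le> c i \<and> c i < 1} = T ` {y. \<forall>i. 0 \<le> y $ i \<and> y $ i < 1}"
proof
  define T :: "real ^ 'd \<Rightarrow> real ^ 'd" where "T = (\<lambda>y. \<Sum>i\<in>UNIV. y $ i *\<^sub>R B i)"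
  have B: "inj B" "independent (range B)" "\<Lambda> = {\<Sum>i\<in>UNIV. real_of_int (z i) *\<^sub>R B i | z. True}"
    using assms by (auto simp: lattice_basis_def)
  show lin: "linear T"
    by (rule linearI) (simp_all add: T_def algebra_simps sum.distrib scaleR_sum_right)
  have "inj T"
  proof (rule linear_injective_0[OF lin, THEN iffD2], intro allI impI)
    fix y assume "T y = 0"
    then have "(\<Sum>v\<in>range B. (y $ inv_into UNIV B v) *\<^sub>R v) = 0"
      by (simp add: T_def sum.reindex[OF B(1)] inv_f_f[OF B(1)])
    then have "y $ inv_into UNIV B v = 0" if "v \<in> range B" for v
      using B(2) that by (auto simp: independent_explicit)
    then have "y $ i = 0" for i using inv_f_f[OF B(1), of i] by (metis rangeI)
    then show "y = 0" by (simp add: vec_eq_iff)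
  qed
  then show "bij T" using linear_injective_imp_surjective[OF lin] by (auto simp: bij_def)
  show "\<Lambda> = T ` {z. \<forall>i. z $ i \<in> \<int>}"
  proof safe
    fix x assume "x \<in> \<Lambda>"
    then obtain z where "x = (\<Sum>i\<in>UNIV. real_of_int (z i) *\<^sub>R B i)" by (auto simp: B(3))
    then have "x = T (\<chi> i. of_int (z i))" by (simp add: T_def)
    then show "x \<in> T ` {z. \<forall>i. z $ i \<in> \<int>}" by auto
  next
    fix z :: "real ^ 'd" assume z: "\<forall>i. z $ i \<in> \<int>"
    have "T z = (\<Sum>i\<in>UNIV. real_of_int \<lfloor>z $ i\<rfloor> *\<^sub>R B i)"
      by (simp add: T_def of_int_floor z)
    then show "T z \<in> \<Lambda>" by (auto simp: B(3))
  qed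
  show "{\<Sum>i\<in>UNIV. c i *\<^sub>R B i | c. \<forall>i. 0 \<le> c i \<and> c i < 1} = T ` {y. \<forall>i. 0 \<le> y $ i \<and> y $ i < 1}"
  proof safe
    fix c :: "'d \<Rightarrow> real" assume "\<forall>i. 0 \<le> c i \<and> c i < 1"
    then show "(\<Sum>i\<in>UNIV. c i *\<^sub>R B i) \<in> T ` {y. \<forall>i. 0 \<le> y $ i \<and> y $ i < 1}"
      by (intro image_eqI[of _ _ "\<chi> i. c i"]) (auto simp: T_def)
  qed (auto simp: T_def)
qed

lemma summable_decay:
  fixes X :: "'v::euclidean_space set" and f :: "'v \<Rightarrow> real"
  assumes "\<delta> > 0" "l > 0" "\<And>x. x \<in> X \<Longrightarrow> l \<le> norm x"
    "\<And>x y. x \<in> X \<Longrightarrow> y \<in> X \<Longrightarrow> x \<noteq> y \<Longrightarrow> l \<le> dist x y"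
    and "\<And>x. x \<in> X \<Longrightarrow> \<bar>f x\<bar> \<le> b * (1 + norm x) powr (- (real DIM('v) + \<delta>))"
  shows "(\<lambda>x. \<bar>f x\<bar>) summable_on X" "f summable_on X"
proof -
  obtain C where C: "\<And>(X :: 'v set) l. finite X \<Longrightarrow> l > 0 \<Longrightarrow> (\<And>x. x \<in> X \<Longrightarrow> l \<le> norm x) \<Longrightarrow>
       (\<And>x y. x \<in> X \<Longrightarrow> y \<in> X \<Longrightarrow> x \<noteq> y \<Longrightarrow> l \<le> dist x y) \<Longrightarrow>
       (\<Sum>x\<in>X. (1 + norm x) powr (- (real DIM('v) + \<delta>))) \<le> C / l ^ DIM('v)"
    using separated_sum_bound[OF assms(1), where ?'v='v] by metis
  have "(\<lambda>x. (1 + norm x) powr (- (real DIM('v) + \<delta>))) summable_on X"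
  proof (rule nonneg_bounded_partial_sums_imp_summable_on)
    show "eventually (\<lambda>Y. (\<Sum>x\<in>Y. (1 + norm x) powr (- (real DIM('v) + \<delta>))) \<le> C / l ^ DIM('v))
            (finite_subsets_at_top X)"
      by (rule eventually_finite_subsets_at_top_weakI, rule C) (use assms(2-4) in blast)+
  qed simp
  then have "(\<lambda>x. b * (1 + norm x) powr (- (real DIM('v) + \<delta>))) summable_on X"
    by (rule summable_on_cmult_right)
  then show "(\<lambda>x. \<bar>f x\<bar>) summable_on X"
    by (rule summable_on_comparison_test) (use assms in auto)
  then show "f summable_on X"
    by (subst summable_on_iff_abs_summable_on_real) simp
qed

text \<open>The tiles \<open>e D + e v\<close>, with \<open>v\<close> a lattice point, partition the
  space, so up to the tile volume a lattice sum is the integral of a step function that is constant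
  on each tile. Convergence of lattice sums thereby becomes a case of dominated convergence.\<close>

lemma has_sum_lattice_tiles:
  fixes T :: "real ^ 'd::finite \<Rightarrow> real ^ 'd" and f :: "real ^ 'd \<Rightarrow> real"
  assumes T: "linear T" "bij T" and e: "e > 0"
    and f: "(\<lambda>v. \<bar>f (e *\<^sub>R v)\<bar>) summable_on T ` {z. \<forall>i. z $ i \<in> \<int>}"
  defines "fl \<equiv> \<lambda>x. T (\<chi> i. real_of_int \<lfloor>inv_into UNIV T x $ i\<rfloor>)"
    and "D \<equiv> T ` {y. \<forall>i. 0 \<le> y $ i \<and> y $ i < 1}"
  shows "integrable lebesgue (\<lambda>x. f (e *\<^sub>R fl (inverse e *\<^sub>R x)))"
    "(\<integral>x. f (e *\<^sub>R fl (inverse e *\<^sub>R x)) \<partial>lebesgue) =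
       measure lebesgue D * (e ^ CARD('d) * infsum (\<lambda>v. f (e *\<^sub>R v)) (T ` {z. \<forall>i. z $ i \<in> \<int>}))"
proof -
  let ?Z = "{z :: real ^ 'd. \<forall>i. z $ i \<in> \<int>}"
  let ?L = "T ` ?Z"
  have "?Z \<subseteq> range (\<lambda>g :: 'd \<Rightarrow> int. \<chi> i. of_int (g i))"
  proof
    fix z :: "real ^ 'd" assume "z \<in> ?Z"
    then have "z = (\<chi> i. of_int \<lfloor>z $ i\<rfloor>)" by (simp add: vec_eq_iff of_int_floor)
    then show "z \<in> range (\<lambda>g :: 'd \<Rightarrow> int. \<chi> i. of_int (g i))" by (rule image_eqI[where x = "\<lambda>i. \<lfloor>z $ i\<rfloor>"]) (rule UNIV_I)
  qed
  then have "countable ?Z" by (rule countable_subset) auto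
  then have cL: "countable ?L" by auto
  have "inj (\<lambda>n::nat. \<chi> i::'d. real n)" by (rule injI) (simp add: vec_eq_iff)
  then have "infinite (range (\<lambda>n::nat. \<chi> i::'d. real n))" by (rule range_inj_infinite)
  moreover have "range (\<lambda>n::nat. \<chi> i::'d. real n) \<subseteq> ?Z" by auto
  ultimately have "infinite ?Z" by (rule infinite_super[rotated])
  moreover have "inj_on T ?Z" using T(2) by (auto simp: bij_def intro: inj_on_subset)
  ultimately have iL: "infinite ?L" by (simp add: finite_image_iff)
  \<comment> \<open>The lattice is enumerated so that the step function becomes a series of
    functions \<open>F n\<close>, each supported on one tile, which can be integrated term by
    term.\<close>
  define u where "u = from_nat_into ?L"
  have u: "bij_betw u UNIV ?L"
    unfolding u_def using cL iL by (rule bij_betw_from_nat_into)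
  have Tinv: "inv_into UNIV T (T y) = y" "T (inv_into UNIV T x) = x" for x y
    using T(2) by (auto simp: bij_def surj_f_inv_f)
  have linv: "linear (inv_into UNIV T)"
    using T by (metis inj_linear_imp_inv_linear bij_def)
  have fl: "x - fl x \<in> D" "fl x \<in> ?L" for x
  proof -
    have "x - fl x = T (inv_into UNIV T x - (\<chi> i. real_of_int \<lfloor>inv_into UNIV T x $ i\<rfloor>))"
      by (simp add: fl_def linear_diff[OF T(1)] Tinv)
    then show "x - fl x \<in> D" by (auto simp: D_def intro!: imageI; linarith)
    show "fl x \<in> ?L" by (auto simp: fl_def)
  qed
  have fl_unique: "fl x = v" if "v \<in> ?L" "x - v \<in> D" for x v
  proof -
    obtain z y where zy: "v = T z" "z \<in> ?Z" "x - v = T y" "\<forall>i. 0 \<le> y $ i \<and> y $ i < 1"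
      using \<open>v \<in> ?L\<close> \<open>x - v \<in> D\<close> by (auto simp: D_def)
    then have "x = T (z + y)" by (simp add: linear_add[OF T(1)] algebra_simps)
    then have "inv_into UNIV T x = z + y" by (simp add: Tinv)
    moreover have "real_of_int \<lfloor>z $ i + y $ i\<rfloor> = z $ i" for i
    proof -
      from zy(2) obtain k where k: "z $ i = of_int k" by (auto elim: Ints_cases)
      then show ?thesis using zy(4)[rule_format, of i] by (simp add: floor_eq_iff)
    qed
    ultimately have "fl x = T z" by (simp add: fl_def vec_eq_iff)
    then show ?thesis by (simp add: zy)
  qed
  define tile where "tile v = (\<lambda>y. e *\<^sub>R y + e *\<^sub>R v) ` D" for v
  have tile_iff: "x \<in> tile v \<longleftrightarrow> fl (inverse e *\<^sub>R x) = v" if "v \<in> ?L" for x v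
  proof
    assume "x \<in> tile v"
    then obtain y where y: "y \<in> D" "x = e *\<^sub>R y + e *\<^sub>R v" by (auto simp: tile_def)
    then have "inverse e *\<^sub>R x - v = y" using e by (simp add: scaleR_add_right)
    then show "fl (inverse e *\<^sub>R x) = v" using fl_unique[OF that] y by simp
  next
    assume "fl (inverse e *\<^sub>R x) = v"
    then have "inverse e *\<^sub>R x - v \<in> D" using fl(1)[of "inverse e *\<^sub>R x"] by simp
    moreover have "x = e *\<^sub>R (inverse e *\<^sub>R x - v) + e *\<^sub>R v" using e by (simp add: scaleR_diff_right)
    ultimately show "x \<in> tile v" unfolding tile_def by (rule rev_image_eqI)
  qed
  have "continuous_on UNIV (inv_into UNIV T)" by (rule linear_continuous_on) (rule linv[unfolded linear_conv_bounded_linear])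
  then have invm[measurable]: "inv_into UNIV T \<in> borel_measurable borel"
    by (rule borel_measurable_continuous_onI)
  have D_eq: "D = {x. \<forall>i. 0 \<le> inv_into UNIV T x $ i \<and> inv_into UNIV T x $ i < 1}"
  proof (rule Set.set_eqI, rule iffI)
    fix x assume "x \<in> {x. \<forall>i. 0 \<le> inv_into UNIV T x $ i \<and> inv_into UNIV T x $ i < 1}"
    then show "x \<in> D" unfolding D_def by (intro image_eqI[of _ _ "inv_into UNIV T x"]) (simp_all add: Tinv)
  next
    fix x assume "x \<in> D"
    then obtain y where "x = T y" "\<forall>i. 0 \<le> y $ i \<and> y $ i < 1" unfolding D_def by blast
    then show "x \<in> {x. \<forall>i. 0 \<le> inv_into UNIV T x $ i \<and> inv_into UNIV T x $ i < 1}" by (simp add: Tinv)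
  qed
  have bD: "bounded D"
    unfolding D_def
  proof (rule bounded_linear_image)
    show "bounded {y :: real ^ 'd. \<forall>i. 0 \<le> y $ i \<and> y $ i < 1}"
      by (rule bounded_subset[OF bounded_cbox[of 0 1]]) (auto simp: mem_box_cart less_imp_le)
    show "bounded_linear T" using T(1) by (simp add: linear_conv_bounded_linear)
  qed
  have tile: "tile v \<in> lmeasurable" "measure lebesgue (tile v) = e ^ CARD('d) * measure lebesgue D" for v
  proof -
    have "tile v = {x. inverse e *\<^sub>R x - v \<in> D}"
    proof (rule Set.set_eqI, rule iffI)
      fix x assume "x \<in> {x. inverse e *\<^sub>R x - v \<in> D}"
      moreover have "x = e *\<^sub>R (inverse e *\<^sub>R x - v) + e *\<^sub>R v" using e by (simp add: scaleR_diff_right)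
      ultimately show "x \<in> tile v" unfolding tile_def by blast
    qed (use e in \<open>auto simp: tile_def scaleR_add_right\<close>)
    also have "\<dots> \<in> sets borel" unfolding D_eq mem_Collect_eq by measurable
    finally have "tile v \<in> sets lebesgue" by (simp add: sets_completionI_sets)
    moreover have "bounded (tile v)"
    proof -
      have "tile v = (+) (e *\<^sub>R v) ` (scaleR e ` D)"
        by (auto simp: tile_def image_image algebra_simps)
      then show ?thesis using bD by (simp add: bounded_translation bounded_scaling)
    qed
    ultimately show "tile v \<in> lmeasurable" by (intro bounded_set_imp_lmeasurable)
    show "measure lebesgue (tile v) = e ^ CARD('d) * measure lebesgue D"
      using measure_lebesgue_affine[of e "e *\<^sub>R v" D] e by (simp add: tile_def)
  qed
  define F where "F = (\<lambda>n x. f (e *\<^sub>R u n) * indicator (tile (u n)) x)"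
  have uL: "u n \<in> ?L" for n using u by (auto simp: bij_betw_def)
  have Fx: "(\<lambda>n. F n x) sums f (e *\<^sub>R fl (inverse e *\<^sub>R x))"
    "summable (\<lambda>n. norm (F n x))" for x
  proof -
    from fl(2) obtain N where N: "u N = fl (inverse e *\<^sub>R x)"
      using u by (metis bij_betw_imp_surj_on imageE)
    have F0: "F n x = (if n = N then f (e *\<^sub>R fl (inverse e *\<^sub>R x)) else 0)" for n
    proof (cases "n = N")
      case True
      then show ?thesis using tile_iff[OF uL, of x N] N by (simp add: F_def)
    next
      case False
      then have "u n \<noteq> u N" using u by (auto simp: bij_betw_def inj_def)
      then show ?thesis using tile_iff[OF uL, of x n] N False by (simp add: F_def)
    qed
    show "(\<lambda>n. F n x) sums f (e *\<^sub>R fl (inverse e *\<^sub>R x))"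
      unfolding F0 by (rule sums_single)
    show "summable (\<lambda>n. norm (F n x))"
      by (rule summable_finite[of "{N}"]) (auto simp: F0)
  qed
  have Fint: "integrable lebesgue (F n)" for n
    unfolding F_def using tile(1)[of "u n"]
    by (intro integrable_mult_right integrable_real_indicator) (auto simp: fmeasurable_def)
  have Fi: "(\<integral>x. F n x \<partial>lebesgue) = f (e *\<^sub>R u n) * (e ^ CARD('d) * measure lebesgue D)" for n
    unfolding F_def by (simp add: tile)
  have Fn: "(\<integral>x. norm (F n x) \<partial>lebesgue) = \<bar>f (e *\<^sub>R u n)\<bar> * (e ^ CARD('d) * measure lebesgue D)" for n
  proof -
    have "(\<integral>x. norm (F n x) \<partial>lebesgue) = (\<integral>x. \<bar>f (e *\<^sub>R u n)\<bar> * indicator (tile (u n)) x \<partial>lebesgue)"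
      unfolding F_def by (simp add: abs_mult)
    then show ?thesis by (simp add: tile)
  qed
  have "(\<lambda>n. \<bar>f (e *\<^sub>R u n)\<bar>) summable_on UNIV"
    using f u by (subst summable_on_reindex_bij_betw[OF u])
  then have sab: "summable (\<lambda>n. \<bar>f (e *\<^sub>R u n)\<bar>)" by (rule summable_on_imp_summable)
  then have sF: "summable (\<lambda>n. \<integral>x. norm (F n x) \<partial>lebesgue)"
    unfolding Fn by (rule summable_mult2)
  have sumF: "(\<lambda>x. suminf (\<lambda>n. F n x)) = (\<lambda>x. f (e *\<^sub>R fl (inverse e *\<^sub>R x)))"
    using Fx(1) by (auto simp: sums_iff)
  show "integrable lebesgue (\<lambda>x. f (e *\<^sub>R fl (inverse e *\<^sub>R x)))"
    using integrable_suminf[of lebesgue F, OF Fint _ sF] Fx(2) by (simp add: sumF)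
  have "(\<lambda>n. f (e *\<^sub>R u n) * (e ^ CARD('d) * measure lebesgue D)) sums
     (\<integral>x. f (e *\<^sub>R fl (inverse e *\<^sub>R x)) \<partial>lebesgue)"
    using sums_integral[of lebesgue F, OF Fint _ sF] Fx(2) by (simp add: sumF Fi)
  moreover have "(\<lambda>n. f (e *\<^sub>R u n) * (e ^ CARD('d) * measure lebesgue D)) sums
     (infsum (\<lambda>v. f (e *\<^sub>R v)) ?L * (e ^ CARD('d) * measure lebesgue D))"
  proof (rule sums_mult2)
    have "(\<lambda>n. f (e *\<^sub>R u n)) summable_on UNIV"
      by (rule norm_summable_imp_summable_on) (use sab in simp)
    then have "(\<lambda>n. f (e *\<^sub>R u n)) sums infsum (\<lambda>n. f (e *\<^sub>R u n)) UNIV"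
      by (intro has_sum_imp_sums has_sum_infsum)
    then show "(\<lambda>n. f (e *\<^sub>R u n)) sums infsum (\<lambda>v. f (e *\<^sub>R v)) ?L"
      by (subst (asm) infsum_reindex_bij_betw[OF u])
  qed
  ultimately show "(\<integral>x. f (e *\<^sub>R fl (inverse e *\<^sub>R x)) \<partial>lebesgue) =
       measure lebesgue D * (e ^ CARD('d) * infsum (\<lambda>v. f (e *\<^sub>R v)) ?L)"
    by (simp add: sums_iff mult_ac)
qed

lemma summable_decay_scaled:
  fixes X :: "'v::euclidean_space set" and f :: "'v \<Rightarrow> real"
  assumes "\<delta> > 0" "l > 0" "e > 0" "\<And>x. x \<in> X \<Longrightarrow> l \<le> norm x"
    "\<And>x y. x \<in> X \<Longrightarrow> y \<in> X \<Longrightarrow> x \<noteq> y \<Longrightarrow> l \<le> dist x y"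
    and "\<And>x. \<bar>f x\<bar> \<le> b * (1 + norm x) powr (- (real DIM('v) + \<delta>))"
  shows "(\<lambda>x. \<bar>f (e *\<^sub>R x)\<bar>) summable_on X"
proof -
  let ?X = "scaleR e ` X"
  have "(\<lambda>x. \<bar>f x\<bar>) summable_on ?X"
  proof (rule summable_decay(1)[OF assms(1), of "e * l"])
    show "e * l > 0" using assms by simp
    show "e * l \<le> norm x" if "x \<in> ?X" for x
      using that assms(3,4) by auto
    show "e * l \<le> dist x y" if "x \<in> ?X" "y \<in> ?X" "x \<noteq> y" for x y
    proof -
      from that obtain x' y' where "x = e *\<^sub>R x'" "y = e *\<^sub>R y'" "x' \<in> X" "y' \<in> X" "x' \<noteq> y'" by auto
      then show ?thesis using assms(3) assms(5)[of x' y'] by (simp add: dist_norm scaleR_diff_right [symmetric])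
    qed
  qed (rule assms(6))
  moreover have "inj_on (scaleR e) X" using assms(3) by (auto simp: inj_on_def)
  ultimately show ?thesis by (subst (asm) summable_on_reindex) (auto simp: o_def)
qed

lemma lattice_basis_separation:
  fixes B :: "'d::finite \<Rightarrow> real ^ 'd"
  assumes "lattice_basis B \<Lambda>"
  shows "\<exists>l>0. (\<forall>x\<in>\<Lambda>. x \<noteq> 0 \<longrightarrow> l \<le> norm x) \<and> (\<forall>x\<in>\<Lambda>. \<forall>y\<in>\<Lambda>. x \<noteq> y \<longrightarrow> l \<le> dist x y)"
proof -
  obtain T :: "real ^ 'd \<Rightarrow> real ^ 'd" where T: "linear T" "bij T" "\<Lambda> = T ` {z. \<forall>i. z $ i \<in> \<int>}"
    by (rule lattice_basis_linear[OF assms])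
  obtain l where l: "l > 0" "\<And>x. l * norm x \<le> norm (T x)"
    using linear_inj_bounded_below_pos[of T] T by (auto simp: bij_def)
  have bnd: "l \<le> norm (T z)" if "\<forall>i. z $ i \<in> \<int>" "z \<noteq> 0" for z
  proof -
    from that obtain i where i: "z $ i \<noteq> 0" by (auto simp: vec_eq_iff)
    then have "1 \<le> \<bar>z $ i\<bar>" using that(1) Ints_nonzero_abs_ge1 by blast
    also have "\<dots> \<le> norm z" by (rule component_le_norm_cart)
    finally have "l * 1 \<le> l * norm z" using l(1) by (intro mult_left_mono) auto
    then show ?thesis using l(2)[of z] by simp
  qed
  show ?thesis
  proof (intro exI[of _ l] conjI ballI impI)
    show "l > 0" by (rule l)
    show "l \<le> norm x" if "x \<in> \<Lambda>" "x \<noteq> 0" for x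
    proof -
      from that obtain z where "x = T z" "\<forall>i. z $ i \<in> \<int>" by (auto simp: T(3))
      then show ?thesis using bnd[of z] that(2) by (cases "z = 0") (auto simp: linear_0[OF T(1)])
    qed
    show "l \<le> dist x y" if "x \<in> \<Lambda>" "y \<in> \<Lambda>" "x \<noteq> y" for x y
    proof -
      from that obtain z w where "x = T z" "y = T w" "\<forall>i. z $ i \<in> \<int>" "\<forall>i. w $ i \<in> \<int>" "z \<noteq> w"
        by (auto simp: T(3))
      then show ?thesis using bnd[of "z - w"] by (simp add: dist_norm linear_diff[OF T(1)])
    qed
  qed
qed

text \<open>As the mesh tends to 0, the step functions converge to \<open>f\<close> at every point
  of continuity. The lattice point 0 is left out because only nonzero vectors matter later; its term
  \<open>e n ^ CARD('d) * f 0\<close> vanishes in the limit.\<close>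

lemma lattice_sum_tendsto:
  fixes B :: "'d::finite \<Rightarrow> real ^ 'd" and f :: "real ^ 'd \<Rightarrow> real"
  assumes B: "lattice_basis B \<Lambda>" and cont: "negligible {x. \<not> isCont f x}" and "\<delta> > 0"
    and decay: "\<And>x. \<bar>f x\<bar> \<le> b * (1 + norm x) powr (- (real DIM(real ^ 'd) + \<delta>))"
    and e0: "e \<longlonglongrightarrow> 0" and epos: "\<And>n. e n > 0"
  defines "V \<equiv> measure lebesgue {\<Sum>i\<in>UNIV. c i *\<^sub>R B i | c. \<forall>i. 0 \<le> c i \<and> c i < 1}"
  shows "(\<lambda>n. V * (e n ^ CARD('d) * infsum (\<lambda>v. f (e n *\<^sub>R v)) (\<Lambda> - {0}))) \<longlonglongrightarrow> integral UNIV f"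
proof -
  let ?s = "real DIM(real ^ 'd) + \<delta>"
  let ?w = "\<lambda>x :: real ^ 'd. (1 + norm x) powr (- ?s)"
  obtain T :: "real ^ 'd \<Rightarrow> real ^ 'd" where T: "linear T" "bij T" "\<Lambda> = T ` {z. \<forall>i. z $ i \<in> \<int>}"
    "{\<Sum>i\<in>UNIV. c i *\<^sub>R B i | c. \<forall>i. 0 \<le> c i \<and> c i < 1} = T ` {y. \<forall>i. 0 \<le> y $ i \<and> y $ i < 1}"
    by (rule lattice_basis_linear[OF B])
  obtain l where l: "l > 0" "\<And>x. x \<in> \<Lambda> \<Longrightarrow> x \<noteq> 0 \<Longrightarrow> l \<le> norm x"
    "\<And>x y. x \<in> \<Lambda> \<Longrightarrow> y \<in> \<Lambda> \<Longrightarrow> x \<noteq> y \<Longrightarrow> l \<le> dist x y"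
    using lattice_basis_separation[OF B] by blast
  define fl where "fl = (\<lambda>x. T (\<chi> i. real_of_int \<lfloor>inv_into UNIV T x $ i\<rfloor>))"
  obtain K where K: "K > 0" "\<And>x. norm (T x) \<le> norm x * K"
    using bounded_linear.pos_bounded[of T] T(1) by (auto simp: linear_conv_bounded_linear)
  define R where "R = real CARD('d) * K"
  have R0: "R \<ge> 0" using K by (simp add: R_def)
  have near: "norm (x - fl x) \<le> R" for x
  proof -
    let ?y = "inv_into UNIV T x - (\<chi> i. real_of_int \<lfloor>inv_into UNIV T x $ i\<rfloor>)"
    have "norm ?y \<le> (\<Sum>i\<in>UNIV. \<bar>?y $ i\<bar>)" by (rule norm_le_l1_cart)
    also have "\<dots> \<le> (\<Sum>i\<in>(UNIV :: 'd set). 1)" by (intro sum_mono) (simp; linarith)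
    finally have "norm ?y * K \<le> R" unfolding R_def using K(1) by (intro mult_right_mono) auto
    moreover have "x - fl x = T ?y"
      using T(2) by (simp add: fl_def linear_diff[OF T(1)] surj_f_inv_f bij_def)
    ultimately show ?thesis using K(2)[of ?y] by simp
  qed
  have zero_in: "0 \<in> \<Lambda>" unfolding T(3) by (rule image_eqI[of _ _ 0]) (auto simp: linear_0[OF T(1)])
  have summ0: "(\<lambda>v. \<bar>f (c *\<^sub>R v)\<bar>) summable_on (\<Lambda> - {0})" if "c > 0" for c
    by (rule summable_decay_scaled[OF \<open>\<delta> > 0\<close> l(1) that _ _ decay]) (use l in auto)
  have ins: "\<Lambda> = insert 0 (\<Lambda> - {0})" using zero_in by auto
  have summ: "(\<lambda>v. \<bar>f (c *\<^sub>R v)\<bar>) summable_on \<Lambda>" if "c > 0" for c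
  proof -
    have "(\<lambda>v. \<bar>f (c *\<^sub>R v)\<bar>) summable_on insert 0 (\<Lambda> - {0})"
      unfolding summable_on_insert_iff by (rule summ0[OF that])
    then show ?thesis by (simp only: ins [symmetric])
  qed
  have split: "infsum (\<lambda>v. f (c *\<^sub>R v)) \<Lambda> = f 0 + infsum (\<lambda>v. f (c *\<^sub>R v)) (\<Lambda> - {0})" if "c > 0" for c
  proof -
    have "(\<lambda>v. f (c *\<^sub>R v)) summable_on (\<Lambda> - {0})"
      using summ0[OF that] by (subst summable_on_iff_abs_summable_on_real) simp
    then have "infsum (\<lambda>v. f (c *\<^sub>R v)) (insert 0 (\<Lambda> - {0})) = f 0 + infsum (\<lambda>v. f (c *\<^sub>R v)) (\<Lambda> - {0})"
      by (subst infsum_insert) auto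
    then show ?thesis by (simp only: ins [symmetric])
  qed
  define F where "F c x = f (c *\<^sub>R fl (inverse c *\<^sub>R x))" for c x
  have Fint: "integrable lebesgue (F c)" "integral UNIV (F c) = V * (c ^ CARD('d) * infsum (\<lambda>v. f (c *\<^sub>R v)) \<Lambda>)"
    if "c > 0" for c
  proof -
    note * = has_sum_lattice_tiles[OF T(1,2) that summ[OF that, unfolded T(3)]]
    show 1: "integrable lebesgue (F c)" using *(1) by (simp add: F_def[abs_def] fl_def)
    show "integral UNIV (F c) = V * (c ^ CARD('d) * infsum (\<lambda>v. f (c *\<^sub>R v)) \<Lambda>)"
      using *(2) by (subst integral_lebesgue[OF 1]) (simp add: F_def[abs_def] fl_def V_def T(3,4))
  qed
  have close: "norm (x - c *\<^sub>R fl (inverse c *\<^sub>R x)) \<le> c * R" if "c > 0" for c x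
  proof -
    have "x - c *\<^sub>R fl (inverse c *\<^sub>R x) = c *\<^sub>R (inverse c *\<^sub>R x - fl (inverse c *\<^sub>R x))"
      using that by (simp add: scaleR_diff_right)
    then show ?thesis using near[of "inverse c *\<^sub>R x"] that by simp
  qed
  have "b \<ge> 0" using decay[of 0] by simp
  \<comment> \<open>Moving a point by at most \<open>R\<close> changes \<open>1 + norm x\<close> at
    most by the factor \<open>1 + R\<close>. This gives one dominating function for all meshes up to
    1.\<close>
  have Fbound: "\<bar>F c x\<bar> \<le> b * (1 + R) powr ?s * ?w x" if "0 < c" "c \<le> 1" for c x
  proof -
    let ?y = "c *\<^sub>R fl (inverse c *\<^sub>R x)"
    have "norm x \<le> norm ?y + norm (x - ?y)" by (rule norm_triangle_sub)
    also have "norm (x - ?y) \<le> c * R" by (rule close[OF that(1)])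
    also have "c * R \<le> R" using that R0 by (simp add: mult_left_le_one_le)
    finally have "1 + norm x \<le> (1 + R) * (1 + norm ?y)"
      using mult_nonneg_nonneg[OF R0 norm_ge_zero[of ?y]] by (simp add: algebra_simps del: norm_scaleR)
    then have "((1 + R) * (1 + norm ?y)) powr (- ?s) \<le> ?w x"
      using \<open>\<delta> > 0\<close> by (intro powr_mono2') (auto intro: add_pos_nonneg)
    then have "(1 + R) powr ?s * ((1 + R) * (1 + norm ?y)) powr (- ?s) \<le> (1 + R) powr ?s * ?w x"
      by (rule mult_left_mono) simp
    moreover have "(1 + R) powr ?s * ((1 + R) * (1 + norm ?y)) powr (- ?s) = ?w ?y"
      using R0 by (subst powr_mult) (auto simp: powr_minus field_simps powr_diff powr_add)
    ultimately have "b * ?w ?y \<le> b * ((1 + R) powr ?s * ?w x)"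
      using \<open>b \<ge> 0\<close> by (intro mult_left_mono) auto
    then show ?thesis using decay[of ?y] by (simp add: F_def mult.assoc)
  qed
  obtain N where N: "\<And>n. n \<ge> N \<Longrightarrow> e n \<le> 1"
    using order_tendstoD(2)[OF e0, of 1] by (auto simp: eventually_sequentially intro: less_imp_le)
  let ?S = "{x. isCont f x}"
  have neg: "negligible (UNIV - ?S)" using cont by (simp add: set_diff_eq)
  have "(\<lambda>n. integral ?S (F (e (n + N)))) \<longlonglongrightarrow> integral ?S f"
  proof (rule dominated_convergence(2))
    show "F (e (n + N)) integrable_on ?S" for n
      by (rule integrable_spike_set[OF integrable_on_lebesgue[OF Fint(1)[OF epos]]])
         (auto intro: negligible_subset[OF neg])
    have "(\<lambda>x. b * (1 + R) powr ?s * ?w x) integrable_on UNIV"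
      by (intro integrable_on_lborel integrable_mult_right integrable_decay) (rule \<open>\<delta> > 0\<close>)
    then show "(\<lambda>x. b * (1 + R) powr ?s * ?w x) integrable_on ?S"
      by (rule integrable_spike_set) (auto intro: negligible_subset[OF neg])
    show "norm (F (e (n + N)) x) \<le> b * (1 + R) powr ?s * ?w x" for n x
      using Fbound[OF epos N] by simp
    show "(\<lambda>n. F (e (n + N)) x) \<longlonglongrightarrow> f x" if "x \<in> ?S" for x
    proof -
      have "(\<lambda>n. e (n + N) * R) \<longlonglongrightarrow> 0"
        using LIMSEQ_ignore_initial_segment[OF e0, of N] by (auto intro: tendsto_mult_left_zero)
      then have "(\<lambda>n. x - e (n + N) *\<^sub>R fl (inverse (e (n + N)) *\<^sub>R x)) \<longlonglongrightarrow> 0"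
        by (rule Lim_null_comparison[rotated]) (auto intro!: always_eventually close epos)
      then have "(\<lambda>n. x - (x - e (n + N) *\<^sub>R fl (inverse (e (n + N)) *\<^sub>R x))) \<longlonglongrightarrow> x - 0"
        by (intro tendsto_diff tendsto_const)
      then have "(\<lambda>n. e (n + N) *\<^sub>R fl (inverse (e (n + N)) *\<^sub>R x)) \<longlonglongrightarrow> x" by simp
      then show ?thesis unfolding F_def using that by (auto intro: isCont_tendsto_compose)
    qed
  qed
  moreover have "integral ?S g = integral UNIV g" for g :: "real ^ 'd \<Rightarrow> real"
    by (rule integral_subset_negligible[OF _ neg]) simp
  ultimately have "(\<lambda>n. integral UNIV (F (e (n + N)))) \<longlonglongrightarrow> integral UNIV f" by simp
  then have "(\<lambda>n. integral UNIV (F (e n))) \<longlonglongrightarrow> integral UNIV f" by (rule LIMSEQ_offset)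
  moreover have "(\<lambda>n. V * (e n ^ CARD('d) * f 0)) \<longlonglongrightarrow> V * (0 ^ CARD('d) * f 0)"
    by (intro tendsto_intros e0)
  ultimately have "(\<lambda>n. integral UNIV (F (e n)) - V * (e n ^ CARD('d) * f 0)) \<longlonglongrightarrow> integral UNIV f - 0"
    by (intro tendsto_diff) (simp_all add: zero_power)
  moreover have "integral UNIV (F (e n)) - V * (e n ^ CARD('d) * f 0)
      = V * (e n ^ CARD('d) * infsum (\<lambda>v. f (e n *\<^sub>R v)) (\<Lambda> - {0}))" for n
    by (simp add: Fint(2)[OF epos] split[OF epos] algebra_simps)
  ultimately show ?thesis by simp
qed

text \<open>\<open>covolume\<close> is a definite description, so its value has to be shown
  independent of the basis. For a positive test function \<open>g\<close>, the sums
  \<open>S n\<close> depend on \<open>\<Lambda>\<close> alone, while \<open>V B * S n\<close> tends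
  to \<open>integral UNIV g\<close> for every basis \<open>B\<close>. As this integral is positive,
  it forces \<open>V B\<close> to be nonzero and the same for all bases.\<close>

lemma covolume_lattice_basis:
  fixes B :: "'d::finite \<Rightarrow> real ^ 'd"
  assumes B: "lattice_basis B \<Lambda>"
  defines "V \<equiv> \<lambda>B :: 'd \<Rightarrow> real ^ 'd. measure lebesgue {\<Sum>i\<in>UNIV. c i *\<^sub>R B i | c. \<forall>i. 0 \<le> c i \<and> c i < 1}"
  shows "covolume \<Lambda> = V B" "V B > 0"
proof -
  define g where "g x = (1 + norm x) powr (- (real DIM(real ^ 'd) + 1))" for x :: "real ^ 'd"
  have gpos: "g x > 0" for x
    using norm_ge_zero[of x] by (simp add: g_def del: norm_ge_zero)
  have gcont: "isCont g x" for x
    unfolding g_def by (intro continuous_intros) (use norm_ge_zero[of x] in linarith)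
  have gint: "integrable lborel g" unfolding g_def by (rule integrable_decay) simp
  have I: "integral UNIV g > 0"
  proof -
    have "integral UNIV g = (\<integral>x. g x \<partial>lborel)" by (rule integral_lborel[OF gint])
    moreover have "(\<integral>x. g x \<partial>lborel) \<noteq> 0"
    proof
      assume "(\<integral>x. g x \<partial>lborel) = 0"
      then have "AE x in lborel. g x = 0"
        using integral_nonneg_eq_0_iff_AE[OF gint] gpos by (simp add: less_imp_le)
      then have "AE x in (lborel :: (real ^ 'd) measure). False"
        by eventually_elim (use gpos in \<open>force simp: less_le\<close>)
      then show False by (simp add: eventually_False ae_filter_eq_bot_iff)
    qed
    moreover have "(\<integral>x. g x \<partial>lborel) \<ge> 0"
      by (rule Bochner_Integration.integral_nonneg) (use gpos less_imp_le in blast)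
    ultimately show ?thesis by simp
  qed
  define S where "S n = inverse (real (Suc n)) ^ CARD('d) * infsum (\<lambda>v. g (inverse (real (Suc n)) *\<^sub>R v)) (\<Lambda> - {0})" for n
  have lim: "(\<lambda>n. V B' * S n) \<longlonglongrightarrow> integral UNIV g" if "lattice_basis B' \<Lambda>" for B' :: "'d \<Rightarrow> real ^ 'd"
    unfolding S_def V_def
  proof (rule lattice_sum_tendsto[OF that, where \<delta> = 1 and b = 1])
    show "negligible {x. \<not> isCont g x}" using gcont by simp
    show "(\<lambda>n. inverse (real (Suc n))) \<longlonglongrightarrow> 0" by (rule LIMSEQ_inverse_real_of_nat)
  qed (auto simp: g_def)
  have nz: "V B' \<noteq> 0" if "lattice_basis B' \<Lambda>" for B' :: "'d \<Rightarrow> real ^ 'd"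
    using lim[OF that] I by (auto simp: LIMSEQ_const_iff)
  have "V B' = V B" if B': "lattice_basis B' \<Lambda>" for B'
  proof -
    have "(\<lambda>n. V B' * S n / V B') \<longlonglongrightarrow> integral UNIV g / V B'"
      using lim[OF B'] nz[OF B'] by (intro tendsto_divide tendsto_const)
    moreover have "(\<lambda>n. V B * S n / V B) \<longlonglongrightarrow> integral UNIV g / V B"
      using lim[OF B] nz[OF B] by (intro tendsto_divide tendsto_const)
    ultimately have "integral UNIV g / V B' = integral UNIV g / V B"
      using nz[OF B] nz[OF B'] by (auto dest: LIMSEQ_unique)
    then show ?thesis using I nz[OF B] nz[OF B'] by (simp add: field_simps)
  qed
  note eq = this
  have "covolume \<Lambda> = (THE v. \<exists>B'. lattice_basis B' \<Lambda> \<and> v = V B')"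
    unfolding covolume_def V_def ..
  also have "\<dots> = V B"
    by (rule the_equality) (use eq B in blast)+
  finally show "covolume \<Lambda> = V B" .
  show "V B > 0" using nz[OF B] by (simp add: V_def less_le)
qed

section \<open>Primitive vectors\<close>

definition discrete_subgroup :: "'v::real_normed_vector set \<Rightarrow> bool" where
  "discrete_subgroup \<Lambda> \<longleftrightarrow> 0 \<in> \<Lambda> \<and> (\<forall>x\<in>\<Lambda>. \<forall>y\<in>\<Lambda>. x - y \<in> \<Lambda>) \<and> (\<exists>l>0. \<forall>x\<in>\<Lambda>. x \<noteq> 0 \<longrightarrow> l \<le> norm x)"

lemma discrete_subgroup_scale_int:
  assumes "discrete_subgroup \<Lambda>" "x \<in> \<Lambda>"
  shows "of_int k *\<^sub>R x \<in> \<Lambda>"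
proof -
  have diff: "a - b \<in> \<Lambda>" if "a \<in> \<Lambda>" "b \<in> \<Lambda>" for a b
    using assms(1) that by (simp add: discrete_subgroup_def)
  have z: "0 \<in> \<Lambda>" using assms(1) by (simp add: discrete_subgroup_def)
  have neg: "- a \<in> \<Lambda>" if "a \<in> \<Lambda>" for a using diff[OF z that] by simp
  have add: "a + b \<in> \<Lambda>" if "a \<in> \<Lambda>" "b \<in> \<Lambda>" for a b
    using diff[OF that(1) neg[OF that(2)]] by simp
  have nat: "real n *\<^sub>R x \<in> \<Lambda>" for n
    by (induction n) (simp_all add: z add assms(2) scaleR_add_left)
  show ?thesis
  proof (cases "k \<ge> 0")
    case True
    then show ?thesis using nat[of "nat k"] by simp
  next
    case False
    then show ?thesis using neg[OF nat[of "nat (- k)"]] by simp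
  qed
qed

text \<open>On one line, the difference of the lengths of \<open>y\<close> and \<open>z\<close> is,
  up to sign, the length of \<open>y - z\<close> or of \<open>y + z\<close>, again a lattice vector.
  So lengths are equal or at least \<open>l\<close> apart, and their infimum is attained.\<close>

lemma shortest_vector_exists:
  fixes x :: "real ^ 'd::finite"
  assumes \<Lambda>: "discrete_subgroup \<Lambda>" and x: "x \<in> \<Lambda>" "x \<noteq> 0"
  shows "\<exists>y\<in>\<Lambda> \<inter> span {x}. y \<noteq> 0 \<and> (\<forall>z\<in>\<Lambda> \<inter> span {x}. z \<noteq> 0 \<longrightarrow> norm y \<le> norm z)"
proof -
  obtain l where l: "l > 0" "\<And>x. x \<in> \<Lambda> \<Longrightarrow> x \<noteq> 0 \<Longrightarrow> l \<le> norm x"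
    using \<Lambda> by (auto simp: discrete_subgroup_def)
  have diff: "a - b \<in> \<Lambda>" "a + b \<in> \<Lambda>" if "a \<in> \<Lambda>" "b \<in> \<Lambda>" for a b
    using \<Lambda> that discrete_subgroup_scale_int[OF \<Lambda> that(2), of "-1"]
    by (force simp: discrete_subgroup_def)+
  let ?S = "{y \<in> \<Lambda> \<inter> span {x}. y \<noteq> 0}"
  have eqn: "norm y = norm z" if yz: "y \<in> ?S" "z \<in> ?S" and close: "\<bar>norm y - norm z\<bar> < l" for y z
  proof -
    obtain a b where ab: "y = a *\<^sub>R x" "z = b *\<^sub>R x" using yz by (auto simp: span_singleton)
    have n: "norm (y - z) = \<bar>a - b\<bar> * norm x" "norm (y + z) = \<bar>a + b\<bar> * norm x"
      by (simp_all add: ab flip: scaleR_diff_left scaleR_add_left)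
    have "norm y - norm z = (\<bar>a\<bar> - \<bar>b\<bar>) * norm x" by (simp add: ab left_diff_distrib)
    then have n': "\<bar>norm y - norm z\<bar> = \<bar>\<bar>a\<bar> - \<bar>b\<bar>\<bar> * norm x" by (simp add: abs_mult)
    have "y - z = 0 \<or> y + z = 0"
    proof (cases "a * b \<ge> 0")
      case True
      then have "\<bar>\<bar>a\<bar> - \<bar>b\<bar>\<bar> = \<bar>a - b\<bar>" by (auto simp: zero_le_mult_iff)
      then have "norm (y - z) < l" using n n' close by simp
      then show ?thesis using l(2)[of "y - z"] diff(1)[of y z] yz by fastforce
    next
      case False
      then have "\<bar>\<bar>a\<bar> - \<bar>b\<bar>\<bar> = \<bar>a + b\<bar>" by (auto simp: mult_less_0_iff not_le)
      then have "norm (y + z) < l" using n n' close by simp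
      then show ?thesis using l(2)[of "y + z"] diff(2)[of y z] yz by fastforce
    qed
    then show ?thesis by (metis add_eq_0_iff eq_iff_diff_eq_0 norm_minus_cancel)
  qed
  define I where "I = (INF y\<in>?S. norm y)"
  have xS: "x \<in> ?S" using x by (simp add: span_base)
  have bdd: "bdd_below (norm ` ?S)" by (rule bdd_belowI[of _ 0]) auto
  \<comment> \<open>A shorter vector would have a length between \<open>I\<close> and
    \<open>norm y\<close>, hence less than \<open>l\<close> away from \<open>norm y\<close>, and
    therefore equal to it.\<close>
  have "\<exists>y\<in>?S. norm y < I + l"
    using cInf_lessD[of "norm ` ?S" "I + l"] xS l(1) by (auto simp: I_def)
  then obtain y where y: "y \<in> ?S" "norm y < I + l" by blast
  have "norm y \<le> norm z" if z: "z \<in> ?S" for z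
  proof (rule ccontr)
    assume "\<not> norm y \<le> norm z"
    moreover have "I \<le> norm z" unfolding I_def using bdd z by (rule cINF_lower)
    ultimately have "norm y = norm z" using y z by (intro eqn) auto
    then show False using \<open>\<not> norm y \<le> norm z\<close> by simp
  qed
  then show ?thesis using y by blast
qed

text \<open>Division with remainder by a shortest vector \<open>y\<close> on the line of
  \<open>x\<close> leaves a remainder shorter than \<open>y\<close>, which must vanish. Both
  \<open>y\<close> and \<open>- y\<close> are primitive; positivity of the multiplier
  \<open>Suc i\<close> selects one of them, which makes the pair unique.\<close>

lemma bij_betw_primitive_vectors:
  fixes \<Lambda> :: "(real ^ 'd::finite) set"
  assumes \<Lambda>: "discrete_subgroup \<Lambda>"
  shows "bij_betw (\<lambda>(i, y). real (Suc i) *\<^sub>R y) (UNIV \<times> primitive_vectors \<Lambda>) (\<Lambda> - {0})"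
proof (rule bij_betw_imageI)
  show "inj_on (\<lambda>(i, y). real (Suc i) *\<^sub>R y) (UNIV \<times> primitive_vectors \<Lambda>)"
  proof (rule inj_onI, clarify)
    fix i y j z assume y: "y \<in> primitive_vectors \<Lambda>" and z: "z \<in> primitive_vectors \<Lambda>"
      and eq: "real (Suc i) *\<^sub>R y = real (Suc j) *\<^sub>R z"
    have le: "norm y \<le> norm z" if y: "y \<in> primitive_vectors \<Lambda>" and z: "z \<in> primitive_vectors \<Lambda>"
      and eq: "real (Suc i) *\<^sub>R y = real (Suc j) *\<^sub>R z" for i y j z
    proof -
      have "z = (real (Suc i) / real (Suc j)) *\<^sub>R y"
        using arg_cong[OF eq, of "\<lambda>v. inverse (real (Suc j)) *\<^sub>R v"] by (simp add: divide_inverse mult.commute)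
      then have "z \<in> span {y}" by (simp add: span_mul span_base)
      then show ?thesis using y z by (auto simp: primitive_vectors_def)
    qed
    have "norm y = norm z" using le[OF y z eq] le[OF z y eq[symmetric]] by simp
    moreover have "real (Suc i) * norm y = real (Suc j) * norm z"
      using arg_cong[OF eq, of norm] by simp
    moreover have "norm y \<noteq> 0" using y by (auto simp: primitive_vectors_def)
    ultimately have "i = j" by simp
    then show "i = j \<and> y = z" using eq by simp
  qed
  show "(\<lambda>(i, y). real (Suc i) *\<^sub>R y) ` (UNIV \<times> primitive_vectors \<Lambda>) = \<Lambda> - {0}"
  proof (intro equalityI subsetI)
    fix x assume "x \<in> (\<lambda>(i, y). real (Suc i) *\<^sub>R y) ` (UNIV \<times> primitive_vectors \<Lambda>)"
    then obtain i y where iy: "x = real (Suc i) *\<^sub>R y" "y \<in> \<Lambda>" "y \<noteq> 0" by (auto simp: primitive_vectors_def)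
    then show "x \<in> \<Lambda> - {0}" using discrete_subgroup_scale_int[OF \<Lambda> iy(2), of "int (Suc i)"] by simp
  next
    fix x assume "x \<in> \<Lambda> - {0}"
    then have x: "x \<in> \<Lambda>" "x \<noteq> 0" by auto
    from shortest_vector_exists[OF \<Lambda> x] obtain y where y: "y \<in> \<Lambda>" "y \<in> span {x}" "y \<noteq> 0"
      and min: "\<And>z. z \<in> \<Lambda> \<Longrightarrow> z \<in> span {x} \<Longrightarrow> z \<noteq> 0 \<Longrightarrow> norm y \<le> norm z" by blast
    from y obtain a where a: "y = a *\<^sub>R x" "a \<noteq> 0" by (auto simp: span_singleton)
    define c where "c = inverse a"
    have xc: "x = c *\<^sub>R y" using a by (simp add: c_def)
    have c0: "c \<noteq> 0" using a by (simp add: c_def)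
    let ?z = "x - of_int \<lfloor>c\<rfloor> *\<^sub>R y"
    have zc: "?z = (c - of_int \<lfloor>c\<rfloor>) *\<^sub>R y" by (simp add: scaleR_diff_left xc[symmetric])
    have "?z \<in> \<Lambda>" using \<Lambda> x discrete_subgroup_scale_int[OF \<Lambda> y(1)] by (simp add: discrete_subgroup_def)
    moreover have "?z \<in> span {x}" by (rule span_diff[OF span_base[OF singletonI] span_mul[OF y(2)]])
    moreover have "norm ?z < norm y"
    proof -
      have "norm ?z = (c - of_int \<lfloor>c\<rfloor>) * norm y" unfolding zc by simp
      also have "\<dots> < 1 * norm y" using y(3) by (intro mult_strict_right_mono) (linarith, simp)
      finally show ?thesis by simp
    qed
    ultimately have "?z = 0" using min[of ?z] by linarith
    then have xk: "x = of_int \<lfloor>c\<rfloor> *\<^sub>R y" by simp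
    then have k0: "\<lfloor>c\<rfloor> \<noteq> 0" using x by auto
    have span_sub: "span {w} \<subseteq> span {x}" if "w \<in> span {x}" for w using that by (simp add: span_minimal)
    have prim: "w \<in> primitive_vectors \<Lambda>" if "w = y \<or> w = - y" for w
    proof -
      have "w \<in> \<Lambda>" using that y(1) discrete_subgroup_scale_int[OF \<Lambda> y(1), of "-1"] by auto
      moreover have "w \<in> span {x}" using that y(2) by (auto intro: span_neg)
      moreover have "norm w = norm y" "w \<noteq> 0" using that y(3) by auto
      ultimately show ?thesis
        unfolding primitive_vectors_def using min span_sub[of w] by auto
    qed
    show "x \<in> (\<lambda>(i, y). real (Suc i) *\<^sub>R y) ` (UNIV \<times> primitive_vectors \<Lambda>)"
    proof (cases "\<lfloor>c\<rfloor> > 0")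
      case True
      then have "real (Suc (nat \<lfloor>c\<rfloor> - 1)) = of_int \<lfloor>c\<rfloor>" by simp
      then show ?thesis using prim[of y] xk by (intro image_eqI[of _ _ "(nat \<lfloor>c\<rfloor> - 1, y)"]) auto
    next
      case False
      then have neg: "\<lfloor>c\<rfloor> < 0" using k0 by linarith
      then have "Suc (nat (- \<lfloor>c\<rfloor>) - 1) = nat (- \<lfloor>c\<rfloor>)" by linarith
      moreover have "real (nat (- \<lfloor>c\<rfloor>)) = - of_int \<lfloor>c\<rfloor>" using neg by (simp add: of_nat_nat)
      ultimately have *: "real (Suc (nat (- \<lfloor>c\<rfloor>) - 1)) = - of_int \<lfloor>c\<rfloor>" by (simp only:)
      have "x = real (Suc (nat (- \<lfloor>c\<rfloor>) - 1)) *\<^sub>R (- y)" unfolding * using xk by simp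
      then show ?thesis using prim[of "- y"] by (intro image_eqI[of _ _ "(nat (- \<lfloor>c\<rfloor>) - 1, - y)"]) auto
    qed
  qed
qed

text \<open>Fubini along the bijection above. After averaging over codes, this is the system that
  \<open>contraction_tendsto_zero\<close> inverts.\<close>

lemma primitive_sums:
  fixes \<Lambda> :: "(real ^ 'd::finite) set" and f :: "real ^ 'd \<Rightarrow> real"
  assumes \<Lambda>: "discrete_subgroup \<Lambda>" and f: "(\<lambda>x. \<bar>f x\<bar>) summable_on (\<Lambda> - {0})"
  shows "(\<lambda>i. infsum (\<lambda>y. f (real (Suc i) *\<^sub>R y)) (primitive_vectors \<Lambda>)) sums infsum f (\<Lambda> - {0})"
    "\<bar>infsum f (primitive_vectors \<Lambda>)\<bar> \<le> infsum (\<lambda>x. \<bar>f x\<bar>) (\<Lambda> - {0})"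
proof -
  let ?P = "primitive_vectors \<Lambda>"
  note bij = bij_betw_primitive_vectors[OF \<Lambda>]
  have fs: "f summable_on (\<Lambda> - {0})" using f by (subst summable_on_iff_abs_summable_on_real) simp
  let ?h = "\<lambda>x. f ((\<lambda>(i, y). real (Suc i) *\<^sub>R y) x)"
  have hs: "(?h has_sum infsum f (\<Lambda> - {0})) (UNIV \<times> ?P)"
    by (rule has_sum_reindex_bij_betw[OF bij, THEN iffD2]) (rule has_sum_infsum[OF fs])
  have "(\<lambda>y. ?h (i, y)) summable_on ?P" for i
    using summable_on_SigmaD1[of "\<lambda>i y. ?h (i, y)" UNIV "\<lambda>_. ?P" i] has_sum_imp_summable[OF hs]
    by (simp add: case_prod_unfold)
  then have "((\<lambda>i. infsum (\<lambda>y. ?h (i, y)) ?P) has_sum infsum f (\<Lambda> - {0})) UNIV"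
    by (intro has_sum_SigmaD[OF hs] has_sum_infsum)
  then show "(\<lambda>i. infsum (\<lambda>y. f (real (Suc i) *\<^sub>R y)) ?P) sums infsum f (\<Lambda> - {0})"
    using has_sum_imp_sums by simp
  have PL: "?P \<subseteq> \<Lambda> - {0}" by (auto simp: primitive_vectors_def)
  have abs: "(\<lambda>x. norm (f x)) summable_on ?P" using summable_on_subset_banach[OF f PL] by simp
  have "\<bar>infsum f ?P\<bar> \<le> infsum (\<lambda>x. \<bar>f x\<bar>) ?P" using norm_infsum_bound[OF abs] by simp
  also have "\<dots> \<le> infsum (\<lambda>x. \<bar>f x\<bar>) (\<Lambda> - {0})"
    using abs f PL by (intro infsum_mono2) auto
  finally show "\<bar>infsum f ?P\<bar> \<le> infsum (\<lambda>x. \<bar>f x\<bar>) (\<Lambda> - {0})" .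
qed

section \<open>Inverting the sums over multiples\<close>

lemma inverse_square_tail:
  assumes "K \<ge> 1"
  shows "(\<lambda>i. 1 / real (i + K) - 1 / real (Suc (i + K))) sums (1 / real K)"
    "1 / real (Suc (i + K)) ^ 2 \<le> 1 / real (i + K) - 1 / real (Suc (i + K))"
proof -
  have "(\<lambda>i. 1 / real (i + K)) \<longlonglongrightarrow> 0"
    using LIMSEQ_ignore_initial_segment[OF lim_1_over_n, of K] by simp
  from telescope_sums'[OF this] show "(\<lambda>i. 1 / real (i + K) - 1 / real (Suc (i + K))) sums (1 / real K)"
    by simp
  have "real (i + K) > 0" using assms by simp
  then show "1 / real (Suc (i + K)) ^ 2 \<le> 1 / real (i + K) - 1 / real (Suc (i + K))"
    by (simp add: divide_simps power2_eq_square)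
qed

text \<open>The value is \<open>1 / 4\<close> for the first term plus \<open>1 / 2\<close> for the
  telescoping tail; the induction carries the sharper bound with \<open>- 1 / real J\<close>. Being
  below 1, it can serve as a contraction factor.\<close>

lemma inverse_square_partial: "(\<Sum>i=1..<J. 1 / real (Suc i) ^ 2) \<le> 3 / 4"
proof -
  have "J < 2 \<or> (\<Sum>i=1..<J. 1 / real (Suc i) ^ 2) \<le> 3 / 4 - 1 / real J"
  proof (induction J)
    case (Suc J)
    consider "Suc J < 2" | "J = 1" | "J \<ge> 2" by linarith
    then show ?case
    proof cases
      case 3
      then have "(\<Sum>i=1..<Suc J. 1 / real (Suc i) ^ 2) \<le> 3 / 4 - 1 / real J + 1 / real (Suc J) ^ 2"
        using Suc by simp
      also have "1 / real (Suc J) ^ 2 \<le> 1 / real J - 1 / real (Suc J)"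
        using inverse_square_tail(2)[of J 0] 3 by simp
      finally show ?thesis by simp
    qed (simp_all add: power2_eq_square)
  qed simp
  moreover have "(\<Sum>i=1..<J. 1 / real (Suc i) ^ 2) \<le> 3 / 4" if "J < 2" using that by simp
  moreover have "3 / 4 - 1 / real J \<le> 3 / 4" by simp
  ultimately show ?thesis by (metis not_less order_trans)
qed

text \<open>
  Instead of Moebius inversion: the system \<open>s j = (\<Sum>i\<ge>1. e (i j))\<close> is inverted by iteration, because the
  weights \<open>i ^ d\<close> make the terms \<open>i \<ge> 2\<close> a contraction with factor \<open>3 / 4\<close>.
\<close>

lemma contraction_tendsto_zero:
  fixes e :: "'p \<Rightarrow> nat \<Rightarrow> real" and d :: nat
  assumes d: "d \<ge> 2"
    and bound: "eventually (\<lambda>p. \<forall>j\<ge>1. \<bar>e p j\<bar> \<le> C / real j ^ d) F"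
    and sums: "eventually (\<lambda>p. \<forall>j\<ge>1. (\<lambda>i. e p (Suc i * j)) sums s p j) F"
    and lim: "\<And>j. j \<ge> 1 \<Longrightarrow> ((\<lambda>p. s p j) \<longlongrightarrow> 0) F"
  shows "((\<lambda>p. e p 1) \<longlongrightarrow> 0) F"
proof -
  define C' where "C' = max C 0"
  have C': "C' \<ge> 0" "C \<le> C'" by (auto simp: C'_def)
  \<comment> \<open>Each substitution of the current bound into the system gains a factor
    \<open>3 / 4\<close>, at the price of passing to multiples of \<open>j\<close> and of an error
    \<open>\<epsilon>\<close>. Hence the claim is made for all \<open>j\<close> and
    \<open>\<epsilon>\<close> at once.\<close>
  have iter: "eventually (\<lambda>p. \<bar>e p j\<bar> * real j ^ d \<le> C' * (3/4) ^ N + \<epsilon>) F" if "j \<ge> 1" "\<epsilon> > 0" for N j \<epsilon>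
    using that
  proof (induction N arbitrary: j \<epsilon>)
    case 0
    show ?case
      using bound
    proof eventually_elim
      case (elim p)
      then have "\<bar>e p j\<bar> \<le> C / real j ^ d" using 0 by blast
      then have "\<bar>e p j\<bar> * real j ^ d \<le> C" using 0 by (simp add: pos_le_divide_eq)
      then show ?case using C' 0 by simp
    qed
  next
    case (Suc N)
    have jpos: "real j ^ d > 0" using Suc by simp
    \<comment> \<open>From \<open>J\<close> on, the terms are controlled by the a priori bound alone
      and add up to at most \<open>\<epsilon> / 3\<close>. Below \<open>J\<close> there are finitely
      many indices, so the induction hypothesis holds eventually for all of them together.\<close>
    obtain J0 :: nat where J0: "3 * C' / \<epsilon> < real J0" using reals_Archimedean2 by blast
    define J where "J = Suc J0"
    have J: "J \<ge> 1" "C' / real J \<le> \<epsilon> / 3"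
      using J0 Suc.prems C' by (auto simp: J_def field_simps)
    have ev1: "eventually (\<lambda>p. \<forall>i\<in>{1..<J}. \<bar>e p (Suc i * j)\<bar> * real (Suc i * j) ^ d \<le> C' * (3/4) ^ N + \<epsilon> / 3) F"
      using Suc.prems by (intro eventually_ball_finite ballI Suc.IH) auto
    have "eventually (\<lambda>p. \<bar>s p j\<bar> < \<epsilon> / 3 / real j ^ d) F"
    proof -
      have "\<epsilon> / 3 / real j ^ d > 0" using Suc.prems by simp
      from tendstoD[OF lim[OF Suc.prems(1)] this] show ?thesis by simp
    qed
    then show ?case
      using ev1 bound sums
    proof eventually_elim
      case (elim p)
      let ?a = "\<lambda>i. e p (Suc i * j)"
      have sq: "real (Suc i) ^ 2 \<le> real (Suc i) ^ d" for i using d by (intro power_increasing) auto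
      have tail: "\<bar>?a (i + J)\<bar> \<le> C' / real j ^ d * (1 / real (i + J) - 1 / real (Suc (i + J)))" for i
      proof -
        have "\<bar>?a (i + J)\<bar> \<le> C / real (Suc (i + J) * j) ^ d" using elim(3)[rule_format, of "Suc (i + J) * j"] Suc.prems(1) by (metis One_nat_def Suc_leI mult_pos_pos less_eq_Suc_le zero_less_Suc)
        also have "\<dots> \<le> C' / real (Suc (i + J) * j) ^ d" using C' by (intro divide_right_mono) auto
        also have "\<dots> = C' / real j ^ d * (1 / real (Suc (i + J)) ^ d)"
          by (simp only: of_nat_mult power_mult_distrib) simp
        also have "\<dots> \<le> C' / real j ^ d * (1 / real (Suc (i + J)) ^ 2)"
          using C' sq[of "i + J"] by (intro mult_left_mono divide_left_mono) auto
        also have "\<dots> \<le> C' / real j ^ d * (1 / real (i + J) - 1 / real (Suc (i + J)))"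
          using C' inverse_square_tail(2)[OF J(1)] by (intro mult_left_mono) auto
        finally show ?thesis .
      qed
      have tsum: "(\<lambda>i. C' / real j ^ d * (1 / real (i + J) - 1 / real (Suc (i + J)))) sums (C' / real j ^ d * (1 / real J))"
        by (intro sums_mult inverse_square_tail J)
      have asum: "?a sums s p j" using elim(4) Suc.prems by blast
      then have "summable (\<lambda>i. ?a (i + J))" by (intro summable_ignore_initial_segment) (rule sums_summable)
      have abs_summable: "summable (\<lambda>i. \<bar>?a (i + J)\<bar>)"
        by (rule summable_comparison_test[OF _ sums_summable[OF tsum]]) (use tail in auto)
      have "\<bar>suminf (\<lambda>i. ?a (i + J))\<bar> \<le> suminf (\<lambda>i. \<bar>?a (i + J)\<bar>)"
        by (rule summable_rabs[OF abs_summable])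
      also have "\<dots> \<le> C' / real j ^ d * (1 / real J)"
        using suminf_le[OF tail abs_summable sums_summable[OF tsum]] sums_unique[OF tsum] by simp
      finally have "\<bar>suminf (\<lambda>i. ?a (i + J))\<bar> * real j ^ d \<le> C' / real j ^ d * (1 / real J) * real j ^ d"
        using jpos by (intro mult_right_mono) auto
      also have "\<dots> = C' / real J" using jpos by simp
      also note J(2)
      finally have T: "\<bar>suminf (\<lambda>i. ?a (i + J))\<bar> * real j ^ d \<le> \<epsilon> / 3" .
      have mid: "(\<Sum>i=1..<J. \<bar>?a i\<bar>) * real j ^ d \<le> 3/4 * (C' * (3/4) ^ N + \<epsilon> / 3)"
      proof -
        have "(\<Sum>i=1..<J. \<bar>?a i\<bar>) * real j ^ d \<le> (\<Sum>i=1..<J. (C' * (3/4) ^ N + \<epsilon> / 3) * (1 / real (Suc i) ^ 2))"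
          unfolding sum_distrib_right
        proof (rule sum_mono)
          fix i assume "i \<in> {1..<J}"
          with elim(2) have "\<bar>?a i\<bar> * real (Suc i * j) ^ d \<le> C' * (3/4) ^ N + \<epsilon> / 3" by blast
          then have "\<bar>?a i\<bar> * real j ^ d * real (Suc i) ^ d \<le> C' * (3/4) ^ N + \<epsilon> / 3"
            by (simp only: of_nat_mult power_mult_distrib mult_ac)
          moreover have "\<bar>?a i\<bar> * real j ^ d * real (Suc i) ^ 2 \<le> \<bar>?a i\<bar> * real j ^ d * real (Suc i) ^ d"
            by (intro mult_left_mono sq) auto
          ultimately have "\<bar>?a i\<bar> * real j ^ d * real (Suc i) ^ 2 \<le> C' * (3/4) ^ N + \<epsilon> / 3" by linarith
          then have "\<bar>?a i\<bar> * real j ^ d \<le> (C' * (3/4) ^ N + \<epsilon> / 3) / real (Suc i) ^ 2"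
            by (subst pos_le_divide_eq) auto
          then show "\<bar>?a i\<bar> * real j ^ d \<le> (C' * (3/4) ^ N + \<epsilon> / 3) * (1 / real (Suc i) ^ 2)" by simp
        qed
        also have "\<dots> = (C' * (3/4) ^ N + \<epsilon> / 3) * (\<Sum>i=1..<J. 1 / real (Suc i) ^ 2)"
          by (simp add: sum_distrib_left)
        also have "\<dots> \<le> (C' * (3/4) ^ N + \<epsilon> / 3) * (3 / 4)"
          using C' Suc.prems by (intro mult_left_mono inverse_square_partial) auto
        finally show ?thesis by simp
      qed
      have "s p j = suminf (\<lambda>i. ?a (i + J)) + (\<Sum>i<J. ?a i)"
        using suminf_split_initial_segment[OF sums_summable[OF asum], of J] sums_unique[OF asum] by simp
      \<comment> \<open>The index \<open>i\<close> stands for the multiple \<open>Suc i\<close>, so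
        the term \<open>i = 0\<close> is \<open>e p j\<close> itself and the remaining sum starts at
        1.\<close>
      also have "(\<Sum>i<J. ?a i) = e p j + (\<Sum>i=1..<J. ?a i)"
        using J(1) by (simp add: lessThan_atLeast0 sum.atLeast_Suc_lessThan)
      finally have "\<bar>e p j\<bar> \<le> \<bar>s p j\<bar> + \<bar>suminf (\<lambda>i. ?a (i + J))\<bar> + \<bar>\<Sum>i=1..<J. ?a i\<bar>" by linarith
      also have "\<bar>\<Sum>i=1..<J. ?a i\<bar> \<le> (\<Sum>i=1..<J. \<bar>?a i\<bar>)" by (rule sum_abs)
      finally have "\<bar>e p j\<bar> * real j ^ d \<le> (\<bar>s p j\<bar> + \<bar>suminf (\<lambda>i. ?a (i + J))\<bar> + (\<Sum>i=1..<J. \<bar>?a i\<bar>)) * real j ^ d"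
        using jpos by (intro mult_right_mono) auto
      also have "\<dots> = \<bar>s p j\<bar> * real j ^ d + \<bar>suminf (\<lambda>i. ?a (i + J))\<bar> * real j ^ d + (\<Sum>i=1..<J. \<bar>?a i\<bar>) * real j ^ d"
        by (simp only: distrib_right)
      also have "\<bar>s p j\<bar> * real j ^ d \<le> \<epsilon> / 3" using elim(1) jpos by (simp add: field_simps)
      finally have "\<bar>e p j\<bar> * real j ^ d \<le> \<epsilon> / 3 + \<epsilon> / 3 + 3/4 * (C' * (3/4) ^ N + \<epsilon> / 3)"
        using T mid by linarith
      then show ?case using Suc.prems by (simp add: algebra_simps)
    qed
  qed
  show ?thesis
  proof (rule tendstoI)
    fix \<epsilon> :: real assume "\<epsilon> > 0"
    have "(\<lambda>N. C' * (3/4) ^ N) \<longlonglongrightarrow> C' * 0"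
      by (intro tendsto_mult tendsto_const LIMSEQ_realpow_zero) auto
    then have "eventually (\<lambda>N. C' * (3/4) ^ N < \<epsilon> / 2) sequentially"
      using \<open>\<epsilon> > 0\<close> by (intro order_tendstoD) auto
    then obtain N where N: "C' * (3/4) ^ N < \<epsilon> / 2" by (auto simp: eventually_sequentially)
    have "eventually (\<lambda>p. \<bar>e p 1\<bar> * real 1 ^ d \<le> C' * (3/4) ^ N + \<epsilon> / 2) F"
      using \<open>\<epsilon> > 0\<close> by (intro iter) auto
    then show "eventually (\<lambda>p. dist (e p 1) 0 < \<epsilon>) F"
      by eventually_elim (use N in auto)
  qed
qed

section \<open>Subspaces over a finite field\<close>

locale finite_field = field F for F :: "'r ring" (structure) +
  assumes fin: "finite (carrier F)"
begin

definition q :: nat where "q = card (carrier F)"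

definition vecs :: "('i::finite \<Rightarrow> 'r) set" where
  "vecs = {v. \<forall>i. v i \<in> carrier F}"

definition vadd :: "('i \<Rightarrow> 'r) \<Rightarrow> ('i \<Rightarrow> 'r) \<Rightarrow> 'i \<Rightarrow> 'r" where
  "vadd u v = (\<lambda>i. u i \<oplus> v i)"

definition vscale :: "'r \<Rightarrow> ('i \<Rightarrow> 'r) \<Rightarrow> 'i \<Rightarrow> 'r" where
  "vscale a v = (\<lambda>i. a \<otimes> v i)"

definition subsp :: "('i::finite \<Rightarrow> 'r) set \<Rightarrow> bool" where
  "subsp S \<longleftrightarrow> S \<subseteq> vecs \<and> (\<lambda>_. \<zero>) \<in> S \<and> (\<forall>u\<in>S. \<forall>v\<in>S. vadd u v \<in> S) \<and>
     (\<forall>a\<in>carrier F. \<forall>v\<in>S. vscale a v \<in> S)"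

lemma q_ge_2: "q \<ge> 2"
proof -
  have "card {\<zero>, \<one>} \<le> q" unfolding q_def by (rule card_mono[OF fin]) auto
  then show ?thesis by simp
qed

lemma pow_less: "i < n \<Longrightarrow> real q ^ i < real q ^ n"
  using q_ge_2 by (intro power_strict_increasing) auto

lemma vecs_eq: "vecs = PiE UNIV (\<lambda>_. carrier F)"
  by (simp add: vecs_def PiE_UNIV_domain Pi_def)

lemma finite_vecs: "finite (vecs :: ('i::finite \<Rightarrow> 'r) set)"
  unfolding vecs_eq by (intro finite_PiE fin) auto

lemma card_vecs: "card (vecs :: ('i::finite \<Rightarrow> 'r) set) = q ^ CARD('i)"
  unfolding vecs_eq by (subst card_PiE) (auto simp: q_def)

lemma vecsD: "v \<in> vecs \<Longrightarrow> v i \<in> carrier F" by (auto simp: vecs_def)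

lemma subspD:
  assumes "subsp S"
  shows "S \<subseteq> vecs" "(\<lambda>_. \<zero>) \<in> S" "u \<in> S \<Longrightarrow> v \<in> S \<Longrightarrow> vadd u v \<in> S"
    "a \<in> carrier F \<Longrightarrow> v \<in> S \<Longrightarrow> vscale a v \<in> S"
  using assms unfolding subsp_def by blast+

lemma vadd_vecs [simp]: "u \<in> vecs \<Longrightarrow> v \<in> vecs \<Longrightarrow> vadd u v \<in> vecs"
  and vscale_vecs [simp]: "a \<in> carrier F \<Longrightarrow> v \<in> vecs \<Longrightarrow> vscale a v \<in> vecs"
  and zero_vecs [simp]: "(\<lambda>_. \<zero>) \<in> vecs"
  by (auto simp: vecs_def vadd_def vscale_def)

lemma subsp_vecs: "subsp vecs"
  by (simp add: subsp_def)

lemma subsp_zero: "subsp {\<lambda>_ :: 'i::finite. \<zero>}"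
proof -
  let ?z = "\<lambda>_ :: 'i. \<zero>"
  have "vadd ?z ?z = ?z" by (simp add: vadd_def)
  moreover have "vscale a ?z = ?z" if "a \<in> carrier F" for a
    using that by (simp add: vscale_def)
  ultimately show ?thesis by (simp add: subsp_def)
qed

lemma subsp_uminus: "subsp S \<Longrightarrow> v \<in> S \<Longrightarrow> vscale (\<ominus> \<one>) v \<in> S"
  by (rule subspD) auto

lemma finite_subsp: "subsp S \<Longrightarrow> finite S"
  using finite_vecs subspD(1) by (blast intro: finite_subset)

definition ext :: "('i::finite \<Rightarrow> 'r) set \<Rightarrow> ('i \<Rightarrow> 'r) \<Rightarrow> ('i \<Rightarrow> 'r) set" where
  "ext S v = (\<lambda>(u, a). vadd u (vscale a v)) ` (S \<times> carrier F)"

text \<open>If two coefficients of \<open>v\<close> differed, the equation could be solved for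
  \<open>v\<close> inside \<open>S\<close>.\<close>

lemma inj_on_ext:
  assumes S: "subsp S" and v: "v \<in> vecs" "v \<notin> S"
  shows "inj_on (\<lambda>(u, a). vadd u (vscale a v)) (S \<times> carrier F)"
proof (rule inj_onI, clarify)
  fix u a u' a' assume u: "u \<in> S" "u' \<in> S" and a: "a \<in> carrier F" "a' \<in> carrier F"
    and eq: "vadd u (vscale a v) = vadd u' (vscale a' v)"
  have uV: "u \<in> vecs" "u' \<in> vecs" using u subspD(1)[OF S] by blast+
  have c: "v i \<in> carrier F" "u i \<in> carrier F" "u' i \<in> carrier F" for i
    using v(1) uV by (auto simp: vecs_def)
  have *: "(a \<ominus> a') \<otimes> v i = u' i \<oplus> \<ominus> u i" for i
  proof -
    have "u i \<oplus> a \<otimes> v i = u' i \<oplus> a' \<otimes> v i" using fun_cong[OF eq, of i] by (simp add: vadd_def vscale_def)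
    moreover have "(a \<ominus> a') \<otimes> v i = (u i \<oplus> a \<otimes> v i) \<oplus> \<ominus> u i \<ominus> a' \<otimes> v i"
      using a c by algebra
    moreover have "(u' i \<oplus> a' \<otimes> v i) \<oplus> \<ominus> u i \<ominus> a' \<otimes> v i = u' i \<oplus> \<ominus> u i"
      using a c by algebra
    ultimately show ?thesis by simp
  qed
  have "a = a'"
  proof (rule ccontr)
    assume "a \<noteq> a'"
    moreover have "a = (a \<ominus> a') \<oplus> a'" using a by algebra
    ultimately have "a \<ominus> a' \<noteq> \<zero>" using a by auto
    then have d: "a \<ominus> a' \<in> Units F" using a by (simp add: field_Units)
    have "v = vscale (inv (a \<ominus> a')) (vadd u' (vscale (\<ominus> \<one>) u))"
    proof
      fix i
      have "v i = inv (a \<ominus> a') \<otimes> ((a \<ominus> a') \<otimes> v i)"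
        using d c a by (simp add: m_assoc [symmetric])
      also have "\<dots> = inv (a \<ominus> a') \<otimes> (u' i \<oplus> \<ominus> \<one> \<otimes> u i)"
        unfolding * using c by (simp add: l_minus)
      finally show "v i = vscale (inv (a \<ominus> a')) (vadd u' (vscale (\<ominus> \<one>) u)) i"
        by (simp add: vscale_def vadd_def)
    qed
    also have "\<dots> \<in> S"
      using d by (intro subspD[OF S] u subsp_uminus[OF S]) auto
    finally show False using v(2) by simp
  qed
  moreover have "u = u'"
  proof
    fix i
    have "\<zero> = u' i \<oplus> \<ominus> u i" using *[of i] \<open>a = a'\<close> a c by (simp add: r_neg a_minus_def)
    then have "u i = (u' i \<oplus> \<ominus> u i) \<oplus> u i" using c by simp
    also have "\<dots> = u' i" using c by (simp add: a_assoc l_neg)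
    finally show "u i = u' i" .
  qed
  ultimately show "u = u' \<and> a = a'" by simp
qed

lemma card_ext: "subsp S \<Longrightarrow> v \<in> vecs \<Longrightarrow> v \<notin> S \<Longrightarrow> card (ext S v) = card S * q"
  unfolding ext_def by (subst card_image[OF inj_on_ext]) (auto simp: q_def card_cartesian_product)

lemma subsp_ext:
  assumes S: "subsp S" and v: "v \<in> vecs"
  shows "subsp (ext S v)"
  unfolding subsp_def
proof (intro conjI ballI)
  show "ext S v \<subseteq> vecs" using subspD(1)[OF S] v by (auto simp: ext_def)
  have "(\<lambda>_. \<zero>) = vadd (\<lambda>_. \<zero>) (vscale \<zero> v)" using v by (auto simp: vadd_def vscale_def vecs_def)
  then show "(\<lambda>_. \<zero>) \<in> ext S v" unfolding ext_def using subspD(2)[OF S] by force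
next
  fix x y assume "x \<in> ext S v" "y \<in> ext S v"
  then obtain u a w b where xy: "x = vadd u (vscale a v)" "y = vadd w (vscale b v)"
    "u \<in> S" "w \<in> S" "a \<in> carrier F" "b \<in> carrier F" by (auto simp: ext_def)
  have uw: "u \<in> vecs" "w \<in> vecs" using xy subspD(1)[OF S] by blast+
  have "vadd x y = vadd (vadd u w) (vscale (a \<oplus> b) v)"
  proof
    fix i
    have "u i \<in> carrier F" "w i \<in> carrier F" "v i \<in> carrier F" using uw v by (auto simp: vecs_def)
    with xy(5,6) show "vadd x y i = vadd (vadd u w) (vscale (a \<oplus> b) v) i"
      unfolding xy vadd_def vscale_def by algebra
  qed
  then show "vadd x y \<in> ext S v"
    unfolding ext_def using xy subspD(3)[OF S] by (intro image_eqI[of _ _ "(vadd u w, a \<oplus> b)"]) auto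
next
  fix c x assume c: "c \<in> carrier F" and "x \<in> ext S v"
  then obtain u a where x: "x = vadd u (vscale a v)" "u \<in> S" "a \<in> carrier F" by (auto simp: ext_def)
  have u: "u \<in> vecs" using x subspD(1)[OF S] by blast
  have "vscale c x = vadd (vscale c u) (vscale (c \<otimes> a) v)"
    using c x u v by (auto simp: vadd_def vscale_def vecs_def r_distr m_assoc)
  then show "vscale c x \<in> ext S v"
    unfolding ext_def using x c subspD(4)[OF S] by (intro image_eqI[of _ _ "(vscale c u, c \<otimes> a)"]) auto
qed

lemma ext_subset_iff:
  assumes S: "subsp S" and v: "v \<in> vecs" and W: "subsp W"
  shows "ext S v \<subseteq> W \<longleftrightarrow> S \<subseteq> W \<and> v \<in> W"
proof
  assume *: "ext S v \<subseteq> W"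
  have "u \<in> ext S v" if "u \<in> S" for u
  proof -
    have "u = vadd u (vscale \<zero> v)" using that subspD(1)[OF S] v by (auto simp: vadd_def vscale_def vecs_def subset_iff)
    then show ?thesis unfolding ext_def using that by force
  qed
  moreover have "v \<in> ext S v"
  proof -
    have "v = vadd (\<lambda>_. \<zero>) (vscale \<one> v)" using v by (auto simp: vadd_def vscale_def vecs_def)
    then show ?thesis unfolding ext_def using subspD(2)[OF S] by force
  qed
  ultimately show "S \<subseteq> W \<and> v \<in> W" using * by blast
next
  assume "S \<subseteq> W \<and> v \<in> W"
  then show "ext S v \<subseteq> W" using subspD(3,4)[OF W] by (auto simp: ext_def)
qed

section \<open>Counting subspaces\<close>

text \<open>The Grassmannian, with the dimension expressed by the cardinality: over a finite field
  each determines the other, and counting arguments apply directly.\<close>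

definition grass :: "nat \<Rightarrow> ('i::finite \<Rightarrow> 'r) set set" where
  "grass k = {W. subsp W \<and> card W = q ^ k}"

lemma finite_grass: "finite (grass k :: ('i::finite \<Rightarrow> 'r) set set)"
  by (rule finite_subset[of _ "Pow vecs"]) (auto simp: grass_def finite_vecs dest: subspD(1))

text \<open>Double counting of pairs consisting of a space \<open>W\<close> containing
  \<open>S\<close> and a vector of \<open>W\<close> outside \<open>S\<close>: each such vector
  enlarges \<open>S\<close> to a space with \<open>q ^ Suc s\<close> elements, to which the
  induction hypothesis applies. The product form avoids divisions during the induction.\<close>

lemma card_grass_containing:
  fixes S :: "('i::finite \<Rightarrow> 'r) set"
  assumes "subsp S" "card S = q ^ s" "s \<le> k" "k \<le> CARD('i)"
  shows "real (card {W \<in> grass k. S \<subseteq> W}) * (\<Prod>i=s..<k. (real q ^ k - real q ^ i))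
       = (\<Prod>i=s..<k. (real q ^ CARD('i) - real q ^ i))"
  using assms
proof (induction "k - s" arbitrary: s S)
  case 0
  then have "s = k" by simp
  have "{W \<in> grass k. S \<subseteq> W} = {S}"
  proof (intro equalityI subsetI)
    fix W assume "W \<in> {W \<in> grass k. S \<subseteq> W}"
    then have W: "subsp W" "card W = q ^ k" "S \<subseteq> W" by (auto simp: grass_def)
    have "S = W" by (rule card_subset_eq[OF finite_subsp[OF W(1)] W(3)]) (use 0 W \<open>s = k\<close> in simp)
    then show "W \<in> {S}" by simp
  qed (use 0 \<open>s = k\<close> in \<open>simp add: grass_def\<close>)
  then show ?case using \<open>s = k\<close> by simp
next
  case (Suc j)
  then have s: "s < k" "j = k - Suc s" "Suc s \<le> k" by auto
  let ?G = "{W \<in> grass k. S \<subseteq> W}" and ?V = "vecs - S"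
  let ?P = "\<lambda>n s. (\<Prod>i=s..<k. (real q ^ n - real q ^ i))"
  have S: "subsp S" "finite S" "S \<subseteq> vecs" using Suc.prems(1) finite_subsp subspD(1) by blast+
  have fG: "finite ?G" by (rule finite_subset[OF _ finite_grass]) auto
  have "(\<Sum>W\<in>?G. card {v \<in> ?V. v \<in> W}) = (\<Sum>v\<in>?V. card {W \<in> ?G. v \<in> W})"
    by (rule sum_multicount_gen) (use fG finite_vecs in auto)
  then have "(\<Sum>W\<in>?G. real (card {v \<in> ?V. v \<in> W})) = (\<Sum>v\<in>?V. real (card {W \<in> ?G. v \<in> W}))"
    by (simp flip: of_nat_sum)
  moreover have "real (card {v \<in> ?V. v \<in> W}) = real q ^ k - real q ^ s" if "W \<in> ?G" for W
  proof -
    have W: "subsp W" "card W = q ^ k" "S \<subseteq> W" using that by (auto simp: grass_def)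
    have "{v \<in> ?V. v \<in> W} = W - S" using subspD(1)[OF W(1)] by blast
    moreover have "card S \<le> card W" using W finite_subsp by (intro card_mono) auto
    ultimately show ?thesis using W S Suc.prems(2) by (simp add: card_Diff_subset of_nat_diff)
  qed
  ultimately have 1: "real (card ?G) * (real q ^ k - real q ^ s) = (\<Sum>v\<in>?V. real (card {W \<in> ?G. v \<in> W}))"
    by simp
  have 2: "real (card {W \<in> ?G. v \<in> W}) * ?P k (Suc s) = ?P CARD('i) (Suc s)" if "v \<in> ?V" for v
  proof -
    have "{W \<in> ?G. v \<in> W} = {W \<in> grass k. ext S v \<subseteq> W}"
      using ext_subset_iff[OF S(1), of v] that by (auto simp: grass_def)
    moreover have "card (ext S v) = q ^ Suc s" using card_ext[OF S(1)] that Suc.prems(2) by simp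
    ultimately show ?thesis
      using Suc.hyps(1)[of "Suc s" "ext S v"] s Suc.prems subsp_ext[OF S(1)] that by simp
  qed
  have "card S \<le> card (vecs :: ('i \<Rightarrow> 'r) set)" using S finite_vecs by (intro card_mono) auto
  then have 3: "real (card ?V) = real q ^ CARD('i) - real q ^ s"
    using S Suc.prems(2) card_vecs[where ?'i='i] by (simp add: card_Diff_subset of_nat_diff)
  have "real (card ?G) * ?P k s = real (card ?G) * (real q ^ k - real q ^ s) * ?P k (Suc s)"
    using s by (simp add: prod.atLeast_Suc_lessThan)
  also have "\<dots> = (\<Sum>v\<in>?V. real (card {W \<in> ?G. v \<in> W}) * ?P k (Suc s))"
    unfolding 1 by (rule sum_distrib_right)
  also have "\<dots> = (\<Sum>v\<in>?V. ?P CARD('i) (Suc s))" by (intro sum.cong refl 2)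
  also have "\<dots> = (real q ^ CARD('i) - real q ^ s) * ?P CARD('i) (Suc s)" using 3 by simp
  also have "\<dots> = ?P CARD('i) s" using s by (simp add: prod.atLeast_Suc_lessThan)
  finally show ?case .
qed

text \<open>In the quotient of the counts for \<open>S\<close> and for the zero space, the factors
  with \<open>i \<ge> s\<close> cancel. The result is the probability that a random
  \<open>k\<close>-dimensional space contains a given \<open>s\<close>-dimensional one.\<close>

lemma card_grass_ratio:
  fixes S :: "('i::finite \<Rightarrow> 'r) set"
  assumes "subsp S" "card S = q ^ s" "s \<le> k" "k \<le> CARD('i)"
  shows "card (grass k :: ('i \<Rightarrow> 'r) set set) > 0"
    "real (card {W \<in> grass k. S \<subseteq> W}) / real (card (grass k :: ('i \<Rightarrow> 'r) set set))
       = (\<Prod>i<s. (real q ^ k - real q ^ i) / (real q ^ CARD('i) - real q ^ i))"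
proof -
  let ?P = "\<lambda>n s. (\<Prod>i=s..<k. (real q ^ n - real q ^ i))"
  have pos: "real q ^ n - real q ^ i > 0" if "i < n" for n i
    using that q_ge_2 by (simp add: pow_less)
  have Pk: "?P k s > 0" "?P k 0 > 0" by (auto intro!: prod_pos pos simp del: diff_gt_0_iff_gt)
  have PD: "?P CARD('i) s > 0" "?P CARD('i) 0 > 0"
    using assms(4) by (auto intro!: prod_pos pos simp del: diff_gt_0_iff_gt)
  have "{W \<in> grass k. {\<lambda>_. \<zero>} \<subseteq> W} = (grass k :: ('i \<Rightarrow> 'r) set set)"
    by (auto simp: grass_def subspD(2))
  then have 0: "real (card (grass k :: ('i \<Rightarrow> 'r) set set)) * ?P k 0 = ?P CARD('i) 0"
    using card_grass_containing[OF subsp_zero, of 0 k, where ?'i='i] assms(4) by simp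
  have "real (card (grass k :: ('i \<Rightarrow> 'r) set set)) * ?P k 0 \<noteq> 0" unfolding 0 using PD(2) by linarith
  then show pos0: "card (grass k :: ('i \<Rightarrow> 'r) set set) > 0" by (cases "card (grass k :: ('i \<Rightarrow> 'r) set set)") auto
  have split: "?P n 0 = (\<Prod>i<s. (real q ^ n - real q ^ i)) * ?P n s" for n
    using assms(3) prod.atLeastLessThan_concat[of 0 s k "\<lambda>i. real q ^ n - real q ^ i"]
    by (simp add: atLeast0LessThan)
  have s: "real (card {W \<in> grass k. S \<subseteq> W}) * ?P k s = ?P CARD('i) s"
    by (rule card_grass_containing[OF assms])
  have D: "(\<Prod>i<s. (real q ^ CARD('i) - real q ^ i)) > 0"
    using assms(3,4) by (auto intro!: prod_pos pos simp del: diff_gt_0_iff_gt)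
  have "real (card {W \<in> grass k. S \<subseteq> W}) * (\<Prod>i<s. (real q ^ CARD('i) - real q ^ i)) * ?P k s
      = ?P CARD('i) 0"
    using s split[of "CARD('i)"] by (simp add: mult_ac)
  also have "\<dots> = real (card (grass k :: ('i \<Rightarrow> 'r) set set)) * (\<Prod>i<s. (real q ^ k - real q ^ i)) * ?P k s"
    using 0 split[of k] by (simp add: mult_ac)
  finally have "real (card {W \<in> grass k. S \<subseteq> W}) * (\<Prod>i<s. (real q ^ CARD('i) - real q ^ i))
     = real (card (grass k :: ('i \<Rightarrow> 'r) set set)) * (\<Prod>i<s. (real q ^ k - real q ^ i))"
    by (rule mult_right_cancel[THEN iffD1, rotated]) (use Pk(1) in linarith)
  note X = this
  have D0: "(\<Prod>i<s. (real q ^ CARD('i) - real q ^ i)) \<noteq> 0" using D by linarith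
  have B0: "real (card (grass k :: ('i \<Rightarrow> 'r) set set)) \<noteq> 0" using pos0 by simp
  show "real (card {W \<in> grass k. S \<subseteq> W}) / real (card (grass k :: ('i \<Rightarrow> 'r) set set))
       = (\<Prod>i<s. (real q ^ k - real q ^ i) / (real q ^ CARD('i) - real q ^ i))"
    unfolding prod_dividef frac_eq_eq[OF B0 D0] X by (rule mult.commute)
qed

text \<open>Each factor of the Gaussian binomial coefficient is at most
  \<open>2 q ^ (D - k)\<close>, with \<open>D\<close> the ambient dimension, because
  \<open>q ^ k - q ^ i \<ge> q ^ k / 2\<close> for \<open>i < k\<close>. It bounds the number of
  possible left kernels later.\<close>

lemma card_grass_le:
  assumes "k \<le> CARD('i)"
  shows "real (card (grass k :: ('i::finite \<Rightarrow> 'r) set set)) \<le> 2 ^ k * real q ^ (k * (CARD('i) - k))"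
proof -
  have pos: "real q ^ k - real q ^ i > 0" if "i < k" for i
    using that q_ge_2 by (simp add: pow_less)
  have "{W \<in> grass k. {\<lambda>_. \<zero>} \<subseteq> W} = (grass k :: ('i \<Rightarrow> 'r) set set)"
    by (auto simp: grass_def subspD(2))
  then have "real (card (grass k :: ('i \<Rightarrow> 'r) set set)) * (\<Prod>i<k. (real q ^ k - real q ^ i))
      = (\<Prod>i<k. (real q ^ CARD('i) - real q ^ i))"
    using card_grass_containing[OF subsp_zero, of 0 k, where ?'i='i] assms by (simp add: atLeast0LessThan)
  moreover have "(\<Prod>i<k. (real q ^ k - real q ^ i)) > 0" by (auto intro!: prod_pos pos simp del: diff_gt_0_iff_gt)
  ultimately have "real (card (grass k :: ('i \<Rightarrow> 'r) set set))
      = (\<Prod>i<k. (real q ^ CARD('i) - real q ^ i) / (real q ^ k - real q ^ i))"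
    unfolding prod_dividef by - (rule nonzero_eq_divide_eq[THEN iffD2, rotated], assumption, linarith)
  also have "\<dots> \<le> (\<Prod>i<k. 2 * real q ^ (CARD('i) - k))"
  proof (rule prod_mono, intro conjI)
    fix i assume "i \<in> {..<k}"
    then have i: "i < k" by simp
    have "real q ^ Suc i \<le> real q ^ k" using i q_ge_2 by (intro power_increasing) auto
    moreover have "2 * real q ^ i \<le> real q ^ Suc i" using q_ge_2 by (simp add: mult_right_mono)
    ultimately have "real q ^ k \<le> 2 * (real q ^ k - real q ^ i)" by simp
    then have "real q ^ (CARD('i) - k) * real q ^ k \<le> real q ^ (CARD('i) - k) * (2 * (real q ^ k - real q ^ i))"
      by (intro mult_left_mono) auto
    moreover have "real q ^ (CARD('i) - k) * real q ^ k = real q ^ CARD('i)"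
      using assms by (simp add: power_add [symmetric])
    moreover have "0 \<le> real q ^ i" by simp
    ultimately have "real q ^ CARD('i) - real q ^ i \<le> 2 * real q ^ (CARD('i) - k) * (real q ^ k - real q ^ i)"
      by (simp only: mult.assoc mult.left_commute[of _ 2])
    then show "(real q ^ CARD('i) - real q ^ i) / (real q ^ k - real q ^ i) \<le> 2 * real q ^ (CARD('i) - k)"
      using pos[OF i] by (simp add: pos_divide_le_eq)
    have "real q ^ i \<le> real q ^ CARD('i)" using i assms q_ge_2 by (intro power_increasing) auto
    then show "0 \<le> (real q ^ CARD('i) - real q ^ i) / (real q ^ k - real q ^ i)"
      using pos[OF i] by simp
  qed
  also have "\<dots> = 2 ^ k * real q ^ (k * (CARD('i) - k))"
    by (simp add: power_mult_distrib power_mult mult.commute[of k])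
  finally show ?thesis .
qed

text \<open>Subtracting the same \<open>q ^ i\<close> from numerator and denominator of
  \<open>q ^ k / q ^ D\<close>, a fraction of value at most 1, cannot increase it.\<close>

lemma ratio_le:
  assumes "s \<le> k" "k \<le> D"
  shows "0 \<le> (\<Prod>i<s. (real q ^ k - real q ^ i) / (real q ^ D - real q ^ i))"
    "(\<Prod>i<s. (real q ^ k - real q ^ i) / (real q ^ D - real q ^ i)) \<le> inverse (real q ^ (s * (D - k)))"
proof -
  have le: "real q ^ i \<le> real q ^ j" if "i \<le> j" for i j
    using that q_ge_2 by (intro power_increasing) auto
  have pos: "real q ^ D - real q ^ i > 0" if "i < s" for i
    using that assms q_ge_2 by (simp add: pow_less)
  show "0 \<le> (\<Prod>i<s. (real q ^ k - real q ^ i) / (real q ^ D - real q ^ i))"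
    using assms pos by (intro prod_nonneg) (auto intro!: divide_nonneg_pos le)
  have "(\<Prod>i<s. (real q ^ k - real q ^ i) / (real q ^ D - real q ^ i)) \<le> (\<Prod>i<s. inverse (real q ^ (D - k)))"
  proof (rule prod_mono, intro conjI)
    fix i assume "i \<in> {..<s}"
    then have i: "i < s" by simp
    show "0 \<le> (real q ^ k - real q ^ i) / (real q ^ D - real q ^ i)"
      using i assms pos[OF i] by (intro divide_nonneg_pos) (auto intro: le)
    have "1 \<le> real q ^ (D - k)" using q_ge_2 by (intro one_le_power) simp
    then have "real q ^ i \<le> real q ^ i * real q ^ (D - k)" using q_ge_2 by simp
    then have "(real q ^ k - real q ^ i) * real q ^ (D - k) \<le> real q ^ D - real q ^ i"
      using assms by (simp add: algebra_simps power_add [symmetric])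
    then show "(real q ^ k - real q ^ i) / (real q ^ D - real q ^ i) \<le> inverse (real q ^ (D - k))"
      using pos[OF i] q_ge_2 by (simp add: field_simps)
  qed
  also have "\<dots> = inverse (real q ^ (s * (D - k)))"
    by (simp add: power_mult power_inverse mult.commute[of s])
  finally show "(\<Prod>i<s. (real q ^ k - real q ^ i) / (real q ^ D - real q ^ i)) \<le> inverse (real q ^ (s * (D - k)))" .
qed

lemma span_exists:
  fixes X :: "('i::finite \<Rightarrow> 'r) set"
  assumes "finite X" "X \<subseteq> vecs"
  shows "\<exists>S r. subsp S \<and> X \<subseteq> S \<and> (\<forall>W. subsp W \<longrightarrow> X \<subseteq> W \<longrightarrow> S \<subseteq> W) \<and> card S = q ^ r \<and> r \<le> card X"
  using assms
proof (induction X rule: finite_induct)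
  case empty
  show ?case
    by (intro exI[of _ "{\<lambda>_. \<zero>}"] exI[of _ 0]) (use subsp_zero subspD(2) in auto)
next
  case (insert x X)
  then obtain S r where S: "subsp S" "X \<subseteq> S" "\<forall>W. subsp W \<longrightarrow> X \<subseteq> W \<longrightarrow> S \<subseteq> W" "card S = q ^ r" "r \<le> card X"
    by auto
  have x: "x \<in> vecs" using insert by simp
  show ?case
  proof (cases "x \<in> S")
    case True
    then show ?thesis using S insert by (intro exI[of _ S] exI[of _ r]) auto
  next
    case False
    have "S \<subseteq> ext S x \<and> x \<in> ext S x" using ext_subset_iff[OF S(1) x subsp_ext[OF S(1) x]] by simp
    moreover have "ext S x \<subseteq> W" if "subsp W" "insert x X \<subseteq> W" for W
      using ext_subset_iff[OF S(1) x that(1)] S(3) that by auto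
    ultimately show ?thesis
      using S insert card_ext[OF S(1) x False] subsp_ext[OF S(1) x]
      by (intro exI[of _ "ext S x"] exI[of _ "Suc r"]) auto
  qed
qed

text \<open>A subspace is its own span, and a span is built by adjoining vectors one at a time, each
  new one multiplying the cardinality by \<open>q\<close>.\<close>

lemma card_subsp:
  assumes "subsp S"
  obtains r where "card S = q ^ r"
proof -
  obtain T r where T: "subsp T" "S \<subseteq> T" "\<forall>W. subsp W \<longrightarrow> S \<subseteq> W \<longrightarrow> T \<subseteq> W" "card T = q ^ r"
    using span_exists[OF finite_subsp[OF assms] subspD(1)[OF assms]] by blast
  then have "T = S" using assms by blast
  then show ?thesis using T(4) that by simp
qed

end

context finite_field begin

section \<open>Linear combinations, rank and kernel\<close>

text \<open>The index set is a parameter because combinations of matrix rows are indexed by a finite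
  type, and those of a basis of a code space by \<open>{..<k}\<close>.\<close>

definition LC :: "'m set \<Rightarrow> ('m \<Rightarrow> 'r) \<Rightarrow> ('m \<Rightarrow> 'i \<Rightarrow> 'r) \<Rightarrow> 'i \<Rightarrow> 'r" where
  "LC A c x = (\<lambda>i. \<Oplus>l\<in>A. c l \<otimes> x l i)"

lemma LC_empty [simp]: "LC {} c x = (\<lambda>_. \<zero>)"
  by (simp add: LC_def)

lemma LC_insert:
  assumes "finite A" "a \<notin> A" "\<And>l. l \<in> insert a A \<Longrightarrow> c l \<in> carrier F" "\<And>l. l \<in> insert a A \<Longrightarrow> x l \<in> vecs"
  shows "LC (insert a A) c x = vadd (vscale (c a) (x a)) (LC A c x)"
  unfolding LC_def vadd_def vscale_def
proof
  fix i
  have "c l \<otimes> x l i \<in> carrier F" if "l \<in> insert a A" for l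
    using assms(3,4)[OF that] by (auto simp: vecs_def)
  then show "(\<Oplus>l\<in>insert a A. c l \<otimes> x l i) = c a \<otimes> x a i \<oplus> (\<Oplus>l\<in>A. c l \<otimes> x l i)"
    using assms(1,2) by (intro finsum_insert) auto
qed

lemma LC_cong:
  assumes "\<And>l. l \<in> A \<Longrightarrow> c l = c' l" "\<And>l. l \<in> A \<Longrightarrow> x l = x' l"
    "\<And>l. l \<in> A \<Longrightarrow> c' l \<in> carrier F" "\<And>l. l \<in> A \<Longrightarrow> x' l \<in> vecs"
  shows "LC A c x = LC A c' x'"
  unfolding LC_def
proof
  fix i
  show "(\<Oplus>l\<in>A. c l \<otimes> x l i) = (\<Oplus>l\<in>A. c' l \<otimes> x' l i)"
    using assms by (intro finsum_cong') (auto simp: vecs_def)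
qed

lemma LC_subsp:
  assumes "finite A" "subsp W" "\<And>l. l \<in> A \<Longrightarrow> c l \<in> carrier F" "\<And>l. l \<in> A \<Longrightarrow> x l \<in> W"
  shows "LC A c x \<in> W"
  using assms(1,3,4)
proof (induction A rule: finite_induct)
  case empty
  then show ?case using subspD(2)[OF assms(2)] by simp
next
  case (insert a A)
  have "LC (insert a A) c x = vadd (vscale (c a) (x a)) (LC A c x)"
    using insert subspD(1)[OF assms(2)] by (intro LC_insert) blast+
  also have "\<dots> \<in> W"
    using insert by (intro subspD(3,4)[OF assms(2)]) auto
  finally show ?case .
qed

lemma LC_vecs:
  assumes "finite A" "\<And>l. l \<in> A \<Longrightarrow> c l \<in> carrier F" "\<And>l. l \<in> A \<Longrightarrow> x l \<in> vecs"
  shows "LC A c x \<in> vecs"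
  using LC_subsp[OF assms(1) subsp_vecs assms(2,3)] .

lemma LC_add:
  assumes "finite A" "\<And>l. l \<in> A \<Longrightarrow> c l \<in> carrier F" "\<And>l. l \<in> A \<Longrightarrow> c' l \<in> carrier F"
    "\<And>l. l \<in> A \<Longrightarrow> x l \<in> vecs"
  shows "LC A (vadd c c') x = vadd (LC A c x) (LC A c' x)"
  unfolding LC_def vadd_def
proof
  fix i
  have "(\<Oplus>l\<in>A. (c l \<oplus> c' l) \<otimes> x l i) = (\<Oplus>l\<in>A. c l \<otimes> x l i \<oplus> c' l \<otimes> x l i)"
    using assms by (intro finsum_cong') (auto simp: vecs_def l_distr)
  also have "\<dots> = (\<Oplus>l\<in>A. c l \<otimes> x l i) \<oplus> (\<Oplus>l\<in>A. c' l \<otimes> x l i)"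
    using assms by (intro finsum_addf) (auto simp: vecs_def)
  finally show "(\<Oplus>l\<in>A. (c l \<oplus> c' l) \<otimes> x l i) = (\<Oplus>l\<in>A. c l \<otimes> x l i) \<oplus> (\<Oplus>l\<in>A. c' l \<otimes> x l i)" .
qed

lemma LC_scale:
  assumes "finite A" "a \<in> carrier F" "\<And>l. l \<in> A \<Longrightarrow> c l \<in> carrier F" "\<And>l. l \<in> A \<Longrightarrow> x l \<in> vecs"
  shows "LC A (vscale a c) x = vscale a (LC A c x)"
  unfolding LC_def vscale_def
proof
  fix i
  have "(\<Oplus>l\<in>A. a \<otimes> c l \<otimes> x l i) = (\<Oplus>l\<in>A. a \<otimes> (c l \<otimes> x l i))"
    using assms by (intro finsum_cong') (auto simp: vecs_def m_assoc)
  also have "\<dots> = a \<otimes> (\<Oplus>l\<in>A. c l \<otimes> x l i)"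
    using assms by (intro finsum_rdistr[symmetric]) (auto simp: vecs_def)
  finally show "(\<Oplus>l\<in>A. a \<otimes> c l \<otimes> x l i) = a \<otimes> (\<Oplus>l\<in>A. c l \<otimes> x l i)" .
qed

lemma LC_zero:
  assumes "\<And>l. l \<in> A \<Longrightarrow> x l \<in> vecs"
  shows "LC A (\<lambda>_. \<zero>) x = (\<lambda>_. \<zero>)"
  unfolding LC_def
proof
  fix i
  have "(\<Oplus>l\<in>A. \<zero> \<otimes> x l i) = (\<Oplus>l\<in>A. \<zero>)"
    using assms by (intro finsum_cong') (auto simp: vecs_def)
  then show "(\<Oplus>l\<in>A. \<zero> \<otimes> x l i) = \<zero>" by (simp add: finsum_zero)
qed

lemma LC_unit:
  assumes "finite A" "a \<in> A" "\<And>l. l \<in> A \<Longrightarrow> x l \<in> vecs"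
  shows "LC A (\<lambda>l. if l = a then \<one> else \<zero>) x = x a"
  unfolding LC_def
proof
  fix i
  have xi: "x l i \<in> carrier F" if "l \<in> A" for l using assms(3)[OF that] by (auto simp: vecs_def)
  have "(\<Oplus>l\<in>A. (if l = a then \<one> else \<zero>) \<otimes> x l i) = (\<Oplus>l\<in>A. if a = l then x l i else \<zero>)"
    using xi by (intro finsum_cong') auto
  also have "\<dots> = x a i"
    using assms xi by (intro finsum_singleton) auto
  finally show "(\<Oplus>l\<in>A. (if l = a then \<one> else \<zero>) \<otimes> x l i) = x a i" .
qed

text \<open>Associativity of the matrix product in terms of coefficient families. It yields the
  linearity of the map \<open>G\<close> that parametrises a code by columns.\<close>

lemma LC_LC:
  assumes "finite A" "finite B" "\<And>l. l \<in> B \<Longrightarrow> a l \<in> carrier F"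
    "\<And>l m. l \<in> B \<Longrightarrow> m \<in> A \<Longrightarrow> y l m \<in> carrier F" "\<And>m. m \<in> A \<Longrightarrow> x m \<in> vecs"
  shows "LC A (\<lambda>m. \<Oplus>l\<in>B. a l \<otimes> y l m) x = LC B a (\<lambda>l. LC A (y l) x)"
  using assms(2,3,4)
proof (induction B rule: finite_induct)
  case empty
  then show ?case using assms by (simp add: LC_zero)
next
  case (insert b B)
  have "LC A (\<lambda>m. \<Oplus>l\<in>insert b B. a l \<otimes> y l m) x
      = LC A (vadd (vscale (a b) (y b)) (\<lambda>m. \<Oplus>l\<in>B. a l \<otimes> y l m)) x"
    unfolding vadd_def vscale_def using insert assms
    by (intro LC_cong) (auto intro!: finsum_insert finsum_closed a_closed m_closed)
  also have "\<dots> = vadd (LC A (vscale (a b) (y b)) x) (LC A (\<lambda>m. \<Oplus>l\<in>B. a l \<otimes> y l m) x)"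
    using insert assms by (intro LC_add) (auto simp: vscale_def intro!: finsum_closed)
  also have "\<dots> = vadd (vscale (a b) (LC A (y b) x)) (LC B a (\<lambda>l. LC A (y l) x))"
    using insert assms by (subst LC_scale) auto
  also have "\<dots> = LC (insert b B) a (\<lambda>l. LC A (y l) x)"
    using insert assms by (intro LC_insert[symmetric]) (auto intro!: LC_vecs)
  finally show ?case .
qed

definition row_span :: "('n::finite \<Rightarrow> 'i::finite \<Rightarrow> 'r) \<Rightarrow> ('i \<Rightarrow> 'r) set" where
  "row_span x = (\<lambda>c. LC UNIV c x) ` vecs"

definition left_kernel :: "('n::finite \<Rightarrow> 'i::finite \<Rightarrow> 'r) \<Rightarrow> ('n \<Rightarrow> 'r) set" where
  "left_kernel x = {c \<in> vecs. LC UNIV c x = (\<lambda>_. \<zero>)}"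

text \<open>The cardinality statement is rank-nullity by counting: after choosing one coefficient
  vector \<open>s v\<close> for each \<open>v\<close> in the row span, every coefficient vector is
  some \<open>s v\<close> plus an element of the left kernel, in exactly one way.\<close>

lemma
  fixes x :: "'n::finite \<Rightarrow> 'i::finite \<Rightarrow> 'r"
  assumes x: "\<And>l. x l \<in> vecs"
  shows subsp_row_span: "subsp (row_span x)"
    and row_span_subset_iff: "subsp W \<Longrightarrow> row_span x \<subseteq> W \<longleftrightarrow> (\<forall>l. x l \<in> W)"
    and subsp_left_kernel: "subsp (left_kernel x)"
    and card_row_span: "card (row_span x) * card (left_kernel x) = q ^ CARD('n)"
proof -
  let ?L = "\<lambda>c. LC UNIV c x"
  have Ladd: "?L (vadd c d) = vadd (?L c) (?L d)" if "c \<in> vecs" "d \<in> vecs" for c d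
    using that x by (intro LC_add) (auto simp: vecsD)
  have Lscale: "?L (vscale a c) = vscale a (?L c)" if "c \<in> vecs" "a \<in> carrier F" for a c
    using that x by (intro LC_scale) (auto simp: vecsD)
  have vec: "?L c \<in> vecs" if "c \<in> vecs" for c
    using that x by (intro LC_vecs) (auto simp: vecsD)
  have zero: "?L (\<lambda>_. \<zero>) = (\<lambda>_. \<zero>)" using x by (intro LC_zero)
  show R: "subsp (row_span x)"
    unfolding subsp_def row_span_def
  proof (intro conjI ballI)
    show "?L ` vecs \<subseteq> vecs" using vec by blast
    show "(\<lambda>_. \<zero>) \<in> ?L ` vecs" using zero zero_vecs by (metis image_eqI)
    show "vadd u v \<in> ?L ` vecs" if "u \<in> ?L ` vecs" "v \<in> ?L ` vecs" for u v
    proof -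
      from that obtain c d where "u = ?L c" "v = ?L d" "c \<in> vecs" "d \<in> vecs" by blast
      then show ?thesis by (intro image_eqI[of _ _ "vadd c d"]) (simp_all add: Ladd)
    qed
    show "vscale a v \<in> ?L ` vecs" if "a \<in> carrier F" "v \<in> ?L ` vecs" for a v
    proof -
      from that obtain c where "v = ?L c" "c \<in> vecs" by blast
      then show ?thesis using that(1) by (intro image_eqI[of _ _ "vscale a c"]) (simp_all add: Lscale)
    qed
  qed
  show K: "subsp (left_kernel x)"
    unfolding subsp_def left_kernel_def
  proof (intro conjI ballI)
    have z: "vadd (\<lambda>_ :: 'i. \<zero>) (\<lambda>_. \<zero>) = (\<lambda>_. \<zero>)" by (simp add: vadd_def)
    have z': "vscale a (\<lambda>_ :: 'i. \<zero>) = (\<lambda>_. \<zero>)" if "a \<in> carrier F" for a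
      using that by (simp add: vscale_def)
    show "{c \<in> vecs. ?L c = (\<lambda>_. \<zero>)} \<subseteq> vecs" by blast
    show "(\<lambda>_. \<zero>) \<in> {c \<in> vecs. ?L c = (\<lambda>_. \<zero>)}" using zero by simp
    show "vadd u v \<in> {c \<in> vecs. ?L c = (\<lambda>_. \<zero>)}"
      if "u \<in> {c \<in> vecs. ?L c = (\<lambda>_. \<zero>)}" "v \<in> {c \<in> vecs. ?L c = (\<lambda>_. \<zero>)}" for u v
      using that by (simp add: Ladd z)
    show "vscale a v \<in> {c \<in> vecs. ?L c = (\<lambda>_. \<zero>)}"
      if "a \<in> carrier F" "v \<in> {c \<in> vecs. ?L c = (\<lambda>_. \<zero>)}" for a v
      using that by (simp add: Lscale z')
  qed
  show "row_span x \<subseteq> W \<longleftrightarrow> (\<forall>l. x l \<in> W)" if W: "subsp W"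
  proof
    assume *: "row_span x \<subseteq> W"
    show "\<forall>l. x l \<in> W"
    proof
      fix l
      have "x l = ?L (\<lambda>m. if m = l then \<one> else \<zero>)" using x by (intro LC_unit[symmetric]) auto
      also have "\<dots> \<in> row_span x" unfolding row_span_def by (rule imageI) (simp add: vecs_def)
      finally show "x l \<in> W" using * by blast
    qed
  next
    assume "\<forall>l. x l \<in> W"
    then show "row_span x \<subseteq> W"
      unfolding row_span_def using W by (auto intro!: LC_subsp simp: vecsD)
  qed
  define s where "s v = (SOME c. c \<in> vecs \<and> ?L c = v)" for v
  have s: "s v \<in> vecs" "?L (s v) = v" if "v \<in> row_span x" for v
  proof -
    have "\<exists>c. c \<in> vecs \<and> ?L c = v" using that by (auto simp: row_span_def)
    from someI_ex[OF this] show "s v \<in> vecs" "?L (s v) = v" by (auto simp: s_def)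
  qed
  have Lk: "?L (vadd (s v) z) = v" if "v \<in> row_span x" "z \<in> left_kernel x" for v z
  proof -
    have "?L (vadd (s v) z) = vadd v (\<lambda>_. \<zero>)"
      using that s[OF that(1)] by (simp add: Ladd left_kernel_def)
    also have "\<dots> = v"
      using that(1) subspD(1)[OF R] by (auto simp: vadd_def vecsD)
    finally show ?thesis .
  qed
  have "bij_betw (\<lambda>(v, z). vadd (s v) z) (row_span x \<times> left_kernel x) vecs"
  proof (rule bij_betw_imageI)
    show "inj_on (\<lambda>(v, z). vadd (s v) z) (row_span x \<times> left_kernel x)"
    proof (rule inj_onI, clarify)
      fix v z v' z' assume *: "v \<in> row_span x" "z \<in> left_kernel x" "v' \<in> row_span x" "z' \<in> left_kernel x"
        and eq: "vadd (s v) z = vadd (s v') z'"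
      have "v = v'" using Lk[OF *(1,2)] Lk[OF *(3,4)] eq by simp
      moreover have "z i = z' i" for i
      proof -
        have "s v i \<in> carrier F" "z i \<in> carrier F" "z' i \<in> carrier F"
          using * s(1)[OF *(1)] by (auto simp: left_kernel_def vecsD)
        moreover have "s v i \<oplus> z i = s v i \<oplus> z' i"
          using fun_cong[OF eq, of i] \<open>v = v'\<close> by (simp add: vadd_def)
        ultimately show ?thesis by (metis r_neg1)
      qed
      ultimately show "v = v' \<and> z = z'" by auto
    qed
    show "(\<lambda>(v, z). vadd (s v) z) ` (row_span x \<times> left_kernel x) = vecs"
    proof (intro equalityI subsetI)
      fix c assume "c \<in> (\<lambda>(v, z). vadd (s v) z) ` (row_span x \<times> left_kernel x)"
      then show "c \<in> vecs" using s(1) by (auto simp: left_kernel_def)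
    next
      fix c :: "'n \<Rightarrow> 'r" assume c: "c \<in> vecs"
      let ?v = "?L c"
      have v: "?v \<in> row_span x" using c by (simp add: row_span_def)
      let ?z = "vadd c (vscale (\<ominus> \<one>) (s ?v))"
      have "?L ?z = vadd ?v (vscale (\<ominus> \<one>) ?v)"
        using c s[OF v] by (simp add: Ladd Lscale)
      also have "\<dots> = (\<lambda>_. \<zero>)"
        using vecsD[OF vec[OF c]] by (auto simp: vadd_def vscale_def l_minus r_neg)
      finally have z: "?z \<in> left_kernel x" using c s[OF v] by (simp add: left_kernel_def)
      have "c = vadd (s ?v) ?z"
      proof
        fix i
        have "c i \<in> carrier F" "s ?v i \<in> carrier F" using c s(1)[OF v] by (auto simp: vecsD)
        then show "c i = vadd (s ?v) ?z i" unfolding vadd_def vscale_def by algebra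
      qed
      then show "c \<in> (\<lambda>(v, z). vadd (s v) z) ` (row_span x \<times> left_kernel x)"
        using v z by (intro image_eqI[of _ _ "(?v, ?z)"]) auto
    qed
  qed
  then have "card (row_span x \<times> left_kernel x) = q ^ CARD('n)"
    using card_vecs[where ?'i='n] by (simp add: bij_betw_same_card)
  then show "card (row_span x) * card (left_kernel x) = q ^ CARD('n)"
    by (simp add: card_cartesian_product)
qed

lemma rank_exists:
  fixes x :: "'n::finite \<Rightarrow> 'i::finite \<Rightarrow> 'r"
  assumes x: "\<And>l. x l \<in> vecs"
  obtains r where "r \<le> CARD('n)" "card (row_span x) = q ^ r" "card (left_kernel x) = q ^ (CARD('n) - r)"
proof -
  obtain r where r: "card (row_span x) = q ^ r" using card_subsp[OF subsp_row_span[of x, OF x]] .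
  obtain s where s: "card (left_kernel x) = q ^ s" using card_subsp[OF subsp_left_kernel[of x, OF x]] .
  have "q ^ (r + s) = q ^ CARD('n)" using card_row_span[of x, OF x] r s by (simp add: power_add)
  then have "r + s = CARD('n)" using q_ge_2 by (simp add: power_inject_exp)
  then show ?thesis using that[of r] r s by (metis add_diff_cancel_left' le_add1)
qed

text \<open>Greedy choice: the combinations of \<open>s < k\<close> chosen vectors form a subspace
  with only \<open>q ^ s\<close> elements, so \<open>W\<close> contains a further vector, and
  \<open>inj_on_ext\<close> keeps coordinates unique. Coordinates are extensional functions on
  \<open>{..<k}\<close>, the shape used by \<open>direct_power\<close>.\<close>

lemma basis_exists:
  fixes W :: "('i::finite \<Rightarrow> 'r) set"
  assumes W: "subsp W" "card W = q ^ k"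
  obtains g :: "nat \<Rightarrow> 'i \<Rightarrow> 'r" where "\<And>l. l < k \<Longrightarrow> g l \<in> W"
    "bij_betw (\<lambda>c. LC {..<k} c g) ({..<k} \<rightarrow>\<^sub>E carrier F) W"
proof -
  have step: "\<exists>g. (\<forall>l<s. g l \<in> W) \<and> inj_on (\<lambda>c. LC {..<s} c g) ({..<s} \<rightarrow>\<^sub>E carrier F)" if "s \<le> k" for s
    using that
  proof (induction s)
    case 0
    then show ?case by (auto simp: inj_on_def)
  next
    case (Suc s)
    then obtain g where g: "\<And>l. l < s \<Longrightarrow> g l \<in> W" "inj_on (\<lambda>c. LC {..<s} c g) ({..<s} \<rightarrow>\<^sub>E carrier F)"
      by auto
    have gV: "g l \<in> vecs" if "l < s" for l using g(1)[OF that] subspD(1)[OF W(1)] by blast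
    let ?T = "(\<lambda>c. LC {..<s} c g) ` ({..<s} \<rightarrow>\<^sub>E carrier F)"
    have TT: "LC {..<s} c g \<in> ?T" if "\<And>l. l < s \<Longrightarrow> c l \<in> carrier F" for c
    proof -
      have "LC {..<s} c g = LC {..<s} (restrict c {..<s}) g"
        using that gV by (intro LC_cong) auto
      then show ?thesis using that by (intro image_eqI[of _ _ "restrict c {..<s}"]) auto
    qed
    have T: "subsp ?T"
      unfolding subsp_def
    proof (intro conjI ballI)
      show "?T \<subseteq> vecs" using gV by (auto intro!: LC_vecs)
      have "LC {..<s} (\<lambda>_. \<zero>) g = (\<lambda>_. \<zero>)" using gV by (intro LC_zero) auto
      then show "(\<lambda>_. \<zero>) \<in> ?T" using TT[of "\<lambda>_. \<zero>"] by simp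
      fix u v assume "u \<in> ?T" "v \<in> ?T"
      then obtain c d where cd: "u = LC {..<s} c g" "v = LC {..<s} d g"
        "c \<in> {..<s} \<rightarrow>\<^sub>E carrier F" "d \<in> {..<s} \<rightarrow>\<^sub>E carrier F" by blast
      have "vadd u v = LC {..<s} (vadd c d) g"
        unfolding cd(1,2) using cd gV by (intro LC_add[symmetric]) auto
      also have "\<dots> \<in> ?T" using cd by (intro TT) (auto simp: vadd_def)
      finally show "vadd u v \<in> ?T" .
    next
      fix a v assume a: "a \<in> carrier F" and "v \<in> ?T"
      then obtain d where d: "v = LC {..<s} d g" "d \<in> {..<s} \<rightarrow>\<^sub>E carrier F" by blast
      have "vscale a v = LC {..<s} (vscale a d) g"
        unfolding d(1) using a d gV by (intro LC_scale[symmetric]) auto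
      also have "\<dots> \<in> ?T" using a d by (intro TT) (auto simp: vscale_def)
      finally show "vscale a v \<in> ?T" .
    qed
    have "card ?T = q ^ s" by (subst card_image[OF g(2)]) (simp add: card_PiE q_def)
    also have "\<dots> < card W" using Suc.prems q_ge_2 W(2) by (simp add: power_strict_increasing)
    finally have "\<not> W \<subseteq> ?T" using card_mono[OF finite_subsp[OF T]] by (auto simp: not_le[symmetric])
    then obtain v where v: "v \<in> W" "v \<notin> ?T" by blast
    have vV: "v \<in> vecs" using v subspD(1)[OF W(1)] by blast
    let ?g = "g(s := v)"
    have eq: "LC {..<Suc s} c ?g = vadd (LC {..<s} (restrict c {..<s}) g) (vscale (c s) v)"
      if c: "c \<in> {..<Suc s} \<rightarrow>\<^sub>E carrier F" for c
    proof -
      have cl: "c l \<in> carrier F" if "l < Suc s" for l using c that by auto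
      have "LC {..<Suc s} c ?g = vadd (vscale (c s) (?g s)) (LC {..<s} c ?g)"
        unfolding lessThan_Suc using cl gV vV by (intro LC_insert) auto
      also have "LC {..<s} c ?g = LC {..<s} (restrict c {..<s}) g"
        using cl gV by (intro LC_cong) auto
      also have "vadd (vscale (c s) (?g s)) (LC {..<s} (restrict c {..<s}) g)
          = vadd (LC {..<s} (restrict c {..<s}) g) (vscale (c s) v)"
      proof -
        have "LC {..<s} (restrict c {..<s}) g \<in> vecs" using cl gV by (intro LC_vecs) auto
        then show ?thesis using cl[of s] vV by (auto simp: vadd_def vscale_def vecsD a_comm)
      qed
      finally show ?thesis .
    qed
    have "inj_on (\<lambda>c. LC {..<Suc s} c ?g) ({..<Suc s} \<rightarrow>\<^sub>E carrier F)"
    proof (rule inj_onI)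
      fix c d assume c: "c \<in> {..<Suc s} \<rightarrow>\<^sub>E carrier F" and d: "d \<in> {..<Suc s} \<rightarrow>\<^sub>E carrier F"
        and "LC {..<Suc s} c ?g = LC {..<Suc s} d ?g"
      then have *: "vadd (LC {..<s} (restrict c {..<s}) g) (vscale (c s) v)
          = vadd (LC {..<s} (restrict d {..<s}) g) (vscale (d s) v)"
        by (simp only: eq[OF c] eq[OF d])
      have rc: "restrict c {..<s} \<in> {..<s} \<rightarrow>\<^sub>E carrier F" "restrict d {..<s} \<in> {..<s} \<rightarrow>\<^sub>E carrier F"
        "c s \<in> carrier F" "d s \<in> carrier F"
        using PiE_mem[OF c] PiE_mem[OF d] by (simp_all add: restrict_PiE_iff)
      have "(LC {..<s} (restrict c {..<s}) g, c s) = (LC {..<s} (restrict d {..<s}) g, d s)"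
        by (rule inj_onD[OF inj_on_ext[OF T vV v(2)]]) (use * rc in auto)
      then have "restrict c {..<s} = restrict d {..<s}" and cs: "c s = d s"
        using inj_onD[OF g(2) _ rc(1,2)] by auto
      then have "c l = d l" if "l < s" for l using that by (metis lessThan_iff restrict_apply')
      then have "c l = d l" if "l < Suc s" for l using that cs by (cases "l = s") auto
      then show "c = d" by (intro PiE_ext[OF c d]) auto
    qed
    moreover have "\<forall>l<Suc s. ?g l \<in> W" using g(1) v(1) by (auto simp: less_Suc_eq)
    ultimately show ?case by blast
  qed
  from step[of k] obtain g where g: "\<And>l. l < k \<Longrightarrow> g l \<in> W" "inj_on (\<lambda>c. LC {..<k} c g) ({..<k} \<rightarrow>\<^sub>E carrier F)"
    by auto
  have "(\<lambda>c. LC {..<k} c g) ` ({..<k} \<rightarrow>\<^sub>E carrier F) = W"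
  proof (rule card_subset_eq[OF finite_subsp[OF W(1)]])
    show "(\<lambda>c. LC {..<k} c g) ` ({..<k} \<rightarrow>\<^sub>E carrier F) \<subseteq> W"
      using g(1) W(1) by (auto intro!: LC_subsp)
    show "card ((\<lambda>c. LC {..<k} c g) ` ({..<k} \<rightarrow>\<^sub>E carrier F)) = card W"
      by (subst card_image[OF g(2)]) (simp add: card_PiE q_def[symmetric] W(2))
  qed
  then show ?thesis using that[of g] g by (simp add: bij_betw_def)
qed

end

section \<open>Submodules of powers of a matrix ring\<close>

context finite_field begin

text \<open>The \<open>t\<close> matrices are placed side by side into one matrix with
  \<open>n\<close> rows of length \<open>t n\<close>. Left multiplication then replaces rows by
  combinations of rows, which is why submodules are governed by a single space of rows.\<close>

definition mrow :: "('t \<Rightarrow> 'r ^ 'n ^ 'n) \<Rightarrow> 'n::finite \<Rightarrow> 't::finite \<times> 'n \<Rightarrow> 'r" where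
  "mrow y l = (\<lambda>(j, i). y j $ l $ i)"

definition of_rows :: "('n::finite \<Rightarrow> 't::finite \<times> 'n \<Rightarrow> 'r) \<Rightarrow> 't \<Rightarrow> 'r ^ 'n ^ 'n" where
  "of_rows \<rho> = (\<lambda>j. \<chi> l i. \<rho> l (j, i))"

lemma mrow_of_rows [simp]: "mrow (of_rows \<rho>) = \<rho>"
  by (simp add: mrow_def of_rows_def fun_eq_iff)

lemma of_rows_mrow [simp]: "of_rows (mrow y) = y"
  by (simp add: mrow_def of_rows_def fun_eq_iff vec_eq_iff)

lemma mrow_inject: "mrow y = mrow z \<Longrightarrow> y = z"
  by (metis of_rows_mrow)

definition matpow :: "('r ^ 'n ^ 'n, 't \<Rightarrow> 'r ^ 'n::finite ^ 'n) module" where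
  "matpow = direct_power UNIV (left_regular_module (matrix_ring F))"

lemma mem_matpow: "y \<in> carrier matpow \<longleftrightarrow> (\<forall>l. mrow y l \<in> vecs)"
  by (auto simp: matpow_def direct_power_def left_regular_module_def matrix_ring_def vecs_def mrow_def PiE_UNIV_domain)

lemma mrow_add: "mrow (y \<oplus>\<^bsub>matpow\<^esub> z) l = vadd (mrow y l) (mrow z l)"
  by (simp add: matpow_def direct_power_def left_regular_module_def matrix_ring_def mrow_def vadd_def fun_eq_iff)

lemma mrow_zero: "mrow \<zero>\<^bsub>matpow\<^esub> l = (\<lambda>_. \<zero>)"
  by (simp add: matpow_def direct_power_def left_regular_module_def matrix_ring_def mrow_def fun_eq_iff)

lemma mrow_smult: "mrow (A \<odot>\<^bsub>matpow\<^esub> y) l = LC UNIV (\<lambda>m. A $ l $ m) (mrow y)"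
  by (simp add: matpow_def direct_power_def left_regular_module_def matrix_ring_def mrow_def LC_def fun_eq_iff)

lemma mem_matrix_ring: "A \<in> carrier (matrix_ring F) \<longleftrightarrow> (\<forall>i j. A $ i $ j \<in> carrier F)"
  by (simp add: matrix_ring_def)

definition code_of :: "('t::finite \<times> 'n::finite \<Rightarrow> 'r) set \<Rightarrow> ('t \<Rightarrow> 'r ^ 'n ^ 'n) set" where
  "code_of W = {y. \<forall>l. mrow y l \<in> W}"

lemma submodule_code_of:
  fixes W :: "('t::finite \<times> 'n::finite \<Rightarrow> 'r) set"
  assumes W: "subsp W"
  shows "submodule (code_of W) (matrix_ring F) (matpow :: ('r ^ 'n ^ 'n, 't \<Rightarrow> 'r ^ 'n ^ 'n) module)"
proof (rule submodule.intro)
  let ?M = "matpow :: ('r ^ 'n ^ 'n, 't \<Rightarrow> 'r ^ 'n ^ 'n) module"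
  have sub: "code_of W \<subseteq> carrier ?M"
    using subspD(1)[OF W] by (auto simp: code_of_def mem_matpow subset_iff)
  \<comment> \<open>The locale \<open>subgroup\<close> speaks of inverses through a definite
    description, which is evaluated here to the row-wise negative.\<close>
  have neg: "m_inv (add_monoid ?M) y = of_rows (\<lambda>l. vscale (\<ominus> \<one>) (mrow y l))" if y: "y \<in> carrier ?M" for y
  proof -
    let ?y = "of_rows (\<lambda>l. vscale (\<ominus> \<one>) (mrow y l))"
    have yv: "mrow y l i \<in> carrier F" for l i using y by (simp add: mem_matpow vecsD)
    have "mrow (y \<oplus>\<^bsub>?M\<^esub> ?y) = mrow \<zero>\<^bsub>?M\<^esub>"
      using yv by (auto simp: mrow_add mrow_zero vadd_def vscale_def fun_eq_iff l_minus r_neg)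
    then have 1: "y \<oplus>\<^bsub>?M\<^esub> ?y = \<zero>\<^bsub>?M\<^esub>" by (rule mrow_inject)
    have "mrow (?y \<oplus>\<^bsub>?M\<^esub> y) = mrow \<zero>\<^bsub>?M\<^esub>"
      using yv by (auto simp: mrow_add mrow_zero vadd_def vscale_def fun_eq_iff l_minus l_neg)
    then have 2: "?y \<oplus>\<^bsub>?M\<^esub> y = \<zero>\<^bsub>?M\<^esub>" by (rule mrow_inject)
    have 3: "?y \<in> carrier ?M" using y by (simp add: mem_matpow)
    have uniq: "z = ?y" if z: "z \<in> carrier ?M" "y \<oplus>\<^bsub>?M\<^esub> z = \<zero>\<^bsub>?M\<^esub>" for z
    proof -
      have "mrow z l i = mrow ?y l i" for l i
      proof -
        have zv: "mrow z l i \<in> carrier F" using z(1) by (simp add: mem_matpow vecsD)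
        have "mrow y l i \<oplus> mrow z l i = \<zero>"
          using fun_cong[OF mrow_add[of y z l], of i] z(2) by (simp add: mrow_zero vadd_def)
        then have "mrow z l i = \<ominus> mrow y l i" using yv[of l i] zv by (metis minus_equality a_comm)
        then show ?thesis using yv[of l i] by (simp add: vscale_def l_minus)
      qed
      then have "mrow z = mrow ?y" by (intro ext)
      then show ?thesis by (rule mrow_inject)
    qed
    show ?thesis
      unfolding m_inv_def by (rule the_equality, simp add: 1 2 3, rule uniq, simp_all)
  qed
  show "subgroup (code_of W) (add_monoid ?M)"
  proof (rule subgroup.intro)
    show "code_of W \<subseteq> carrier (add_monoid ?M)" using sub by simp
    show "x \<otimes>\<^bsub>add_monoid ?M\<^esub> y \<in> code_of W" if "x \<in> code_of W" "y \<in> code_of W" for x y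
      using that subspD(3)[OF W] by (simp add: code_of_def mrow_add)
    show "\<one>\<^bsub>add_monoid ?M\<^esub> \<in> code_of W"
      using subspD(2)[OF W] by (simp add: code_of_def mrow_zero)
    show "m_inv (add_monoid ?M) x \<in> code_of W" if "x \<in> code_of W" for x
    proof -
      have "x \<in> carrier ?M" using that sub by blast
      then show ?thesis using that subsp_uminus[OF W] by (simp add: neg code_of_def)
    qed
  qed
  show "submodule_axioms (code_of W) (matrix_ring F) ?M"
    by unfold_locales
       (auto simp: code_of_def mrow_smult mem_matrix_ring intro!: LC_subsp[OF _ W])
qed

lemma card_code_of:
  fixes W :: "('t::finite \<times> 'n::finite \<Rightarrow> 'r) set"
  assumes "finite W"
  shows "card (code_of W) = card W ^ CARD('n)"
proof -
  have "bij_betw of_rows (PiE (UNIV :: 'n set) (\<lambda>_. W)) (code_of W)"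
    by (rule bij_betw_byWitness[where f' = mrow]) (auto simp: code_of_def PiE_UNIV_domain)
  then have "card (code_of W) = card (PiE (UNIV :: 'n set) (\<lambda>_. W))"
    by (simp add: bij_betw_same_card)
  then show ?thesis by (simp add: card_PiE)
qed

text \<open>\<open>W\<close> is recovered from the code elements all of whose rows are
  equal.\<close>

lemma code_of_inj: "code_of W = code_of W' \<Longrightarrow> W = W'"
proof -
  have *: "W = {v. of_rows (\<lambda>_. v) \<in> code_of W}" for W :: "('t::finite \<times> 'n::finite \<Rightarrow> 'r) set"
    by (simp add: code_of_def)
  show "code_of W = code_of W' \<Longrightarrow> W = W'" using *[of W] *[of W'] by simp
qed

section \<open>Codes and powers of the column module\<close>

definition colpow :: "nat \<Rightarrow> ('r ^ 'n ^ 'n, nat \<Rightarrow> 'r ^ 'n::finite) module" where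
  "colpow k = direct_power {..<k} (column_module F)"

lemma mem_colpow: "Y \<in> carrier (colpow k :: ('r ^ 'n ^ 'n, nat \<Rightarrow> 'r ^ 'n::finite) module) \<longleftrightarrow>
    Y \<in> extensional {..<k} \<and> (\<forall>m<k. \<forall>i. Y m $ i \<in> carrier F)"
  by (auto simp: colpow_def direct_power_def column_module_def PiE_def)

lemma colpow_add: "Y \<oplus>\<^bsub>colpow k\<^esub> Y' = (\<lambda>m\<in>{..<k}. \<chi> i. Y m $ i \<oplus> Y' m $ i)"
  by (simp add: colpow_def direct_power_def column_module_def)

lemma colpow_smult: "A \<odot>\<^bsub>colpow k\<^esub> Y = (\<lambda>m\<in>{..<k}. \<chi> i. \<Oplus>l\<in>UNIV. A $ i $ l \<otimes> Y m $ l)"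
  by (simp add: colpow_def direct_power_def column_module_def)

lemma card_colpow: "card (carrier (colpow k :: ('r ^ 'n ^ 'n, nat \<Rightarrow> 'r ^ 'n::finite) module)) = (q ^ CARD('n)) ^ k"
proof -
  have "bij_betw vec_lambda (vecs :: ('n \<Rightarrow> 'r) set) {v. \<forall>i. v $ i \<in> carrier F}"
    by (rule bij_betw_byWitness[where f' = vec_nth]) (auto simp: vecs_def)
  then have "card {v :: 'r ^ 'n. \<forall>i. v $ i \<in> carrier F} = q ^ CARD('n)"
    using card_vecs[where ?'i='n] by (simp add: bij_betw_same_card[symmetric])
  then show ?thesis by (simp add: colpow_def direct_power_def column_module_def card_PiE)
qed

text \<open>A \<open>k\<close>-tuple of columns is a coefficient matrix with \<open>n\<close> rows
  and \<open>k\<close> columns; multiplying it by a basis of \<open>W\<close> gives the rows of a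
  code element. This map \<open>G\<close> commutes with left multiplication by associativity, and
  its inverse \<open>H\<close> is the isomorphism in the required direction.\<close>

lemma left_module_isomorphic_code_of:
  fixes W :: "('t::finite \<times> 'n::finite \<Rightarrow> 'r) set"
  assumes W: "subsp W" "card W = q ^ k"
  shows "left_module_isomorphic (matrix_ring F)
     ((matpow :: ('r ^ 'n ^ 'n, 't \<Rightarrow> 'r ^ 'n ^ 'n) module)\<lparr>carrier := code_of W\<rparr>) (colpow k)"
proof -
  let ?M = "matpow :: ('r ^ 'n ^ 'n, 't \<Rightarrow> 'r ^ 'n ^ 'n) module"
  let ?N = "colpow k :: ('r ^ 'n ^ 'n, nat \<Rightarrow> 'r ^ 'n) module"
  obtain g where g: "\<And>l. l < k \<Longrightarrow> g l \<in> W" "bij_betw (\<lambda>c. LC {..<k} c g) ({..<k} \<rightarrow>\<^sub>E carrier F) W"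
    by (rule basis_exists[OF W]) blast
  have gV: "g l \<in> vecs" if "l < k" for l using g(1)[OF that] subspD(1)[OF W(1)] by blast
  define G where "G Y = of_rows (\<lambda>l. LC {..<k} (\<lambda>m. Y m $ l) g)" for Y :: "nat \<Rightarrow> 'r ^ 'n"
  have rowG: "mrow (G Y) l = LC {..<k} (\<lambda>m. Y m $ l) g" for Y l by (simp add: G_def)
  have rowG': "mrow (G Y) l = LC {..<k} (\<lambda>m\<in>{..<k}. Y m $ l) g" if "Y \<in> carrier ?N" for Y l
    unfolding rowG using that gV by (intro LC_cong) (auto simp: mem_colpow)
  have resY: "(\<lambda>m\<in>{..<k}. Y m $ l) \<in> {..<k} \<rightarrow>\<^sub>E carrier F" if "Y \<in> carrier ?N" for Y l
    using that by (simp add: mem_colpow restrict_PiE_iff)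
  have bij: "bij_betw G (carrier ?N) (code_of W)"
  proof (rule bij_betw_imageI)
    show "inj_on G (carrier ?N)"
    proof (rule inj_onI)
      fix Y Y' assume Y: "Y \<in> carrier ?N" "Y' \<in> carrier ?N" and eq: "G Y = G Y'"
      have "(\<lambda>m\<in>{..<k}. Y m $ l) = (\<lambda>m\<in>{..<k}. Y' m $ l)" for l
        by (rule inj_onD[OF bij_betw_imp_inj_on[OF g(2)] _ resY[OF Y(1)] resY[OF Y(2)]])
           (simp add: rowG'[OF Y(1), symmetric] rowG'[OF Y(2), symmetric] eq)
      then have "Y m $ l = Y' m $ l" if "m < k" for m l
        using that by (metis lessThan_iff restrict_apply')
      then show "Y = Y'"
        using Y by (intro extensionalityI[of Y "{..<k}"]) (auto simp: mem_colpow vec_eq_iff)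
    qed
    show "G ` carrier ?N = code_of W"
    proof (intro equalityI subsetI)
      fix y assume "y \<in> G ` carrier ?N"
      then show "y \<in> code_of W"
        using g(1) W(1) by (auto simp: code_of_def rowG mem_colpow intro!: LC_subsp)
    next
      fix y assume "y \<in> code_of W"
      then have "mrow y l \<in> (\<lambda>c. LC {..<k} c g) ` ({..<k} \<rightarrow>\<^sub>E carrier F)" for l
        using bij_betw_imp_surj_on[OF g(2)] by (simp add: code_of_def)
      then have "\<exists>c. c \<in> {..<k} \<rightarrow>\<^sub>E carrier F \<and> LC {..<k} c g = mrow y l" for l
        by (metis (no_types, lifting) imageE)
      then obtain c where c: "\<And>l. c l \<in> {..<k} \<rightarrow>\<^sub>E carrier F" "\<And>l. LC {..<k} (c l) g = mrow y l"
        by metis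
      let ?Y = "\<lambda>m\<in>{..<k}. \<chi> l. c l m"
      have Y: "?Y \<in> carrier ?N" using PiE_mem[OF c(1)] by (auto simp: mem_colpow)
      have "mrow (G ?Y) l = mrow y l" for l
        unfolding rowG c(2)[symmetric] using PiE_mem[OF c(1)] gV by (intro LC_cong) auto
      then have "G ?Y = y" by (intro mrow_inject) auto
      then show "y \<in> G ` carrier ?N" using Y by blast
    qed
  qed
  have addN: "Y \<oplus>\<^bsub>?N\<^esub> Y' \<in> carrier ?N" if "Y \<in> carrier ?N" "Y' \<in> carrier ?N" for Y Y'
    using that by (auto simp: mem_colpow colpow_add)
  have addG: "G (Y \<oplus>\<^bsub>?N\<^esub> Y') = G Y \<oplus>\<^bsub>?M\<^esub> G Y'" if Y: "Y \<in> carrier ?N" "Y' \<in> carrier ?N" for Y Y'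
  proof (rule mrow_inject, rule ext)
    fix l
    have "mrow (G (Y \<oplus>\<^bsub>?N\<^esub> Y')) l = LC {..<k} (vadd (\<lambda>m. Y m $ l) (\<lambda>m. Y' m $ l)) g"
      unfolding rowG using Y gV
      by (intro LC_cong) (auto simp: mem_colpow colpow_add vadd_def)
    also have "\<dots> = vadd (LC {..<k} (\<lambda>m. Y m $ l) g) (LC {..<k} (\<lambda>m. Y' m $ l) g)"
      using Y gV by (intro LC_add) (auto simp: mem_colpow)
    finally show "mrow (G (Y \<oplus>\<^bsub>?N\<^esub> Y')) l = mrow (G Y \<oplus>\<^bsub>?M\<^esub> G Y') l"
      by (simp add: mrow_add rowG)
  qed
  have smN: "A \<odot>\<^bsub>?N\<^esub> Y \<in> carrier ?N" if "A \<in> carrier (matrix_ring F)" "Y \<in> carrier ?N" for A Y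
    using that by (auto simp: mem_colpow mem_matrix_ring colpow_smult intro!: finsum_closed)
  have smG: "G (A \<odot>\<^bsub>?N\<^esub> Y) = A \<odot>\<^bsub>?M\<^esub> G Y" if A: "A \<in> carrier (matrix_ring F)" and Y: "Y \<in> carrier ?N" for A Y
  proof (rule mrow_inject, rule ext)
    fix l
    have "mrow (G (A \<odot>\<^bsub>?N\<^esub> Y)) l = LC {..<k} (\<lambda>m. \<Oplus>i\<in>UNIV. A $ l $ i \<otimes> Y m $ i) g"
      unfolding rowG using Y A gV
      by (intro LC_cong) (auto simp: mem_colpow mem_matrix_ring colpow_smult intro!: finsum_closed)
    also have "\<dots> = LC UNIV (\<lambda>i. A $ l $ i) (\<lambda>i. LC {..<k} (\<lambda>m. Y m $ i) g)"
      using Y A gV by (intro LC_LC) (auto simp: mem_colpow mem_matrix_ring)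
    finally show "mrow (G (A \<odot>\<^bsub>?N\<^esub> Y)) l = mrow (A \<odot>\<^bsub>?M\<^esub> G Y) l"
      by (simp add: mrow_smult rowG[abs_def])
  qed
  define H where "H = inv_into (carrier ?N) G"
  have H: "H y \<in> carrier ?N" "G (H y) = y" if "y \<in> code_of W" for y
    using that bij unfolding H_def by (auto simp: bij_betw_def inv_into_into f_inv_into_f)
  have HG: "H (G Y) = Y" if "Y \<in> carrier ?N" for Y
    using that bij unfolding H_def by (simp add: bij_betw_def)
  show ?thesis
    unfolding left_module_isomorphic_def
  proof (intro exI[of _ H] conjI ballI)
    show "bij_betw H (carrier (?M\<lparr>carrier := code_of W\<rparr>)) (carrier ?N)"
      using bij_betw_inv_into[OF bij] by (simp add: H_def)
    show "H (x \<oplus>\<^bsub>?M\<lparr>carrier := code_of W\<rparr>\<^esub> y) = H x \<oplus>\<^bsub>?N\<^esub> H y"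
      if "x \<in> carrier (?M\<lparr>carrier := code_of W\<rparr>)" "y \<in> carrier (?M\<lparr>carrier := code_of W\<rparr>)" for x y
    proof -
      have "x \<in> code_of W" "y \<in> code_of W" using that by auto
      then have "G (H x \<oplus>\<^bsub>?N\<^esub> H y) = x \<oplus>\<^bsub>?M\<^esub> y" using H addG by simp
      then have "H (x \<oplus>\<^bsub>?M\<^esub> y) = H (G (H x \<oplus>\<^bsub>?N\<^esub> H y))" by simp
      also have "\<dots> = H x \<oplus>\<^bsub>?N\<^esub> H y" using \<open>x \<in> code_of W\<close> \<open>y \<in> code_of W\<close> H addN by (intro HG) auto
      finally show ?thesis by simp
    qed
    show "H (A \<odot>\<^bsub>?M\<lparr>carrier := code_of W\<rparr>\<^esub> x) = A \<odot>\<^bsub>?N\<^esub> H x"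
      if "A \<in> carrier (matrix_ring F)" "x \<in> carrier (?M\<lparr>carrier := code_of W\<rparr>)" for A x
    proof -
      have x: "x \<in> code_of W" using that by auto
      then have "G (A \<odot>\<^bsub>?N\<^esub> H x) = A \<odot>\<^bsub>?M\<^esub> x" using H smG that(1) by simp
      then have "H (A \<odot>\<^bsub>?M\<^esub> x) = H (G (A \<odot>\<^bsub>?N\<^esub> H x))" by simp
      also have "\<dots> = A \<odot>\<^bsub>?N\<^esub> H x" using x H smN that(1) by (intro HG) auto
      finally show ?thesis by simp
    qed
  qed
qed

text \<open>Morita correspondence by elementary matrices: \<open>E l m\<close> moves row
  \<open>m\<close> to row \<open>l\<close> and clears the other rows. So all rows range over the
  same space \<open>W\<close>, and any choice of \<open>n\<close> rows from \<open>W\<close> can be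
  assembled inside \<open>C\<close>.\<close>

lemma submodule_eq_code_of:
  fixes C :: "('t::finite \<Rightarrow> 'r ^ 'n::finite ^ 'n) set"
  assumes C: "submodule C (matrix_ring F) matpow"
  obtains W where "subsp W" "C = code_of W"
proof -
  let ?M = "matpow :: ('r ^ 'n ^ 'n, 't \<Rightarrow> 'r ^ 'n ^ 'n) module"
  interpret submodule C "matrix_ring F" ?M by (rule C)
  have Cadd: "x \<oplus>\<^bsub>?M\<^esub> y \<in> C" if "x \<in> C" "y \<in> C" for x y using m_closed[OF that] by simp
  have Czero: "\<zero>\<^bsub>?M\<^esub> \<in> C" using one_closed by simp
  have Csm: "A \<odot>\<^bsub>?M\<^esub> x \<in> C" if "A \<in> carrier (matrix_ring F)" "x \<in> C" for A x
    using that by (rule smult_closed)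
  have Cv: "mrow y l \<in> vecs" if "y \<in> C" for y l
  proof -
    have "y \<in> carrier ?M" using that subset by auto
    then show ?thesis by (simp add: mem_matpow)
  qed
  \<comment> \<open>Any row index would do; \<open>undefined\<close> merely names one.\<close>
  define l0 :: 'n where "l0 = undefined"
  define E :: "'n \<Rightarrow> 'n \<Rightarrow> 'r ^ 'n ^ 'n" where
    "E l m = (\<chi> a b. if a = l then (if b = m then \<one> else \<zero>) else \<zero>)" for l m
  have E: "E l m \<in> carrier (matrix_ring F)" for l m by (simp add: E_def mem_matrix_ring)
  have rowE: "mrow (E l m \<odot>\<^bsub>?M\<^esub> y) a = (if a = l then mrow y m else (\<lambda>_. \<zero>))"
    if "y \<in> C" for l m y a
  proof -
    have "(\<lambda>b. E l m $ a $ b) = (if a = l then (\<lambda>b. if b = m then \<one> else \<zero>) else (\<lambda>_. \<zero>))"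
      by (auto simp: E_def fun_eq_iff)
    then show ?thesis using Cv[OF that] unfolding mrow_smult by (simp add: LC_unit LC_zero)
  qed
  define W where "W = (\<lambda>y. mrow y l0) ` C"
  have "subsp W"
    unfolding subsp_def
  proof (intro conjI ballI)
    show "W \<subseteq> vecs" using Cv by (auto simp: W_def)
    show "(\<lambda>_. \<zero>) \<in> W" unfolding W_def using Czero by (intro image_eqI[of _ _ "\<zero>\<^bsub>?M\<^esub>"]) (simp_all add: mrow_zero)
    show "vadd u v \<in> W" if uv: "u \<in> W" "v \<in> W" for u v
    proof -
      obtain x y where "u = mrow x l0" "v = mrow y l0" "x \<in> C" "y \<in> C"
        using uv unfolding W_def by blast
      then show ?thesis unfolding W_def using Cadd
        by (intro image_eqI[of _ _ "x \<oplus>\<^bsub>?M\<^esub> y"]) (simp_all add: mrow_add)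
    qed
    show "vscale a v \<in> W" if a: "a \<in> carrier F" and v: "v \<in> W" for a v
    proof -
      obtain y where y: "v = mrow y l0" "y \<in> C" using v unfolding W_def by blast
      define A :: "'r ^ 'n ^ 'n" where "A = (\<chi> l m. if l = m then a else \<zero>)"
      have A: "A \<in> carrier (matrix_ring F)" using a by (simp add: A_def mem_matrix_ring)
      have row: "(\<lambda>m. A $ l0 $ m) = vscale a (\<lambda>m. if m = l0 then \<one> else \<zero>)"
        using a by (auto simp: A_def vscale_def)
      have "mrow (A \<odot>\<^bsub>?M\<^esub> y) l0 = vscale a (LC UNIV (\<lambda>m. if m = l0 then \<one> else \<zero>) (mrow y))"
        unfolding mrow_smult row using a Cv[OF y(2)] by (intro LC_scale) auto
      also have "\<dots> = vscale a v" using Cv[OF y(2)] y(1) by (simp add: LC_unit)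
      finally show ?thesis unfolding W_def using Csm[OF A y(2)]
        by (intro image_eqI[of _ _ "A \<odot>\<^bsub>?M\<^esub> y"]) simp_all
    qed
  qed
  moreover have "C = code_of W"
  proof (intro equalityI subsetI)
    fix y assume y: "y \<in> C"
    have "mrow y l \<in> W" for l
    proof -
      have "mrow y l = mrow (E l0 l \<odot>\<^bsub>?M\<^esub> y) l0" using rowE[OF y] by simp
      also have "\<dots> \<in> W" unfolding W_def using Csm[OF E y] by (rule imageI)
      finally show ?thesis .
    qed
    then show "y \<in> code_of W" by (simp add: code_of_def)
  next
    fix y assume "y \<in> code_of W"
    then have "mrow y l \<in> (\<lambda>y. mrow y l0) ` C" for l
      unfolding W_def[symmetric] by (simp add: code_of_def)
    then have "\<exists>z. z \<in> C \<and> mrow z l0 = mrow y l" for l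
      by (metis (no_types, lifting) imageE)
    then obtain z where z: "\<And>l. z l \<in> C" "\<And>l. mrow (z l) l0 = mrow y l" by metis
    have yv: "mrow y l \<in> vecs" for l using Cv[OF z(1)] z(2) by metis
    \<comment> \<open>Rows are filled in one at a time: adding \<open>E b l0\<close> times an
      element with the right row \<open>l0\<close> sets the row \<open>b\<close>, zero so far, and
      leaves the others unchanged.\<close>
    have "\<exists>w\<in>C. \<forall>l. mrow w l = (if l \<in> B then mrow y l else (\<lambda>_. \<zero>))" if "finite B" for B
      using that
    proof (induction B rule: finite_induct)
      case empty
      show ?case using Czero by (intro bexI[of _ "\<zero>\<^bsub>?M\<^esub>"]) (simp_all add: mrow_zero)
    next
      case (insert b B)
      then obtain w where w: "w \<in> C" "\<And>l. mrow w l = (if l \<in> B then mrow y l else (\<lambda>_. \<zero>))" by blast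
      let ?w = "w \<oplus>\<^bsub>?M\<^esub> (E b l0 \<odot>\<^bsub>?M\<^esub> z b)"
      have "vadd (mrow y l) (\<lambda>_. \<zero>) = mrow y l" "vadd (\<lambda>_. \<zero>) (mrow y l) = mrow y l"
        "vadd (\<lambda>_. \<zero>) (\<lambda>_. \<zero>) = (\<lambda>_ :: 't \<times> 'n. \<zero>)" for l
        using vecsD[OF yv[of l]] by (auto simp: vadd_def)
      then have "mrow ?w l = (if l \<in> insert b B then mrow y l else (\<lambda>_. \<zero>))" for l
        using insert.hyps by (simp add: mrow_add rowE[OF z(1)] w(2) z(2))
      then show ?case using Cadd[OF w(1) Csm[OF E z(1)]] by blast
    qed
    from this[of UNIV] obtain w where "w \<in> C" "\<And>l. mrow w l = mrow y l" by auto
    then show "y \<in> C" using mrow_inject[of w y] by auto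
  qed
  ultimately show ?thesis by (rule that)
qed

text \<open>Of the isomorphism, the forward direction uses only equality of cardinalities:
  \<open>card W ^ n = (q ^ k) ^ n\<close> already forces \<open>card W = q ^ k\<close>.\<close>

lemma codes_eq: "(codes k F :: ('t::finite \<Rightarrow> 'r ^ 'n::finite ^ 'n) set set) = code_of ` grass k"
proof -
  let ?M = "matpow :: ('r ^ 'n ^ 'n, 't \<Rightarrow> 'r ^ 'n ^ 'n) module"
  have codes: "C \<in> codes k F \<longleftrightarrow> submodule C (matrix_ring F) ?M \<and>
      left_module_isomorphic (matrix_ring F) (?M\<lparr>carrier := C\<rparr>) (colpow k)" for C
    by (simp add: codes_def Let_def matpow_def colpow_def)
  show ?thesis
  proof (intro equalityI subsetI)
    fix C :: "('t \<Rightarrow> 'r ^ 'n ^ 'n) set" assume "C \<in> codes k F"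
    then have C: "submodule C (matrix_ring F) ?M" "left_module_isomorphic (matrix_ring F) (?M\<lparr>carrier := C\<rparr>) (colpow k)"
      by (simp_all add: codes)
    obtain W where W: "subsp W" "C = code_of W" by (rule submodule_eq_code_of[OF C(1)])
    have "card C = card (carrier (colpow k :: ('r ^ 'n ^ 'n, nat \<Rightarrow> 'r ^ 'n) module))"
      using C(2) by (auto simp: left_module_isomorphic_def dest: bij_betw_same_card)
    then have "card W ^ CARD('n) = (q ^ k) ^ CARD('n)"
      using W card_code_of[OF finite_subsp[OF W(1)]] by (simp add: card_colpow power_mult [symmetric] mult.commute)
    then have "card W = q ^ k" by (rule power_eq_imp_eq_base) auto
    then show "C \<in> code_of ` grass k" using W by (simp add: grass_def)
  next
    fix C :: "('t \<Rightarrow> 'r ^ 'n ^ 'n) set" assume "C \<in> code_of ` grass k"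
    then obtain W where W: "subsp W" "card W = q ^ k" "C = code_of W" by (auto simp: grass_def)
    then show "C \<in> codes k F"
      by (simp add: codes submodule_code_of left_module_isomorphic_code_of)
  qed
qed

text \<open>The code of \<open>W\<close> contains \<open>y\<close> iff \<open>W\<close> contains the
  row span of \<open>y\<close>, so this is a count of subspaces containing a given one.\<close>

lemma codes_containing:
  fixes y :: "'t::finite \<Rightarrow> 'r ^ 'n::finite ^ 'n"
  assumes y: "\<And>l. mrow y l \<in> vecs" and r: "card (row_span (mrow y)) = q ^ r" "r \<le> k" "k \<le> CARD('n) * CARD('t)"
  shows "finite (codes k F :: ('t \<Rightarrow> 'r ^ 'n ^ 'n) set set)"
    "card (codes k F :: ('t \<Rightarrow> 'r ^ 'n ^ 'n) set set) > 0"
    "real (card {C \<in> codes k F. y \<in> C}) / real (card (codes k F :: ('t \<Rightarrow> 'r ^ 'n ^ 'n) set set))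
       = (\<Prod>i<r. (real q ^ k - real q ^ i) / (real q ^ (CARD('n) * CARD('t)) - real q ^ i))"
proof -
  have D: "CARD('t \<times> 'n) = CARD('n) * CARD('t)" by (simp add: mult.commute)
  have inj: "inj_on code_of X" for X :: "('t \<times> 'n \<Rightarrow> 'r) set set"
    by (rule inj_onI) (rule code_of_inj)
  have "{C \<in> codes k F. y \<in> C} = code_of ` {W \<in> grass k. row_span (mrow y) \<subseteq> W}"
  proof -
    have "y \<in> code_of W \<longleftrightarrow> row_span (mrow y) \<subseteq> W" if "W \<in> grass k" for W
      using that row_span_subset_iff[of "mrow y", OF y] by (simp add: grass_def code_of_def)
    then show ?thesis by (auto simp: codes_eq)
  qed
  then have c: "card {C \<in> codes k F. y \<in> C} = card {W \<in> grass k. row_span (mrow y) \<subseteq> W}"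
    by (simp add: card_image inj)
  have c0: "card (codes k F :: ('t \<Rightarrow> 'r ^ 'n ^ 'n) set set) = card (grass k :: ('t \<times> 'n \<Rightarrow> 'r) set set)"
    by (simp add: codes_eq card_image inj)
  show "finite (codes k F :: ('t \<Rightarrow> 'r ^ 'n ^ 'n) set set)"
    by (simp add: codes_eq finite_grass)
  show "card (codes k F :: ('t \<Rightarrow> 'r ^ 'n ^ 'n) set set) > 0"
    unfolding c0 by (rule card_grass_ratio(1)[OF subsp_row_span[of "mrow y", OF y] r(1,2)]) (simp only: D r(3))
  show "real (card {C \<in> codes k F. y \<in> C}) / real (card (codes k F :: ('t \<Rightarrow> 'r ^ 'n ^ 'n) set set))
       = (\<Prod>i<r. (real q ^ k - real q ^ i) / (real q ^ (CARD('n) * CARD('t)) - real q ^ i))"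
    unfolding c c0
    using card_grass_ratio(2)[OF subsp_row_span[of "mrow y", OF y] r(1,2)] r(3) by (simp only: D)
qed

end

section \<open>Rings of integers and orders\<close>

text \<open>With leading coefficient \<open>a\<close> and degree \<open>n\<close>, the number
  \<open>a ^ (n - 1) * poly p x\<close> is the value at \<open>a x\<close> of the monic integral
  polynomial with coefficients \<open>c i\<close>.\<close>

lemma algebraic_imp_multiple_algebraic_int:
  fixes x :: "'k::field_char_0"
  assumes "algebraic x"
  shows "\<exists>D::nat. D > 0 \<and> algebraic_int (of_nat D * x)"
proof -
  from assms obtain p where p: "\<And>i. coeff p i \<in> \<int>" "p \<noteq> 0" "poly p x = 0" by (rule algebraicE) blast
  define n where "n = degree p"
  have n0: "n > 0" using p unfolding n_def by (intro Nat.gr0I) (auto elim!: degree_eq_zeroE)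
  obtain a where a: "lead_coeff p = of_int a" using p(1) by (auto elim: Ints_cases)
  have a0: "a \<noteq> 0" using p(2) a by auto
  define c where "c i = (if i = n then 1 else coeff p i * of_int a ^ (n - 1 - i))" for i
  define q where "q = (\<Sum>i\<le>n. monom (c i) i)"
  have cq: "coeff q i = (if i \<le> n then c i else 0)" for i
    by (simp add: q_def coeff_sum)
  have "degree q = n"
    by (rule antisym) (auto intro!: degree_le le_degree simp: cq c_def)
  then have lead: "lead_coeff q = 1" by (simp add: cq c_def)
  have ints: "coeff q i \<in> \<int>" for i
    using p(1) by (auto simp: cq c_def)
  have "poly q (of_int a * x) = (\<Sum>i\<le>n. c i * (of_int a * x) ^ i)"
    by (simp add: q_def poly_sum poly_monom)
  also have "\<dots> = (\<Sum>i\<le>n. of_int a ^ (n - 1) * (coeff p i * x ^ i))"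
  proof (rule sum.cong)
    fix i assume "i \<in> {..n}"
    show "c i * (of_int a * x) ^ i = of_int a ^ (n - 1) * (coeff p i * x ^ i)"
    proof (cases "i = n")
      case True
      have "(of_int a :: 'k) ^ n = of_int a ^ (n - 1) * of_int a" using n0 by (cases n) auto
      then show ?thesis using True a by (simp add: c_def power_mult_distrib n_def)
    next
      case False
      then have "(of_int a :: 'k) ^ (n - 1) = of_int a ^ (n - 1 - i) * of_int a ^ i"
        using \<open>i \<in> {..n}\<close> by (simp add: power_add [symmetric])
      then show ?thesis using False by (simp add: c_def power_mult_distrib)
    qed
  qed simp
  also have "\<dots> = of_int a ^ (n - 1) * poly p x"
    by (simp add: poly_altdef n_def sum_distrib_left)
  finally have "poly q (of_int a * x) = 0" using p by simp
  then have ai: "algebraic_int (of_int a * x)" using lead ints by (intro algebraic_int.intros) auto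
  show ?thesis
  proof (cases "a > 0")
    case True
    then show ?thesis using ai by (intro exI[of _ "nat a"]) auto
  next
    case False
    have "algebraic_int (- (of_int a * x))" using ai by (rule algebraic_int_minus)
    then show ?thesis using False a0 by (intro exI[of _ "nat (- a)"]) auto
  qed
qed

lemma rat_smult_field: "rat_smult r x = of_rat r * (x :: 'k::field_char_0)"
proof -
  have "r = of_int (fst (quotient_of r)) / of_int (snd (quotient_of r))"
    by (metis prod.collapse quotient_of_div)
  then have "of_rat r = (of_int (fst (quotient_of r)) / of_int (snd (quotient_of r)) :: 'k)"
    by (metis of_rat_divide of_rat_of_int_eq)
  then show ?thesis by (simp add: rat_smult_def)
qed

lemma number_field_algebraic:
  assumes "number_field TYPE('k::field_char_0)"
  shows "algebraic (x :: 'k)"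
proof -
  obtain B where "finite_dimensional_vector_space (rat_smult :: rat \<Rightarrow> 'k \<Rightarrow> 'k) B"
    using assms by (auto simp: number_field_def)
  then interpret V: finite_dimensional_vector_space "rat_smult :: rat \<Rightarrow> 'k \<Rightarrow> 'k" B .
  let ?n = "card B"
  \<comment> \<open>Linear dependence is a property of sets, so a coincidence of two powers of
    \<open>x\<close> is treated separately; it gives a difference of two monomials.\<close>
  show ?thesis
  proof (cases "inj_on (\<lambda>i. x ^ i) {..?n}")
    case False
    then obtain i j where ij: "i < j" "x ^ i = x ^ j" by (auto simp: inj_on_def) (metis linorder_neqE_nat)
    let ?p = "monom 1 j - monom 1 i :: 'k poly"
    have "coeff ?p j = 1" using ij by simp
    then have "?p \<noteq> 0" by (metis coeff_0 zero_neq_one)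
    moreover have "poly ?p x = 0" using ij by (simp add: poly_monom)
    moreover have "coeff ?p l \<in> \<int>" for l by simp
    ultimately show ?thesis by (intro algebraicI[of ?p])
  next
    case True
    let ?S = "(\<lambda>i. x ^ i) ` {..?n}"
    have "card ?S = Suc ?n" using True by (simp add: card_image)
    then have "V.dependent ?S"
      using V.independent_card_le_dim[of ?S UNIV] by (auto simp: V.dim_UNIV)
    then obtain u where u: "\<exists>v\<in>?S. u v \<noteq> 0" "(\<Sum>v\<in>?S. rat_smult (u v) v) = 0"
      using V.dependent_finite[of ?S] by auto
    let ?p = "\<Sum>i\<le>?n. monom (of_rat (u (x ^ i))) i :: 'k poly"
    have cp: "coeff ?p i = (if i \<le> ?n then of_rat (u (x ^ i)) else 0)" for i
      by (simp add: coeff_sum)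
    from u(1) obtain i where "i \<le> ?n" "u (x ^ i) \<noteq> 0" by auto
    then have "coeff ?p i \<noteq> 0" by (simp add: cp)
    then have "?p \<noteq> 0" by (metis coeff_0)
    moreover have "poly ?p x = (\<Sum>i\<le>?n. rat_smult (u (x ^ i)) (x ^ i))"
      by (simp add: poly_sum poly_monom rat_smult_field)
    moreover have "\<dots> = 0" using u(2) True by (simp add: sum.reindex)
    ultimately show ?thesis by (intro algebraicI'[of ?p]) (auto simp: cp)
  qed
qed

text \<open>
  Pigeonhole: two multiples of \<open>y\<close> are close modulo the integer points, and then their difference
  vanishes modulo the integer points.
\<close>

lemma bounded_denominators:
  fixes \<kappa> :: "'v::ab_group_add \<Rightarrow> 'e \<Rightarrow> rat" and S :: "'v set"
  assumes "finite E" and kdiff: "\<And>x y e. e \<in> E \<Longrightarrow> \<kappa> (x - y) e = \<kappa> x e - \<kappa> y e"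
    and S0: "0 \<in> S" and Sdiff: "\<And>x y. x \<in> S \<Longrightarrow> y \<in> S \<Longrightarrow> x - y \<in> S"
    and lat: "\<And>a :: 'e \<Rightarrow> int. \<exists>w\<in>S. \<forall>e\<in>E. \<kappa> w e = of_int (a e)"
    and c: "c > 0" "\<And>y. y \<in> S \<Longrightarrow> (\<And>e. e \<in> E \<Longrightarrow> \<bar>\<kappa> y e\<bar> < c) \<Longrightarrow> (\<And>e. e \<in> E \<Longrightarrow> \<kappa> y e = 0)"
  shows "\<exists>M::nat. M > 0 \<and> (\<forall>y\<in>S. \<forall>e\<in>E. of_nat M * \<kappa> y e \<in> \<int>)"
proof -
  obtain L0 :: nat where "inverse (of_nat (Suc L0)) < c" using reals_Archimedean[OF c(1)] by blast
  define L where "L = Suc L0"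
  have L: "L > 0" "inverse (of_nat L) < c" using \<open>inverse (of_nat (Suc L0)) < c\<close> by (auto simp: L_def)
  \<comment> \<open>The number of boxes of side \<open>1 / L\<close>; among the \<open>H + 1\<close>
    multiples with \<open>j \<le> H\<close>, two share a box.\<close>
  define H where "H = L ^ card E"
  have k0: "\<kappa> 0 e = 0" if "e \<in> E" for e using kdiff[OF that, of 0 0] by simp
  have kneg: "\<kappa> (- x) e = - \<kappa> x e" if "e \<in> E" for x e using kdiff[OF that, of 0 x] k0[OF that] by simp
  have kadd: "\<kappa> (x + y) e = \<kappa> x e + \<kappa> y e" if "e \<in> E" for x y e
    using kdiff[OF that, of x "- y"] kneg[OF that] by simp
  have Sadd: "x + y \<in> S" if "x \<in> S" "y \<in> S" for x y
    using Sdiff[OF that(1) Sdiff[OF S0 that(2)]] by simp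
  have key: "\<exists>M. 0 < M \<and> M \<le> H \<and> (\<forall>e\<in>E. of_nat M * \<kappa> y e \<in> \<int>)" if y: "y \<in> S" for y
  proof -
    \<comment> \<open>The multiple \<open>j y\<close>, by recursion because the group
      \<open>'v\<close> carries no scalars.\<close>
    define jy where "jy = rec_nat 0 (\<lambda>_ z. z + y)"
    have jyS: "jy j \<in> S" for j by (induction j) (auto simp: jy_def S0 Sadd y)
    have jyk: "\<kappa> (jy j) e = of_nat j * \<kappa> y e" if "e \<in> E" for j e
      by (induction j) (auto simp: jy_def k0 kadd that algebra_simps)
    define box where "box j = (\<lambda>e\<in>E. nat \<lfloor>of_nat L * frac (\<kappa> (jy j) e)\<rfloor>)" for j
    have "box ` {..H} \<subseteq> (\<Pi>\<^sub>E e\<in>E. {..<L})"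
    proof (intro image_subsetI PiE_I)
      fix j e assume e: "e \<in> E"
      have "of_nat L * frac (\<kappa> (jy j) e) < of_nat L * 1"
        using L(1) frac_lt_1[of "\<kappa> (jy j) e"] by (intro mult_strict_left_mono) auto
      then have "\<lfloor>of_nat L * frac (\<kappa> (jy j) e)\<rfloor> < int L" by (simp add: floor_less_iff)
      then show "box j e \<in> {..<L}" using e L(1) by (simp add: box_def nat_less_iff)
    qed (simp add: box_def)
    then have "card (box ` {..H}) \<le> card (\<Pi>\<^sub>E e\<in>E. {..<L})"
      using \<open>finite E\<close> by (intro card_mono finite_PiE) auto
    also have "\<dots> = H" using \<open>finite E\<close> by (simp add: card_PiE H_def)
    finally have "\<not> inj_on box {..H}" using card_image[of box "{..H}"] by auto
    then obtain i j where ij: "i < j" "j \<le> H" "box i = box j"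
      unfolding inj_on_def by (metis atMost_iff linorder_neqE_nat)
    obtain w where w: "w \<in> S" "\<And>e. e \<in> E \<Longrightarrow> \<kappa> w e = of_int (\<lfloor>\<kappa> (jy j) e\<rfloor> - \<lfloor>\<kappa> (jy i) e\<rfloor>)"
      using lat[of "\<lambda>e. \<lfloor>\<kappa> (jy j) e\<rfloor> - \<lfloor>\<kappa> (jy i) e\<rfloor>"] by blast
    let ?z = "jy j - jy i - w"
    have "?z \<in> S" using jyS w by (intro Sdiff)
    moreover have kz: "\<kappa> ?z e = frac (\<kappa> (jy j) e) - frac (\<kappa> (jy i) e)" if "e \<in> E" for e
      using that by (simp add: kdiff w frac_def)
    moreover have "\<bar>\<kappa> ?z e\<bar> < c" if e: "e \<in> E" for e
    proof -
      let ?a = "of_nat L * frac (\<kappa> (jy j) e)" and ?b = "of_nat L * frac (\<kappa> (jy i) e)"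
      have "nat \<lfloor>?b\<rfloor> = nat \<lfloor>?a\<rfloor>" using fun_cong[OF ij(3), of e] e by (simp add: box_def)
      moreover have "0 \<le> \<lfloor>?a\<rfloor>" "0 \<le> \<lfloor>?b\<rfloor>" by auto
      ultimately have "\<lfloor>?a\<rfloor> = \<lfloor>?b\<rfloor>" by (metis eq_nat_nat_iff)
      then have "\<bar>?a - ?b\<bar> < 1" by linarith
      then have "of_nat L * \<bar>\<kappa> ?z e\<bar> < 1"
        using kz[OF e] by (simp add: right_diff_distrib[symmetric] abs_mult)
      then have "\<bar>\<kappa> ?z e\<bar> < inverse (of_nat L)" using L(1) by (simp add: field_simps)
      then show ?thesis using L(2) by simp
    qed
    ultimately have z0: "\<kappa> ?z e = 0" if "e \<in> E" for e using c(2)[of ?z] that by blast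
    have "of_nat (j - i) * \<kappa> y e \<in> \<int>" if "e \<in> E" for e
    proof -
      have "\<kappa> (jy j) e - \<kappa> (jy i) e = \<kappa> w e" using z0[OF that] by (simp add: kdiff that)
      then have "of_nat (j - i) * \<kappa> y e = \<kappa> w e"
        using ij(1) by (simp add: jyk that of_nat_diff left_diff_distrib)
      then show ?thesis by (simp add: w that)
    qed
    then show ?thesis using ij by (intro exI[of _ "j - i"]) auto
  qed
  \<comment> \<open>The multiplier found for \<open>y\<close> depends on \<open>y\<close> but is at
    most \<open>H\<close>, so it divides \<open>fact H\<close>.\<close>
  show ?thesis
  proof (intro exI[of _ "fact H :: nat"] conjI ballI)
    fix y e assume ye: "y \<in> S" "e \<in> E"
    from key[OF ye(1)] obtain M where M: "0 < M" "M \<le> H" "of_nat M * \<kappa> y e \<in> \<int>" using ye(2) by blast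
    then obtain r where r: "fact H = M * r" using dvd_fact[of M H] by (metis dvdE Suc_leI One_nat_def)
    have "of_nat (fact H :: nat) * \<kappa> y e = of_nat r * (of_nat M * \<kappa> y e)" by (simp add: r)
    then show "of_nat (fact H :: nat) * \<kappa> y e \<in> \<int>" using M(3) by (metis Ints_mult Ints_of_nat)
  qed simp
qed

lemma common_denominator:
  fixes X :: "rat set"
  assumes "finite X"
  shows "\<exists>D::nat. D > 0 \<and> (\<forall>r\<in>X. of_nat D * r \<in> \<int>)"
  using assms
proof (induction X rule: finite_induct)
  case (insert x X)
  then obtain D :: nat where D: "D > 0" "\<And>r. r \<in> X \<Longrightarrow> of_nat D * r \<in> \<int>" by blast
  obtain a b where ab: "x = of_int a / of_int b" "b > 0" by (metis quotient_of_div quotient_of_denom_pos prod.collapse)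
  have x: "of_nat (nat b) * x = of_int a" using ab by simp
  show ?case
  proof (intro exI[of _ "D * nat b"] conjI ballI)
    show "0 < D * nat b" using D ab by simp
    fix r assume "r \<in> insert x X"
    then show "of_nat (D * nat b) * r \<in> \<int>"
    proof
      assume "r = x"
      then have "of_nat (D * nat b) * r = of_nat D * of_int a" by (simp only: of_nat_mult mult.assoc x)
      also have "\<dots> = of_int (int D * a)" by simp
      finally show ?thesis by (simp only: Ints_of_int)
    next
      assume "r \<in> X"
      have "of_nat (D * nat b) * r = of_nat (nat b) * (of_nat D * r)" by (simp only: of_nat_mult mult_ac)
      then show ?thesis using D(2)[OF \<open>r \<in> X\<close>] by (metis Ints_mult Ints_of_nat)
    qed
  qed
qed (auto intro: exI[of _ 1])

text \<open>The bound on denominators comes from \<open>bounded_denominators\<close>. Its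
  discreteness condition holds because the coordinates of all powers of an integer \<open>y\<close>
  share one denominator, while the powers of a small \<open>y\<close> tend to 0; so some power, and
  hence \<open>y\<close>, is 0. The ring axioms of \<open>\<O>\<^sub>K\<close> enter through
  \<open>one\<close> and \<open>ring\<close>; they are read off later from the locale
  \<open>primeideal\<close>.\<close>

lemma number_field_structure:
  assumes nf: "number_field TYPE('k::field_char_0)"
    and one: "1 \<in> (\<O>\<^sub>K :: 'k set)"
    and ring: "\<And>x y :: 'k. x \<in> \<O>\<^sub>K \<Longrightarrow> y \<in> \<O>\<^sub>K \<Longrightarrow> x - y \<in> \<O>\<^sub>K \<and> x * y \<in> \<O>\<^sub>K"
  shows "\<exists>(E :: 'k set) \<kappa> (M :: nat). finite E \<and> E \<subseteq> \<O>\<^sub>K \<and> card E = rat_degree TYPE('k) \<and>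
    (\<forall>x. x = (\<Sum>e\<in>E. of_rat (\<kappa> x e) * e)) \<and> (\<forall>x y e. \<kappa> (x + y) e = \<kappa> x e + \<kappa> y e) \<and>
    (\<forall>r x e. \<kappa> (of_rat r * x) e = r * \<kappa> x e) \<and>
    M > 0 \<and> (\<forall>y\<in>\<O>\<^sub>K. \<forall>e\<in>E. of_nat M * \<kappa> y e \<in> \<int>)"
proof -
  obtain B where "finite_dimensional_vector_space (rat_smult :: rat \<Rightarrow> 'k \<Rightarrow> 'k) B"
    using nf by (auto simp: number_field_def)
  then interpret V: finite_dimensional_vector_space "rat_smult :: rat \<Rightarrow> 'k \<Rightarrow> 'k" B .
  obtain E where E: "E \<subseteq> \<O>\<^sub>K" "V.independent E" "\<O>\<^sub>K \<subseteq> V.span E"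
    using V.maximal_independent_subset[of "\<O>\<^sub>K"] by metis
  have spanE: "V.span E = UNIV"
  proof -
    have "x \<in> V.span E" for x
    proof -
      obtain D :: nat where D: "D > 0" "of_nat D * x \<in> \<O>\<^sub>K"
        using algebraic_imp_multiple_algebraic_int[OF number_field_algebraic[OF nf], of x]
        by (auto simp: ring_of_integers_def)
      then have "rat_smult (1 / of_nat D) (of_nat D * x) \<in> V.span E"
        using E(3) by (intro V.span_scale) auto
      moreover have "rat_smult (1 / of_nat D) (of_nat D * x) = x"
        using D(1) by (simp add: rat_smult_field of_rat_divide)
      ultimately show ?thesis by simp
    qed
    then show ?thesis by auto
  qed
  have finE: "finite E" using V.finiteI_independent[OF E(2)] .
  have cardE: "card E = rat_degree TYPE('k)"
    unfolding rat_degree_def using V.basis_card_eq_dim[of E UNIV] E spanE by simp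
  define \<kappa> where "\<kappa> = V.representation E"
  have rep: "x = (\<Sum>e\<in>E. of_rat (\<kappa> x e) * e)" for x
    using V.sum_representation_eq[OF E(2), of x E] finE spanE by (simp add: \<kappa>_def rat_smult_field)
  have kadd: "\<kappa> (x + y) e = \<kappa> x e + \<kappa> y e" for x y e
    unfolding \<kappa>_def by (subst V.representation_add[OF E(2)]) (simp_all add: spanE)
  have kscale: "\<kappa> (of_rat r * x) e = r * \<kappa> x e" for r x e
    unfolding \<kappa>_def rat_smult_field[symmetric] by (subst V.representation_scale[OF E(2)]) (simp_all add: spanE)
  have kneg: "\<kappa> (- x) e = - \<kappa> x e" for x e using kscale[of "-1" x e] by simp
  have kdiff: "\<kappa> (x - y) e = \<kappa> x e - \<kappa> y e" for x y e
    using kadd[of x "- y" e] kneg[of y e] by simp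
  have ksum: "\<kappa> (\<Sum>i\<in>A. g i) e = (\<Sum>i\<in>A. \<kappa> (g i) e)" for A e and g :: "nat \<Rightarrow> 'k"
  proof (induction A rule: infinite_finite_induct)
    case (insert a A)
    then show ?case by (simp add: kadd)
  qed (use kscale[of 0 0] in simp_all)
  have k_eq_0: "x = 0" if "\<And>e. e \<in> E \<Longrightarrow> \<kappa> x e = 0" for x
    using rep[of x] that by simp
  define N where "N x = (\<Sum>e\<in>E. \<bar>\<kappa> x e\<bar>)" for x
  have N0: "N x \<ge> 0" for x by (simp add: N_def sum_nonneg)
  have Nadd: "N (x + y) \<le> N x + N y" for x y
    unfolding N_def sum.distrib[symmetric] kadd by (intro sum_mono abs_triangle_ineq)
  have Nscale: "N (of_rat r * x) = \<bar>r\<bar> * N x" for r x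
    by (simp add: N_def kscale abs_mult sum_distrib_left)
  have Nsum: "N (\<Sum>i\<in>A. g i) \<le> (\<Sum>i\<in>A. N (g i))" if "finite A" for A and g :: "'k \<Rightarrow> 'k"
    using that
  proof (induction A rule: finite_induct)
    case empty
    show ?case using kscale[of 0 0] by (simp add: N_def)
  next
    case (insert a A)
    then show ?case using Nadd[of "g a" "sum g A"] by simp
  qed
  \<comment> \<open>A bound for \<open>N\<close> on all products of basis elements, which makes
    \<open>N\<close> submultiplicative up to the factor \<open>C\<close>; the added 1 keeps it
    positive.\<close>
  define C where "C = (\<Sum>e\<in>E. \<Sum>e'\<in>E. N (e * e')) + 1"
  have Cpos: "C > 0" unfolding C_def using N0 by (intro add_nonneg_pos sum_nonneg) auto
  have NEE: "N (e * e') \<le> C" if "e \<in> E" "e' \<in> E" for e e'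
  proof -
    have "N (e * e') \<le> (\<Sum>e'\<in>E. N (e * e'))" using finE that N0 by (intro member_le_sum) auto
    also have "\<dots> \<le> (\<Sum>e\<in>E. \<Sum>e'\<in>E. N (e * e'))"
      using finE that N0 by (intro member_le_sum[of e E "\<lambda>e. \<Sum>e'\<in>E. N (e * e')"]) (auto intro: sum_nonneg)
    finally show ?thesis by (simp add: C_def)
  qed
  have NE: "N (e * y) \<le> C * N y" if e: "e \<in> E" for e y
  proof -
    have "e * y = (\<Sum>e'\<in>E. of_rat (\<kappa> y e') * (e * e'))"
      by (subst rep[of y]) (simp add: sum_distrib_left mult.left_commute)
    then have "N (e * y) \<le> (\<Sum>e'\<in>E. N (of_rat (\<kappa> y e') * (e * e')))" using Nsum[OF finE] by simp
    also have "\<dots> \<le> (\<Sum>e'\<in>E. \<bar>\<kappa> y e'\<bar> * C)"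
      unfolding Nscale using NEE[OF e] by (intro sum_mono mult_left_mono) auto
    finally show ?thesis by (simp add: N_def sum_distrib_left mult.commute)
  qed
  have Nmult: "N (x * y) \<le> C * N x * N y" for x y
  proof -
    have "x * y = (\<Sum>e\<in>E. of_rat (\<kappa> x e) * (e * y))"
      by (subst rep[of x]) (simp add: sum_distrib_right mult.assoc)
    then have "N (x * y) \<le> (\<Sum>e\<in>E. N (of_rat (\<kappa> x e) * (e * y)))" using Nsum[OF finE] by simp
    also have "\<dots> \<le> (\<Sum>e\<in>E. \<bar>\<kappa> x e\<bar> * (C * N y))"
      unfolding Nscale using NE by (intro sum_mono mult_left_mono) auto
    finally show ?thesis by (simp add: N_def sum_distrib_left sum_distrib_right mult_ac)
  qed
  have discrete: "y = 0" if y: "y \<in> \<O>\<^sub>K" and small: "C * N y < 1" for y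
  proof -
    from y obtain P where P: "lead_coeff P = 1" "\<And>i. coeff P i \<in> \<int>" "poly P y = 0"
      by (auto simp: ring_of_integers_def algebraic_int.simps)
    define s where "s = degree P"
    have "finite ((\<lambda>(i, e). \<kappa> (y ^ i) e) ` ({..<s} \<times> E))" using finE by simp
    from common_denominator[OF this] obtain D :: nat where D: "D > 0"
      "\<And>i e. i < s \<Longrightarrow> e \<in> E \<Longrightarrow> of_nat D * \<kappa> (y ^ i) e \<in> \<int>" by auto
    \<comment> \<open>The monic equation of degree \<open>s\<close> expresses \<open>y ^ k\<close>
      with \<open>k \<ge> s\<close> by lower powers with integer coefficients, so the common
      denominator of the first \<open>s\<close> powers serves for all.\<close>
    have den: "of_nat D * \<kappa> (y ^ k) e \<in> \<int>" if e: "e \<in> E" for k e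
    proof (induction k rule: less_induct)
      case (less k)
      show ?case
      proof (cases "k < s")
        case True
        then show ?thesis using D(2) e by blast
      next
        case False
        have "0 = (\<Sum>i\<le>s. coeff P i * y ^ i)" using P(3) by (simp add: poly_altdef s_def)
        also have "\<dots> = (\<Sum>i<s. coeff P i * y ^ i) + y ^ s"
          using P(1) by (simp add: lessThan_Suc_atMost[symmetric] s_def)
        finally have "y ^ s = - (\<Sum>i<s. coeff P i * y ^ i)" by (simp add: eq_neg_iff_add_eq_0 add.commute)
        moreover have "y ^ k = y ^ (k - s) * y ^ s" using False by (simp add: power_add[symmetric])
        ultimately have yk: "y ^ k = - (\<Sum>i<s. coeff P i * y ^ (k - s + i))"
          by (simp add: sum_distrib_left power_add mult_ac)
        have "\<forall>i. \<exists>z. coeff P i = of_int z" using P(2) by (auto elim: Ints_cases)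
        from choice[OF this] obtain a where a: "\<And>i. coeff P i = of_int (a i)" by blast
        have "\<kappa> (coeff P i * z) e = of_int (a i) * \<kappa> z e" for i z
          using kscale[of "of_int (a i)" z e] by (simp only: a of_rat_of_int_eq)
        then have "\<kappa> (y ^ k) e = - (\<Sum>i<s. of_int (a i) * \<kappa> (y ^ (k - s + i)) e)"
          by (subst yk) (simp only: kneg ksum)
        then have "of_nat D * \<kappa> (y ^ k) e = - (\<Sum>i<s. of_int (a i) * (of_nat D * \<kappa> (y ^ (k - s + i)) e))"
          by (simp add: sum_distrib_left mult.left_commute)
        moreover have "(\<Sum>i<s. of_int (a i) * (of_nat D * \<kappa> (y ^ (k - s + i)) e)) \<in> \<int>"
          using False by (intro Ints_sum Ints_mult Ints_of_int less) auto
        ultimately show ?thesis by (metis Ints_minus)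
      qed
    qed
    let ?\<theta> = "C * N y"
    have Npow: "N (y ^ k) \<le> ?\<theta> ^ k * N 1" for k
    proof (induction k)
      case (Suc k)
      have "N (y ^ Suc k) \<le> C * N y * N (y ^ k)" using Nmult[of y "y ^ k"] by simp
      also have "\<dots> \<le> C * N y * (?\<theta> ^ k * N 1)"
        using Suc Cpos N0 by (intro mult_left_mono) (auto intro: mult_nonneg_nonneg less_imp_le)
      finally show ?case by (simp add: mult_ac)
    qed simp
    have "0 < inverse (real_of_rat (of_nat D * N 1 + 1))"
      using N0[of 1] by (simp add: add_nonneg_pos)
    then obtain k where "real_of_rat ?\<theta> ^ k < inverse (real_of_rat (of_nat D * N 1 + 1))"
      using real_arch_pow_inv[of _ "real_of_rat ?\<theta>"] small by (metis of_rat_1 of_rat_less)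
    then have "real_of_rat (?\<theta> ^ k) < real_of_rat (inverse (of_nat D * N 1 + 1))"
      by (simp only: of_rat_power of_rat_inverse)
    then have k: "?\<theta> ^ k < inverse (of_nat D * N 1 + 1)" by (simp only: of_rat_less)
    have pos: "of_nat D * N 1 + 1 > 0" using N0[of 1] by (simp add: add_nonneg_pos)
    have "of_nat D * N (y ^ k) \<le> of_nat D * (?\<theta> ^ k * N 1)" using Npow by (intro mult_left_mono) auto
    also have "\<dots> = (of_nat D * N 1) * ?\<theta> ^ k" by simp
    also have "\<dots> \<le> (of_nat D * N 1) * inverse (of_nat D * N 1 + 1)"
      using k N0[of 1] by (intro mult_left_mono) auto
    also have "\<dots> < 1" using pos by (simp add: field_simps)
    finally have small_pow: "of_nat D * N (y ^ k) < 1" .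
    have "\<kappa> (y ^ k) e = 0" if e: "e \<in> E" for e
    proof -
      have "\<bar>\<kappa> (y ^ k) e\<bar> \<le> N (y ^ k)" unfolding N_def using finE e by (intro member_le_sum) auto
      then have "of_nat D * \<bar>\<kappa> (y ^ k) e\<bar> \<le> of_nat D * N (y ^ k)" by (intro mult_left_mono) auto
      then have "\<bar>of_nat D * \<kappa> (y ^ k) e\<bar> < 1" using small_pow by (simp add: abs_mult)
      then have "of_nat D * \<kappa> (y ^ k) e = 0" using den[OF e, of k] Ints_nonzero_abs_less1 by blast
      then show ?thesis using D(1) by simp
    qed
    then have "y ^ k = 0" by (rule k_eq_0)
    then show ?thesis by simp
  qed
  have zeroO: "0 \<in> (\<O>\<^sub>K :: 'k set)" using ring[OF one one] by simp
  have addO: "x + y \<in> \<O>\<^sub>K" if "x \<in> \<O>\<^sub>K" "y \<in> \<O>\<^sub>K" for x y :: 'k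
    using ring[OF that(1)] ring[OF zeroO that(2)] by (metis diff_0 diff_minus_eq_add)
  have intO: "of_int z \<in> (\<O>\<^sub>K :: 'k set)" for z by (simp add: ring_of_integers_def int_imp_algebraic_int)
  have sumO: "(\<Sum>e\<in>A. g e) \<in> \<O>\<^sub>K" if "finite A" "\<And>e. e \<in> A \<Longrightarrow> g e \<in> \<O>\<^sub>K" for A and g :: "'k \<Rightarrow> 'k"
    using that by (induction A rule: finite_induct) (auto simp: zeroO addO)
  have kE: "\<kappa> e e' = (if e' = e then 1 else 0)" if "e \<in> E" for e e'
    unfolding \<kappa>_def by (subst V.representation_basis[OF E(2) that]) auto
  \<comment> \<open>The threshold \<open>c\<close> is chosen so that coordinates below it give
    \<open>C * N y < 1\<close>.\<close>
  have "\<exists>M::nat. M > 0 \<and> (\<forall>y\<in>\<O>\<^sub>K. \<forall>e\<in>E. of_nat M * \<kappa> y e \<in> \<int>)"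
  proof (rule bounded_denominators[OF finE, where c = "inverse (C * (of_nat (card E) + 1))"])
    show "inverse (C * (of_nat (card E) + 1)) > 0"
      using Cpos by (simp add: add_nonneg_pos)
    show "\<exists>w\<in>\<O>\<^sub>K. \<forall>e\<in>E. \<kappa> w e = of_int (a e)" for a :: "'k \<Rightarrow> int"
    proof (intro bexI ballI)
      let ?w = "\<Sum>e\<in>E. of_int (a e) * e"
      show "?w \<in> \<O>\<^sub>K" using E(1) ring intO finE by (intro sumO) auto
      fix e assume e: "e \<in> E"
      have "\<kappa> (\<Sum>e'\<in>A. of_int (a e') * e') e = (if e \<in> A then of_int (a e) else 0)" if "finite A" "A \<subseteq> E" for A
        using that
      proof (induction A rule: finite_induct)
        case empty
        then show ?case using kscale[of 0 0 e] by simp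
      next
        case (insert x A)
        then have "\<kappa> (of_int (a x) * x) e = of_int (a x) * \<kappa> x e"
          using kscale[of "of_int (a x)" x e] by simp
        then show ?case using insert by (auto simp: kadd kE)
      qed
      from this[OF finE] show "\<kappa> ?w e = of_int (a e)" using e by simp
    qed
    fix y e assume y: "y \<in> \<O>\<^sub>K" "\<And>e. e \<in> E \<Longrightarrow> \<bar>\<kappa> y e\<bar> < inverse (C * (of_nat (card E) + 1))" and "e \<in> E"
    have "N y \<le> (\<Sum>e\<in>E. inverse (C * (of_nat (card E) + 1)))"
      unfolding N_def using y(2) by (intro sum_mono less_imp_le)
    also have "\<dots> = of_nat (card E) * inverse (C * (of_nat (card E) + 1))" by simp
    finally have "C * N y \<le> C * (of_nat (card E) * inverse (C * (of_nat (card E) + 1)))"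
      using Cpos by (intro mult_left_mono) auto
    also have "\<dots> = of_nat (card E) / (of_nat (card E) + 1)"
      using Cpos by (simp add: divide_inverse)
    also have "\<dots> < 1" by (simp add: divide_less_eq_1 add_nonneg_pos)
    finally have "y = 0" using discrete[OF y(1)] by simp
    then show "\<kappa> y e = 0" using kscale[of 0 0 e] by simp
  qed (use kdiff zeroO ring in auto)
  then show ?thesis
    using finE E(1) cardE rep kadd kscale by blast
qed

section \<open>The lattice of an order\<close>

lemma independent_family:
  fixes v :: "'d::finite \<Rightarrow> real ^ 'd"
  assumes "\<And>y :: real ^ 'd. (\<Sum>k\<in>UNIV. y $ k *\<^sub>R v k) = 0 \<Longrightarrow> y = 0"
  shows "inj v" "independent (range v)" "surj (\<lambda>y :: real ^ 'd. \<Sum>k\<in>UNIV. y $ k *\<^sub>R v k)"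
proof -
  define T where "T = (\<lambda>y :: real ^ 'd. \<Sum>k\<in>UNIV. y $ k *\<^sub>R v k)"
  have lin: "linear T"
    by (rule linearI) (simp_all add: T_def algebra_simps sum.distrib scaleR_sum_right)
  have inj: "inj T"
    by (rule linear_injective_0[OF lin, THEN iffD2]) (use assms in \<open>auto simp: T_def\<close>)
  have Tax: "T (axis k 1) = v k" for k
  proof -
    have "T (axis k 1) = (\<Sum>j\<in>UNIV. if j = k then v j else 0)"
      unfolding T_def by (intro sum.cong) (auto simp: axis_def)
    then show ?thesis by simp
  qed
  show "inj v"
  proof (rule injI)
    fix i j assume "v i = v j"
    then have "T (axis i 1) = T (axis j 1)" by (simp add: Tax)
    then have "axis i (1::real) = axis j 1" using inj by (simp add: inj_def)
    then show "i = j" by (simp add: axis_eq_axis)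
  qed
  have "range v = T ` Basis"
    by (auto simp: Basis_vec_def Tax[symmetric])
  moreover have "independent (T ` (Basis :: (real ^ 'd) set))"
    by (rule linear_independent_injective_image[OF lin independent_Basis inj_on_subset[OF inj subset_UNIV]])
  ultimately show "independent (range v)" by simp
  show "surj (\<lambda>y :: real ^ 'd. \<Sum>k\<in>UNIV. y $ k *\<^sub>R v k)"
    using linear_injective_imp_surjective[OF lin inj] by (simp add: T_def)
qed

lemma det_Ints:
  fixes A :: "real ^ 'd::finite ^ 'd"
  assumes "\<And>i j. A $ i $ j \<in> \<int>"
  shows "det A \<in> \<int>"
  unfolding det_def using assms by (intro Ints_sum Ints_mult Ints_prod) auto

text \<open>
  Among the families of lattice vectors with nonzero determinant, one with minimal determinant is a
  basis: a fractional coordinate could be used to decrease the determinant.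
\<close>

lemma integral_lattice_basis:
  fixes \<Lambda> :: "(real ^ 'd::finite) set"
  assumes diff: "\<And>x y. x \<in> \<Lambda> \<Longrightarrow> y \<in> \<Lambda> \<Longrightarrow> x - y \<in> \<Lambda>" and ax: "\<And>k. axis k 1 \<in> \<Lambda>"
    and M: "M > 0" "\<And>x i. x \<in> \<Lambda> \<Longrightarrow> real M * x $ i \<in> \<int>"
  obtains b :: "'d \<Rightarrow> real ^ 'd" where "inj b" "independent (range b)"
    "\<Lambda> = {\<Sum>k\<in>UNIV. real_of_int (z k) *\<^sub>R b k | z. True}"
proof -
  let ?m = "real M ^ CARD('d)"
  have mpos: "?m > 0" using M by simp
  have zero: "0 \<in> \<Lambda>" using diff[OF ax[of undefined] ax[of undefined]] by simp
  have neg: "- x \<in> \<Lambda>" if "x \<in> \<Lambda>" for x using diff[OF zero that] by simp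
  have add: "x + y \<in> \<Lambda>" if "x \<in> \<Lambda>" "y \<in> \<Lambda>" for x y using diff[OF that(1) neg[OF that(2)]] by simp
  have nat: "real n *\<^sub>R x \<in> \<Lambda>" if "x \<in> \<Lambda>" for x n
    by (induction n) (simp_all add: zero add that scaleR_add_left)
  have int: "real_of_int k *\<^sub>R x \<in> \<Lambda>" if "x \<in> \<Lambda>" for x k
  proof (cases "k \<ge> 0")
    case True
    then show ?thesis using nat[OF that, of "nat k"] by simp
  next
    case False
    then show ?thesis using neg[OF nat[OF that, of "nat (- k)"]] by simp
  qed
  have sum: "(\<Sum>i\<in>I. g i) \<in> \<Lambda>" if "\<And>i. i \<in> I \<Longrightarrow> g i \<in> \<Lambda>" for I and g :: "'d \<Rightarrow> real ^ 'd"
    using that by (induction I rule: infinite_finite_induct) (simp_all add: zero add)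
  \<comment> \<open>Multiplied by \<open>real M ^ CARD('d)\<close>, determinants of families of
    lattice vectors are integers, so the nonzero ones have a least absolute value.\<close>
  define dets where "dets = {k::nat. k > 0 \<and> (\<exists>A :: real ^ 'd ^ 'd. (\<forall>i. row i A \<in> \<Lambda>) \<and> \<bar>?m * det A\<bar> = real k)}"
  have detsI: "\<exists>k. \<bar>?m * det A\<bar> = real k \<and> (det A \<noteq> 0 \<longrightarrow> k \<in> dets)" if A: "\<And>i. row i A \<in> \<Lambda>" for A :: "real ^ 'd ^ 'd"
  proof -
    have "?m * det A = det (\<chi> i. real M *s row i A)"
      using det_rows_mul[of "\<lambda>_. real M" "\<lambda>i. row i A"] by (simp add: row_def)
    also have "\<dots> \<in> \<int>"
      by (rule det_Ints) (use M(2)[OF A] in simp)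
    finally obtain z where z: "?m * det A = of_int z" by (auto elim: Ints_cases)
    have k: "\<bar>?m * det A\<bar> = real (nat \<bar>z\<bar>)" unfolding z by simp
    moreover have "nat \<bar>z\<bar> \<in> dets" if "det A \<noteq> 0"
    proof -
      have "?m * det A \<noteq> 0" using that mpos by simp
      then have "nat \<bar>z\<bar> > 0" using z by simp
      then show ?thesis unfolding dets_def using A k by blast
    qed
    ultimately show ?thesis by blast
  qed
  have "row i (mat 1 :: real ^ 'd ^ 'd) \<in> \<Lambda>" for i
  proof -
    have "row i (mat 1 :: real ^ 'd ^ 'd) = axis i 1" by (auto simp: row_def mat_def axis_def vec_eq_iff)
    then show ?thesis using ax by simp
  qed
  then have "dets \<noteq> {}" using detsI[of "mat 1"] by auto
  define k0 where "k0 = (LEAST k. k \<in> dets)"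
  have "k0 \<in> dets" unfolding k0_def using \<open>dets \<noteq> {}\<close> by (auto intro: LeastI)
  then obtain A :: "real ^ 'd ^ 'd" where A: "\<And>i. row i A \<in> \<Lambda>" "\<bar>?m * det A\<bar> = real k0" "k0 > 0"
    by (auto simp: dets_def)
  have detA: "det A \<noteq> 0" using A(2,3) by auto
  then have "invertible A" by (simp add: invertible_det_nz)
  then obtain A' where "A ** A' = mat 1" by (auto simp: invertible_def)
  then have indep0: "\<forall>c. (\<Sum>i\<in>UNIV. c i *s row i A) = 0 \<longrightarrow> (\<forall>i. c i = 0)"
    using matrix_right_invertible_independent_rows[of A] by blast
  define b where "b i = row i A" for i
  have fam: "y = 0" if "(\<Sum>k\<in>UNIV. y $ k *\<^sub>R b k) = 0" for y :: "real ^ 'd"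
    using indep0[rule_format, of "\<lambda>k. y $ k"] that by (simp add: b_def scalar_mult_eq_scaleR vec_eq_iff)
  note indep = independent_family[of b, OF fam]
  have "\<Lambda> = {\<Sum>k\<in>UNIV. real_of_int (z k) *\<^sub>R b k | z. True}"
  proof (intro equalityI subsetI)
    fix x assume "x \<in> {\<Sum>k\<in>UNIV. real_of_int (z k) *\<^sub>R b k | z. True}"
    then obtain z where "x = (\<Sum>k\<in>UNIV. real_of_int (z k) *\<^sub>R b k)" by blast
    then show "x \<in> \<Lambda>" using A(1) by (auto intro!: sum int simp: b_def)
  next
    fix x assume x: "x \<in> \<Lambda>"
    obtain y where y: "x = (\<Sum>k\<in>UNIV. y $ k *\<^sub>R b k)" using indep(3) by (rule surjE)
    have "frac (y $ k) = 0" for k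
    proof (rule ccontr)
      assume nz: "frac (y $ k) \<noteq> 0"
      define f where "f = (\<chi> i. frac (y $ i))"
      let ?A = "(\<chi> i. if i = k then (\<Sum>i\<in>UNIV. f $ i *s row i A) else row i A) :: real ^ 'd ^ 'd"
      \<comment> \<open>Row \<open>k\<close> is replaced by the combination with coefficients
        \<open>frac (y $ i)\<close>, again a lattice vector. By Cramer's rule the determinant
        shrinks by the factor \<open>frac (y $ k) < 1\<close>.\<close>
      have det: "det ?A = f $ k * det A" by (rule cramer_lemma_transpose)
      have "(\<Sum>i\<in>UNIV. f $ i *s row i A) = x - (\<Sum>i\<in>UNIV. real_of_int \<lfloor>y $ i\<rfloor> *\<^sub>R b i)"
        by (simp add: y f_def frac_def b_def scalar_mult_eq_scaleR scaleR_diff_left sum_subtractf)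
      also have "\<dots> \<in> \<Lambda>" using x A(1) by (intro diff sum int) (simp_all add: b_def)
      finally have w: "(\<Sum>i\<in>UNIV. f $ i *s row i A) \<in> \<Lambda>" .
      have "row i ?A \<in> \<Lambda>" for i
      proof -
        have "row i ?A = (if i = k then (\<Sum>i\<in>UNIV. f $ i *s row i A) else row i A)"
          by (simp add: row_def vec_eq_iff)
        then show ?thesis using w A(1) by simp
      qed
      from detsI[of ?A, OF this] obtain k' where k': "\<bar>?m * det ?A\<bar> = real k'" "det ?A \<noteq> 0 \<longrightarrow> k' \<in> dets" by blast
      have "f $ k \<noteq> 0" "f $ k \<ge> 0" "f $ k < 1" using nz by (simp_all add: f_def frac_lt_1)
      then have "k' \<in> dets" using k'(2) det detA by simp
      then have "k0 \<le> k'" unfolding k0_def by (rule Least_le)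
      moreover have "real k' = f $ k * real k0"
        using k'(1) A(2) \<open>f $ k \<ge> 0\<close> by (simp add: det abs_mult mult.left_commute)
      moreover have "f $ k * real k0 < 1 * real k0"
        using \<open>f $ k < 1\<close> A(3) by (intro mult_strict_right_mono) auto
      ultimately show False by simp
    qed
    then have *: "real_of_int \<lfloor>y $ k\<rfloor> = y $ k" for k by (simp add: frac_def)
    have "x = (\<Sum>k\<in>UNIV. real_of_int \<lfloor>y $ k\<rfloor> *\<^sub>R b k)" unfolding y by (simp only: *)
    then show "x \<in> {\<Sum>k\<in>UNIV. real_of_int (z k) *\<^sub>R b k | z. True}"
      by (intro CollectI exI[of _ "\<lambda>k. \<lfloor>y $ k\<rfloor>"] conjI TrueI)
  qed
  then show ?thesis using that[of b] indep(1,2) by blast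
qed

text \<open>Pulling the lattice back along \<open>T\<close> turns the bound on denominators of
  rational coordinates into the hypothesis of \<open>integral_lattice_basis\<close>.\<close>

lemma lattice_basis_exists:
  fixes \<Lambda> :: "(real ^ 'd::finite) set" and T :: "real ^ 'd \<Rightarrow> real ^ 'd"
  assumes T: "linear T" "bij T"
    and diff: "\<And>x y. x \<in> \<Lambda> \<Longrightarrow> y \<in> \<Lambda> \<Longrightarrow> x - y \<in> \<Lambda>" and ax: "\<And>k. T (axis k 1) \<in> \<Lambda>"
    and M: "M > 0" "\<And>x i. T x \<in> \<Lambda> \<Longrightarrow> real M * x $ i \<in> \<int>"
  shows "\<exists>B. lattice_basis B \<Lambda>"
proof -
  let ?L = "{x. T x \<in> \<Lambda>}"
  obtain b :: "'d \<Rightarrow> real ^ 'd" where b: "inj b" "independent (range b)"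
    "?L = {\<Sum>k\<in>UNIV. real_of_int (z k) *\<^sub>R b k | z. True}"
    by (rule integral_lattice_basis[of ?L M]) (use diff ax M in \<open>simp_all add: linear_diff[OF T(1)]\<close>)
  have inj: "inj T" using T(2) by (simp add: bij_def)
  have TL: "\<Lambda> = T ` ?L"
  proof (intro equalityI subsetI)
    fix x assume "x \<in> \<Lambda>"
    moreover obtain y where "x = T y" using T(2) by (metis bij_pointE)
    ultimately show "x \<in> T ` ?L" by blast
  qed auto
  have Tsum: "T (\<Sum>k\<in>UNIV. real_of_int (z k) *\<^sub>R b k) = (\<Sum>k\<in>UNIV. real_of_int (z k) *\<^sub>R T (b k))" for z
    by (simp add: linear_sum[OF T(1)] linear_cmul[OF T(1)])
  have "lattice_basis (T \<circ> b) \<Lambda>"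
    unfolding lattice_basis_def
  proof (intro conjI)
    show "inj (T \<circ> b)" using inj b(1) by (rule inj_compose)
    show "independent (range (T \<circ> b))"
      using linear_independent_injective_image[OF T(1) b(2) inj_on_subset[OF inj subset_UNIV]] by (simp add: image_comp)
    have "T ` ?L = {T (\<Sum>k\<in>UNIV. real_of_int (z k) *\<^sub>R b k) | z. True}" unfolding b(3) by blast
    then show "\<Lambda> = {\<Sum>i\<in>UNIV. real_of_int (z i) *\<^sub>R (T \<circ> b) i |z. True}"
      using TL by (simp add: Tsum)
  qed
  then show ?thesis by blast
qed

section \<open>The tensor product with the reals\<close>

lemma tensor_add_left: "tensor (a + b) r = tensor a r + tensor b r"
  by transfer (use tensor_relations.add_left in \<open>simp add: tensor_eq_def diff_diff_eq\<close>)

lemma tensor_rat_smult: "tensor (rat_smult c a) r = of_rat c *\<^sub>R tensor a r"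
  by transfer (use tensor_relations.balanced in \<open>simp add: tensor_eq_def\<close>)

lemma scaleR_tensor: "r *\<^sub>R tensor a s = tensor a (r * s)"
  by transfer (simp add: tensor_eq_def tensor_relations.zero)

lemma tensor_zero_left: "tensor 0 r = 0"
  using tensor_add_left[of 0 0 r] by simp

lemma tensor_sum_left: "finite A \<Longrightarrow> tensor (\<Sum>i\<in>A. g i) r = (\<Sum>i\<in>A. tensor (g i) r)"
  by (induction A rule: finite_induct) (simp_all add: tensor_zero_left tensor_add_left)

lemma real_tensor_in_span:
  fixes z :: "'a::{division_ring,ring_char_0} real_tensor"
  shows "z \<in> span (range (\<lambda>a. tensor a 1))"
proof (induction z rule: real_tensor.abs_induct)
  case (1 u)
  have zero: "abs_real_tensor 0 = (0 :: 'a real_tensor)" by (simp add: zero_real_tensor_def)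
  have diff: "abs_real_tensor (v - w) = (abs_real_tensor v - abs_real_tensor w :: 'a real_tensor)" for v w
    by (simp add: minus_real_tensor.abs_eq)
  show ?case
  proof (rule frag_induction[of u UNIV])
    show "abs_real_tensor 0 \<in> span (range (\<lambda>a :: 'a. tensor a 1))" unfolding zero by (rule span_zero)
    show "abs_real_tensor (frag_of x) \<in> span (range (\<lambda>a :: 'a. tensor a 1))" for x
    proof -
      obtain a r where x: "x = (a, r)" by (cases x)
      have "abs_real_tensor (frag_of x) = tensor a r" by (simp add: x tensor_def)
      also have "\<dots> = r *\<^sub>R tensor a 1" by (simp add: scaleR_tensor)
      also have "\<dots> \<in> span (range (\<lambda>a. tensor a 1))" by (intro span_mul span_base) auto
      finally show ?thesis .
    qed
    show "abs_real_tensor (v - w) \<in> span (range (\<lambda>a :: 'a. tensor a 1))"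
      if "abs_real_tensor v \<in> span (range (\<lambda>a. tensor a 1))" "abs_real_tensor w \<in> span (range (\<lambda>a. tensor a 1))" for v w
      unfolding diff using that by (rule span_diff)
  qed auto
qed

lemma real_embedding_diff:
  assumes "linear \<Psi>"
  shows "real_embedding \<Psi> (x - y) = real_embedding \<Psi> x - real_embedding \<Psi> y"
proof -
  have "tensor (a - b) 1 = tensor a 1 - tensor b 1" for a b :: 'a
    using tensor_add_left[of "a - b" b 1] by (simp add: algebra_simps)
  then have "(\<chi> j. tensor ((x - y) $ j) 1) = (\<chi> j. tensor (x $ j) 1) - (\<chi> j. tensor (y $ j) 1)"
    by (simp add: vec_eq_iff)
  then show ?thesis by (simp add: real_embedding_def linear_diff[OF assms])
qed

text \<open>
  The vectors \<open>u i\<close> placed at the coordinates \<open>j\<close> span \<open>(A \<otimes> \<real>)\<^sup>t\<close>; since there are exactly as many of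
  them as the dimension of the target of \<open>\<Psi>\<close>, they are independent.
\<close>

lemma real_embedding_coordinates:
  fixes \<Psi> :: "('a::{division_ring,ring_char_0} real_tensor) ^ 't::finite \<Rightarrow> real ^ 'd::finite"
    and u :: "'i \<Rightarrow> 'a" and c :: "'a \<Rightarrow> 'i \<Rightarrow> rat"
  assumes \<Psi>: "linear \<Psi>" "bij \<Psi>" and I: "finite I" "card I * CARD('t) = CARD('d)"
    and c: "\<And>x. x = (\<Sum>i\<in>I. rat_smult (c x i) (u i))"
  obtains \<beta> :: "'d \<Rightarrow> 'i \<times> 't" and T :: "real ^ 'd \<Rightarrow> real ^ 'd" where "bij_betw \<beta> UNIV (I \<times> UNIV)"
    "linear T" "bij T"
    "\<And>x. real_embedding \<Psi> x = T (\<chi> k. of_rat (c (x $ snd (\<beta> k)) (fst (\<beta> k))))"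
    "\<And>k. T (axis k 1) = real_embedding \<Psi> (\<chi> j. if j = snd (\<beta> k) then u (fst (\<beta> k)) else 0)"
proof -
  have "card (UNIV :: 'd set) = card (I \<times> (UNIV :: 't set))" using I by (simp add: card_cartesian_product)
  then obtain \<beta> where \<beta>: "bij_betw \<beta> (UNIV :: 'd set) (I \<times> (UNIV :: 't set))"
    using finite_same_card_bij[of "UNIV :: 'd set" "I \<times> (UNIV :: 't set)"] I(1) by auto
  define plc where "plc j z = (\<chi> l. if l = j then z else 0)" for j :: 't and z :: "'a real_tensor"
  define v where "v k = \<Psi> (plc (snd (\<beta> k)) (tensor (u (fst (\<beta> k))) 1))" for k
  have plclin: "linear (plc j)" for j by (rule linearI) (auto simp: plc_def vec_eq_iff)
  have lin: "linear (\<lambda>z. \<Psi> (plc j z))" for j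
    using linear_compose[OF plclin \<Psi>(1)] by (simp add: o_def)
  define T where "T = (\<lambda>y :: real ^ 'd. \<Sum>k\<in>UNIV. y $ k *\<^sub>R v k)"
  have tens: "tensor x 1 = (\<Sum>i\<in>I. of_rat (c x i) *\<^sub>R tensor (u i) 1)" for x
  proof -
    have "tensor x 1 = tensor (\<Sum>i\<in>I. rat_smult (c x i) (u i)) 1"
      by (rule arg_cong[where f = "\<lambda>a. tensor a 1", OF c])
    then show ?thesis by (simp add: tensor_sum_left[OF I(1)] tensor_rat_smult)
  qed
  have decomp: "\<Psi> z = (\<Sum>j\<in>UNIV. \<Psi> (plc j (z $ j)))" for z
  proof -
    have "z = (\<Sum>j\<in>UNIV. plc j (z $ j))"
      by (simp add: vec_eq_iff plc_def)
    then have "\<Psi> z = \<Psi> (\<Sum>j\<in>UNIV. plc j (z $ j))" by (rule arg_cong)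
    then show ?thesis unfolding linear_sum[OF \<Psi>(1)] .
  qed
  have tj: "\<Psi> (plc j (tensor a 1)) = (\<Sum>i\<in>I. of_rat (c a i) *\<^sub>R \<Psi> (plc j (tensor (u i) 1)))" for j a
    by (subst tens[of a]) (simp add: linear_sum[OF lin] linear_cmul[OF lin])
  have emb: "real_embedding \<Psi> x = T (\<chi> k. of_rat (c (x $ snd (\<beta> k)) (fst (\<beta> k))))" for x
  proof -
    have "real_embedding \<Psi> x = (\<Sum>j\<in>UNIV. \<Psi> (plc j (tensor (x $ j) 1)))"
      unfolding real_embedding_def by (subst decomp) simp
    also have "\<dots> = (\<Sum>j\<in>UNIV. \<Sum>i\<in>I. of_rat (c (x $ j) i) *\<^sub>R \<Psi> (plc j (tensor (u i) 1)))"
      by (intro sum.cong refl tj)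
    also have "\<dots> = (\<Sum>i\<in>I. \<Sum>j\<in>UNIV. of_rat (c (x $ j) i) *\<^sub>R \<Psi> (plc j (tensor (u i) 1)))"
      by (rule sum.swap)
    also have "\<dots> = (\<Sum>(i, j)\<in>I \<times> UNIV. of_rat (c (x $ j) i) *\<^sub>R \<Psi> (plc j (tensor (u i) 1)))"
      by (rule sum.cartesian_product)
    also have "\<dots> = (\<Sum>k\<in>UNIV. of_rat (c (x $ snd (\<beta> k)) (fst (\<beta> k))) *\<^sub>R v k)"
      unfolding v_def by (subst sum.reindex_bij_betw[OF \<beta>, symmetric]) (simp add: case_prod_unfold)
    finally show ?thesis by (simp add: T_def)
  qed
  have Tlin: "linear T" by (rule linearI) (simp_all add: T_def algebra_simps sum.distrib scaleR_sum_right)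
  have "x \<in> span (range v)" for x
  proof -
    obtain z where z: "x = \<Psi> z" using \<Psi>(2) by (metis bij_pointE)
    have "\<Psi> (plc j w) \<in> span (range v)" for j w
    proof -
      have base: "\<Psi> (plc j (tensor a 1)) \<in> span (range v)" for a
      proof -
        have "\<Psi> (plc j (tensor (u i) 1)) \<in> span (range v)" if "i \<in> I" for i
        proof -
          have "(i, j) \<in> range \<beta>" using bij_betw_imp_surj_on[OF \<beta>] that by simp
          then obtain k where "(i, j) = \<beta> k" by (rule rangeE)
          then have "\<beta> k = (i, j)" by (rule sym)
          then have "\<Psi> (plc j (tensor (u i) 1)) = v k" by (simp add: v_def)
          then show ?thesis by (simp add: span_base)
        qed
        then show ?thesis unfolding tj[of j a] by (intro span_sum span_mul)
      qed
      have "w \<in> span (range (\<lambda>a. tensor a 1))" by (rule real_tensor_in_span)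
      then have "\<Psi> (plc j w) \<in> span ((\<lambda>z. \<Psi> (plc j z)) ` range (\<lambda>a. tensor a 1))"
        unfolding linear_span_image[OF lin] by (rule imageI)
      also have "\<dots> \<subseteq> span (range v)" by (rule span_minimal) (use base in auto)
      finally show ?thesis .
    qed
    then show ?thesis unfolding z by (subst decomp) (intro span_sum)
  qed
  then have span: "span (range v) = UNIV" by auto
  have Trange: "T ` UNIV = UNIV"
  proof -
    have "subspace (range T)" using Tlin by (rule linear_subspace_image) simp
    moreover have "v k \<in> range T" for k
    proof -
      have "T (axis k 1) = (\<Sum>j\<in>UNIV. if j = k then v j else 0)"
        unfolding T_def by (intro sum.cong) (auto simp: axis_def)
      then have "T (axis k 1) = v k" by simp
      then show ?thesis by (metis rangeI)
    qed
    ultimately have "span (range v) \<subseteq> range T" by (intro span_minimal) auto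
    then show ?thesis using span by auto
  qed
  then have bij: "bij T" using linear_surjective_imp_injective[OF Tlin] by (simp add: bij_def)
  have Tax: "T (axis k 1) = real_embedding \<Psi> (\<chi> j. if j = snd (\<beta> k) then u (fst (\<beta> k)) else 0)" for k
  proof -
    have "T (axis k 1) = (\<Sum>j\<in>UNIV. if j = k then v j else 0)"
      unfolding T_def by (intro sum.cong) (auto simp: axis_def)
    then have "T (axis k 1) = v k" by simp
    moreover have "(\<chi> j. tensor ((\<chi> j. if j = snd (\<beta> k) then u (fst (\<beta> k)) else 0) $ j) 1)
        = plc (snd (\<beta> k)) (tensor (u (fst (\<beta> k))) 1)"
      by (simp add: plc_def vec_eq_iff tensor_zero_left)
    ultimately show ?thesis by (simp add: real_embedding_def v_def)
  qed
  show ?thesis by (rule that[OF \<beta> Tlin bij emb Tax])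
qed

lemma center_embeddingD:
  fixes \<iota> :: "'k::field_char_0 \<Rightarrow> 'a::{division_ring,ring_char_0}"
  assumes "center_embedding \<iota>"
  shows "\<iota> 1 = 1" "\<iota> (x + y) = \<iota> x + \<iota> y" "\<iota> (x * y) = \<iota> x * \<iota> y" "\<iota> 0 = 0" "\<iota> (- x) = - \<iota> x"
    "\<iota> (of_int z) = of_int z" "\<iota> x * a = a * \<iota> x"
proof -
  show one: "\<iota> 1 = 1" and add: "\<And>x y. \<iota> (x + y) = \<iota> x + \<iota> y" and "\<iota> (x * y) = \<iota> x * \<iota> y"
    using assms by (auto simp: center_embedding_def)
  show zero: "\<iota> 0 = 0" using add[of 0 0] by simp
  show neg: "\<iota> (- x) = - \<iota> x" for x using add[of x "- x"] zero by (simp add: eq_neg_iff_add_eq_0 add.commute)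
  have nat: "\<iota> (of_nat n) = of_nat n" for n by (induction n) (simp_all add: zero one add)
  show "\<iota> (of_int z) = of_int z"
  proof (cases z rule: int_cases2)
    case (nonneg n)
    then show ?thesis by (simp add: nat)
  next
    case (nonpos n)
    then show ?thesis by (simp add: nat neg)
  qed
  have "\<iota> x \<in> {z. \<forall>x. z * x = x * z}" using assms unfolding center_embedding_def by blast
  then show "\<iota> x * a = a * \<iota> x" by simp
qed

text \<open>Identifies the fraction in \<open>rat_smult\<close> with a central element, so rational
  scalars can be moved past products in the noncommutative \<open>A\<close>.\<close>

lemma rat_smult_center:
  fixes \<iota> :: "'k::field_char_0 \<Rightarrow> 'a::{division_ring,ring_char_0}"
  assumes \<iota>: "center_embedding \<iota>"
  shows "rat_smult r x = \<iota> (of_rat r) * x"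
proof -
  let ?a = "fst (quotient_of r)" and ?b = "snd (quotient_of r)"
  have b: "?b \<noteq> 0" using quotient_of_denom_pos'[of r] by simp
  have "of_rat r = (of_int ?a / of_int ?b :: 'k)"
    using rat_smult_field[of r "1 :: 'k"] by (simp add: rat_smult_def)
  then have "of_rat r * of_int ?b = (of_int ?a :: 'k)" using b by simp
  then have "\<iota> (of_rat r) * of_int ?b = of_int ?a"
    by (metis center_embeddingD(3,6)[OF \<iota>])
  then have "\<iota> (of_rat r) = of_int ?a / of_int ?b" using b by (simp add: eq_divide_eq)
  then show ?thesis by (simp add: rat_smult_def)
qed

text \<open>The rational basis consists of the products \<open>e v\<close>, with \<open>e\<close>
  from a basis of \<open>K\<close> made of integers and \<open>v\<close> from a basis of
  \<open>A\<close> over \<open>K\<close> taken from the order. Denominators are bounded in two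
  stages: the finitely many generators of the order have \<open>K\<close>-coordinates with a common
  denominator \<open>D\<close>, and integers of \<open>K\<close> have rational coordinates with
  denominator \<open>M\<close>.\<close>

lemma order_structure:
  fixes \<iota> :: "'k::field_char_0 \<Rightarrow> 'a::{division_ring,ring_char_0}"
  assumes nf: "number_field TYPE('k)" and \<iota>: "center_embedding \<iota>"
    and fd: "\<exists>B. finite_dimensional_vector_space (alg_smult \<iota>) B" and ord: "is_order \<iota> \<O>"
    and one: "1 \<in> (\<O>\<^sub>K :: 'k set)"
    and ring: "\<And>x y :: 'k. x \<in> \<O>\<^sub>K \<Longrightarrow> y \<in> \<O>\<^sub>K \<Longrightarrow> x - y \<in> \<O>\<^sub>K \<and> x * y \<in> \<O>\<^sub>K"
  shows "\<exists>(I :: ('k \<times> 'a) set) u c (M :: nat). finite I \<and>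
     card I = rat_degree TYPE('k) * vector_space.dim (alg_smult \<iota>) UNIV \<and> u ` I \<subseteq> \<O> \<and>
     (\<forall>x. x = (\<Sum>i\<in>I. rat_smult (c x i) (u i))) \<and> (\<forall>x y i. c (x + y) i = c x i + c y i) \<and>
     (\<forall>r x i. c (rat_smult r x) i = r * c x i) \<and>
     M > 0 \<and> (\<forall>y\<in>\<O>. \<forall>i\<in>I. of_nat M * c y i \<in> \<int>)"
proof -
  have nfs: "\<exists>(E :: 'k set) \<kappa> (M :: nat). finite E \<and> E \<subseteq> \<O>\<^sub>K \<and> card E = rat_degree TYPE('k) \<and>
    (\<forall>x. x = (\<Sum>e\<in>E. of_rat (\<kappa> x e) * e)) \<and> (\<forall>x y e. \<kappa> (x + y) e = \<kappa> x e + \<kappa> y e) \<and>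
    (\<forall>r x e. \<kappa> (of_rat r * x) e = r * \<kappa> x e) \<and>
    M > 0 \<and> (\<forall>y\<in>\<O>\<^sub>K. \<forall>e\<in>E. of_nat M * \<kappa> y e \<in> \<int>)"
    by (rule number_field_structure) (use nf one ring in blast)+
  obtain E :: "'k set" and \<kappa> :: "'k \<Rightarrow> 'k \<Rightarrow> rat" and M :: nat where *: "finite E \<and> E \<subseteq> \<O>\<^sub>K \<and> card E = rat_degree TYPE('k) \<and>
    (\<forall>x. x = (\<Sum>e\<in>E. of_rat (\<kappa> x e) * e)) \<and> (\<forall>x y e. \<kappa> (x + y) e = \<kappa> x e + \<kappa> y e) \<and>
    (\<forall>r x e. \<kappa> (of_rat r * x) e = r * \<kappa> x e) \<and>
    M > 0 \<and> (\<forall>y\<in>\<O>\<^sub>K. \<forall>e\<in>E. of_nat M * \<kappa> y e \<in> \<int>)"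
    using nfs by (elim exE) (rule that)
  have E: "finite E" "E \<subseteq> \<O>\<^sub>K" "card E = rat_degree TYPE('k)"
    and k: "\<And>x. x = (\<Sum>e\<in>E. of_rat (\<kappa> x e) * e)" "\<And>x y e. \<kappa> (x + y) e = \<kappa> x e + \<kappa> y e"
      "\<And>r x e. \<kappa> (of_rat r * x) e = r * \<kappa> x e"
    and M: "M > 0" "\<And>y e. y \<in> \<O>\<^sub>K \<Longrightarrow> e \<in> E \<Longrightarrow> of_nat M * \<kappa> y e \<in> \<int>"
    using * by blast+
  obtain B where "finite_dimensional_vector_space (alg_smult \<iota>) B" using fd by blast
  then interpret V: finite_dimensional_vector_space "alg_smult \<iota>" B .
  obtain b where b: "b \<subseteq> \<O>" "V.independent b" "\<O> \<subseteq> V.span b"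
    using V.maximal_independent_subset[of \<O>] by metis
  have "V.span \<O> = UNIV" using ord by (simp add: is_order_def)
  then have spanb: "V.span b = UNIV"
    using V.span_mono[OF b(3)] unfolding V.span_span by auto
  have finb: "finite b" using V.finiteI_independent[OF b(2)] .
  have cardb: "card b = V.dim UNIV"
    using V.basis_card_eq_dim[of b UNIV] b spanb by simp
  let ?r = "V.representation b"
  have rep: "x = (\<Sum>v\<in>b. \<iota> (?r x v) * v)" for x
    using V.sum_representation_eq[OF b(2), of x b] finb spanb by (simp add: alg_smult_def)
  have radd: "?r (x + y) v = ?r x v + ?r y v" for x y v
    by (subst V.representation_add[OF b(2)]) (simp_all add: spanb)
  have rscale: "?r (\<iota> a * x) v = a * ?r x v" for a x v
    unfolding alg_smult_def[of \<iota> a x, symmetric] by (subst V.representation_scale[OF b(2)]) (simp_all add: spanb)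
  have rzero: "?r 0 v = 0" for v using rscale[of 0 0 v] by simp
  have rsum: "?r (\<Sum>g\<in>G. h g) v = (\<Sum>g\<in>G. ?r (h g) v)" if "finite G" for G and h :: "'a \<Rightarrow> 'a" and v
    using that by (induction G rule: finite_induct) (simp_all add: radd rzero)
  have isum: "\<iota> (\<Sum>e\<in>G. h e) = (\<Sum>e\<in>G. \<iota> (h e))" if "finite G" for G and h :: "'k \<Rightarrow> 'k"
    using that by (induction G rule: finite_induct) (simp_all add: center_embeddingD[OF \<iota>])
  \<comment> \<open>Pairs as indices make the cardinality immediate, whether or not distinct pairs
    have distinct products.\<close>
  define I where "I = E \<times> b"
  define u where "u = (\<lambda>(e, v). \<iota> e * v)"
  define c where "c x = (\<lambda>(e, v). \<kappa> (?r x v) e)" for x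
  obtain G where G: "finite G" "\<O> = {\<Sum>g\<in>G. alg_smult \<iota> (a g) g | a. \<forall>g\<in>G. a g \<in> \<O>\<^sub>K}"
    using ord by (auto simp: is_order_def)
  have zeroO: "0 \<in> (\<O>\<^sub>K :: 'k set)" using ring[OF one one] by simp
  have addO: "x + y \<in> \<O>\<^sub>K" if "x \<in> \<O>\<^sub>K" "y \<in> \<O>\<^sub>K" for x y :: 'k
    using ring[OF that(1)] ring[OF zeroO that(2)] by (metis diff_0 diff_minus_eq_add)
  have sumO: "(\<Sum>e\<in>A. h e) \<in> \<O>\<^sub>K" if "finite A" "\<And>e. e \<in> A \<Longrightarrow> h e \<in> \<O>\<^sub>K" for A and h :: "'a \<Rightarrow> 'k"
    using that by (induction A rule: finite_induct) (auto simp: zeroO addO)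
  have natO: "of_nat z \<in> (\<O>\<^sub>K :: 'k set)" for z by (simp add: ring_of_integers_def int_imp_algebraic_int)
  have "\<exists>D::nat. D > 0 \<and> (\<forall>x\<in>X. of_nat D * x \<in> \<O>\<^sub>K)" if "finite X" for X :: "'k set"
    using that
  proof (induction X rule: finite_induct)
    case (insert x X)
    then obtain D :: nat where D: "D > 0" "\<And>x. x \<in> X \<Longrightarrow> of_nat D * x \<in> \<O>\<^sub>K" by blast
    obtain D' :: nat where D': "D' > 0" "of_nat D' * x \<in> \<O>\<^sub>K"
      using algebraic_imp_multiple_algebraic_int[OF number_field_algebraic[OF nf], of x]
      by (auto simp: ring_of_integers_def)
    show ?case
    proof (intro exI[of _ "D * D'"] conjI ballI)
      fix y assume "y \<in> insert x X"
      then show "of_nat (D * D') * y \<in> \<O>\<^sub>K"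
      proof
        assume "y = x"
        then have *: "of_nat (D * D') * y = of_nat D * (of_nat D' * x)" by (simp add: mult.assoc)
        show ?thesis unfolding * using ring[OF natO D'(2)] by blast
      next
        assume "y \<in> X"
        have *: "of_nat (D * D') * y = of_nat D' * (of_nat D * y)" by (simp add: mult_ac)
        show ?thesis unfolding * using ring[OF natO D(2)[OF \<open>y \<in> X\<close>]] by blast
      qed
    qed (use D D' in simp)
  qed (auto intro: exI[of _ 1])
  from this[of "(\<lambda>(g, v). ?r g v) ` (G \<times> b)"] obtain D :: nat where D: "D > 0"
    "\<And>g v. g \<in> G \<Longrightarrow> v \<in> b \<Longrightarrow> of_nat D * ?r g v \<in> \<O>\<^sub>K" using G(1) finb by auto
  have den: "of_nat (M * D) * c y i \<in> \<int>" if y: "y \<in> \<O>" and i: "i \<in> I" for y i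
  proof -
    obtain e v where ev: "i = (e, v)" "e \<in> E" "v \<in> b" using i by (auto simp: I_def)
    obtain a where a: "y = (\<Sum>g\<in>G. \<iota> (a g) * g)" "\<And>g. g \<in> G \<Longrightarrow> a g \<in> \<O>\<^sub>K"
      using y by (auto simp: G(2) alg_smult_def)
    have "of_nat D * ?r y v = (\<Sum>g\<in>G. a g * (of_nat D * ?r g v))"
      unfolding a(1) rsum[OF G(1)] rscale by (simp add: sum_distrib_left mult.left_commute)
    also have "\<dots> \<in> \<O>\<^sub>K" using ring a(2) D(2) ev(3) by (intro sumO G(1)) blast
    finally have "of_nat M * \<kappa> (of_nat D * ?r y v) e \<in> \<int>" using M(2) ev(2) by blast
    moreover have "\<kappa> (of_nat D * ?r y v) e = of_nat D * \<kappa> (?r y v) e"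
      using k(3)[of "of_nat D" "?r y v" e] by simp
    ultimately show ?thesis by (simp add: ev(1) c_def mult.assoc)
  qed
  have rep': "x = (\<Sum>i\<in>I. rat_smult (c x i) (u i))" for x
  proof -
    have "x = (\<Sum>v\<in>b. \<iota> (?r x v) * v)" by (rule rep)
    also have "\<dots> = (\<Sum>v\<in>b. \<Sum>e\<in>E. \<iota> (of_rat (\<kappa> (?r x v) e)) * (\<iota> e * v))"
    proof (rule sum.cong[OF refl])
      fix v
      have "\<iota> (?r x v) = \<iota> (\<Sum>e\<in>E. of_rat (\<kappa> (?r x v) e) * e)" by (rule arg_cong[OF k(1)])
      also have "\<dots> = (\<Sum>e\<in>E. \<iota> (of_rat (\<kappa> (?r x v) e)) * \<iota> e)"
        by (simp only: isum[OF E(1)] center_embeddingD(3)[OF \<iota>])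
      finally show "\<iota> (?r x v) * v = (\<Sum>e\<in>E. \<iota> (of_rat (\<kappa> (?r x v) e)) * (\<iota> e * v))"
        by (simp add: sum_distrib_right mult.assoc)
    qed
    also have "\<dots> = (\<Sum>e\<in>E. \<Sum>v\<in>b. \<iota> (of_rat (\<kappa> (?r x v) e)) * (\<iota> e * v))" by (rule sum.swap)
    also have "\<dots> = (\<Sum>(e, v)\<in>I. \<iota> (of_rat (\<kappa> (?r x v) e)) * (\<iota> e * v))"
      unfolding I_def by (rule sum.cartesian_product)
    finally show ?thesis by (simp add: c_def u_def rat_smult_center[OF \<iota>] case_prod_unfold)
  qed
  have cadd: "c (x + y) i = c x i + c y i" for x y i
    by (cases i) (simp add: c_def radd k(2))
  have cscale: "c (rat_smult r x) i = r * c x i" for r x i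
    by (cases i) (simp add: c_def rat_smult_center[OF \<iota>] rscale k(3))
  have usub: "u ` I \<subseteq> \<O>"
  proof -
    have "alg_smult \<iota> e v \<in> \<O>" if "e \<in> E" "v \<in> b" for e v
      using ord that E(2) b(1) unfolding is_order_def by blast
    then show ?thesis by (auto simp: I_def u_def alg_smult_def)
  qed
  have finI: "finite I" and cardI: "card I = rat_degree TYPE('k) * V.dim UNIV"
    using E finb cardb by (simp_all add: I_def card_cartesian_product)
  have MD: "M * D > 0" using M D by simp
  show ?thesis
    by (intro exI[of _ I] exI[of _ u] exI[of _ c] exI[of _ "M * D"] conjI allI ballI
          finI cardI usub rep' cadd cscale MD den) assumption+
qed

section \<open>Primes and residue fields\<close>

locale prime_of_integers =
  fixes \<pp> :: "'k::field_char_0 set"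
  assumes nf: "number_field TYPE('k)" and prime: "\<pp> \<in> nonzero_primes"
begin

lemma primeideal: "primeideal \<pp> (subring_of \<O>\<^sub>K)" and nonzero: "\<pp> \<noteq> {0}"
  using prime by (auto simp: nonzero_primes_def)

sublocale P: primeideal \<pp> "subring_of \<O>\<^sub>K" by (rule primeideal)

lemma ring_simps [simp]:
  "carrier (subring_of S) = S" "x \<otimes>\<^bsub>subring_of S\<^esub> y = x * y" "x \<oplus>\<^bsub>subring_of S\<^esub> y = x + y"
  "\<one>\<^bsub>subring_of S\<^esub> = 1" "\<zero>\<^bsub>subring_of S\<^esub> = 0"
  by (simp_all add: subring_of_def)

lemma one_O: "1 \<in> (\<O>\<^sub>K :: 'k set)"
  and mult_O: "x \<in> (\<O>\<^sub>K :: 'k set) \<Longrightarrow> y \<in> \<O>\<^sub>K \<Longrightarrow> x * y \<in> \<O>\<^sub>K"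
  and add_O: "x \<in> (\<O>\<^sub>K :: 'k set) \<Longrightarrow> y \<in> \<O>\<^sub>K \<Longrightarrow> x + y \<in> \<O>\<^sub>K"
  using P.one_closed P.m_closed P.a_closed by simp_all

lemma uminus_O:
  assumes "x \<in> (\<O>\<^sub>K :: 'k set)"
  shows "- x \<in> \<O>\<^sub>K"
proof -
  have "\<exists>y\<in>\<O>\<^sub>K. x + y = 0" using P.l_neg[of x] P.a_inv_closed[of x] assms by (metis ring_simps(1,3,5) add.commute)
  then show ?thesis by (metis add_eq_0_iff)
qed

lemma diff_O: "x \<in> (\<O>\<^sub>K :: 'k set) \<Longrightarrow> y \<in> \<O>\<^sub>K \<Longrightarrow> x - y \<in> \<O>\<^sub>K"
  using add_O[OF _ uminus_O] by (metis diff_conv_add_uminus)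

lemma ring_O: "x \<in> (\<O>\<^sub>K :: 'k set) \<Longrightarrow> y \<in> \<O>\<^sub>K \<Longrightarrow> x - y \<in> \<O>\<^sub>K \<and> x * y \<in> \<O>\<^sub>K"
  by (simp add: diff_O mult_O)

lemma int_O: "of_int z \<in> (\<O>\<^sub>K :: 'k set)"
  by (simp add: ring_of_integers_def int_imp_algebraic_int)

lemma nat_O: "of_nat z \<in> (\<O>\<^sub>K :: 'k set)"
  using int_O[of "int z"] by simp

lemma in_O: "x \<in> \<pp> \<Longrightarrow> x \<in> \<O>\<^sub>K"
  using P.a_Hcarr by simp

lemma prime_mult: "x \<in> \<pp> \<Longrightarrow> y \<in> \<O>\<^sub>K \<Longrightarrow> x * y \<in> \<pp>"
  using P.I_r_closed by simp

lemma prime_add: "x \<in> \<pp> \<Longrightarrow> y \<in> \<pp> \<Longrightarrow> x + y \<in> \<pp>"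
  using additive_subgroup.a_closed[OF P.additive_subgroup_axioms] by simp

lemma prime_zero: "0 \<in> \<pp>"
  using additive_subgroup.zero_closed[OF P.additive_subgroup_axioms] by simp

lemma prime_uminus: "x \<in> \<pp> \<Longrightarrow> - x \<in> \<pp>"
  using prime_mult[of x "- 1"] uminus_O[OF one_O] by simp

lemma one_not_in: "1 \<notin> \<pp>"
  using P.one_imp_carrier P.I_notcarr by auto

lemma prime_cases: "x \<in> \<O>\<^sub>K \<Longrightarrow> y \<in> \<O>\<^sub>K \<Longrightarrow> x * y \<in> \<pp> \<Longrightarrow> x \<in> \<pp> \<or> y \<in> \<pp>"
  using P.I_prime by simp

lemma nat_in_prime_factor:
  assumes "of_nat n \<in> \<pp>" "n > 0"
  shows "\<exists>p::nat. Factorial_Ring.prime p \<and> of_nat p \<in> \<pp>"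
  using assms
proof (induction n rule: less_induct)
  case (less n)
  have "n \<noteq> 1" using less.prems one_not_in by auto
  then obtain p where p: "Factorial_Ring.prime p" "p dvd n" using prime_factor_nat by blast
  then obtain m where m: "n = p * m" by (auto simp: dvd_def)
  have "of_nat p * of_nat m \<in> \<pp>" using less.prems m by simp
  then have "of_nat p \<in> \<pp> \<or> of_nat m \<in> \<pp>" using prime_cases nat_O by blast
  moreover have "m < n" "m > 0" using m less.prems prime_gt_1_nat[OF p(1)] by auto
  ultimately show ?case using p(1) less.IH by blast
qed

lemma poly_O:
  assumes "\<And>i. coeff Q i \<in> \<int>" "y \<in> \<O>\<^sub>K"
  shows "poly Q y \<in> (\<O>\<^sub>K :: 'k set)"
  using assms(1)
proof (induction Q)
  case 0
  show ?case using int_O[of 0] by simp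
next
  case (pCons a Q)
  have "a \<in> \<int>" using pCons.prems[of 0] by simp
  then have "a \<in> \<O>\<^sub>K" using int_O by (auto elim: Ints_cases)
  moreover have "poly Q y \<in> \<O>\<^sub>K" using pCons.IH pCons.prems[of "Suc _"] by simp
  ultimately show ?case using assms(2) by (simp add: add_O mult_O)
qed

text \<open>Cancelling powers of the variable from an integral equation of a nonzero
  \<open>y\<close> in the ideal leaves a nonzero constant term. It is an integer divisible by
  \<open>y\<close> in \<open>\<O>\<^sub>K\<close>, hence in the ideal, and so is one of its prime
  factors.\<close>

lemma prime_exists: "\<exists>p::nat. Factorial_Ring.prime p \<and> of_nat p \<in> \<pp>"
proof -
  obtain y where y: "y \<in> \<pp>" "y \<noteq> 0" using nonzero prime_zero by blast
  then have yO: "y \<in> \<O>\<^sub>K" by (simp add: in_O)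
  then obtain P where P: "lead_coeff P = 1" "\<And>i. coeff P i \<in> \<int>" "poly P y = 0"
    by (auto simp: ring_of_integers_def algebraic_int.simps)
  have "P \<noteq> 0" using P(1) by auto
  have "\<exists>Q. Q \<noteq> 0 \<and> (\<forall>i. coeff Q i \<in> \<int>) \<and> poly Q y = 0 \<and> coeff Q 0 \<noteq> 0"
    using \<open>P \<noteq> 0\<close> P(2,3)
  proof (induction P)
    case (pCons a Q)
    show ?case
    proof (cases "a = 0")
      case True
      then have "poly Q y = 0" "Q \<noteq> 0" using pCons.prems y by auto
      moreover have "coeff Q i \<in> \<int>" for i using pCons.prems(2)[of "Suc i"] by simp
      ultimately show ?thesis using pCons.IH by blast
    next
      case False
      then show ?thesis using pCons.prems by (intro exI[of _ "pCons a Q"]) auto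
    qed
  qed simp
  then obtain Q where Q: "\<And>i. coeff Q i \<in> \<int>" "poly Q y = 0" "coeff Q 0 \<noteq> 0" by blast
  obtain a Q' where aQ: "Q = pCons a Q'" by (cases Q)
  have "poly Q' y \<in> \<O>\<^sub>K"
    by (rule poly_O[OF _ yO]) (use Q(1)[of "Suc _"] in \<open>simp add: aQ\<close>)
  then have "y * poly Q' y \<in> \<pp>" using y(1) by (intro prime_mult)
  moreover have "a = - (y * poly Q' y)" using Q(2) by (simp add: aQ eq_neg_iff_add_eq_0)
  ultimately have "a \<in> \<pp>" using prime_uminus by simp
  moreover obtain z where z: "a = of_int z" using Q(1)[of 0] by (auto simp: aQ elim: Ints_cases)
  moreover have "z \<noteq> 0" using Q(3) z by (auto simp: aQ)
  ultimately have "of_nat (nat \<bar>z\<bar>) \<in> \<pp>"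
    using prime_uminus[of "of_int z"] by (cases "z \<ge> 0") (simp_all add: of_nat_nat)
  then show ?thesis using nat_in_prime_factor[of "nat \<bar>z\<bar>"] \<open>z \<noteq> 0\<close> by simp
qed

lemma coprime_not_both:
  assumes "of_int a \<in> \<pp>" "of_int b \<in> \<pp>"
  shows "\<not> Rings.coprime a b"
proof
  assume "Rings.coprime a b"
  then obtain x y where "x * a + y * b = 1" by (metis bezout_int coprime_imp_gcd_eq_1)
  then have "of_int a * of_int x + of_int b * of_int y = (1 :: 'k)"
    by (metis mult.commute of_int_1 of_int_add of_int_mult)
  moreover have "of_int a * of_int x + of_int b * of_int y \<in> \<pp>"
    using assms by (intro prime_add prime_mult int_O)
  ultimately show False using one_not_in by simp
qed

text \<open>The description in \<open>prime_below\<close> is meaningful since two distinct prime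
  numbers in the ideal would put 1 into it.\<close>

lemma prime_below_prime: "Factorial_Ring.prime (prime_below \<pp>)" "of_nat (prime_below \<pp>) \<in> \<pp>"
proof -
  obtain p :: nat where p: "Factorial_Ring.prime p" "of_nat p \<in> \<pp>" using prime_exists by blast
  have "prime_below \<pp> = p"
    unfolding prime_below_def
  proof (rule the_equality)
    fix r assume r: "Factorial_Ring.prime r \<and> of_nat r \<in> \<pp>"
    show "r = p"
    proof (rule ccontr)
      assume "r \<noteq> p"
      then have "Rings.coprime r p" using r p by (simp add: primes_coprime)
      then have "Rings.coprime (int r) (int p)" by simp
      then show False using coprime_not_both[of "int r" "int p"] r p by simp
    qed
  qed (use p in simp)
  then show "Factorial_Ring.prime (prime_below \<pp>)" "of_nat (prime_below \<pp>) \<in> \<pp>" using p by auto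
qed

lemma coset_eq_iff:
  assumes "x \<in> \<O>\<^sub>K" "y \<in> \<O>\<^sub>K"
  shows "\<pp> +>\<^bsub>subring_of \<O>\<^sub>K\<^esub> x = \<pp> +>\<^bsub>subring_of \<O>\<^sub>K\<^esub> y \<longleftrightarrow> x - y \<in> \<pp>"
proof -
  have coset: "\<pp> +>\<^bsub>subring_of \<O>\<^sub>K\<^esub> x = (\<lambda>h. h + x) ` \<pp>" for x
    by (auto simp: a_r_coset_def r_coset_def subring_of_def)
  show ?thesis
  proof
    assume "\<pp> +>\<^bsub>subring_of \<O>\<^sub>K\<^esub> x = \<pp> +>\<^bsub>subring_of \<O>\<^sub>K\<^esub> y"
    then have "(\<lambda>h. h + x) ` \<pp> = (\<lambda>h. h + y) ` \<pp>" by (simp add: coset)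
    moreover have "x \<in> (\<lambda>h. h + x) ` \<pp>" using prime_zero by (intro image_eqI[of _ _ 0]) auto
    ultimately have "x \<in> (\<lambda>h. h + y) ` \<pp>" by simp
    then show "x - y \<in> \<pp>" by auto
  next
    assume *: "x - y \<in> \<pp>"
    have "(\<lambda>h. h + x) ` \<pp> = (\<lambda>h. h + y) ` \<pp>"
    proof (intro equalityI image_subsetI)
      fix h assume "h \<in> \<pp>"
      then show "h + x \<in> (\<lambda>h. h + y) ` \<pp>" using prime_add[OF _ *] by (intro image_eqI[of _ _ "h + (x - y)"]) auto
    next
      fix h assume "h \<in> \<pp>"
      then show "h + y \<in> (\<lambda>h. h + x) ` \<pp>" using prime_add[OF _ prime_uminus[OF *]]
        by (intro image_eqI[of _ _ "h + - (x - y)"]) auto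
    qed
    then show "\<pp> +>\<^bsub>subring_of \<O>\<^sub>K\<^esub> x = \<pp> +>\<^bsub>subring_of \<O>\<^sub>K\<^esub> y" by (simp add: coset)
  qed
qed

lemma carrier_residue_field: "carrier (residue_field \<pp>) = (\<lambda>x. \<pp> +>\<^bsub>subring_of \<O>\<^sub>K\<^esub> x) ` \<O>\<^sub>K"
  by (auto simp: residue_field_def FactRing_def A_RCOSETS_def')

text \<open>With \<open>p\<close> the prime number below: the \<open>M\<close>-fold coordinates are
  integers, and if those of \<open>x\<close> and \<open>y\<close> agree modulo \<open>M p\<close>,
  then \<open>x - y\<close> is \<open>p\<close> times an integral combination of \<open>E\<close>,
  hence in the ideal. So the cosets are no more numerous than the tuples of residues.\<close>

lemma finite_residue_field: "finite (carrier (residue_field \<pp>))"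
proof -
  let ?p = "prime_below \<pp>" and ?h = "\<lambda>x. \<pp> +>\<^bsub>subring_of \<O>\<^sub>K\<^esub> x"
  have nfs: "\<exists>(E :: 'k set) \<kappa> (M :: nat). finite E \<and> E \<subseteq> \<O>\<^sub>K \<and> card E = rat_degree TYPE('k) \<and>
    (\<forall>x. x = (\<Sum>e\<in>E. of_rat (\<kappa> x e) * e)) \<and> (\<forall>x y e. \<kappa> (x + y) e = \<kappa> x e + \<kappa> y e) \<and>
    (\<forall>r x e. \<kappa> (of_rat r * x) e = r * \<kappa> x e) \<and>
    M > 0 \<and> (\<forall>y\<in>\<O>\<^sub>K. \<forall>e\<in>E. of_nat M * \<kappa> y e \<in> \<int>)"
    by (rule number_field_structure) (use nf one_O ring_O in blast)+
  obtain E :: "'k set" and \<kappa> :: "'k \<Rightarrow> 'k \<Rightarrow> rat" and M :: nat where *: "finite E \<and> E \<subseteq> \<O>\<^sub>K \<and> card E = rat_degree TYPE('k) \<and>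
    (\<forall>x. x = (\<Sum>e\<in>E. of_rat (\<kappa> x e) * e)) \<and> (\<forall>x y e. \<kappa> (x + y) e = \<kappa> x e + \<kappa> y e) \<and>
    (\<forall>r x e. \<kappa> (of_rat r * x) e = r * \<kappa> x e) \<and>
    M > 0 \<and> (\<forall>y\<in>\<O>\<^sub>K. \<forall>e\<in>E. of_nat M * \<kappa> y e \<in> \<int>)"
    using nfs by (elim exE) (rule that)
  have E: "finite E" "E \<subseteq> \<O>\<^sub>K"
    and k: "\<And>x. x = (\<Sum>e\<in>E. of_rat (\<kappa> x e) * e)" "\<And>x y e. \<kappa> (x + y) e = \<kappa> x e + \<kappa> y e"
      "\<And>r x e. \<kappa> (of_rat r * x) e = r * \<kappa> x e"
    and M: "M > 0" "\<And>y e. y \<in> \<O>\<^sub>K \<Longrightarrow> e \<in> E \<Longrightarrow> of_nat M * \<kappa> y e \<in> \<int>"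
    using * by blast+
  have kdiff: "\<kappa> (x - y) e = \<kappa> x e - \<kappa> y e" for x y e
    using k(2)[of "x - y" y e] by simp
  define g where "g y = (\<lambda>e\<in>E. \<lfloor>of_nat M * \<kappa> y e\<rfloor> mod int (M * ?p))" for y
  have gfin: "finite (g ` \<O>\<^sub>K)"
  proof (rule finite_subset)
    have "int (M * ?p) > 0" using M prime_gt_0_nat[OF prime_below_prime(1)] by simp
    then show "g ` \<O>\<^sub>K \<subseteq> (\<Pi>\<^sub>E e\<in>E. {0..<int (M * ?p)})" by (auto simp: g_def)
    show "finite (\<Pi>\<^sub>E e\<in>E. {0..<int (M * ?p)})" using E(1) by (intro finite_PiE) auto
  qed
  have geq: "?h x = ?h y" if xy: "x \<in> \<O>\<^sub>K" "y \<in> \<O>\<^sub>K" "g x = g y" for x y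
  proof -
    have "\<exists>w. \<kappa> (x - y) e = of_nat ?p * of_int w" if e: "e \<in> E" for e
    proof -
      obtain a where a: "of_nat M * \<kappa> x e = of_int a" using M(2)[OF xy(1) e] by (auto elim: Ints_cases)
      obtain b where b: "of_nat M * \<kappa> y e = of_int b" using M(2)[OF xy(2) e] by (auto elim: Ints_cases)
      have "a mod int (M * ?p) = b mod int (M * ?p)"
        using fun_cong[OF xy(3), of e] e by (simp add: g_def a b)
      then obtain w where w: "a - b = int (M * ?p) * w" by (auto simp: mod_eq_dvd_iff dvd_def)
      have "of_nat M * \<kappa> (x - y) e = of_int (a - b)" by (simp add: kdiff right_diff_distrib a b)
      also have "\<dots> = of_nat M * (of_nat ?p * of_int w)" unfolding w by simp
      finally show ?thesis using M(1) by auto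
    qed
    then obtain w where w: "\<And>e. e \<in> E \<Longrightarrow> \<kappa> (x - y) e = of_nat ?p * of_int (w e)" by metis
    have "x - y = (\<Sum>e\<in>E. of_rat (\<kappa> (x - y) e) * e)" by (rule k(1))
    also have "\<dots> = (\<Sum>e\<in>E. of_nat ?p * (of_int (w e) * e))"
      by (rule sum.cong) (simp_all add: w of_rat_mult)
    also have "\<dots> \<in> \<pp>"
    proof -
      have *: "of_nat ?p * (of_int (w e) * e) \<in> \<pp>" if "e \<in> E" for e
        using that E(2) by (intro prime_mult prime_below_prime mult_O int_O) auto
      have "(\<Sum>e\<in>A. h e) \<in> \<pp>" if "finite A" "\<And>e. e \<in> A \<Longrightarrow> h e \<in> \<pp>" for A and h :: "'k \<Rightarrow> 'k"
        using that by (induction A rule: finite_induct) (auto simp: prime_zero prime_add)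
      from this[OF E(1) *] show ?thesis .
    qed
    finally show ?thesis using coset_eq_iff[OF xy(1,2)] by simp
  qed
  have "?h ` \<O>\<^sub>K \<subseteq> (\<lambda>z. ?h (SOME y. y \<in> \<O>\<^sub>K \<and> g y = z)) ` (g ` \<O>\<^sub>K)"
  proof (rule image_subsetI)
    fix x :: 'k assume x: "x \<in> \<O>\<^sub>K"
    let ?y = "SOME y. y \<in> \<O>\<^sub>K \<and> g y = g x"
    have "?y \<in> \<O>\<^sub>K \<and> g ?y = g x" by (rule someI[of _ x]) (use x in simp)
    then have "?h x = ?h ?y" using x by (intro geq) auto
    then show "?h x \<in> (\<lambda>z. ?h (SOME y. y \<in> \<O>\<^sub>K \<and> g y = z)) ` (g ` \<O>\<^sub>K)"
      using x by (intro image_eqI[of _ _ "g x"]) auto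
  qed
  then show ?thesis unfolding carrier_residue_field by (rule finite_subset[OF _ finite_imageI[OF gfin]])
qed

lemma field_residue_field: "field (residue_field \<pp>)"
proof -
  interpret R: domain "residue_field \<pp>" unfolding residue_field_def by (rule P.quotient_is_domain)
  have "x \<in> Units (residue_field \<pp>)" if x: "x \<in> carrier (residue_field \<pp>)" "x \<noteq> \<zero>\<^bsub>residue_field \<pp>\<^esub>" for x
  proof -
    let ?m = "\<lambda>y. x \<otimes>\<^bsub>residue_field \<pp>\<^esub> y"
    have "inj_on ?m (carrier (residue_field \<pp>))"
      by (rule inj_onI) (use x R.m_lcancel in blast)
    then have "?m ` carrier (residue_field \<pp>) = carrier (residue_field \<pp>)"
      using finite_residue_field x by (intro endo_inj_surj) auto
    then obtain y where "y \<in> carrier (residue_field \<pp>)" "?m y = \<one>\<^bsub>residue_field \<pp>\<^esub>"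
      using R.one_closed by (metis imageE)
    moreover from this have "y \<otimes>\<^bsub>residue_field \<pp>\<^esub> x = \<one>\<^bsub>residue_field \<pp>\<^esub>"
      using x R.m_comm by simp
    ultimately show ?thesis unfolding Units_def using x by blast
  qed
  moreover have "\<zero>\<^bsub>residue_field \<pp>\<^esub> \<notin> Units (residue_field \<pp>)" by (simp add: R.zero_not_one Units_def)
  ultimately have "Units (residue_field \<pp>) = carrier (residue_field \<pp>) - {\<zero>\<^bsub>residue_field \<pp>\<^esub>}"
    using R.Units_closed by blast
  then show ?thesis by (rule R.cring_fieldI)
qed

lemma finite_field_residue_field: "finite_field (residue_field \<pp>)"
  by (rule finite_field.intro[OF field_residue_field finite_field_axioms.intro[OF finite_residue_field]])

text \<open>The numbers \<open>0, ..., p - 1\<close> lie in distinct cosets. Hence \<open>q\<close>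
  tends to infinity along the family.\<close>

lemma residue_card_ge: "prime_below \<pp> \<le> residue_card \<pp>"
proof -
  let ?p = "prime_below \<pp>"
  have "inj_on (\<lambda>j. \<pp> +>\<^bsub>subring_of \<O>\<^sub>K\<^esub> of_nat j) {..<?p}"
  proof (rule inj_onI)
    fix i j assume ij: "i \<in> {..<?p}" "j \<in> {..<?p}"
      and "\<pp> +>\<^bsub>subring_of \<O>\<^sub>K\<^esub> of_nat i = \<pp> +>\<^bsub>subring_of \<O>\<^sub>K\<^esub> of_nat j"
    then have "of_nat i - of_nat j \<in> \<pp>" using coset_eq_iff[OF nat_O nat_O] by simp
    then have in_p: "of_int (int i - int j) \<in> \<pp>" by simp
    show "i = j"
    proof (rule ccontr)
      assume "i \<noteq> j"
      have "\<not> int ?p dvd (int i - int j)"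
      proof
        assume "int ?p dvd (int i - int j)"
        then have "int ?p \<le> \<bar>int i - int j\<bar>" using \<open>i \<noteq> j\<close> by (intro dvd_imp_le_int[of "int i - int j" "int ?p", simplified]) auto
        then show False using ij by auto
      qed
      then have "Rings.coprime (int ?p) (int i - int j)"
        using prime_below_prime(1) by (intro prime_imp_coprime) auto
      then show False using coprime_not_both[of "int ?p" "int i - int j"] prime_below_prime(2) in_p by simp
    qed
  qed
  then have "card {..<?p} \<le> card (carrier (residue_field \<pp>))"
    by (rule card_inj_on_le) (auto simp: carrier_residue_field nat_O finite_residue_field[unfolded carrier_residue_field])
  then show ?thesis by (simp add: residue_card_def)
qed

end

section \<open>Reduction modulo a prime\<close>

lemma ring_subring_of:
  fixes S :: "'a::ring_1 set"
  assumes one: "1 \<in> S" and diff: "\<And>x y. x \<in> S \<Longrightarrow> y \<in> S \<Longrightarrow> x - y \<in> S"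
    and mult: "\<And>x y. x \<in> S \<Longrightarrow> y \<in> S \<Longrightarrow> x * y \<in> S"
  shows "ring (subring_of S)"
proof -
  have zero: "0 \<in> S" using diff[OF one one] by simp
  have neg: "- x \<in> S" if "x \<in> S" for x using diff[OF zero that] by simp
  have add: "x + y \<in> S" if "x \<in> S" "y \<in> S" for x y using diff[OF that(1) neg[OF that(2)]] by simp
  have ex: "\<exists>y\<in>S. x + y = 0" if "x \<in> S" for x using neg[OF that] by (intro bexI[of _ "- x"]) auto
  show ?thesis
  proof (rule ringI)
    show "abelian_group (subring_of S)"
      by (rule abelian_groupI) (simp_all add: subring_of_def zero add ex add.assoc add.commute)
    show "Group.monoid (subring_of S)"
      by (rule Group.monoidI) (simp_all add: subring_of_def one mult mult.assoc)
  qed (simp_all add: subring_of_def distrib_left distrib_right)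
qed

section \<open>Coordinates and left ideals of an order\<close>

text \<open>Bundles the data of \<open>order_structure\<close>, which are the same for all
  primes.\<close>

locale order_coords =
  fixes \<iota> :: "'k::field_char_0 \<Rightarrow> 'a::{division_ring,ring_char_0}" and \<O> :: "'a set"
    and I :: "'i set" and u :: "'i \<Rightarrow> 'a" and c :: "'a \<Rightarrow> 'i \<Rightarrow> rat" and M :: nat
  assumes center: "center_embedding \<iota>" and order: "is_order \<iota> \<O>"
    and finI: "finite I" and uO: "i \<in> I \<Longrightarrow> u i \<in> \<O>"
    and rep: "x = (\<Sum>i\<in>I. rat_smult (c x i) (u i))"
    and cadd: "c (x + y) i = c x i + c y i" and cscale: "c (rat_smult r x) i = r * c x i"
    and M: "M > 0" and den: "y \<in> \<O> \<Longrightarrow> i \<in> I \<Longrightarrow> of_nat M * c y i \<in> \<int>"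
begin

lemma one_O: "1 \<in> \<O>" and diff_O: "x \<in> \<O> \<Longrightarrow> y \<in> \<O> \<Longrightarrow> x - y \<in> \<O>"
  and mult_O: "x \<in> \<O> \<Longrightarrow> y \<in> \<O> \<Longrightarrow> x * y \<in> \<O>"
  and smult_O: "a \<in> \<O>\<^sub>K \<Longrightarrow> x \<in> \<O> \<Longrightarrow> \<iota> a * x \<in> \<O>"
  using order unfolding is_order_def alg_smult_def by blast+

lemma zero_O: "0 \<in> \<O>" using diff_O[OF one_O one_O] by simp

lemma uminus_O: "x \<in> \<O> \<Longrightarrow> - x \<in> \<O>" using diff_O[OF zero_O] by fastforce

lemma add_O: "x \<in> \<O> \<Longrightarrow> y \<in> \<O> \<Longrightarrow> x + y \<in> \<O>"
  using diff_O[OF _ uminus_O] by (metis diff_minus_eq_add)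

lemma sum_O: "finite A \<Longrightarrow> (\<And>i. i \<in> A \<Longrightarrow> g i \<in> \<O>) \<Longrightarrow> (\<Sum>i\<in>A. g i) \<in> \<O>"
  by (induction A rule: finite_induct) (auto simp: zero_O add_O)

lemma int_O: "of_int z \<in> \<O>"
proof -
  have "of_nat n \<in> \<O>" for n by (induction n) (auto simp: zero_O one_O add_O)
  then show ?thesis by (cases z rule: int_cases2) (auto simp: uminus_O)
qed

lemma rat_smult_mult: "rat_smult r x * y = rat_smult r (x * y :: 'a)"
  by (simp add: rat_smult_center[OF center] mult.assoc)

lemma rat_smult_mult_right: "x * rat_smult r y = rat_smult r (x * y :: 'a)"
  by (metis rat_smult_center[OF center] center_embeddingD(7)[OF center] mult.assoc)

lemma rat_smult_add_left: "rat_smult (r + s) x = rat_smult r x + rat_smult s (x :: 'a)"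
  by (simp add: rat_smult_center[OF center] center_embeddingD(2)[OF center] of_rat_add distrib_right)

lemma rat_smult_of_int: "rat_smult (of_int z) x = of_int z * (x :: 'a)"
  by (simp add: rat_smult_center[OF center] center_embeddingD(6)[OF center])

lemma c_zero: "c 0 i = 0" using cadd[of 0 0 i] by simp

lemma c_uminus: "c (- x) i = - c x i" using cadd[of x "- x" i] by (simp add: c_zero)

lemma c_diff: "c (x - y) i = c x i - c y i" using cadd[of x "- y" i] by (simp add: c_uminus)

lemma c_sum: "finite A \<Longrightarrow> c (\<Sum>j\<in>A. g j) i = (\<Sum>j\<in>A. c (g j) i)"
  by (induction A rule: finite_induct) (simp_all add: c_zero cadd)

lemma c_eq_0: "(\<And>i. i \<in> I \<Longrightarrow> c x i = 0) \<Longrightarrow> x = 0"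
  by (subst rep) (simp add: rat_smult_def)

text \<open>Stands for the Euclidean length in \<open>A \<otimes> \<real>\<close> but is defined on
  \<open>A\<close> alone; the final proof compares the two by the constant
  \<open>c0\<close>.\<close>

definition nrm :: "'a \<Rightarrow> real" where
  "nrm x = (\<Sum>i\<in>I. \<bar>real_of_rat (c x i)\<bar>)"

lemma nrm_nonneg: "nrm x \<ge> 0" by (simp add: nrm_def sum_nonneg)

lemma c_le_nrm: "i \<in> I \<Longrightarrow> \<bar>real_of_rat (c x i)\<bar> \<le> nrm x"
  unfolding nrm_def using finI by (intro member_le_sum) auto

lemma nrm_ge: "y \<in> \<O> \<Longrightarrow> y \<noteq> 0 \<Longrightarrow> 1 \<le> real M * nrm y"
proof -
  assume y: "y \<in> \<O>" "y \<noteq> 0"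
  then obtain i where i: "i \<in> I" "c y i \<noteq> 0" using c_eq_0 by blast
  have "of_nat M * c y i \<noteq> 0" using i M by simp
  then have "1 \<le> \<bar>of_nat M * c y i\<bar>" using den[OF y(1) i(1)] Ints_nonzero_abs_ge1 by blast
  then have "real_of_rat 1 \<le> real_of_rat \<bar>of_nat M * c y i\<bar>" by (simp only: of_rat_less_eq)
  also have "\<dots> = real M * \<bar>real_of_rat (c y i)\<bar>" by (simp add: abs_mult of_rat_mult)
  also have "\<dots> \<le> real M * nrm y" by (intro mult_left_mono c_le_nrm i) auto
  finally show ?thesis by simp
qed

text \<open>
  \<open>Z\<close> represents the cosets of \<open>\<O> y\<close> in \<open>\<O>\<close>: the integral parts of the coordinates of \<open>x / y\<close> can be removed.
\<close>

lemma left_ideal_index_bound: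
  obtains C where "C > 0" "\<And>y. y \<in> \<O> \<Longrightarrow> y \<noteq> 0 \<Longrightarrow> \<exists>Z. finite Z \<and> Z \<subseteq> \<O> \<and>
     real (card Z) \<le> (C * nrm y) ^ card I \<and> (\<forall>x\<in>\<O>. \<exists>z\<in>Z. \<exists>w\<in>\<O>. x = z + w * y)"
proof -
  define C1 where "C1 = (\<Sum>i\<in>I. \<Sum>j\<in>I. nrm (u i * u j))"
  have C1: "C1 \<ge> 0" unfolding C1_def by (intro sum_nonneg nrm_nonneg)
  have c_uy: "(\<Sum>i\<in>I. \<bar>real_of_rat (c (u i * y) l)\<bar>) \<le> C1 * nrm y" if l: "l \<in> I" for y l
  proof -
    have "\<bar>real_of_rat (c (u i * y) l)\<bar> \<le> (\<Sum>j\<in>I. nrm (u i * u j)) * nrm y" if i: "i \<in> I" for i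
    proof -
      have "u i * y = u i * (\<Sum>j\<in>I. rat_smult (c y j) (u j))" by (rule arg_cong[OF rep])
      then have "u i * y = (\<Sum>j\<in>I. rat_smult (c y j) (u i * u j))"
        by (simp only: sum_distrib_left rat_smult_mult_right)
      then have "c (u i * y) l = (\<Sum>j\<in>I. c y j * c (u i * u j) l)"
        by (simp only: c_sum[OF finI] cscale)
      then have "\<bar>real_of_rat (c (u i * y) l)\<bar> = \<bar>\<Sum>j\<in>I. real_of_rat (c y j) * real_of_rat (c (u i * u j) l)\<bar>"
        by (simp add: of_rat_sum of_rat_mult)
      also have "\<dots> \<le> (\<Sum>j\<in>I. \<bar>real_of_rat (c y j) * real_of_rat (c (u i * u j) l)\<bar>)" by (rule sum_abs)
      also have "\<dots> \<le> (\<Sum>j\<in>I. nrm y * nrm (u i * u j))"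
        unfolding abs_mult using l by (intro sum_mono mult_mono c_le_nrm nrm_nonneg) auto
      finally show ?thesis by (simp add: sum_distrib_left mult.commute)
    qed
    then have "(\<Sum>i\<in>I. \<bar>real_of_rat (c (u i * y) l)\<bar>) \<le> (\<Sum>i\<in>I. (\<Sum>j\<in>I. nrm (u i * u j)) * nrm y)"
      by (rule sum_mono)
    then show ?thesis by (simp add: C1_def sum_distrib_right)
  qed
  \<comment> \<open>The first term bounds \<open>2 B\<close>, and the second absorbs the 1 in the
    count \<open>2 B + 1\<close> of integers in \<open>{-B..B}\<close>, by
    \<open>nrm_ge\<close>.\<close>
  define C where "C = 2 * real M * C1 + real M"
  have "C > 0" using C1 M by (simp add: C_def add_nonneg_pos)
  moreover have "\<exists>Z. finite Z \<and> Z \<subseteq> \<O> \<and>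
     real (card Z) \<le> (C * nrm y) ^ card I \<and> (\<forall>x\<in>\<O>. \<exists>z\<in>Z. \<exists>w\<in>\<O>. x = z + w * y)"
    if y: "y \<in> \<O>" "y \<noteq> 0" for y
  proof -
    \<comment> \<open>Cosets may be represented more than once; meeting every coset is enough for an
      upper bound of the index.\<close>
    define Z where "Z = {z \<in> \<O>. \<forall>l\<in>I. \<bar>real_of_rat (c z l)\<bar> \<le> C1 * nrm y}"
    define B where "B = \<lfloor>real M * (C1 * nrm y)\<rfloor>"
    have B0: "B \<ge> 0" unfolding B_def using C1 nrm_nonneg[of y] by simp
    define g where "g z = (\<lambda>l\<in>I. \<lfloor>of_nat M * c z l\<rfloor>)" for z
    have gM: "of_nat M * c z l = of_int (g z l)" if "z \<in> \<O>" "l \<in> I" for z l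
      using den[OF that] that(2) by (auto simp: g_def of_int_floor)
    have gZ: "g ` Z \<subseteq> (\<Pi>\<^sub>E l\<in>I. {-B..B})"
    proof (intro image_subsetI PiE_I)
      fix z l assume z: "z \<in> Z" and l: "l \<in> I"
      have "real_of_int \<bar>g z l\<bar> = \<bar>real_of_rat (of_int (g z l))\<bar>" by simp
      also have "\<dots> = \<bar>real_of_rat (of_nat M * c z l)\<bar>" using gM z l by (simp add: Z_def)
      also have "\<dots> = real M * \<bar>real_of_rat (c z l)\<bar>" by (simp add: of_rat_mult abs_mult)
      also have "\<dots> \<le> real M * (C1 * nrm y)" using z l by (intro mult_left_mono) (auto simp: Z_def)
      finally have "\<bar>g z l\<bar> \<le> B" by (simp add: B_def le_floor_iff)
      then show "g z l \<in> {-B..B}" by auto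
    qed (simp add: g_def)
    have inj: "inj_on g Z"
    proof (rule inj_onI)
      fix z z' assume z: "z \<in> Z" "z' \<in> Z" "g z = g z'"
      have "c (z - z') l = 0" if l: "l \<in> I" for l
      proof -
        have "of_nat M * c z l = of_nat M * c z' l"
          using gM[of z l] gM[of z' l] z l by (simp add: Z_def)
        then show ?thesis using M by (simp add: c_diff)
      qed
      then have "z - z' = 0" by (rule c_eq_0)
      then show "z = z'" by simp
    qed
    have finP: "finite (\<Pi>\<^sub>E l\<in>I. {-B..B})" using finI by (intro finite_PiE) auto
    have finZ: "finite Z" using finite_subset[OF gZ finP] inj by (rule finite_imageD)
    have "card Z = card (g ` Z)" using inj by (simp add: card_image)
    also have "\<dots> \<le> card (\<Pi>\<^sub>E l\<in>I. {-B..B})" by (rule card_mono[OF finP gZ])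
    also have "\<dots> = nat (2 * B + 1) ^ card I" using finI by (simp add: card_PiE)
    finally have "real (card Z) \<le> real (nat (2 * B + 1)) ^ card I" by (simp flip: of_nat_power)
    also have "\<dots> \<le> (C * nrm y) ^ card I"
    proof (rule power_mono)
      have "real (nat (2 * B + 1)) = 2 * real_of_int B + 1" using B0 by simp
      also have "real_of_int B \<le> real M * (C1 * nrm y)" by (simp add: B_def)
      finally have "real (nat (2 * B + 1)) \<le> 2 * (real M * (C1 * nrm y)) + real M * nrm y"
        using nrm_ge[OF y] by linarith
      then show "real (nat (2 * B + 1)) \<le> C * nrm y" by (simp add: C_def algebra_simps)
    qed simp
    finally have cardZ: "real (card Z) \<le> (C * nrm y) ^ card I" .
    have "\<exists>z\<in>Z. \<exists>w\<in>\<O>. x = z + w * y" if x: "x \<in> \<O>" for x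
    proof -
      \<comment> \<open>Division by \<open>y\<close> on the right, as \<open>\<O> y\<close> is a
        left ideal; rounding the coordinates of the quotient down gives \<open>w\<close>.\<close>
      define a where "a = c (x * inverse y)"
      define w where "w = (\<Sum>i\<in>I. of_int \<lfloor>a i\<rfloor> * u i)"
      have w: "w \<in> \<O>" unfolding w_def by (intro sum_O finI mult_O int_O uO)
      have "x = x * inverse y * y" using y(2) by (simp add: mult.assoc)
      also have "\<dots> = (\<Sum>i\<in>I. rat_smult (a i) (u i)) * y"
        unfolding a_def by (rule arg_cong[where f = "\<lambda>z. z * y", OF rep])
      also have "\<dots> = (\<Sum>i\<in>I. rat_smult (a i) (u i * y))"
        by (simp only: sum_distrib_right rat_smult_mult)
      finally have xa: "x = (\<Sum>i\<in>I. rat_smult (a i) (u i * y))" .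
      have "w * y = (\<Sum>i\<in>I. rat_smult (of_int \<lfloor>a i\<rfloor>) (u i * y))"
        by (simp add: w_def sum_distrib_right mult.assoc rat_smult_of_int)
      moreover have "rat_smult (a i) z = rat_smult (frac (a i)) z + rat_smult (of_int \<lfloor>a i\<rfloor>) z" for i and z :: 'a
        using rat_smult_add_left[of "frac (a i)" "of_int \<lfloor>a i\<rfloor>" z] by (simp add: frac_def)
      then have "x = (\<Sum>i\<in>I. rat_smult (frac (a i)) (u i * y)) + (\<Sum>i\<in>I. rat_smult (of_int \<lfloor>a i\<rfloor>) (u i * y))"
        by (subst xa) (simp only: sum.distrib)
      ultimately have z: "x - w * y = (\<Sum>i\<in>I. rat_smult (frac (a i)) (u i * y))"
        by (simp only: add_diff_cancel_right')
      have "\<bar>real_of_rat (c (x - w * y) l)\<bar> \<le> C1 * nrm y" if l: "l \<in> I" for l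
      proof -
        have "c (x - w * y) l = (\<Sum>i\<in>I. frac (a i) * c (u i * y) l)"
          unfolding z c_sum[OF finI] cscale ..
        then have "\<bar>real_of_rat (c (x - w * y) l)\<bar> = \<bar>\<Sum>i\<in>I. real_of_rat (frac (a i)) * real_of_rat (c (u i * y) l)\<bar>"
          by (simp add: of_rat_sum of_rat_mult)
        also have "\<dots> \<le> (\<Sum>i\<in>I. \<bar>real_of_rat (frac (a i)) * real_of_rat (c (u i * y) l)\<bar>)" by (rule sum_abs)
        also have "\<dots> \<le> (\<Sum>i\<in>I. \<bar>real_of_rat (c (u i * y) l)\<bar>)"
        proof (rule sum_mono)
          fix i
          have "real_of_rat (frac (a i)) \<le> real_of_rat 1" using frac_lt_1[of "a i"] by (simp only: of_rat_less_eq)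
          then have "\<bar>real_of_rat (frac (a i))\<bar> \<le> 1" by simp
          then show "\<bar>real_of_rat (frac (a i)) * real_of_rat (c (u i * y) l)\<bar> \<le> \<bar>real_of_rat (c (u i * y) l)\<bar>"
            unfolding abs_mult by (rule mult_left_le_one_le[rotated -1]) auto
        qed
        also have "\<dots> \<le> C1 * nrm y" by (rule c_uy[OF l])
        finally show ?thesis .
      qed
      then have "x - w * y \<in> Z" using x w y(1) by (simp add: Z_def diff_O mult_O)
      moreover have "x = (x - w * y) + w * y" by simp
      ultimately show ?thesis using w by blast
    qed
    then show ?thesis using finZ cardZ by (intro exI[of _ Z]) (auto simp: Z_def)
  qed
  ultimately show ?thesis by (rule that)
qed

end

section \<open>The reduction homomorphism\<close>

locale order_prime = order_coords \<iota> \<O> I u c M + P: prime_of_integers \<pp>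
  for \<iota> :: "'k::field_char_0 \<Rightarrow> 'a::{division_ring,ring_char_0}" and \<O> :: "'a set"
    and I :: "'i set" and u c M and \<pp> :: "'k set" +
  fixes h :: "'a set \<Rightarrow> 'k set ^ 'n::finite ^ 'n"
  assumes h: "h \<in> ring_iso (subring_of \<O> Quot extended_ideal \<iota> \<O> \<pp>) (matrix_ring (residue_field \<pp>))"
begin

abbreviation F :: "'k set ring" where "F \<equiv> residue_field \<pp>"

sublocale FF: finite_field F by (rule P.finite_field_residue_field)

lemma q_eq: "FF.q = residue_card \<pp>" by (simp add: FF.q_def residue_card_def)

definition \<psi> :: "'a \<Rightarrow> 'k set ^ 'n ^ 'n" where
  "\<psi> x = h (extended_ideal \<iota> \<O> \<pp> +>\<^bsub>subring_of \<O>\<^esub> x)"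

text \<open>One factor of the product is only a subset of the center, so absorption is shown by
  induction over the finite sums, where an element of the order is moved past the central factor.
  The ideal property is what makes \<open>\<psi>\<close> a ring homomorphism.\<close>

lemma ideal_extended: "ideal (extended_ideal \<iota> \<O> \<pp>) (subring_of \<O>)"
proof (rule idealI)
  let ?J = "extended_ideal \<iota> \<O> \<pp>" and ?R = "subring_of \<O>"
  show ring: "ring ?R" by (rule ring_subring_of) (simp_all add: one_O diff_O mult_O)
  have Jind: "Q x" if "x \<in> ?J" "\<And>a y. a \<in> \<pp> \<Longrightarrow> y \<in> \<O> \<Longrightarrow> Q (\<iota> a * y)" "\<And>x y. x \<in> ?J \<Longrightarrow> y \<in> ?J \<Longrightarrow> Q x \<Longrightarrow> Q y \<Longrightarrow> Q (x + y)" for Q x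
    using that(1) unfolding extended_ideal_def
  proof (induction rule: ideal_prod.induct)
    case (prod i j)
    then show ?case using that(2) by (auto simp: subring_of_def)
  next
    case (sum s1 s2)
    then show ?case using that(3)[of s1 s2] by (simp add: extended_ideal_def subring_of_def)
  qed
  have Jprod: "\<iota> a * y \<in> ?J" if "a \<in> \<pp>" "y \<in> \<O>" for a y
    unfolding extended_ideal_def using ideal_prod.prod[of "\<iota> a" "\<iota> ` \<pp>" y \<O> ?R] that by (simp add: subring_of_def)
  have Jadd: "x + y \<in> ?J" if "x \<in> ?J" "y \<in> ?J" for x y
    using ideal_prod.sum[of x ?R "\<iota> ` \<pp>" \<O> y] that by (simp add: extended_ideal_def subring_of_def)
  have sub: "?J \<subseteq> \<O>"
  proof
    fix x assume "x \<in> ?J"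
    then show "x \<in> \<O>" by (rule Jind) (simp_all add: smult_O P.in_O add_O)
  qed
  have Jzero: "0 \<in> ?J" using Jprod[OF P.prime_zero zero_O] by simp
  have Jneg: "- x \<in> ?J" if "x \<in> ?J" for x
    using that
  proof (rule Jind)
    fix a y assume ay: "a \<in> \<pp>" "y \<in> \<O>"
    have "- (\<iota> a * y) = \<iota> (- a) * y" by (simp add: center_embeddingD(5)[OF center])
    then show "- (\<iota> a * y) \<in> ?J" using Jprod[OF P.prime_uminus[OF ay(1)] ay(2)] by simp
  next
    fix x y assume "- x \<in> ?J" "- y \<in> ?J"
    then show "- (x + y) \<in> ?J" using Jadd[of "- x" "- y"] by simp
  qed
  interpret R: ring ?R by (rule ring)
  have inv: "\<ominus>\<^bsub>?R\<^esub> x = - x" if "x \<in> \<O>" for x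
    using R.minus_equality[of "- x" x] that by (simp add: subring_of_def uminus_O)
  show "subgroup ?J (add_monoid ?R)"
  proof (rule subgroup.intro)
    show "?J \<subseteq> carrier (add_monoid ?R)" using sub by (simp add: subring_of_def)
    show "x \<otimes>\<^bsub>add_monoid ?R\<^esub> y \<in> ?J" if "x \<in> ?J" "y \<in> ?J" for x y
      using Jadd[OF that] by (simp add: subring_of_def)
    show "\<one>\<^bsub>add_monoid ?R\<^esub> \<in> ?J" using Jzero by (simp add: subring_of_def)
    show "m_inv (add_monoid ?R) x \<in> ?J" if "x \<in> ?J" for x
      using inv[of x] Jneg[OF that] that sub unfolding a_inv_def by auto
  qed
  show "x \<otimes>\<^bsub>?R\<^esub> a \<in> ?J" if a: "a \<in> ?J" and x: "x \<in> carrier ?R" for a x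
  proof -
    have xO: "x \<in> \<O>" using x by (simp add: subring_of_def)
    have "x * a \<in> ?J"
      using a
    proof (rule Jind)
      fix b y assume b: "b \<in> \<pp>" "y \<in> \<O>"
      have "x * (\<iota> b * y) = \<iota> b * (x * y)"
        using center_embeddingD(7)[OF center, of b x] by (simp add: mult.assoc[symmetric])
      then show "x * (\<iota> b * y) \<in> ?J" using Jprod[OF b(1) mult_O[OF xO b(2)]] by simp
    qed (simp add: distrib_left Jadd)
    then show ?thesis by (simp add: subring_of_def)
  qed
  show "a \<otimes>\<^bsub>?R\<^esub> x \<in> ?J" if a: "a \<in> ?J" and x: "x \<in> carrier ?R" for a x
  proof -
    have xO: "x \<in> \<O>" using x by (simp add: subring_of_def)
    have "a * x \<in> ?J"
      using a
    proof (rule Jind)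
      fix b y assume b: "b \<in> \<pp>" "y \<in> \<O>"
      then show "\<iota> b * y * x \<in> ?J" using Jprod[OF b(1) mult_O[OF b(2) xO]] by (simp add: mult.assoc)
    qed (simp add: distrib_right Jadd)
    then show ?thesis by (simp add: subring_of_def)
  qed
qed

lemma psi_hom: "\<psi> \<in> ring_hom (subring_of \<O>) (matrix_ring F)"
proof -
  have "h \<circ> (\<lambda>x. extended_ideal \<iota> \<O> \<pp> +>\<^bsub>subring_of \<O>\<^esub> x) \<in> ring_hom (subring_of \<O>) (matrix_ring F)"
    using ideal.rcos_ring_hom[OF ideal_extended] h by (intro ring_hom_trans) (auto simp: ring_iso_def)
  then show ?thesis by (simp add: \<psi>_def[abs_def] o_def)
qed

lemma psi_closed: "x \<in> \<O> \<Longrightarrow> \<psi> x $ l $ i \<in> carrier F"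
  using ring_hom_closed[OF psi_hom, of x] by (simp add: subring_of_def FF.mem_matrix_ring)

lemma psi_add: "x \<in> \<O> \<Longrightarrow> y \<in> \<O> \<Longrightarrow> \<psi> (x + y) $ l $ i = \<psi> x $ l $ i \<oplus>\<^bsub>F\<^esub> \<psi> y $ l $ i"
  using ring_hom_add[OF psi_hom, of x y] by (simp add: subring_of_def matrix_ring_def)

lemma psi_mult: "x \<in> \<O> \<Longrightarrow> y \<in> \<O> \<Longrightarrow> \<psi> (x * y) $ l $ i = (\<Oplus>\<^bsub>F\<^esub>m\<in>UNIV. \<psi> x $ l $ m \<otimes>\<^bsub>F\<^esub> \<psi> y $ m $ i)"
  using ring_hom_mult[OF psi_hom, of x y] by (simp add: subring_of_def matrix_ring_def)

lemma psi_surj: "\<psi> ` \<O> = carrier (matrix_ring F)"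
proof -
  have "h ` carrier (subring_of \<O> Quot extended_ideal \<iota> \<O> \<pp>) = carrier (matrix_ring F)"
    using h by (auto simp: ring_iso_def bij_betw_def)
  moreover have "carrier (subring_of \<O> Quot extended_ideal \<iota> \<O> \<pp>)
      = (\<lambda>x. extended_ideal \<iota> \<O> \<pp> +>\<^bsub>subring_of \<O>\<^esub> x) ` \<O>"
    by (auto simp: FactRing_def A_RCOSETS_def' subring_of_def)
  ultimately show ?thesis by (simp add: \<psi>_def[abs_def] image_image)
qed

definition \<rho> :: "'a \<Rightarrow> 'n \<Rightarrow> 'n \<Rightarrow> 'k set" where
  "\<rho> y l i = \<psi> y $ l $ i"

lemma rho_vecs: "y \<in> \<O> \<Longrightarrow> \<rho> y l \<in> FF.vecs"
  by (simp add: \<rho>_def FF.vecs_def psi_closed)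

lemma rho_add: "x \<in> \<O> \<Longrightarrow> y \<in> \<O> \<Longrightarrow> \<rho> (x + y) l = FF.vadd (\<rho> x l) (\<rho> y l)"
  by (simp add: \<rho>_def FF.vadd_def fun_eq_iff psi_add)

lemma rho_mult: "x \<in> \<O> \<Longrightarrow> y \<in> \<O> \<Longrightarrow> \<rho> (x * y) l = FF.LC UNIV (\<rho> x l) (\<rho> y)"
  by (simp add: \<rho>_def FF.LC_def fun_eq_iff psi_mult)

lemma rho_surj:
  assumes "\<And>l. v l \<in> FF.vecs"
  shows "\<exists>x\<in>\<O>. \<rho> x = v"
proof -
  have "(\<chi> l i. v l i) \<in> carrier (matrix_ring F)" using assms by (simp add: FF.mem_matrix_ring FF.vecsD)
  then obtain x where "x \<in> \<O>" "\<psi> x = (\<chi> l i. v l i)" using psi_surj by (metis imageE)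
  then show ?thesis by (intro bexI[of _ x]) (simp_all add: \<rho>_def fun_eq_iff)
qed

text \<open>
  If \<open>\<psi> y\<close> has rank \<open>r\<close>, then \<open>\<O> y\<close> reduces to matrices with rows in a space of dimension \<open>r\<close>, so its
  index in \<open>\<O>\<close> is at least \<open>q ^ (n (n - r))\<close>.
\<close>

lemma index_ge:
  assumes y: "y \<in> \<O>" and r: "card (FF.row_span (\<rho> y)) = FF.q ^ r"
    and Z: "finite Z" "Z \<subseteq> \<O>" "\<forall>x\<in>\<O>. \<exists>z\<in>Z. \<exists>w\<in>\<O>. x = z + w * y"
  shows "FF.q ^ (CARD('n) * CARD('n)) \<le> card Z * FF.q ^ (r * CARD('n))"
proof -
  let ?S = "FF.row_span (\<rho> y)"
  have S: "FF.subsp ?S" by (rule FF.subsp_row_span) (rule rho_vecs[OF y])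
  let ?V = "PiE (UNIV :: 'n set) (\<lambda>_. FF.vecs :: ('n \<Rightarrow> 'k set) set)"
  let ?D = "PiE (UNIV :: 'n set) (\<lambda>_. ?S)"
  have finD: "finite ?D" using FF.finite_subsp[OF S] by (intro finite_PiE) auto
  have "?V \<subseteq> (\<lambda>(z, v). \<lambda>l. FF.vadd (\<rho> z l) (v l)) ` (Z \<times> ?D)"
  proof
    fix v assume "v \<in> ?V"
    then have "\<And>l. v l \<in> FF.vecs" by auto
    then obtain x where x: "x \<in> \<O>" "\<rho> x = v" using rho_surj by blast
    then obtain z w where zw: "z \<in> Z" "w \<in> \<O>" "x = z + w * y" using Z(3) by blast
    have "\<rho> (w * y) l \<in> ?S" for l
      unfolding rho_mult[OF zw(2) y] FF.row_span_def using rho_vecs[OF zw(2)] by (rule imageI)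
    moreover have "v = (\<lambda>l. FF.vadd (\<rho> z l) (\<rho> (w * y) l))"
      using zw Z(2) y by (auto simp: x(2)[symmetric] fun_eq_iff rho_add mult_O subset_iff)
    ultimately show "v \<in> (\<lambda>(z, v). \<lambda>l. FF.vadd (\<rho> z l) (v l)) ` (Z \<times> ?D)"
      using zw(1) by (intro image_eqI[of _ _ "(z, \<rho> (w * y))"]) auto
  qed
  then have "card ?V \<le> card (Z \<times> ?D)"
    using Z(1) finD by (intro surj_card_le) auto
  moreover have "card ?V = FF.q ^ (CARD('n) * CARD('n))"
    by (simp add: card_PiE FF.card_vecs power_mult)
  moreover have "card (Z \<times> ?D) = card Z * FF.q ^ (r * CARD('n))"
    by (simp add: card_cartesian_product card_PiE r power_mult)
  ultimately show ?thesis by simp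
qed

text \<open>If \<open>q ^ s\<close> coefficient vectors annihilate the rows, the rank is at most
  \<open>n - s\<close>, and \<open>index_ge\<close> requires at least \<open>q ^ (n s)\<close>
  representatives modulo \<open>\<O> y\<close>. Comparison with the upper bound in terms of
  \<open>nrm y\<close> shows that elements of low rank are long.\<close>

lemma nrm_lower_bound:
  assumes C: "\<And>y. y \<in> \<O> \<Longrightarrow> y \<noteq> 0 \<Longrightarrow> \<exists>Z. finite Z \<and> Z \<subseteq> \<O> \<and>
     real (card Z) \<le> (C * nrm y) ^ card I \<and> (\<forall>x\<in>\<O>. \<exists>z\<in>Z. \<exists>w\<in>\<O>. x = z + w * y)"
    and y: "y \<in> \<O>" "y \<noteq> 0" and K: "K \<subseteq> FF.left_kernel (\<rho> y)" "card K = FF.q ^ s"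
  shows "real FF.q ^ (CARD('n) * s) \<le> (C * nrm y) ^ card I"
proof -
  obtain Z where Z: "finite Z" "Z \<subseteq> \<O>" "real (card Z) \<le> (C * nrm y) ^ card I"
    "\<forall>x\<in>\<O>. \<exists>z\<in>Z. \<exists>w\<in>\<O>. x = z + w * y" using C[OF y] by blast
  obtain r where r: "r \<le> CARD('n)" "card (FF.row_span (\<rho> y)) = FF.q ^ r"
    "card (FF.left_kernel (\<rho> y)) = FF.q ^ (CARD('n) - r)"
    using FF.rank_exists[of "\<rho> y", OF rho_vecs[OF y(1)]] by blast
  have "card K \<le> card (FF.left_kernel (\<rho> y))"
    using K(1) FF.finite_subsp[OF FF.subsp_left_kernel[of "\<rho> y", OF rho_vecs[OF y(1)]]] by (rule card_mono[rotated])
  then have "s \<le> CARD('n) - r" using r K(2) FF.q_ge_2 by (simp add: power_increasing_iff)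
  then have "CARD('n) * s + r * CARD('n) \<le> CARD('n) * CARD('n)"
    using r(1) by (metis add.commute add_le_imp_le_diff le_add_diff_inverse mult.commute mult_le_mono2 distrib_left Nat.le_diff_conv2)
  then have "FF.q ^ (CARD('n) * s + r * CARD('n)) \<le> FF.q ^ (CARD('n) * CARD('n))"
    using FF.q_ge_2 by (intro power_increasing) auto
  also have "\<dots> \<le> card Z * FF.q ^ (r * CARD('n))" by (rule index_ge[OF y(1) r(2) Z(1,2,4)])
  finally have "FF.q ^ (CARD('n) * s) * FF.q ^ (r * CARD('n)) \<le> card Z * FF.q ^ (r * CARD('n))"
    by (simp only: power_add)
  then have "FF.q ^ (CARD('n) * s) \<le> card Z" using FF.q_ge_2 by simp
  then have "real (FF.q ^ (CARD('n) * s)) \<le> real (card Z)" by (rule of_nat_mono)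
  then show ?thesis using Z(3) by (simp only: of_nat_power)
qed

end

section \<open>Averages over the code lattices\<close>

lemma has_sum_finite_sum:
  fixes g :: "'b \<Rightarrow> 'c \<Rightarrow> 'd::topological_comm_monoid_add"
  assumes "finite B" "\<And>b. b \<in> B \<Longrightarrow> (g b has_sum s b) A"
  shows "((\<lambda>x. \<Sum>b\<in>B. g b x) has_sum (\<Sum>b\<in>B. s b)) A"
  using assms by (induction B rule: finite_induct) (simp_all add: has_sum_add)

text \<open>The packing estimates are made for finite sets of vectors; this carries them over to
  infinite sums.\<close>

lemma infsum_bounded_finite_sums:
  fixes g :: "'b \<Rightarrow> real"
  assumes "\<And>X. finite X \<Longrightarrow> X \<subseteq> A \<Longrightarrow> (\<Sum>x\<in>X. \<bar>g x\<bar>) \<le> K"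
  shows "(\<lambda>x. \<bar>g x\<bar>) summable_on A" "g summable_on A" "infsum (\<lambda>x. \<bar>g x\<bar>) A \<le> K" "\<bar>infsum g A\<bar> \<le> K"
proof -
  show abs: "(\<lambda>x. \<bar>g x\<bar>) summable_on A"
  proof (rule nonneg_bounded_partial_sums_imp_summable_on)
    show "eventually (\<lambda>X. (\<Sum>x\<in>X. \<bar>g x\<bar>) \<le> K) (finite_subsets_at_top A)"
      using assms by (intro eventually_finite_subsets_at_top_weakI) auto
  qed simp
  then show "g summable_on A" by (subst summable_on_iff_abs_summable_on_real) simp
  show le: "infsum (\<lambda>x. \<bar>g x\<bar>) A \<le> K" by (rule infsum_le_finite_sums[OF abs assms])
  have "norm (infsum g A) \<le> infsum (\<lambda>x. norm (g x)) A" by (rule norm_infsum_bound) (use abs in simp)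
  then show "\<bar>infsum g A\<bar> \<le> K" using le by simp
qed

text \<open>\<open>C\<close>, \<open>c0\<close>, \<open>K\<close> and \<open>\<delta>\<close> are
  parameters because they are the same for all primes, which makes the bounds below uniform. The
  equation for \<open>\<beta>\<close> is the normalisation of the covolume with the negative
  exponent moved to the other side.\<close>

locale code_average = order_prime \<iota> \<O> I u c M \<pp> h
  for \<iota> :: "'k::field_char_0 \<Rightarrow> 'a::{division_ring,ring_char_0}" and \<O> :: "'a set"
    and I :: "'i set" and u c M and \<pp> :: "'k set" and h :: "'a set \<Rightarrow> 'k set ^ 'n::finite ^ 'n" +
  fixes emb :: "'a ^ 't::finite \<Rightarrow> real ^ 'd::finite" and C c0 K \<delta> \<beta> :: real and k :: nat
  assumes emb_diff: "emb (x - y) = emb x - emb y"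
    and emb_ge: "c0 * nrm (x $ j) \<le> norm (emb x)"
    and index: "a \<in> \<O> \<Longrightarrow> a \<noteq> 0 \<Longrightarrow> \<exists>Z. finite Z \<and> Z \<subseteq> \<O> \<and>
       real (card Z) \<le> (C * nrm a) ^ card I \<and> (\<forall>b\<in>\<O>. \<exists>z\<in>Z. \<exists>w\<in>\<O>. b = z + w * a)"
    and sep: "finite X \<Longrightarrow> l > 0 \<Longrightarrow> (\<And>x. x \<in> X \<Longrightarrow> l \<le> norm x) \<Longrightarrow>
       (\<And>x y. x \<in> X \<Longrightarrow> y \<in> X \<Longrightarrow> x \<noteq> y \<Longrightarrow> l \<le> dist x y) \<Longrightarrow>
       (\<Sum>x\<in>X. (1 + norm (x :: real ^ 'd)) powr (- (real CARD('d) + \<delta>))) \<le> K / l ^ CARD('d)"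
    and dim: "CARD('d) = card I * CARD('t)" and pos: "C > 0" "c0 > 0" "K > 0" "\<beta> > 0"
    and k: "CARD('n) \<le> k" "k \<le> CARD('n) * CARD('t)"
    and \<beta>: "\<beta> ^ CARD('d) * real (residue_card \<pp>) ^ (CARD('n) * CARD('n) * CARD('t)) = real (residue_card \<pp>) ^ (CARD('n) * k)"
begin

abbreviation q :: nat where "q \<equiv> residue_card \<pp>"

definition w :: "real ^ 'd \<Rightarrow> real" where "w x = (1 + norm x) powr (- (real CARD('d) + \<delta>))"

definition X0 :: "('a ^ 't) set" where "X0 = coord_power \<O> - {0}"

abbreviation \<Phi> :: "'a ^ 't \<Rightarrow> 't \<Rightarrow> 'k set ^ 'n ^ 'n" where "\<Phi> \<equiv> reduction \<iota> \<O> \<pp> h"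

abbreviation rows :: "'a ^ 't \<Rightarrow> 'n \<Rightarrow> 't \<times> 'n \<Rightarrow> 'k set" where "rows x \<equiv> FF.mrow (\<Phi> x)"

abbreviation codeset :: "('t \<Rightarrow> 'k set ^ 'n ^ 'n) set set" where "codeset \<equiv> codes k F"

lemma w_pos: "w x > 0"
  using norm_ge_zero[of x] by (simp add: w_def del: norm_ge_zero)

lemma q_ge_2: "q \<ge> 2" using FF.q_ge_2 by (simp add: q_eq)

lemma Phi_eq: "\<Phi> x = (\<lambda>j. \<psi> (x $ j))"
  by (simp add: reduction_def \<psi>_def)

lemma rows_eq: "rows x l (j, i) = \<rho> (x $ j) l i"
  by (simp add: FF.mrow_def Phi_eq \<rho>_def)

lemma coordD: "x \<in> coord_power \<O> \<Longrightarrow> x $ j \<in> \<O>"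
  by (simp add: coord_power_def)

lemma coord_diff: "x \<in> coord_power \<O> \<Longrightarrow> y \<in> coord_power \<O> \<Longrightarrow> x - y \<in> coord_power \<O>"
  by (simp add: coord_power_def diff_O)

lemma rows_vecs: "x \<in> coord_power \<O> \<Longrightarrow> rows x l \<in> FF.vecs"
  by (auto simp: FF.vecs_def FF.mrow_def Phi_eq intro: psi_closed[OF coordD])

lemma rows_closed: "x \<in> coord_power \<O> \<Longrightarrow> rows x l ji \<in> carrier F"
  using rows_vecs[of x l] unfolding FF.vecs_def by blast

lemma rows_add:
  assumes x: "x \<in> coord_power \<O>" and y: "y \<in> coord_power \<O>"
  shows "rows (x + y) l = FF.vadd (rows x l) (rows y l)"
proof
  fix ji :: "'t \<times> 'n"
  show "rows (x + y) l ji = FF.vadd (rows x l) (rows y l) ji"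
    using psi_add[OF coordD[OF x] coordD[OF y]]
    by (cases ji) (simp add: FF.vadd_def rows_eq \<rho>_def)
qed

lemma rows_diff_mem:
  assumes x: "x \<in> coord_power \<O>" and y: "y \<in> coord_power \<O>" and W: "FF.subsp W" "rows x l \<in> W" "rows y l \<in> W"
  shows "rows (x - y) l \<in> W"
proof -
  have xy: "x - y \<in> coord_power \<O>" using x y by (rule coord_diff)
  have "rows x l = FF.vadd (rows (x - y) l) (rows y l)" using rows_add[OF xy y] by simp
  then have "FF.vadd (rows x l) (FF.vscale (\<ominus>\<^bsub>F\<^esub> \<one>\<^bsub>F\<^esub>) (rows y l)) = rows (x - y) l"
    using rows_closed[OF xy] rows_closed[OF y]
    by (simp add: FF.vadd_def FF.vscale_def fun_eq_iff FF.l_minus FF.a_assoc FF.r_neg)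
  moreover have "FF.vadd (rows x l) (FF.vscale (\<ominus>\<^bsub>F\<^esub> \<one>\<^bsub>F\<^esub>) (rows y l)) \<in> W"
    by (intro FF.subspD(3)[OF W(1)] FF.subspD(4)[OF W(1)] W(2,3)) simp
  ultimately show ?thesis by simp
qed

text \<open>This closure property turns a lower bound for the length of annihilated vectors into a
  lower bound for their distances.\<close>

lemma kernel_diff:
  assumes x: "x \<in> coord_power \<O>" and y: "y \<in> coord_power \<O>"
    and a: "a \<in> FF.left_kernel (rows x)" "a \<in> FF.left_kernel (rows y)"
  shows "a \<in> FF.left_kernel (rows (x - y))"
proof -
  have av: "a l \<in> carrier F" for l using a(1) by (simp add: FF.left_kernel_def FF.vecs_def)
  have xy: "x - y \<in> coord_power \<O>" using x y by (rule coord_diff)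
  have eq: "rows x l ji = rows (x - y) l ji \<oplus>\<^bsub>F\<^esub> rows y l ji" for l ji
    using fun_cong[OF rows_add[OF xy y, of l], of ji] by (simp add: FF.vadd_def)
  have "(\<Oplus>\<^bsub>F\<^esub>l\<in>UNIV. a l \<otimes>\<^bsub>F\<^esub> rows (x - y) l ji) = \<zero>\<^bsub>F\<^esub>" for ji
  proof -
    have zero: "(\<Oplus>\<^bsub>F\<^esub>l\<in>UNIV. a l \<otimes>\<^bsub>F\<^esub> rows x l ji) = \<zero>\<^bsub>F\<^esub>" "(\<Oplus>\<^bsub>F\<^esub>l\<in>UNIV. a l \<otimes>\<^bsub>F\<^esub> rows y l ji) = \<zero>\<^bsub>F\<^esub>"
      using a unfolding FF.left_kernel_def FF.LC_def by (auto dest: fun_cong[where x = ji])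
    let ?s = "\<Oplus>\<^bsub>F\<^esub>l\<in>UNIV. a l \<otimes>\<^bsub>F\<^esub> rows (x - y) l ji"
    have cl: "?s \<in> carrier F" using av rows_closed[OF xy] by (intro FF.finsum_closed) auto
    have "(\<Oplus>\<^bsub>F\<^esub>l\<in>UNIV. a l \<otimes>\<^bsub>F\<^esub> rows x l ji) = (\<Oplus>\<^bsub>F\<^esub>l\<in>UNIV. a l \<otimes>\<^bsub>F\<^esub> rows (x - y) l ji \<oplus>\<^bsub>F\<^esub> a l \<otimes>\<^bsub>F\<^esub> rows y l ji)"
      unfolding eq using av rows_closed[OF xy] rows_closed[OF y] by (intro FF.finsum_cong') (auto simp: FF.r_distr)
    also have "\<dots> = ?s \<oplus>\<^bsub>F\<^esub> (\<Oplus>\<^bsub>F\<^esub>l\<in>UNIV. a l \<otimes>\<^bsub>F\<^esub> rows y l ji)"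
      using av rows_closed[OF xy] rows_closed[OF y] by (intro FF.finsum_addf) auto
    finally show ?thesis using zero cl by simp
  qed
  then show ?thesis using a(1) by (simp add: FF.left_kernel_def FF.LC_def)
qed

lemma emb_zero [simp]: "emb 0 = 0" using emb_diff[of 0 0] by simp

lemma emb_lower: "x \<in> X0 \<Longrightarrow> c0 / real M \<le> norm (emb x)"
proof -
  assume x: "x \<in> X0"
  then obtain j where j: "x $ j \<noteq> 0" "x $ j \<in> \<O>" by (auto simp: X0_def vec_eq_iff coordD)
  have "1 / real M \<le> nrm (x $ j)" using nrm_ge[OF j(2,1)] M by (simp add: field_simps)
  then have "c0 * (1 / real M) \<le> c0 * nrm (x $ j)" using pos by (intro mult_left_mono) auto
  then show ?thesis using emb_ge[of x j] by simp
qed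

lemma emb_neq_0: "x \<in> X0 \<Longrightarrow> emb x \<noteq> 0"
  using emb_lower[of x] pos(2) M by (auto simp: field_simps)

lemma inj_emb: "inj_on emb (coord_power \<O>)"
proof (rule inj_onI)
  fix x y assume x: "x \<in> coord_power \<O>" "y \<in> coord_power \<O>" "emb x = emb y"
  then have "x - y \<notin> X0" using emb_neq_0[of "x - y"] emb_diff[of x y] by auto
  then show "x = y" using coord_diff[OF x(1,2)] by (simp add: X0_def)
qed

text \<open>
  The nonzero vectors annihilated from the left by \<open>Z\<close> are closed under differences and long.
\<close>

lemma kernel_sum_bound:
  assumes Z: "card Z = q ^ s" and X: "finite X" "X \<subseteq> X0" "\<And>x. x \<in> X \<Longrightarrow> Z \<subseteq> FF.left_kernel (rows x)" and e: "e > 0"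
  shows "(\<Sum>x\<in>X. w (e *\<^sub>R emb x)) \<le> K * (C / c0) ^ CARD('d) / (e ^ CARD('d) * real q ^ (CARD('n) * s * CARD('t)))"
proof -
  let ?d = "CARD('d)" and ?a = "CARD('n) * s * CARD('t)"
  \<comment> \<open>\<open>nrm_lower_bound\<close> raised to the power \<open>CARD('t)\<close> and
    solved for the norm, with \<open>CARD('d) = card I * CARD('t)\<close>.\<close>
  define l where "l = (c0 / C) * root ?d (real q ^ ?a)"
  have d: "?d > 0" by simp
  have lpos: "l > 0" using pos q_ge_2 by (simp add: l_def real_root_gt_zero)
  have ld: "l ^ ?d = (c0 / C) ^ ?d * real q ^ ?a" unfolding l_def power_mult_distrib by simp
  have key: "l \<le> norm (emb x)" if x: "x \<in> X0" and Zx: "Z \<subseteq> FF.left_kernel (rows x)" for x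
  proof -
    obtain j where j: "x $ j \<noteq> 0" "x $ j \<in> \<O>" using x by (auto simp: X0_def vec_eq_iff coordD)
    \<comment> \<open>A coefficient vector that annihilates the rows of all components annihilates
      those of the nonzero component \<open>j\<close>.\<close>
    have "Z \<subseteq> FF.left_kernel (\<rho> (x $ j))"
    proof
      fix a assume "a \<in> Z"
      then have a: "a \<in> FF.left_kernel (rows x)" using Zx by blast
      then have "(\<Oplus>\<^bsub>F\<^esub>l\<in>UNIV. a l \<otimes>\<^bsub>F\<^esub> rows x l (j, i)) = \<zero>\<^bsub>F\<^esub>" for i
        by (simp add: FF.left_kernel_def FF.LC_def fun_eq_iff)
      then show "a \<in> FF.left_kernel (\<rho> (x $ j))"
        using a by (simp add: FF.left_kernel_def FF.LC_def rows_eq)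
    qed
    then have "real q ^ (CARD('n) * s) \<le> (C * nrm (x $ j)) ^ card I"
      using nrm_lower_bound[OF index j(2,1), of Z s] Z by (simp add: q_eq)
    also have "\<dots> \<le> (C / c0 * norm (emb x)) ^ card I"
      using emb_ge[of x j] pos nrm_nonneg[of "x $ j"] by (intro power_mono) (simp_all add: field_simps)
    finally have "(real q ^ (CARD('n) * s)) ^ CARD('t) \<le> ((C / c0 * norm (emb x)) ^ card I) ^ CARD('t)"
      by (intro power_mono) auto
    then have *: "real q ^ ?a \<le> (C / c0 * norm (emb x)) ^ ?d"
      by (simp only: power_mult[symmetric] dim)
    have nn: "0 \<le> C / c0 * norm (emb x)" using pos by simp
    have "root ?d (real q ^ ?a) \<le> root ?d ((C / c0 * norm (emb x)) ^ ?d)"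
      using * by (rule real_root_le_mono[OF d])
    also have "\<dots> = C / c0 * norm (emb x)" by (rule real_root_power_cancel[OF d nn])
    finally have "(c0 / C) * root ?d (real q ^ ?a) \<le> (c0 / C) * (C / c0 * norm (emb x))"
      using pos by (intro mult_left_mono) auto
    then show ?thesis using pos by (simp add: l_def)
  qed
  have inj: "inj_on (\<lambda>x. e *\<^sub>R emb x) X"
    using inj_emb X(2) e by (auto simp: inj_on_def X0_def)
  have "(\<Sum>x\<in>X. w (e *\<^sub>R emb x)) = (\<Sum>v\<in>(\<lambda>x. e *\<^sub>R emb x) ` X. w v)"
    using inj by (simp add: sum.reindex)
  also have "\<dots> \<le> K / (e * l) ^ ?d"
    unfolding w_def
  proof (rule sep)
    show "e * l \<le> norm v" if "v \<in> (\<lambda>x. e *\<^sub>R emb x) ` X" for v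
      using that key X e by auto
    fix v v' assume "v \<in> (\<lambda>x. e *\<^sub>R emb x) ` X" "v' \<in> (\<lambda>x. e *\<^sub>R emb x) ` X" "v \<noteq> v'"
    then obtain x y where xy: "x \<in> X" "y \<in> X" "v = e *\<^sub>R emb x" "v' = e *\<^sub>R emb y" "x \<noteq> y" by auto
    have c: "x \<in> coord_power \<O>" "y \<in> coord_power \<O>" using xy X(2) by (auto simp: X0_def)
    have "x - y \<in> X0" using coord_diff[OF c] xy(5) by (simp add: X0_def)
    moreover have "Z \<subseteq> FF.left_kernel (rows (x - y))"
      using kernel_diff[OF c] X(3)[OF xy(1)] X(3)[OF xy(2)] by blast
    ultimately have "l \<le> norm (emb (x - y))" by (rule key)
    moreover have "dist v v' = e * norm (emb (x - y))"
      using e by (simp add: dist_norm xy emb_diff scaleR_diff_right[symmetric])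
    ultimately show "e * l \<le> dist v v'" using e by simp
  qed (use X(1) e lpos in auto)
  also have "\<dots> = K * (C / c0) ^ ?d / (e ^ ?d * real q ^ ?a)"
    using pos by (simp add: power_mult_distrib ld power_divide field_simps)
  finally show ?thesis .
qed

text \<open>The vectors of rank \<open>r\<close> as a whole are not closed under differences, so
  they are sorted by their left kernel first. The number of kernels is bounded by
  \<open>card_grass_le\<close>, and each class by \<open>kernel_sum_bound\<close>.\<close>

lemma rank_sum_bound:
  assumes r: "r \<le> CARD('n)" and X: "finite X" "X \<subseteq> X0" "\<And>x. x \<in> X \<Longrightarrow> card (FF.left_kernel (rows x)) = q ^ (CARD('n) - r)"
    and e: "e > 0"
  shows "(\<Sum>x\<in>X. w (e *\<^sub>R emb x)) \<le> 2 ^ CARD('n) * real q ^ ((CARD('n) - r) * r) *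
     (K * (C / c0) ^ CARD('d) / (e ^ CARD('d) * real q ^ (CARD('n) * (CARD('n) - r) * CARD('t))))"
proof -
  let ?s = "CARD('n) - r"
  let ?G = "FF.grass ?s :: ('n \<Rightarrow> 'k set) set set"
  let ?B = "K * (C / c0) ^ CARD('d) / (e ^ CARD('d) * real q ^ (CARD('n) * ?s * CARD('t)))"
  have ker: "FF.left_kernel (rows x) \<in> ?G" if "x \<in> X" for x
    using that X FF.subsp_left_kernel[of "rows x", OF rows_vecs] by (auto simp: FF.grass_def q_eq X0_def)
  have "(\<Sum>x\<in>X. w (e *\<^sub>R emb x)) = (\<Sum>Z\<in>?G. \<Sum>x\<in>{x \<in> X. FF.left_kernel (rows x) = Z}. w (e *\<^sub>R emb x))"
    using ker by (intro sum.group[symmetric] X(1) FF.finite_grass) auto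
  also have "\<dots> \<le> (\<Sum>Z\<in>?G. ?B)"
  proof (rule sum_mono)
    fix Z assume "Z \<in> ?G"
    then have "card Z = q ^ ?s" by (simp add: FF.grass_def q_eq)
    then show "(\<Sum>x\<in>{x \<in> X. FF.left_kernel (rows x) = Z}. w (e *\<^sub>R emb x)) \<le> ?B"
      by (rule kernel_sum_bound) (use X e in auto)
  qed
  also have "\<dots> = real (card ?G) * ?B" by simp
  also have "\<dots> \<le> (2 ^ CARD('n) * real q ^ (?s * r)) * ?B"
  proof (rule mult_right_mono)
    have "real (card ?G) \<le> 2 ^ ?s * real q ^ (?s * (CARD('n) - ?s))"
      using FF.card_grass_le[where 'i = 'n, of ?s] by (simp add: q_eq)
    also have "\<dots> \<le> 2 ^ CARD('n) * real q ^ (?s * r)"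
      using r q_ge_2 by (intro mult_mono power_increasing) auto
    finally show "real (card ?G) \<le> 2 ^ CARD('n) * real q ^ (?s * r)" .
    show "0 \<le> ?B" using pos e by simp
  qed
  finally show ?thesis .
qed

text \<open>The probability that a random code contains a given element of rank \<open>r\<close>, by
  \<open>rank_cases\<close>.\<close>

definition ratio :: "nat \<Rightarrow> real" where
  "ratio r = (\<Prod>i<r. (real q ^ k - real q ^ i) / (real q ^ (CARD('n) * CARD('t)) - real q ^ i))"

definition P :: "'a ^ 't \<Rightarrow> real" where
  "P x = real (card {C \<in> codeset. \<Phi> x \<in> C}) / real (card codeset)"

definition B0 :: real where "B0 = 2 ^ CARD('n) * (K * (C / c0) ^ CARD('d))"

lemma B0_nonneg: "B0 \<ge> 0" using pos by (simp add: B0_def)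

lemma rank_cases:
  assumes x: "x \<in> coord_power \<O>"
  obtains r where "r \<le> CARD('n)" "P x = ratio r" "card (FF.left_kernel (rows x)) = q ^ (CARD('n) - r)"
proof -
  obtain r where r: "r \<le> CARD('n)" "card (FF.row_span (rows x)) = FF.q ^ r"
    "card (FF.left_kernel (rows x)) = FF.q ^ (CARD('n) - r)"
    by (rule FF.rank_exists[of "rows x", OF rows_vecs[OF x]])
  have "P x = ratio r"
    unfolding P_def ratio_def using FF.codes_containing(3)[of "\<Phi> x" r k, OF rows_vecs[OF x] r(2)] r(1) k
    by (simp add: q_eq)
  then show ?thesis using r that by (simp add: q_eq)
qed

lemma codeset_finite: "finite codeset" "card codeset > 0"
proof -
  have z: "(0 :: 'a ^ 't) \<in> coord_power \<O>" by (simp add: coord_power_def zero_O)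
  obtain r where r: "r \<le> CARD('n)" "card (FF.row_span (rows 0)) = FF.q ^ r"
    by (rule FF.rank_exists[of "rows 0", OF rows_vecs[OF z]])
  show "finite codeset" "card codeset > 0"
    using FF.codes_containing(1,2)[of "\<Phi> 0" r k, OF rows_vecs[OF z] r(2)] r(1) k by simp_all
qed

lemma ratio_Suc: "r < CARD('n) \<Longrightarrow> ratio (Suc r) \<le> ratio r"
proof -
  assume r: "r < CARD('n)"
  let ?D = "CARD('n) * CARD('t)"
  have "real q ^ r < real q ^ k" using r k q_ge_2 by (intro power_strict_increasing) auto
  moreover have "real q ^ k \<le> real q ^ ?D" using k q_ge_2 by (intro power_increasing) auto
  ultimately have "(real q ^ k - real q ^ r) / (real q ^ ?D - real q ^ r) \<le> 1" by (simp add: field_simps)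
  moreover have "0 \<le> ratio r" unfolding ratio_def using FF.ratio_le(1)[of r k ?D] r k by (simp add: q_eq)
  ultimately have "ratio r * ((real q ^ k - real q ^ r) / (real q ^ ?D - real q ^ r)) \<le> ratio r" by (intro mult_left_le) auto
  then show ?thesis by (simp add: ratio_def)
qed

text \<open>Elements of smaller rank are contained more often, since each further factor of
  \<open>ratio\<close> is at most 1.\<close>

lemma ratio_antimono: "r \<le> CARD('n) \<Longrightarrow> ratio CARD('n) \<le> ratio r"
proof (induction rule: inc_induct)
  case (step r)
  then show ?case using ratio_Suc[of r] by simp
qed simp

lemma ratio_nonneg: "r \<le> CARD('n) \<Longrightarrow> 0 \<le> ratio r"
  unfolding ratio_def using FF.ratio_le(1)[of r k "CARD('n) * CARD('t)"] k by (simp add: q_eq)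

text \<open>The exponents of \<open>q\<close>, with \<open>s = n - r\<close>, are
  \<open>- r (n t - k)\<close> from the probability, \<open>r s\<close> from the number of kernels,
  \<open>- n s t\<close> from the length of the vectors and \<open>n (n t - k)\<close> from the
  scaling. Their sum is \<open>s (r - k)\<close>. By \<open>r \<le> n \<le> k\<close> it is at most
  0, and at most \<open>- 1\<close> if \<open>r < n\<close>.\<close>

lemma weighted_rank_bound:
  assumes r: "r \<le> CARD('n)" and X: "finite X" "X \<subseteq> X0" "\<And>x. x \<in> X \<Longrightarrow> card (FF.left_kernel (rows x)) = q ^ (CARD('n) - r)"
    and j: "j > 0"
  shows "ratio r * (\<Sum>x\<in>X. w ((real j * \<beta>) *\<^sub>R emb x)) \<le> B0 / real j ^ CARD('d)"
    "r < CARD('n) \<Longrightarrow> ratio r * (\<Sum>x\<in>X. w ((real j * \<beta>) *\<^sub>R emb x)) \<le> B0 / (real j ^ CARD('d) * real q)"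
proof -
  let ?n = "CARD('n)" and ?t = "CARD('t)" and ?d = "CARD('d)" and ?Q = "real q"
  let ?s = "?n - r"
  let ?S = "\<Sum>x\<in>X. w ((real j * \<beta>) *\<^sub>R emb x)"
  have Q: "?Q > 0" "?Q \<ge> 1" using q_ge_2 by auto
  have e: "real j * \<beta> > 0" using j pos by simp
  have S: "?S \<le> B0 * ?Q ^ (?s * r) / ((real j * \<beta>) ^ ?d * ?Q ^ (?n * ?s * ?t))"
    using rank_sum_bound[OF r X e] by (simp add: B0_def mult_ac)
  have S0: "0 \<le> ?S" using w_pos by (intro sum_nonneg less_imp_le)
  have "ratio r \<le> inverse (?Q ^ (r * (?n * ?t - k)))"
    unfolding ratio_def using FF.ratio_le(2)[of r k "?n * ?t"] r k by (simp add: q_eq)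
  then have "ratio r * ?S \<le> inverse (?Q ^ (r * (?n * ?t - k))) * (B0 * ?Q ^ (?s * r) / ((real j * \<beta>) ^ ?d * ?Q ^ (?n * ?s * ?t)))"
    using S S0 Q by (intro mult_mono) auto
  also have "\<dots> = B0 / real j ^ ?d * (?Q ^ (?s * r) / ?Q ^ (k * ?s))"
  proof -
    \<comment> \<open>Names for \<open>n - r\<close> and \<open>n t - k\<close> that are free of
      truncated subtraction make the exponent identity \<open>ex\<close> a polynomial one.\<close>
    obtain s where s: "?n = r + s" using r le_Suc_ex by blast
    obtain a where a: "?n * ?t = k + a" using k le_Suc_ex by blast
    have ex: "r * a + ?n * s * ?t + ?n * k = ?n * ?n * ?t + k * s"
    proof -
      have "?n * s * ?t = s * (k + a)" by (simp add: a[symmetric] mult_ac)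
      moreover have "?n * ?n * ?t = (r + s) * (k + a)" by (simp add: a[symmetric] s[symmetric] mult_ac)
      moreover have "?n * k = (r + s) * k" by (simp add: s)
      ultimately show ?thesis by (simp add: algebra_simps)
    qed
    have "?Q ^ (r * a) * ((\<beta> ^ ?d) * ?Q ^ (?n * s * ?t)) * ?Q ^ (?n * ?n * ?t) = ?Q ^ (r * a + ?n * s * ?t) * (\<beta> ^ ?d * ?Q ^ (?n * ?n * ?t))"
      by (simp add: power_add mult_ac)
    also have "\<dots> = ?Q ^ (r * a + ?n * s * ?t + ?n * k)" unfolding \<beta> by (simp only: power_add)
    also have "\<dots> = ?Q ^ (k * s) * ?Q ^ (?n * ?n * ?t)" unfolding ex by (simp add: power_add mult_ac)
    finally have den: "?Q ^ (r * a) * ((\<beta> ^ ?d) * ?Q ^ (?n * s * ?t)) = ?Q ^ (k * s)" using Q by simp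
    have "inverse (?Q ^ (r * a)) * (B0 * ?Q ^ (s * r) / ((real j * \<beta>) ^ ?d * ?Q ^ (?n * s * ?t)))
      = B0 * ?Q ^ (s * r) / (real j ^ ?d * (?Q ^ (r * a) * ((\<beta> ^ ?d) * ?Q ^ (?n * s * ?t))))"
      by (simp add: power_mult_distrib divide_inverse mult_ac)
    also have "\<dots> = B0 / real j ^ ?d * (?Q ^ (s * r) / ?Q ^ (k * s))" unfolding den by simp
    moreover have "?s = s" "?n * ?t - k = a" using s a by simp_all
    ultimately show ?thesis by simp
  qed
  finally have main: "ratio r * ?S \<le> B0 / real j ^ ?d * (?Q ^ (?s * r) / ?Q ^ (k * ?s))" .
  have B: "0 \<le> B0 / real j ^ ?d" using B0_nonneg by simp
  have "r * ?s \<le> k * ?s" using r k by (intro mult_right_mono) auto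
  then have "?Q ^ (?s * r) \<le> ?Q ^ (k * ?s)" using Q by (intro power_increasing) (auto simp: mult.commute)
  then have "?Q ^ (?s * r) / ?Q ^ (k * ?s) \<le> 1" using Q by simp
  then have "B0 / real j ^ ?d * (?Q ^ (?s * r) / ?Q ^ (k * ?s)) \<le> B0 / real j ^ ?d * 1" using B by (rule mult_left_mono)
  then show "ratio r * ?S \<le> B0 / real j ^ ?d" using main by simp
  assume rn: "r < ?n"
  \<comment> \<open>The spare factor \<open>q\<close> comes from \<open>k \<ge> r + 1\<close>
    together with \<open>?s \<ge> 1\<close>.\<close>
  then have "Suc r * ?s \<le> k * ?s" using k by (intro mult_right_mono) auto
  moreover have "Suc (?s * r) \<le> Suc r * ?s" using rn by (simp add: mult.commute)
  ultimately have "Suc (?s * r) \<le> k * ?s" by linarith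
  then have "?Q ^ Suc (?s * r) \<le> ?Q ^ (k * ?s)" using Q by (intro power_increasing) auto
  then have "?Q ^ (?s * r) / ?Q ^ (k * ?s) \<le> 1 / ?Q" using Q by (simp add: field_simps)
  then have "B0 / real j ^ ?d * (?Q ^ (?s * r) / ?Q ^ (k * ?s)) \<le> B0 / real j ^ ?d * (1 / ?Q)" using B by (rule mult_left_mono)
  then show "ratio r * ?S \<le> B0 / (real j ^ ?d * ?Q)" using main by simp
qed

lemma P_nonneg: "P x \<ge> 0" by (simp add: P_def)

text \<open>Both sums are grouped by rank. In the second, the full-rank vectors drop out, and for
  \<open>r < n\<close> antitonicity gives
  \<open>\<bar>ratio r - ratio n\<bar> \<le> ratio r\<close>, so each remaining rank contributes
  \<open>O(1/q)\<close>.\<close>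

lemma weighted_sum_bound:
  assumes X: "finite X" "X \<subseteq> X0" and j: "j > 0"
  shows "(\<Sum>x\<in>X. P x * w ((real j * \<beta>) *\<^sub>R emb x)) \<le> (real CARD('n) + 1) * B0 / real j ^ CARD('d)"
    "(\<Sum>x\<in>X. \<bar>P x - ratio CARD('n)\<bar> * w ((real j * \<beta>) *\<^sub>R emb x)) \<le> (real CARD('n) + 1) * B0 / (real j ^ CARD('d) * real q)"
proof -
  let ?n = "CARD('n)" and ?w = "\<lambda>x. w ((real j * \<beta>) *\<^sub>R emb x)"
  have "\<exists>r. r \<le> ?n \<and> P x = ratio r \<and> card (FF.left_kernel (rows x)) = q ^ (?n - r)" if x: "x \<in> coord_power \<O>" for x
    by (rule rank_cases[OF x]) blast
  then obtain rk where rk: "rk x \<le> ?n" "P x = ratio (rk x)" "card (FF.left_kernel (rows x)) = q ^ (?n - rk x)"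
    if "x \<in> coord_power \<O>" for x by metis
  have XO: "x \<in> coord_power \<O>" if "x \<in> X" for x using that X by (auto simp: X0_def)
  have split: "(\<Sum>x\<in>X. g x) = (\<Sum>r\<le>?n. \<Sum>x\<in>{x \<in> X. rk x = r}. g x)" for g :: "'a ^ 't \<Rightarrow> real"
    using rk(1) XO by (intro sum.group[symmetric] X(1)) auto
  have kern: "card (FF.left_kernel (rows x)) = q ^ (?n - r)" if "x \<in> {x \<in> X. rk x = r}" for x r
    using that rk(3) XO by auto
  have "(\<Sum>x\<in>X. P x * ?w x) \<le> (\<Sum>r\<le>?n. B0 / real j ^ CARD('d))"
    unfolding split
  proof (rule sum_mono)
    fix r assume r: "r \<in> {..?n}"
    have "(\<Sum>x\<in>{x \<in> X. rk x = r}. P x * ?w x) = ratio r * (\<Sum>x\<in>{x \<in> X. rk x = r}. ?w x)"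
      unfolding sum_distrib_left using rk(2) XO by (intro sum.cong) auto
    also have "\<dots> \<le> B0 / real j ^ CARD('d)"
      by (rule weighted_rank_bound(1)) (use r X j kern in auto)
    finally show "(\<Sum>x\<in>{x \<in> X. rk x = r}. P x * ?w x) \<le> B0 / real j ^ CARD('d)" .
  qed
  then show "(\<Sum>x\<in>X. P x * ?w x) \<le> (real ?n + 1) * B0 / real j ^ CARD('d)" by (simp add: add.commute)
  have "(\<Sum>x\<in>X. \<bar>P x - ratio ?n\<bar> * ?w x) \<le> (\<Sum>r\<le>?n. B0 / (real j ^ CARD('d) * real q))"
    unfolding split
  proof (rule sum_mono)
    fix r assume r: "r \<in> {..?n}"
    have nn: "0 \<le> B0 / (real j ^ CARD('d) * real q)" using B0_nonneg by simp
    have eq: "(\<Sum>x\<in>{x \<in> X. rk x = r}. \<bar>P x - ratio ?n\<bar> * ?w x) = \<bar>ratio r - ratio ?n\<bar> * (\<Sum>x\<in>{x \<in> X. rk x = r}. ?w x)"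
      unfolding sum_distrib_left using rk(2) XO by (intro sum.cong) auto
    show "(\<Sum>x\<in>{x \<in> X. rk x = r}. \<bar>P x - ratio ?n\<bar> * ?w x) \<le> B0 / (real j ^ CARD('d) * real q)"
    proof (cases "r = ?n")
      case True
      then show ?thesis using nn eq by simp
    next
      case False
      have "\<bar>ratio r - ratio ?n\<bar> \<le> ratio r" using ratio_antimono[of r] ratio_nonneg[of ?n] r by simp
      then have "\<bar>ratio r - ratio ?n\<bar> * (\<Sum>x\<in>{x \<in> X. rk x = r}. ?w x) \<le> ratio r * (\<Sum>x\<in>{x \<in> X. rk x = r}. ?w x)"
        by (rule mult_right_mono) (intro sum_nonneg less_imp_le w_pos)
      also have "\<dots> \<le> B0 / (real j ^ CARD('d) * real q)"
        by (rule weighted_rank_bound(2)) (use False r X j kern in auto)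
      finally show ?thesis using eq by simp
    qed
  qed
  then show "(\<Sum>x\<in>X. \<bar>P x - ratio ?n\<bar> * ?w x) \<le> (real ?n + 1) * B0 / (real j ^ CARD('d) * real q)" by (simp add: add.commute)
qed

section \<open>Sums over the random lattices\<close>

abbreviation \<Lambda> :: "('t \<Rightarrow> 'k set ^ 'n ^ 'n) set \<Rightarrow> (real ^ 'd) set" where
  "\<Lambda> D \<equiv> code_lattice \<beta> emb \<O> \<Phi> D"

lemma discrete_code_lattice:
  assumes D: "D \<in> codeset"
  shows "discrete_subgroup (\<Lambda> D)"
proof -
  obtain W where W: "FF.subsp W" "D = FF.code_of W" using D by (auto simp: FF.codes_eq FF.grass_def)
  have mem: "\<Phi> x \<in> D \<longleftrightarrow> (\<forall>l. rows x l \<in> W)" for x by (simp add: W FF.code_of_def)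
  have z: "(0 :: 'a ^ 't) \<in> coord_power \<O>" by (simp add: coord_power_def zero_O)
  have diff: "\<Phi> (x - y) \<in> D" if "x \<in> coord_power \<O>" "y \<in> coord_power \<O>" "\<Phi> x \<in> D" "\<Phi> y \<in> D" for x y
    using that rows_diff_mem[OF that(1,2) W(1)] by (simp add: mem)
  have "rows 0 l = FF.vadd (rows 0 l) (rows 0 l)" for l using rows_add[OF z z] by simp
  then have "rows 0 l ji \<oplus>\<^bsub>F\<^esub> rows 0 l ji = rows 0 l ji" for l ji
    unfolding FF.vadd_def by metis
  then have "rows 0 l ji = \<zero>\<^bsub>F\<^esub>" for l ji
    using rows_closed[OF z, of l ji] FF.add.l_cancel_one by blast
  then have "rows 0 l = (\<lambda>_. \<zero>\<^bsub>F\<^esub>)" for l by blast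
  then have zD: "\<Phi> 0 \<in> D" using FF.subspD(2)[OF W(1)] by (simp add: mem)
  show ?thesis
    unfolding discrete_subgroup_def
  proof (intro conjI ballI)
    show "0 \<in> \<Lambda> D" unfolding code_lattice_def using z zD by (intro image_eqI[of _ _ 0]) auto
    show "v - v' \<in> \<Lambda> D" if "v \<in> \<Lambda> D" "v' \<in> \<Lambda> D" for v v'
    proof -
      obtain x y where xy: "x \<in> coord_power \<O>" "\<Phi> x \<in> D" "v = \<beta> *\<^sub>R emb x" "y \<in> coord_power \<O>" "\<Phi> y \<in> D" "v' = \<beta> *\<^sub>R emb y"
        using \<open>v \<in> \<Lambda> D\<close> \<open>v' \<in> \<Lambda> D\<close> by (auto simp: code_lattice_def)
      then show ?thesis unfolding code_lattice_def
        using coord_diff diff by (intro image_eqI[of _ _ "x - y"]) (auto simp: emb_diff scaleR_diff_right)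
    qed
    show "\<exists>l>0. \<forall>v\<in>\<Lambda> D. v \<noteq> 0 \<longrightarrow> l \<le> norm v"
    proof (intro exI conjI ballI impI)
      show "\<beta> * (c0 / real M) > 0" using pos M by simp
      fix v assume "v \<in> \<Lambda> D" "v \<noteq> 0"
      then obtain x where x: "x \<in> coord_power \<O>" "v = \<beta> *\<^sub>R emb x" by (auto simp: code_lattice_def)
      then have "x \<in> X0" using \<open>v \<noteq> 0\<close> by (auto simp: X0_def)
      then show "\<beta> * (c0 / real M) \<le> norm v" using mult_left_mono[OF emb_lower[of x], of \<beta>] pos x by simp
    qed
  qed
qed

text \<open>Exchanging average and sum gives every vector \<open>x\<close> the weight
  \<open>P x\<close>. Replacing \<open>P x\<close> by the constant \<open>ratio n\<close> costs
  \<open>O(1/q)\<close> by \<open>weighted_sum_bound\<close> and leaves a multiple of the sum over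
  the whole order lattice.\<close>

lemma average_code_lattice_sum:
  fixes g :: "real ^ 'd \<Rightarrow> real"
  assumes g: "\<And>v. \<bar>g v\<bar> \<le> b * w v" and j: "j > 0"
  shows "D \<in> codeset \<Longrightarrow> (\<lambda>v. \<bar>g (real j *\<^sub>R v)\<bar>) summable_on (\<Lambda> D - {0})"
    "\<bar>average (\<lambda>D. infsum (\<lambda>v. g (real j *\<^sub>R v)) (\<Lambda> D - {0})) codeset\<bar> \<le> b * ((real CARD('n) + 1) * B0) / real j ^ CARD('d)"
    "\<bar>average (\<lambda>D. infsum (\<lambda>v. g (real j *\<^sub>R v)) (\<Lambda> D - {0})) codeset
        - ratio CARD('n) * infsum (\<lambda>v. g ((real j * \<beta>) *\<^sub>R v)) (emb ` coord_power \<O> - {0})\<bar>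
      \<le> b * ((real CARD('n) + 1) * B0) / (real j ^ CARD('d) * real q)"
proof -
  let ?g = "\<lambda>x. g ((real j * \<beta>) *\<^sub>R emb x)" and ?w = "\<lambda>x. w ((real j * \<beta>) *\<^sub>R emb x)"
  have e: "real j * \<beta> > 0" using j pos by simp
  have b: "b \<ge> 0" using g[of 0] w_pos[of 0] by (smt (verit) abs_ge_zero zero_le_mult_iff)
  have zk: "(\<lambda>_. \<zero>\<^bsub>F\<^esub>) \<in> FF.left_kernel (rows x)" if "x \<in> X0" for x
    by (rule FF.subspD(2)[OF FF.subsp_left_kernel[of "rows x", OF rows_vecs]]) (use that in \<open>simp add: X0_def\<close>)
  \<comment> \<open>Summability over all nonzero vectors is the case \<open>s = 0\<close> of
    \<open>kernel_sum_bound\<close>, with the zero vector as the only prescribed element of the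
    kernel.\<close>
  have gs: "(\<lambda>x. \<bar>?g x\<bar>) summable_on X0"
  proof (rule infsum_bounded_finite_sums(1))
    fix X assume X: "finite X" "X \<subseteq> X0"
    have "(\<Sum>x\<in>X. \<bar>?g x\<bar>) \<le> (\<Sum>x\<in>X. b * ?w x)" by (intro sum_mono g)
    also have "\<dots> = b * (\<Sum>x\<in>X. ?w x)" by (simp add: sum_distrib_left)
    also have "(\<Sum>x\<in>X. ?w x) \<le> K * (C / c0) ^ CARD('d) / ((real j * \<beta>) ^ CARD('d) * real q ^ (CARD('n) * 0 * CARD('t)))"
      by (rule kernel_sum_bound[of "{\<lambda>_. \<zero>\<^bsub>F\<^esub>}"])
        (use X e zk in auto)
    finally show "(\<Sum>x\<in>X. \<bar>?g x\<bar>) \<le> b * (K * (C / c0) ^ CARD('d) / ((real j * \<beta>) ^ CARD('d) * real q ^ (CARD('n) * 0 * CARD('t))))"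
      using b by (simp add: mult_left_mono)
  qed
  have lat: "\<Lambda> D - {0} = (\<lambda>x. \<beta> *\<^sub>R emb x) ` {x \<in> X0. \<Phi> x \<in> D}" for D
    using emb_neq_0 pos by (auto simp: code_lattice_def X0_def)
  have inj: "inj_on (\<lambda>x. \<beta> *\<^sub>R emb x) {x \<in> X0. \<Phi> x \<in> D}" for D
    using inj_emb pos by (auto simp: inj_on_def X0_def)
  have sumD: "(\<lambda>x. \<bar>?g x\<bar>) summable_on {x \<in> X0. \<Phi> x \<in> D}" for D
    by (rule summable_on_subset_banach[OF gs]) auto
  show "(\<lambda>v. \<bar>g (real j *\<^sub>R v)\<bar>) summable_on (\<Lambda> D - {0})" if "D \<in> codeset" for D
    unfolding lat summable_on_reindex[OF inj] using sumD[of D] by (simp add: o_def)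
  have gD: "?g summable_on {x \<in> X0. \<Phi> x \<in> D}" for D
    using sumD by (subst summable_on_iff_abs_summable_on_real) simp
  have hD: "((\<lambda>x. of_bool (\<Phi> x \<in> D) * ?g x) has_sum infsum (\<lambda>v. g (real j *\<^sub>R v)) (\<Lambda> D - {0})) X0" for D
  proof -
    have "infsum (\<lambda>v. g (real j *\<^sub>R v)) (\<Lambda> D - {0}) = infsum ?g {x \<in> X0. \<Phi> x \<in> D}"
      unfolding lat infsum_reindex[OF inj] by (simp add: o_def)
    then have "(?g has_sum infsum (\<lambda>v. g (real j *\<^sub>R v)) (\<Lambda> D - {0})) {x \<in> X0. \<Phi> x \<in> D}"
      using has_sum_infsum[OF gD[of D]] by simp
    then show ?thesis by (rule has_sum_cong_neutral[THEN iffD1, rotated 3]) auto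
  qed
  let ?S = "average (\<lambda>D. infsum (\<lambda>v. g (real j *\<^sub>R v)) (\<Lambda> D - {0})) codeset"
  have "((\<lambda>x. \<Sum>D\<in>codeset. of_bool (\<Phi> x \<in> D) * ?g x) has_sum (\<Sum>D\<in>codeset. infsum (\<lambda>v. g (real j *\<^sub>R v)) (\<Lambda> D - {0}))) X0"
    by (rule has_sum_finite_sum[OF codeset_finite(1) hD])
  from has_sum_cmult_right[OF this, of "1 / real (card codeset)"]
  have "((\<lambda>x. 1 / real (card codeset) * (\<Sum>D\<in>codeset. of_bool (\<Phi> x \<in> D) * ?g x)) has_sum ?S) X0"
    by (simp add: average_def)
  moreover have "1 / real (card codeset) * (\<Sum>D\<in>codeset. of_bool (\<Phi> x \<in> D) * ?g x) = P x * ?g x" for x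
    using codeset_finite(1) by (simp add: P_def sum_distrib_right[symmetric] sum_of_bool_eq Int_def)
  ultimately have S: "((\<lambda>x. P x * ?g x) has_sum ?S) X0" by simp
  show "\<bar>?S\<bar> \<le> b * ((real CARD('n) + 1) * B0) / real j ^ CARD('d)"
  proof -
    have "\<bar>infsum (\<lambda>x. P x * ?g x) X0\<bar> \<le> b * ((real CARD('n) + 1) * B0) / real j ^ CARD('d)"
    proof (rule infsum_bounded_finite_sums(4))
      fix X assume X: "finite X" "X \<subseteq> X0"
      have "(\<Sum>x\<in>X. \<bar>P x * ?g x\<bar>) \<le> (\<Sum>x\<in>X. P x * (b * ?w x))"
        unfolding abs_mult using P_nonneg by (intro sum_mono mult_mono g) auto
      also have "\<dots> = b * (\<Sum>x\<in>X. P x * ?w x)" by (simp add: sum_distrib_left mult_ac)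
      also have "\<dots> \<le> b * ((real CARD('n) + 1) * B0 / real j ^ CARD('d))"
        by (intro mult_left_mono weighted_sum_bound(1) X j b)
      finally show "(\<Sum>x\<in>X. \<bar>P x * ?g x\<bar>) \<le> b * ((real CARD('n) + 1) * B0) / real j ^ CARD('d)" by simp
    qed
    then show ?thesis using infsumI[OF S] by simp
  qed
  have inj0: "inj_on emb X0" using inj_emb by (auto simp: inj_on_def X0_def)
  have lat0: "emb ` coord_power \<O> - {0} = emb ` X0" using emb_neq_0 by (auto simp: X0_def)
  have "infsum (\<lambda>v. g ((real j * \<beta>) *\<^sub>R v)) (emb ` coord_power \<O> - {0}) = infsum ?g X0"
    unfolding lat0 infsum_reindex[OF inj0] by (simp add: o_def)
  moreover have "?g summable_on X0" using gs by (subst summable_on_iff_abs_summable_on_real) simp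
  ultimately have "(?g has_sum infsum (\<lambda>v. g ((real j * \<beta>) *\<^sub>R v)) (emb ` coord_power \<O> - {0})) X0"
    using has_sum_infsum by fastforce
  from has_sum_add[OF S has_sum_cmult_right[OF this, of "- ratio CARD('n)"]]
  have diff: "((\<lambda>x. (P x - ratio CARD('n)) * ?g x) has_sum
      (?S - ratio CARD('n) * infsum (\<lambda>v. g ((real j * \<beta>) *\<^sub>R v)) (emb ` coord_power \<O> - {0}))) X0"
    by (simp add: left_diff_distrib)
  have "\<bar>infsum (\<lambda>x. (P x - ratio CARD('n)) * ?g x) X0\<bar> \<le> b * ((real CARD('n) + 1) * B0) / (real j ^ CARD('d) * real q)"
  proof (rule infsum_bounded_finite_sums(4))
    fix X assume X: "finite X" "X \<subseteq> X0"
    have "(\<Sum>x\<in>X. \<bar>(P x - ratio CARD('n)) * ?g x\<bar>) \<le> (\<Sum>x\<in>X. \<bar>P x - ratio CARD('n)\<bar> * (b * ?w x))"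
      unfolding abs_mult by (intro sum_mono mult_left_mono g) auto
    also have "\<dots> = b * (\<Sum>x\<in>X. \<bar>P x - ratio CARD('n)\<bar> * ?w x)" by (simp add: sum_distrib_left mult_ac)
    also have "\<dots> \<le> b * ((real CARD('n) + 1) * B0 / (real j ^ CARD('d) * real q))"
      by (intro mult_left_mono weighted_sum_bound(2) X j b)
    finally show "(\<Sum>x\<in>X. \<bar>(P x - ratio CARD('n)) * ?g x\<bar>) \<le> b * ((real CARD('n) + 1) * B0) / (real j ^ CARD('d) * real q)" by simp
  qed
  then show "\<bar>?S - ratio CARD('n) * infsum (\<lambda>v. g ((real j * \<beta>) *\<^sub>R v)) (emb ` coord_power \<O> - {0})\<bar>
      \<le> b * ((real CARD('n) + 1) * B0) / (real j ^ CARD('d) * real q)"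
    using infsumI[OF diff] by simp
qed

text \<open>These are the inputs of \<open>contraction_tendsto_zero\<close>: the system over the
  multiples, because a finite average commutes with series, and an a priori bound of order
  \<open>1 / j ^ d\<close> that is uniform in the prime.\<close>

lemma average_primitive:
  fixes g :: "real ^ 'd \<Rightarrow> real"
  assumes g: "\<And>v. \<bar>g v\<bar> \<le> b * w v" and j: "j > 0"
  shows "(\<lambda>i. average (\<lambda>D. infsum (\<lambda>v. g (real (Suc i * j) *\<^sub>R v)) (primitive_vectors (\<Lambda> D))) codeset)
      sums average (\<lambda>D. infsum (\<lambda>v. g (real j *\<^sub>R v)) (\<Lambda> D - {0})) codeset"
    "\<bar>average (\<lambda>D. infsum (\<lambda>v. g (real j *\<^sub>R v)) (primitive_vectors (\<Lambda> D))) codeset\<bar>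
       \<le> b * ((real CARD('n) + 1) * B0) / real j ^ CARD('d)"
proof -
  let ?g = "\<lambda>v. g (real j *\<^sub>R v)"
  have ps: "(\<lambda>i. infsum (\<lambda>v. g (real (Suc i * j) *\<^sub>R v)) (primitive_vectors (\<Lambda> D))) sums infsum ?g (\<Lambda> D - {0})"
    "\<bar>infsum ?g (primitive_vectors (\<Lambda> D))\<bar> \<le> infsum (\<lambda>v. \<bar>?g v\<bar>) (\<Lambda> D - {0})" if D: "D \<in> codeset" for D
    using primitive_sums[OF discrete_code_lattice[OF D] average_code_lattice_sum(1)[OF g j D]]
    by (simp_all only: of_nat_mult scaleR_scaleR mult.commute[of "real j"])
  show "(\<lambda>i. average (\<lambda>D. infsum (\<lambda>v. g (real (Suc i * j) *\<^sub>R v)) (primitive_vectors (\<Lambda> D))) codeset)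
      sums average (\<lambda>D. infsum ?g (\<Lambda> D - {0})) codeset"
    unfolding average_def by (intro sums_divide sums_sum ps(1))
  have "\<bar>average (\<lambda>D. infsum ?g (primitive_vectors (\<Lambda> D))) codeset\<bar> \<le> average (\<lambda>D. infsum (\<lambda>v. \<bar>?g v\<bar>) (\<Lambda> D - {0})) codeset"
    unfolding average_def abs_divide
    by (intro divide_mono order_trans[OF sum_abs] sum_mono ps(2)) (use codeset_finite in auto)
  also have "\<dots> \<le> b * ((real CARD('n) + 1) * B0) / real j ^ CARD('d)"
    using average_code_lattice_sum(2)[of "\<lambda>v. \<bar>g v\<bar>" b j] g j by simp
  finally show "\<bar>average (\<lambda>D. infsum ?g (primitive_vectors (\<Lambda> D))) codeset\<bar> \<le> b * ((real CARD('n) + 1) * B0) / real j ^ CARD('d)" .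
qed

end

section \<open>The limit\<close>

lemma scaling_factor_power:
  assumes "n > 0" "m > 0" "t > 0" "q > 0"
  shows "scaling_factor n m t k q ^ (n\<^sup>2 * m * t) * real q ^ (n * n * t) = real q ^ (n * k)"
proof -
  let ?x = "real n * real k - real n ^ 2 * real t"
  have "real (n\<^sup>2 * m * t) * (?x / (real n ^ 2 * real m * real t)) = ?x" using assms by simp
  then have "scaling_factor n m t k q ^ (n\<^sup>2 * m * t) = real q powr ?x"
    unfolding scaling_factor_def using assms by (subst powr_power) simp_all
  moreover have "real q ^ (n * n * t) = real q powr (real n ^ 2 * real t)"
    using assms by (simp add: powr_realpow[symmetric] power2_eq_square)
  moreover have "real q ^ (n * k) = real q powr (real n * real k)"
    using assms by (simp add: powr_realpow[symmetric])
  ultimately show ?thesis by (simp add: powr_add[symmetric])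
qed

text \<open>The exponent is negative by \<open>k < n t\<close>. So the mesh of the scaled order
  lattice tends to 0, which makes its sums Riemann sums.\<close>

lemma scaling_factor_tendsto_zero:
  assumes "n > 0" "m > 0" "t > 0" "k < n * t"
  shows "scaling_factor n m t k \<longlonglongrightarrow> 0"
proof -
  have "real n * real k < real n * (real n * real t)"
    using assms by (intro mult_strict_left_mono) (simp_all flip: of_nat_mult)
  then have "(real n * real k - real n ^ 2 * real t) / (real n ^ 2 * real m * real t) < 0"
    using assms by (intro divide_neg_pos) (simp_all add: power2_eq_square mult_ac)
  from tendsto_neg_powr[OF this filterlim_real_sequentially]
  show ?thesis by (simp add: scaling_factor_def[abs_def])
qed

text \<open>The full-rank probability is asymptotic to \<open>q ^ (n k - n D)\<close>; with
  \<open>D = n t\<close> this equals the scaling factor raised to the dimension.\<close>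

lemma subspace_ratio_tendsto:
  assumes "n \<le> k" "k \<le> D"
  shows "(\<lambda>q. (\<Prod>i<n. (real q ^ k - real q ^ i) / (real q ^ D - real q ^ i)) * real q ^ (n * D) / real q ^ (n * k)) \<longlonglongrightarrow> 1"
proof -
  have small: "(\<lambda>q. real q ^ i / real q ^ l) \<longlonglongrightarrow> 0" if "i < l" for i l
  proof (rule Lim_transform_eventually)
    show "(\<lambda>q. (1 / real q) ^ (l - i)) \<longlonglongrightarrow> 0" using that by (intro tendsto_null_power lim_1_over_n) simp
    show "\<forall>\<^sub>F q in sequentially. (1 / real q) ^ (l - i) = real q ^ i / real q ^ l"
      using eventually_gt_at_top[of 0]
    proof eventually_elim
      case (elim q)
      have "real q ^ l = real q ^ i * real q ^ (l - i)" using that by (simp flip: power_add)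
      then show ?case using elim by (simp add: power_divide)
    qed
  qed
  have "(\<lambda>q. \<Prod>i<n. (1 - real q ^ i / real q ^ k) / (1 - real q ^ i / real q ^ D)) \<longlonglongrightarrow> (\<Prod>i<n. (1 - 0) / (1 - 0))"
    by (intro tendsto_prod tendsto_divide tendsto_diff tendsto_const small) (use assms in auto)
  then have lim: "(\<lambda>q. \<Prod>i<n. (1 - real q ^ i / real q ^ k) / (1 - real q ^ i / real q ^ D)) \<longlonglongrightarrow> 1" by simp
  show ?thesis
  proof (rule Lim_transform_eventually[OF lim])
    show "\<forall>\<^sub>F q in sequentially. (\<Prod>i<n. (1 - real q ^ i / real q ^ k) / (1 - real q ^ i / real q ^ D))
      = (\<Prod>i<n. (real q ^ k - real q ^ i) / (real q ^ D - real q ^ i)) * real q ^ (n * D) / real q ^ (n * k)"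
      using eventually_gt_at_top[of 1]
    proof eventually_elim
      case (elim q)
      have "(1 - real q ^ i / real q ^ k) / (1 - real q ^ i / real q ^ D) =
          (real q ^ k - real q ^ i) / (real q ^ D - real q ^ i) * (real q ^ D / real q ^ k)" for i
      proof -
        have "1 - real q ^ i / real q ^ l = (real q ^ l - real q ^ i) / real q ^ l" for l
          using elim by (simp add: diff_divide_distrib)
        then show ?thesis by (simp add: mult.commute)
      qed
      then have "(\<Prod>i<n. (1 - real q ^ i / real q ^ k) / (1 - real q ^ i / real q ^ D)) =
          (\<Prod>i<n. (real q ^ k - real q ^ i) / (real q ^ D - real q ^ i)) * (real q ^ D / real q ^ k) ^ n"
        by (simp only: prod.distrib prod_constant card_lessThan)
      then show ?case by (simp add: power_divide power_mult[symmetric] mult.commute)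
    qed
  qed
qed

text \<open>The product behaves like \<open>\<beta> ^ d\<close>, with \<open>\<beta>\<close> the
  scaling factor, times the lattice sum of mesh \<open>j \<beta>\<close>, that is, like a Riemann
  sum divided by \<open>covolume \<Lambda> * j ^ d\<close>.\<close>

lemma weighted_lattice_sum_tendsto:
  fixes f :: "real ^ 'd::finite \<Rightarrow> real"
  assumes B: "lattice_basis B \<Lambda>" and cont: "negligible {x. \<not> isCont f x}" and \<delta>: "\<delta> > 0"
    and decay: "\<And>x. \<bar>f x\<bar> \<le> b * (1 + norm x) powr (- (real CARD('d) + \<delta>))"
    and nmt: "n > 0" "m > 0" "t > 0" and k: "n \<le> k" "k < n * t" and d: "CARD('d) = n\<^sup>2 * m * t" and j: "j > 0"
  shows "(\<lambda>q. (\<Prod>i<n. (real q ^ k - real q ^ i) / (real q ^ (n * t) - real q ^ i)) *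
      infsum (\<lambda>v. f ((real j * scaling_factor n m t k q) *\<^sub>R v)) (\<Lambda> - {0}))
    \<longlonglongrightarrow> integral UNIV f / (covolume \<Lambda> * real j ^ CARD('d))"
proof -
  let ?b = "scaling_factor n m t k" and ?d = "CARD('d)" and ?V = "covolume \<Lambda>"
  let ?S = "\<lambda>q. infsum (\<lambda>v. f ((real j * ?b q) *\<^sub>R v)) (\<Lambda> - {0})"
  let ?R = "\<lambda>q. \<Prod>i<n. (real q ^ k - real q ^ i) / (real q ^ (n * t) - real q ^ i)"
  have V: "?V > 0" using covolume_lattice_basis[OF B] by simp
  have pos: "?b q > 0" if "q > 0" for q using that by (simp add: scaling_factor_def)
  \<comment> \<open>\<open>Suc q\<close> because the scaling factor vanishes at
    \<open>q = 0\<close>, while \<open>lattice_sum_tendsto\<close> asks for positive meshes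
    throughout.\<close>
  have "(\<lambda>q. real j * ?b (Suc q)) \<longlonglongrightarrow> real j * 0"
    by (intro tendsto_mult tendsto_const LIMSEQ_Suc[OF scaling_factor_tendsto_zero] nmt k)
  then have e0: "(\<lambda>q. real j * ?b (Suc q)) \<longlonglongrightarrow> 0" by simp
  have "(\<lambda>q. ?V * ((real j * ?b (Suc q)) ^ ?d * ?S (Suc q))) \<longlonglongrightarrow> integral UNIV f"
    using lattice_sum_tendsto[OF B cont \<delta> _ e0, of b] decay j pos covolume_lattice_basis(1)[OF B] by simp
  from tendsto_mult[OF LIMSEQ_Suc[OF subspace_ratio_tendsto[of n k "n * t"]] this] k
  have "(\<lambda>q. ?R (Suc q) * real (Suc q) ^ (n * (n * t)) / real (Suc q) ^ (n * k) * (?V * ((real j * ?b (Suc q)) ^ ?d * ?S (Suc q)))) \<longlonglongrightarrow> integral UNIV f"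
    by simp
  moreover have "?R (Suc q) * real (Suc q) ^ (n * (n * t)) / real (Suc q) ^ (n * k) * (?V * ((real j * ?b (Suc q)) ^ ?d * ?S (Suc q)))
      = ?V * real j ^ ?d * (?R (Suc q) * ?S (Suc q))" for q
  proof -
    have *: "?b (Suc q) ^ ?d * real (Suc q) ^ (n * (n * t)) = real (Suc q) ^ (n * k)"
      using scaling_factor_power[of n m t "Suc q" k] nmt d by (simp add: mult.assoc)
    have "?R (Suc q) * real (Suc q) ^ (n * (n * t)) / real (Suc q) ^ (n * k) * (?V * ((real j * ?b (Suc q)) ^ ?d * ?S (Suc q)))
      = (?b (Suc q) ^ ?d * real (Suc q) ^ (n * (n * t))) / real (Suc q) ^ (n * k) * (?V * real j ^ ?d * (?R (Suc q) * ?S (Suc q)))"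
      by (simp only: power_mult_distrib times_divide_eq_left times_divide_eq_right mult_ac)
    then show ?thesis unfolding * by simp
  qed
  ultimately have "(\<lambda>q. ?V * real j ^ ?d * (?R (Suc q) * ?S (Suc q))) \<longlonglongrightarrow> integral UNIV f" by simp
  from tendsto_divide[OF this tendsto_const[of "?V * real j ^ ?d"]]
  have "(\<lambda>q. ?R (Suc q) * ?S (Suc q)) \<longlonglongrightarrow> integral UNIV f / (?V * real j ^ ?d)"
    using V j by simp
  then show ?thesis by (rule LIMSEQ_imp_Suc)
qed

theorem theorem3p7:
  fixes \<iota> :: "'k::field_char_0 \<Rightarrow> 'a::{division_ring,ring_char_0}"
    and \<O> :: "'a set"
    and primes :: "'k set set"
    and h :: "'k set \<Rightarrow> 'a set \<Rightarrow> 'k set ^ 'n::finite ^ 'n"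
    and \<Psi> :: "('a real_tensor) ^ 't::finite \<Rightarrow> real ^ 'd::finite"
    and f :: "real ^ 'd \<Rightarrow> real"
    and n m t k :: nat
  assumes number_field: "number_field TYPE('k)"
    and center: "center_embedding \<iota>"
    and finite_dim: "\<exists>B. finite_dimensional_vector_space (alg_smult \<iota>) B"
    and n_def: "real n = sqrt (real (vector_space.dim (alg_smult \<iota>) UNIV))"
    and m_def: "m = rat_degree TYPE('k)"
    and order: "is_order \<iota> \<O>"
    and t: "t \<ge> 2"
    and card_n: "CARD('n) = n"
    and card_t: "CARD('t) = t"
    and card_d: "CARD('d) = n\<^sup>2 * m * t"
    and primes: "infinite primes" "primes \<subseteq> nonzero_primes"
    and h: "\<And>\<pp>. \<pp> \<in> primes \<Longrightarrow>
              h \<pp> \<in> ring_iso (subring_of \<O> Quot extended_ideal \<iota> \<O> \<pp>)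
                            (matrix_ring (residue_field \<pp>))"
    and \<Psi>: "linear \<Psi>" "bij \<Psi>"
    and f: "semi_admissible f"
    and k: "n \<le> k" "k < n * t" "(n - 1) * t < k"
  shows "\<exists>L. ((\<lambda>\<pp>. average
                  (\<lambda>C. \<Sum>\<^sub>\<infinity>v \<in> primitive_vectors
                           (code_lattice (scaling_factor n m t k (residue_card \<pp>))
                              (real_embedding \<Psi>) \<O> (reduction \<iota> \<O> \<pp> (h \<pp>)) C). f v)
                  (codes k (residue_field \<pp>)))
              \<longlongrightarrow> L) (inf (filtercomap prime_below at_top) (principal primes))
           \<and> L \<le> inverse (zeta_nat (n\<^sup>2 * m * t)
                          * covolume (real_embedding \<Psi> ` coord_power \<O>))
                  * integral UNIV f"
proof -
  let ?emb = "real_embedding \<Psi>" and ?d = "n\<^sup>2 * m * t"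
  let ?\<Lambda> = "?emb ` coord_power \<O>"
  let ?V = "covolume ?\<Lambda>" and ?J = "integral UNIV f"
  let ?F = "inf (filtercomap prime_below at_top) (principal primes)"
  have prime: "prime_of_integers \<pp>" if "\<pp> \<in> primes" for \<pp>
    using that primes(2) number_field by unfold_locales auto
  \<comment> \<open>One prime of the family is fixed to obtain the ring axioms of
    \<open>\<O>\<^sub>K\<close>, which are part of \<open>primeideal\<close>.\<close>
  obtain \<pp>0 where p0: "\<pp>0 \<in> primes" using primes(1) by (metis finite.emptyI all_not_in_conv)
  interpret P0: prime_of_integers \<pp>0 by (rule prime[OF p0])
  have "x - y \<in> (\<O>\<^sub>K :: 'k set)" if "x \<in> \<O>\<^sub>K" "y \<in> \<O>\<^sub>K" for x y
    using P0.add_O[OF that(1) P0.uminus_O[OF that(2)]] by simp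
  then have "\<exists>(I :: ('k \<times> 'a) set) u c (M :: nat). finite I \<and>
     card I = rat_degree TYPE('k) * vector_space.dim (alg_smult \<iota>) UNIV \<and> u ` I \<subseteq> \<O> \<and>
     (\<forall>x. x = (\<Sum>i\<in>I. rat_smult (c x i) (u i))) \<and> (\<forall>x y i. c (x + y) i = c x i + c y i) \<and>
     (\<forall>r x i. c (rat_smult r x) i = r * c x i) \<and>
     M > 0 \<and> (\<forall>y\<in>\<O>. \<forall>i\<in>I. of_nat M * c y i \<in> \<int>)"
    by (intro order_structure number_field center finite_dim order P0.one_O conjI P0.mult_O)
  then obtain I :: "('k \<times> 'a) set" and u c and M :: nat where st: "finite I \<and>
     card I = rat_degree TYPE('k) * vector_space.dim (alg_smult \<iota>) UNIV \<and> u ` I \<subseteq> \<O> \<and>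
     (\<forall>x. x = (\<Sum>i\<in>I. rat_smult (c x i) (u i))) \<and> (\<forall>x y i. c (x + y) i = c x i + c y i) \<and>
     (\<forall>r x i. c (rat_smult r x) i = r * c x i) \<and>
     M > 0 \<and> (\<forall>y\<in>\<O>. \<forall>i\<in>I. of_nat M * c y i \<in> \<int>)"
    by (elim exE) (rule that)
  have rep: "x = (\<Sum>i\<in>I. rat_smult (c x i) (u i))" for x using st by (elim conjE) (erule spec)
  note st3 = st[THEN conjunct2, THEN conjunct2]
  note st5 = st3[THEN conjunct2, THEN conjunct2]
  interpret order_coords \<iota> \<O> I u c M
  proof (rule order_coords.intro[OF center order])
    show "finite I" by (rule st[THEN conjunct1])
    show "u i \<in> \<O>" if "i \<in> I" for i using st3[THEN conjunct1] that by blast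
    show "x = (\<Sum>i\<in>I. rat_smult (c x i) (u i))" for x by (rule rep)
    show "c (x + y) i = c x i + c y i" for x y i using st5[THEN conjunct1] by blast
    show "c (rat_smult r x) i = r * c x i" for r x i using st5[THEN conjunct2, THEN conjunct1] by blast
    show "M > 0" using st5 by blast
    show "of_nat M * c y i \<in> \<int>" if "y \<in> \<O>" "i \<in> I" for y i using st5 that by blast
  qed
  have "real n ^ 2 = real (vector_space.dim (alg_smult \<iota>) UNIV)" using n_def by simp
  then have "n\<^sup>2 = vector_space.dim (alg_smult \<iota>) UNIV" by (metis of_nat_eq_iff of_nat_power)
  then have cardI: "card I = m * n\<^sup>2" using st[THEN conjunct2, THEN conjunct1] m_def by simp
  then have dim: "CARD('d) = card I * CARD('t)" by (simp add: card_d card_t)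
  have n: "n > 0" using card_n by (metis zero_less_card_finite)
  \<comment> \<open>Finite types are nonempty, so the equation for \<open>CARD('d)\<close> forces
    \<open>m > 0\<close>.\<close>
  have "CARD('d) > 0" by simp
  then have m: "m > 0" unfolding card_d by simp
  \<comment> \<open>From \<open>t \<ge> 2\<close>; exponent at least 2 gives both the convergence of
    the zeta series and the contraction factor \<open>3 / 4\<close>.\<close>
  have d: "?d \<ge> 2"
    using t n m mult_le_mono[of 1 "n\<^sup>2 * m" 2 t] by simp
  have I: "card I > 0" using cardI n m by simp

  obtain C where C: "C > 0" "\<And>y. y \<in> \<O> \<Longrightarrow> y \<noteq> 0 \<Longrightarrow> \<exists>Z. finite Z \<and> Z \<subseteq> \<O> \<and>
     real (card Z) \<le> (C * nrm y) ^ card I \<and> (\<forall>x\<in>\<O>. \<exists>z\<in>Z. \<exists>w\<in>\<O>. x = z + w * y)"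
    by (rule left_ideal_index_bound) (rule that)
  \<comment> \<open>Here \<open>\<beta>\<close> matches real coordinates with pairs of a basis index
    and a component; the scaling factor, called \<open>\<beta>\<close> in the locale
    \<open>code_average\<close>, is \<open>s \<pp>\<close> below.\<close>
  obtain \<beta> :: "'d \<Rightarrow> ('k \<times> 'a) \<times> 't" and T :: "real ^ 'd \<Rightarrow> real ^ 'd" where \<beta>: "bij_betw \<beta> UNIV (I \<times> UNIV)"
    and T: "linear T" "bij T"
    and embT: "\<And>x. ?emb x = T (\<chi> k. of_rat (c (x $ snd (\<beta> k)) (fst (\<beta> k))))"
    and Tax: "\<And>k. T (axis k 1) = ?emb (\<chi> j. if j = snd (\<beta> k) then u (fst (\<beta> k)) else 0)"
    by (rule real_embedding_coordinates[OF \<Psi> finI dim[symmetric] rep]) (rule that)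
  have injT: "inj T" using T(2) by (simp add: bij_def)
  obtain l where l: "l > 0" "\<And>z. l * norm z \<le> norm (T z)"
    using linear_inj_bounded_below_pos[OF T(1) injT] by blast
  \<comment> \<open>\<open>nrm\<close> adds up \<open>card I\<close> coordinates, each at most the
    norm of the coordinate vector, and \<open>T\<close> shrinks that norm at most by the factor
    \<open>l\<close>.\<close>
  define c0 where "c0 = l / real (card I)"
  have c0: "c0 > 0" using l I by (simp add: c0_def)
  have emb_ge: "c0 * nrm (x $ j) \<le> norm (?emb x)" for x j
  proof -
    let ?z = "\<chi> k. of_rat (c (x $ snd (\<beta> k)) (fst (\<beta> k))) :: real ^ 'd"
    have "\<bar>real_of_rat (c (x $ j) i)\<bar> \<le> norm ?z" if "i \<in> I" for i
    proof -
      have "(i, j) \<in> range \<beta>" using \<beta> that by (simp add: bij_betw_def)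
      then obtain k where "\<beta> k = (i, j)" by (metis imageE)
      then show ?thesis using component_le_norm_cart[of ?z k] by simp
    qed
    then have "nrm (x $ j) \<le> (\<Sum>i\<in>I. norm ?z)" unfolding nrm_def by (rule sum_mono)
    then have "c0 * nrm (x $ j) \<le> c0 * (real (card I) * norm ?z)" using c0 by (intro mult_left_mono) auto
    also have "\<dots> \<le> norm (T ?z)" using l(2)[of ?z] I by (simp add: c0_def)
    finally show ?thesis by (simp add: embT)
  qed
  have "\<exists>B. lattice_basis B ?\<Lambda>"
  proof (rule lattice_basis_exists[OF T _ _ M])
    show "v - w \<in> ?\<Lambda>" if vw: "v \<in> ?\<Lambda>" "w \<in> ?\<Lambda>" for v w
    proof -
      obtain x y where "x \<in> coord_power \<O>" "v = ?emb x" "y \<in> coord_power \<O>" "w = ?emb y" using vw by (elim imageE)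
      then show ?thesis
        by (intro image_eqI[of _ _ "x - y"]) (simp_all add: real_embedding_diff[OF \<Psi>(1)] coord_power_def diff_O)
    qed
    show "T (axis k 1) \<in> ?\<Lambda>" for k
    proof -
      have "fst (\<beta> k) \<in> I" using \<beta> by (metis bij_betwE mem_Times_iff UNIV_I)
      then show ?thesis unfolding Tax by (intro imageI) (simp add: coord_power_def uO zero_O)
    qed
    fix z k assume "T z \<in> ?\<Lambda>"
    then obtain x where x: "x \<in> coord_power \<O>" "T z = ?emb x" by auto
    then have z: "z = (\<chi> k. of_rat (c (x $ snd (\<beta> k)) (fst (\<beta> k))))" using embT injT by (simp add: inj_eq)
    have "fst (\<beta> k) \<in> I" using \<beta> by (metis bij_betwE mem_Times_iff UNIV_I)
    then have "of_nat M * c (x $ snd (\<beta> k)) (fst (\<beta> k)) \<in> \<int>" using x(1) by (intro den) (simp_all add: coord_power_def)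
    then obtain a where "of_nat M * c (x $ snd (\<beta> k)) (fst (\<beta> k)) = of_int a" by (elim Ints_cases)
    then have "real_of_rat (of_nat M * c (x $ snd (\<beta> k)) (fst (\<beta> k))) = real_of_int a" by simp
    then show "real M * z $ k \<in> \<int>" by (simp add: z of_rat_mult)
  qed
  then obtain B where B: "lattice_basis B ?\<Lambda>" by blast
  have V: "?V > 0" using covolume_lattice_basis[OF B] by simp

  obtain b \<delta> where \<delta>: "\<delta> > 0" and dec: "\<And>x. \<bar>f x\<bar> \<le> b / (1 + norm x) powr (real DIM(real ^ 'd) + \<delta>)"
    using f unfolding semi_admissible_def by blast
  have decay: "\<bar>f x\<bar> \<le> b * (1 + norm x) powr (- (real CARD('d) + \<delta>))" for x
    using dec[of x] unfolding powr_minus_divide by simp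
  have cont: "negligible {x. \<not> isCont f x}"
    using f by (intro riemann_integrable_isCont_ae) (simp add: semi_admissible_def)
  obtain K where K: "K > 0" "\<And>(X :: (real ^ 'd) set) l. finite X \<Longrightarrow> l > 0 \<Longrightarrow> (\<And>x. x \<in> X \<Longrightarrow> l \<le> norm x) \<Longrightarrow>
       (\<And>x y. x \<in> X \<Longrightarrow> y \<in> X \<Longrightarrow> x \<noteq> y \<Longrightarrow> l \<le> dist x y) \<Longrightarrow>
       (\<Sum>x\<in>X. (1 + norm x) powr (- (real DIM(real ^ 'd) + \<delta>))) \<le> K / l ^ DIM(real ^ 'd)"
    using separated_sum_bound[OF \<delta>, where ?'v = "real ^ 'd"] by metis
  have sep: "(\<Sum>x\<in>X. (1 + norm x) powr (- (real CARD('d) + \<delta>))) \<le> K / l ^ CARD('d)"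
    if "finite X" "l > 0" "\<And>x. x \<in> X \<Longrightarrow> l \<le> norm x"
      "\<And>x y. x \<in> X \<Longrightarrow> y \<in> X \<Longrightarrow> x \<noteq> y \<Longrightarrow> l \<le> dist x y" for X :: "(real ^ 'd) set" and l
    using K(2)[OF that] by simp

  define s where "s \<pp> = scaling_factor n m t k (residue_card \<pp>)" for \<pp> :: "'k set"
  define \<Lambda>s where "\<Lambda>s \<pp> = code_lattice (s \<pp>) ?emb \<O> (reduction \<iota> \<O> \<pp> (h \<pp>))" for \<pp>
  \<comment> \<open>Averages are kept for every dilation \<open>j\<close>, since the system that
    determines \<open>Pv \<pp> 1\<close> involves all of them. The comparison term \<open>G\<close>
    depends on the prime only through \<open>q\<close>, so its limit can be taken along the natural
    numbers.\<close>
  define Pv where "Pv \<pp> j = average (\<lambda>D. infsum (\<lambda>v. f (real j *\<^sub>R v)) (primitive_vectors (\<Lambda>s \<pp> D))) (codes k (residue_field \<pp>))" for \<pp> and j :: nat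
  define Sv where "Sv \<pp> j = average (\<lambda>D. infsum (\<lambda>v. f (real j *\<^sub>R v)) (\<Lambda>s \<pp> D - {0})) (codes k (residue_field \<pp>))" for \<pp> and j :: nat
  define G where "G j q = (\<Prod>i<n. (real q ^ k - real q ^ i) / (real q ^ (n * t) - real q ^ i)) *
      infsum (\<lambda>v. f ((real j * scaling_factor n m t k q) *\<^sub>R v)) (?\<Lambda> - {0})" for j q :: nat
  \<comment> \<open>The common constant of the estimates; nothing in it depends on the
    prime.\<close>
  define A where "A = b * ((real n + 1) * (2 ^ n * (K * (C / c0) ^ ?d)))"
  have est: "(\<lambda>i. Pv \<pp> (Suc i * j)) sums Sv \<pp> j \<and> \<bar>Pv \<pp> j\<bar> \<le> A / real j ^ ?d \<and>
     \<bar>Sv \<pp> j - G j (residue_card \<pp>)\<bar> \<le> A / (real j ^ ?d * real (residue_card \<pp>))"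
    if p: "\<pp> \<in> primes" and j: "j > 0" for \<pp> j
  proof -
    interpret P: prime_of_integers \<pp> by (rule prime[OF p])
    interpret OP: order_prime \<iota> \<O> I u c M \<pp> "h \<pp>" by unfold_locales (rule h[OF p])
    have q: "residue_card \<pp> > 0" using OP.FF.q_ge_2 OP.q_eq by simp
    have "s \<pp> > 0" using q by (simp add: s_def scaling_factor_def)
    moreover have "s \<pp> ^ CARD('d) * real (residue_card \<pp>) ^ (CARD('n) * CARD('n) * CARD('t)) = real (residue_card \<pp>) ^ (CARD('n) * k)"
      unfolding s_def card_n card_t card_d using n m t q by (intro scaling_factor_power) auto
    ultimately interpret CA: code_average \<iota> \<O> I u c M \<pp> "h \<pp>" ?emb C c0 K \<delta> "s \<pp>" k
      by (intro code_average.intro OP.order_prime_axioms code_average_axioms.intro real_embedding_diff[OF \<Psi>(1)] emb_ge C sep dim c0 K(1))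
        (use k card_n card_t in auto)
    have fw: "\<bar>f v\<bar> \<le> b * CA.w v" for v unfolding CA.w_def by (rule decay)
    have A: "b * ((real CARD('n) + 1) * CA.B0) = A" by (simp add: A_def CA.B0_def card_n card_d)
    have R: "CA.ratio CARD('n) = (\<Prod>i<n. (real (residue_card \<pp>) ^ k - real (residue_card \<pp>) ^ i) /
        (real (residue_card \<pp>) ^ (n * t) - real (residue_card \<pp>) ^ i))"
      by (simp add: CA.ratio_def card_n card_t)
    show ?thesis
      using CA.average_primitive[OF fw j] CA.average_code_lattice_sum(3)[OF fw j]
      unfolding A R by (simp only: Pv_def Sv_def G_def \<Lambda>s_def s_def card_d)
  qed

  have ev_primes: "eventually (\<lambda>\<pp>. \<pp> \<in> primes) ?F" by (simp add: eventually_inf_principal)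
  have card_top: "filterlim residue_card at_top ?F"
    unfolding filterlim_at_top
  proof
    fix N
    have "eventually (\<lambda>\<pp>. N \<le> prime_below \<pp>) (filtercomap prime_below at_top)"
      by (intro eventually_filtercomapI eventually_ge_at_top)
    then have "eventually (\<lambda>\<pp>. N \<le> prime_below \<pp>) ?F" by (rule filter_leD[rotated]) simp
    with ev_primes show "eventually (\<lambda>\<pp>. N \<le> residue_card \<pp>) ?F"
    proof eventually_elim
      case (elim \<pp>)
      show ?case using prime_of_integers.residue_card_ge[OF prime[OF elim(1)]] elim(2) by linarith
    qed
  qed
  \<comment> \<open>\<open>Sv\<close> differs from \<open>G\<close> by \<open>O(1/q)\<close>, and
    the limit of \<open>G\<close> along the natural numbers is pulled back along
    \<open>residue_card\<close>.\<close>
  have Slim: "((\<lambda>\<pp>. Sv \<pp> j) \<longlongrightarrow> ?J / (?V * real j ^ ?d)) ?F" if j: "j > 0" for j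
  proof -
    have "(G j \<longlongrightarrow> ?J / (?V * real j ^ CARD('d))) sequentially"
      unfolding G_def[abs_def] using t
      by (intro weighted_lattice_sum_tendsto[OF B cont \<delta> decay n m _ k(1,2) card_d j]) simp
    from filterlim_compose[OF this card_top]
    have G: "((\<lambda>\<pp>. G j (residue_card \<pp>)) \<longlongrightarrow> ?J / (?V * real j ^ ?d)) ?F" by (simp only: card_d)
    have inv: "((\<lambda>\<pp>. inverse (real (residue_card \<pp>))) \<longlongrightarrow> 0) ?F"
      by (rule filterlim_compose[OF lim_inverse_n card_top])
    have "((\<lambda>\<pp>. Sv \<pp> j - G j (residue_card \<pp>)) \<longlongrightarrow> 0) ?F"
    proof (rule tendsto_rabs_zero_cancel, rule tendsto_sandwich)
      show "eventually (\<lambda>\<pp>. 0 \<le> \<bar>Sv \<pp> j - G j (residue_card \<pp>)\<bar>) ?F" by simp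
      show "eventually (\<lambda>\<pp>. \<bar>Sv \<pp> j - G j (residue_card \<pp>)\<bar> \<le> A / real j ^ ?d * inverse (real (residue_card \<pp>))) ?F"
        using ev_primes
      proof eventually_elim
        case (elim \<pp>)
        show ?case using est[OF elim j] by (simp add: divide_inverse mult_ac)
      qed
      show "((\<lambda>\<pp>. A / real j ^ ?d * inverse (real (residue_card \<pp>))) \<longlongrightarrow> 0) ?F"
        by (rule tendsto_mult_right_zero[OF inv])
    qed simp
    from tendsto_add[OF this G] show ?thesis by simp
  qed

  let ?Z = "zeta_nat ?d"
  have "summable (\<lambda>i. inverse (real i ^ ?d))" using inverse_power_summable[OF d, where ?'a = real] by simp
  then have sumZ: "summable (\<lambda>i. 1 / real (Suc i) ^ ?d)"
    using summable_Suc_iff[of "\<lambda>i. inverse (real i ^ ?d)"] by (simp add: divide_inverse)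
  then have Z: "(\<lambda>i. 1 / real (Suc i) ^ ?d) sums ?Z" unfolding zeta_nat_def by (rule summable_sums)
  have Zpos: "?Z > 0" unfolding zeta_nat_def using sumZ by (intro suminf_pos) auto
  \<comment> \<open>Forced by the system: the sum over \<open>i \<ge> 1\<close> of
    \<open>L / (i j) ^ ?d\<close> is \<open>?Z * L / j ^ ?d\<close>, and this has to equal the limit
    \<open>?J / (?V * j ^ ?d)\<close> of \<open>Sv\<close>. The contraction is applied to the
    differences from this exact solution.\<close>
  define L where "L = inverse (?Z * ?V) * ?J"
  have "((\<lambda>\<pp>. Pv \<pp> 1 - L / real 1 ^ ?d) \<longlongrightarrow> 0) ?F"
  proof (rule contraction_tendsto_zero[OF d, where C = "A + \<bar>L\<bar>" and s = "\<lambda>\<pp> j. Sv \<pp> j - ?J / (?V * real j ^ ?d)"])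
    show "eventually (\<lambda>\<pp>. \<forall>j\<ge>1. \<bar>Pv \<pp> j - L / real j ^ ?d\<bar> \<le> (A + \<bar>L\<bar>) / real j ^ ?d) ?F"
      using ev_primes
    proof (rule eventually_mono, intro allI impI)
      fix \<pp> j assume p: "\<pp> \<in> primes" and j: "(1 :: nat) \<le> j"
      have "\<bar>Pv \<pp> j - L / real j ^ ?d\<bar> \<le> \<bar>Pv \<pp> j\<bar> + \<bar>L / real j ^ ?d\<bar>" by (rule abs_triangle_ineq4)
      also have "\<dots> \<le> A / real j ^ ?d + \<bar>L\<bar> / real j ^ ?d" using est[OF p, of j] j by (intro add_mono) auto
      finally show "\<bar>Pv \<pp> j - L / real j ^ ?d\<bar> \<le> (A + \<bar>L\<bar>) / real j ^ ?d" by (simp add: add_divide_distrib)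
    qed
    show "eventually (\<lambda>\<pp>. \<forall>j\<ge>1. (\<lambda>i. Pv \<pp> (Suc i * j) - L / real (Suc i * j) ^ ?d) sums (Sv \<pp> j - ?J / (?V * real j ^ ?d))) ?F"
      using ev_primes
    proof (rule eventually_mono, intro allI impI)
      fix \<pp> j assume p: "\<pp> \<in> primes" and j: "(1 :: nat) \<le> j"
      have "?Z * (L / real j ^ ?d) = ?J / (?V * real j ^ ?d)" using Zpos V by (simp add: L_def field_simps)
      with sums_mult2[OF Z, of "L / real j ^ ?d"]
      have "(\<lambda>i. 1 / real (Suc i) ^ ?d * (L / real j ^ ?d)) sums (?J / (?V * real j ^ ?d))" by (simp only:)
      moreover have "1 / real (Suc i) ^ ?d * (L / real j ^ ?d) = L / real (Suc i * j) ^ ?d" for i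
        by (simp only: of_nat_mult power_mult_distrib times_divide_times_eq mult_1)
      ultimately have "(\<lambda>i. L / real (Suc i * j) ^ ?d) sums (?J / (?V * real j ^ ?d))" by (simp only:)
      with est[OF p, of j] j
      show "(\<lambda>i. Pv \<pp> (Suc i * j) - L / real (Suc i * j) ^ ?d) sums (Sv \<pp> j - ?J / (?V * real j ^ ?d))"
        by (intro sums_diff) auto
    qed
    show "((\<lambda>\<pp>. Sv \<pp> j - ?J / (?V * real j ^ ?d)) \<longlongrightarrow> 0) ?F" if "1 \<le> j" for j
      using tendsto_diff[OF Slim[of j] tendsto_const[of "?J / (?V * real j ^ ?d)"]] that by simp
  qed
  from tendsto_add[OF this tendsto_const[of L]] have "((\<lambda>\<pp>. Pv \<pp> 1) \<longlongrightarrow> L) ?F" by simp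
  then show ?thesis
    unfolding Pv_def \<Lambda>s_def s_def by (intro exI[of _ L]) (simp add: L_def)
qed

end
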